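(* Let $\alpha\in(0,2)$. There exists $\widetilde T_\alpha>0$ such that, for any $T>\widetilde T_\alpha$ and any $(v^0,v^1)\in L^2(0,1)\times H^{-1}_\alpha$, the following holds. Let $v$ be the solution by transposition of $$v_{tt}-(x^\alpha v_x)_x=0\text{ in }Q=(0,T)\times(0,1),\quad\text{boundary conditions (BC)},\quad v(0,\cdot)=v^0,\ v_t(0,\cdot)=v^1.$$ If $v_x(\cdot,1)\in L^2(0,T)$, then $(v^0,v^1)\in H^1_\alpha\times L^2(0,1)$.
   Context: Boundary conditions (BC) for a function $y(t,x)$: $y(t,1)=0$ for $t\in(0,T)$, together with $y(t,0)=0$ if $\alpha\in(0,1)$, or $\lim_{x\to0^+}(x^\alpha y_x)(t,x)=0$ if $\alpha\in[1,2)$. Spaces. If $\alpha\in(0,1)$, $H^1_\alpha$ is the set of $u\in L^2(0,1)$ that are absolutely continuous on $[0,1]$ with $x^{\alpha/2}u_x\in L^2(0,1)$ and $u(0)=u(1)=0$. If $\alpha\in[1,2)$, $H^1_\alpha$ is the set of $u\in L^2(0,1)$ that are locally absolutely continuous on $(0,1]$ with $x^{\alpha/2}u_x\in L^2(0,1)$ and $u(1)=0$. In both cases $\|u\|_{H^1_\alpha}=(\|u\|_{L^2}^2+\|x^{\alpha/2}u_x\|_{L^2}^2)^{1/2}$. $H^{-1}_\alpha$ is the dual of $H^1_\alpha$, with $L^2(0,1)\hookrightarrow H^{-1}_\alpha$ through the $L^2$ inner product. Weak solution. For $f\in L^1(0,T;L^2(0,1))$ and $(y^0,y^1)\in H^1_\alpha\times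 L^2(0,1)$, a weak solution of $y_{tt}-(x^\alpha y_x)_x=f$ with (BC) and initial data $(y^0,y^1)$ is $y\in C^0([0,T];H^1_\alpha)\cap C^1([0,T];L^2(0,1))$ with $y(0,\cdot)=y^0$, $y_t(0,\cdot)=y^1$ and $\int_0^T\int_0^1(-y_t w\phi'+x^\alpha y_xw_x\phi)\,dx\,dt=\int_0^T\int_0^1 fw\phi\,dx\,dt$ for all $w\in H^1_\alpha$, $\phi\in C_c^\infty(0,T)$. It exists, is unique, and satisfies $y_x(\cdot,1)\in L^2(0,T)$. Weak solutions of the backward problem with $\theta(T,\cdot)=\theta_t(T,\cdot)=0$ are defined via $t\mapsto T-t$. Solution by transposition with data $(v^0,v^1)\in L^2(0,1)\times H^{-1}_\alpha$: $v\in L^\infty(0,T;L^2(0,1))$ such that for every $F\in L^1(0,T;L^2(0,1))$, $\int_0^T\int_0^1 vF\,dx\,dt=-(v^0,\theta_t(0,\cdot))_{L^2(0,1)}+\langle v^1,\theta(0,\cdot)\rangle_{H^{-1}_\alpha,H^1_\alpha}$, where $\theta$ is the weak solution of $\theta_{tt}-(x^\alpha\theta_x)_x=F$ with (BC) and $\theta(T,\cdot)=\theta_t(T,\cdot)=0$. It exists and is unique. Normal trace of a solution by transposition $v$: let $\xi\in H^1_\alpha$ be the unique element with $\int_0^1x^\alpha\xi_xw_x\,dx=-\langle v^1,w\rangle$ for all $w\in H^1_\alpha$; then $V(t,x)=\int_0^tv(s,x)\,ds+\xi(x)$ is the weak solution of the homogeneous problem with data $(\xi,v^0)$, so $V_x(\cdot,1)\in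 L^2(0,T)$, and $v_x(\cdot,1):=\frac{d}{dt}V_x(\cdot,1)$ in $\mathcal D'(0,T)$ (for weak solutions this is the usual trace). *)

theory Defs
  imports "HOL-Analysis.Analysis"
begin

text \<open>
  Elements of Lebesgue and Sobolev spaces are represented by real functions.  Square integrable
  functions are identified when they agree almost everywhere, and wherever two such functions are
  compared below this is done with \<open>AE\<close>.
\<close>

definition L2 :: "real set \<Rightarrow> (real \<Rightarrow> real) set" where
  "L2 S = {u. u \<in> borel_measurable (lebesgue_on S) \<and> integrable (lebesgue_on S) (\<lambda>x. (u x)\<^sup>2)}"

definition L2_nrm :: "real set \<Rightarrow> (real \<Rightarrow> real) \<Rightarrow> real" where
  "L2_nrm S u = sqrt (\<integral>x. (u x)\<^sup>2 \<partial>lebesgue_on S)"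

abbreviation I01 :: "real set" where "I01 \<equiv> {0<..<1}"

text \<open>
  Absolute continuity on \<open>[a,b]\<close>: a finite family of non-overlapping intervals is given by the set
  of pairs of its endpoints.
\<close>

definition abs_cont_on :: "real \<Rightarrow> real \<Rightarrow> (real \<Rightarrow> real) \<Rightarrow> bool" where
  "abs_cont_on a b u \<longleftrightarrow>
    (\<forall>\<epsilon>>0. \<exists>\<delta>>0. \<forall>P :: (real \<times> real) set.
       finite P \<and> (\<forall>(c, d)\<in>P. a \<le> c \<and> c \<le> d \<and> d \<le> b) \<and>
       (\<forall>p\<in>P. \<forall>q\<in>P. p \<noteq> q \<longrightarrow> {fst p<..<snd p} \<inter> {fst q<..<snd q} = {}) \<and>
       (\<Sum>(c, d)\<in>P. d - c) < \<delta>
       \<longrightarrow> (\<Sum>(c, d)\<in>P. \<bar>u d - u c\<bar>) < \<epsilon>)"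

text \<open>
  The derivative \<open>u\<^sub>x\<close> of a (locally) absolutely continuous function is its almost everywhere
  existing classical derivative \<open>deriv u\<close>.
\<close>

definition H1 :: "real \<Rightarrow> (real \<Rightarrow> real) set" where
  "H1 \<alpha> = {u. u \<in> L2 I01 \<and> (\<lambda>x. x powr (\<alpha> / 2) * deriv u x) \<in> L2 I01 \<and> u 1 = 0 \<and>
     (if \<alpha> < 1 then abs_cont_on 0 1 u \<and> u 0 = 0 else (\<forall>a\<in>I01. abs_cont_on a 1 u))}"

definition H1_nrm :: "real \<Rightarrow> (real \<Rightarrow> real) \<Rightarrow> real" where
  "H1_nrm \<alpha> u = sqrt ((L2_nrm I01 u)\<^sup>2 + (L2_nrm I01 (\<lambda>x. x powr (\<alpha> / 2) * deriv u x))\<^sup>2)"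

text \<open>
  The dual space: functionals of which only the values on \<open>H1 \<alpha>\<close> are relevant.
  The duality pairing of \<open>L\<close> and \<open>w\<close> is \<open>L w\<close>.
\<close>

definition H1_dual :: "real \<Rightarrow> ((real \<Rightarrow> real) \<Rightarrow> real) set" where
  "H1_dual \<alpha> = {L. (\<forall>u\<in>H1 \<alpha>. \<forall>w\<in>H1 \<alpha>. L (\<lambda>x. u x + w x) = L u + L w) \<and>
     (\<forall>c. \<forall>u\<in>H1 \<alpha>. L (\<lambda>x. c * u x) = c * L u) \<and>
     (\<exists>C. \<forall>u\<in>H1 \<alpha>. \<bar>L u\<bar> \<le> C * H1_nrm \<alpha> u)}"

definition flux_form :: "real \<Rightarrow> (real \<Rightarrow> real) \<Rightarrow> (real \<Rightarrow> real) \<Rightarrow> real" where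
  "flux_form \<alpha> u w = (\<integral>x. x powr \<alpha> * deriv u x * deriv w x \<partial>lebesgue_on I01)"

text \<open>
  \<open>L\<^sup>1(0,T;L\<^sup>2(0,1))\<close> and \<open>L\<^sup>\<infinity>(0,T;L\<^sup>2(0,1))\<close> as spaces of measurable functions
  on \<open>(0,T) \<times> (0,1)\<close> with mixed norms; the first argument is time.
\<close>

definition meas_Q :: "real \<Rightarrow> (real \<Rightarrow> real \<Rightarrow> real) \<Rightarrow> bool" where
  "meas_Q T f \<longleftrightarrow> (\<lambda>(t, x). f t x) \<in> borel_measurable (lebesgue_on ({0<..<T} \<times> I01))"

definition L1_L2 :: "real \<Rightarrow> (real \<Rightarrow> real \<Rightarrow> real) set" where
  "L1_L2 T = {f. meas_Q T f \<and> (AE t in lebesgue_on {0<..<T}. f t \<in> L2 I01) \<and>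
     integrable (lebesgue_on {0<..<T}) (\<lambda>t. L2_nrm I01 (f t))}"

definition Linf_L2 :: "real \<Rightarrow> (real \<Rightarrow> real \<Rightarrow> real) set" where
  "Linf_L2 T = {f. meas_Q T f \<and>
     (\<exists>C. AE t in lebesgue_on {0<..<T}. f t \<in> L2 I01 \<and> L2_nrm I01 (f t) \<le> C)}"

definition test_fun :: "real \<Rightarrow> (real \<Rightarrow> real) \<Rightarrow> bool" where
  "test_fun T \<phi> \<longleftrightarrow> (\<forall>n t. (deriv ^^ n) \<phi> differentiable (at t)) \<and>
     compact (closure {t. \<phi> t \<noteq> 0}) \<and> closure {t. \<phi> t \<noteq> 0} \<subseteq> {0<..<T}"

definition C0_H1 :: "real \<Rightarrow> real \<Rightarrow> (real \<Rightarrow> real \<Rightarrow> real) \<Rightarrow> bool" where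
  "C0_H1 \<alpha> T y \<longleftrightarrow> (\<forall>t\<in>{0..T}. y t \<in> H1 \<alpha> \<and>
     ((\<lambda>s. H1_nrm \<alpha> (\<lambda>x. y s x - y t x)) \<longlongrightarrow> 0) (at t within {0..T}))"

text \<open>\<open>y \<in> C\<^sup>1([0,T];L\<^sup>2(0,1))\<close> with time derivative \<open>y'\<close>.\<close>

definition C1_L2 :: "real \<Rightarrow> (real \<Rightarrow> real \<Rightarrow> real) \<Rightarrow> (real \<Rightarrow> real \<Rightarrow> real) \<Rightarrow> bool" where
  "C1_L2 T y y' \<longleftrightarrow> (\<forall>t\<in>{0..T}. y t \<in> L2 I01 \<and> y' t \<in> L2 I01 \<and>
     ((\<lambda>s. L2_nrm I01 (\<lambda>x. (y s x - y t x) / (s - t) - y' t x)) \<longlongrightarrow> 0) (at t within {0..T}) \<and>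
     ((\<lambda>s. L2_nrm I01 (\<lambda>x. y' s x - y' t x)) \<longlongrightarrow> 0) (at t within {0..T}))"

text \<open>
  Weak solution \<open>y\<close>, with time derivative \<open>y'\<close>, source \<open>f\<close> and initial data \<open>(y0, y1)\<close>.
  The boundary conditions are encoded in \<open>H1 \<alpha>\<close> as trial and test space.
\<close>

definition weak_solution ::
  "real \<Rightarrow> real \<Rightarrow> (real \<Rightarrow> real \<Rightarrow> real) \<Rightarrow> (real \<Rightarrow> real) \<Rightarrow> (real \<Rightarrow> real) \<Rightarrow>
   (real \<Rightarrow> real \<Rightarrow> real) \<Rightarrow> (real \<Rightarrow> real \<Rightarrow> real) \<Rightarrow> bool" where
  "weak_solution \<alpha> T f y0 y1 y y' \<longleftrightarrow>
     C0_H1 \<alpha> T y \<and> C1_L2 T y y' \<and>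
     (AE x in lebesgue_on I01. y 0 x = y0 x) \<and> (AE x in lebesgue_on I01. y' 0 x = y1 x) \<and>
     (\<forall>w\<in>H1 \<alpha>. \<forall>\<phi>. test_fun T \<phi> \<longrightarrow>
        (\<integral>t. (\<integral>x. - y' t x * w x * deriv \<phi> t
                    + x powr \<alpha> * deriv (y t) x * deriv w x * \<phi> t \<partial>lebesgue_on I01)
           \<partial>lebesgue_on {0<..<T})
        = (\<integral>t. (\<integral>x. f t x * w x * \<phi> t \<partial>lebesgue_on I01) \<partial>lebesgue_on {0<..<T}))"

text \<open>Backward problem with vanishing data at time \<open>T\<close>, through the reflection of time.\<close>

definition backward_solution ::
  "real \<Rightarrow> real \<Rightarrow> (real \<Rightarrow> real \<Rightarrow> real) \<Rightarrow>
   (real \<Rightarrow> real \<Rightarrow> real) \<Rightarrow> (real \<Rightarrow> real \<Rightarrow> real) \<Rightarrow> bool" where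
  "backward_solution \<alpha> T F \<theta> \<theta>' \<longleftrightarrow>
     weak_solution \<alpha> T (\<lambda>t. F (T - t)) (\<lambda>x. 0) (\<lambda>x. 0) (\<lambda>t. \<theta> (T - t)) (\<lambda>t x. - \<theta>' (T - t) x)"

definition transposition_solution ::
  "real \<Rightarrow> real \<Rightarrow> (real \<Rightarrow> real) \<Rightarrow> ((real \<Rightarrow> real) \<Rightarrow> real) \<Rightarrow> (real \<Rightarrow> real \<Rightarrow> real) \<Rightarrow> bool" where
  "transposition_solution \<alpha> T v0 v1 v \<longleftrightarrow>
     v \<in> Linf_L2 T \<and>
     (\<forall>F\<in>L1_L2 T. \<forall>\<theta> \<theta>'. backward_solution \<alpha> T F \<theta> \<theta>' \<longrightarrow>
        (\<integral>t. (\<integral>x. v t x * F t x \<partial>lebesgue_on I01) \<partial>lebesgue_on {0<..<T})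
        = - (\<integral>x. v0 x * \<theta>' 0 x \<partial>lebesgue_on I01) + v1 (\<theta> 0))"

text \<open>
  The trace \<open>y\<^sub>x(\<cdot>,1) = G\<close> in \<open>L\<^sup>2(0,T)\<close>: the map \<open>x \<mapsto> y(\<cdot>,x)\<close> into \<open>L\<^sup>2(0,T)\<close> has the left
  derivative \<open>G\<close> at \<open>1\<close>.  For a weak solution \<open>y(t,\<cdot>)\<close> is only absolutely continuous, so no
  pointwise derivative at \<open>1\<close> is available for each individual \<open>t\<close>.
\<close>

definition normal_trace :: "real \<Rightarrow> (real \<Rightarrow> real \<Rightarrow> real) \<Rightarrow> (real \<Rightarrow> real) \<Rightarrow> bool" where
  "normal_trace T y G \<longleftrightarrow> G \<in> L2 {0<..<T} \<and>
     (\<forall>\<^sub>F x in at_left 1. (\<lambda>t. (y t x - y t 1) / (x - 1)) \<in> L2 {0<..<T}) \<and>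
     ((\<lambda>x. L2_nrm {0<..<T} (\<lambda>t. (y t x - y t 1) / (x - 1) - G t)) \<longlongrightarrow> 0) (at_left 1)"

text \<open>
  \<open>V(t,x) = \<integral>\<^sub>0\<^sup>t v(s,x) ds + \<xi>(x)\<close>, where each \<open>V(t,\<cdot>)\<close> is the representative in \<open>H1 \<alpha>\<close>.
\<close>

definition lifted_solution ::
  "real \<Rightarrow> real \<Rightarrow> ((real \<Rightarrow> real) \<Rightarrow> real) \<Rightarrow> (real \<Rightarrow> real \<Rightarrow> real) \<Rightarrow> (real \<Rightarrow> real \<Rightarrow> real) \<Rightarrow> bool" where
  "lifted_solution \<alpha> T v1 v V \<longleftrightarrow>
     (\<exists>\<xi>\<in>H1 \<alpha>. (\<forall>w\<in>H1 \<alpha>. flux_form \<alpha> \<xi> w = - v1 w) \<and>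
        (\<forall>t\<in>{0..T}. V t \<in> H1 \<alpha> \<and>
           (AE x in lebesgue_on I01. V t x = (\<integral>s. v s x \<partial>lebesgue_on {0<..<t}) + \<xi> x)))"

text \<open>
  The normal trace of a solution by transposition, \<open>v\<^sub>x(\<cdot>,1) = d/dt V\<^sub>x(\<cdot>,1)\<close> in the sense of
  distributions on \<open>(0,T)\<close>, is the function \<open>g \<in> L\<^sup>2(0,T)\<close>.
\<close>

definition transposition_normal_trace ::
  "real \<Rightarrow> real \<Rightarrow> ((real \<Rightarrow> real) \<Rightarrow> real) \<Rightarrow> (real \<Rightarrow> real \<Rightarrow> real) \<Rightarrow> (real \<Rightarrow> real) \<Rightarrow> bool" where
  "transposition_normal_trace \<alpha> T v1 v g \<longleftrightarrow>
     g \<in> L2 {0<..<T} \<and>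
     (\<exists>V G. lifted_solution \<alpha> T v1 v V \<and> normal_trace T V G \<and>
        (\<forall>\<phi>. test_fun T \<phi> \<longrightarrow>
           (\<integral>t. g t * \<phi> t \<partial>lebesgue_on {0<..<T}) = - (\<integral>t. G t * deriv \<phi> t \<partial>lebesgue_on {0<..<T})))"

end

(* With A = - d/dx (x^alpha d/dx) under (BC), the compact operator Kop = A^-1 turns everything into an
   abstract equation in L^2(0,1): testing the transposition identity with explicit backward solutions
   theta(t) = (tau - t)_+^2 / 2 * Kop w shows that V(t) = xi + int_0^t v satisfies
   <V(t), Kop w> = <xi, Kop w> + t <v0, Kop w> - int_0^t int_0^s <V(r), w> dr ds for all w.
   Mollify V in time and differentiate: the result is a smooth solution whose normal trace is a
   mollification of g, hence bounded in L^2 uniformly in the mollification parameter.  The multiplier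
   x u_x + (alpha/4) u gives the observability estimate: for T large, the energy of this solution is
   controlled by its normal trace.  The energy at time 0 is therefore bounded, so the data (v0, v1) are
   bounded functionals in the stronger norm, and Riesz representation gives (v0, v1) in H^1 x L^2. *)
theory Submission
  imports Defs
begin

section \<open>Absolutely continuous functions\<close>

text \<open>The data lie one order below the energy space, so the multiplier argument does not apply
  to v itself. Regularising in time alone commutes with the operator and keeps the boundary
  conditions, and observability is then used in the direction that bounds the data by the trace. The
  mollifier looks forward over a window of length h \<le> T/2, which leaves at least T/2 for the
  observation; the threshold 8 (1 + C) / (2 - \<alpha>), with C a bound for \<open>R\<close>, is
  where T (2 - \<alpha>) / 4 exceeds 2 (1 + C).

  Testing against the range of \<open>Kop\<close> is conclusive because \<open>Kop\<close> is
  symmetric and injective. Integrations by parts in x are performed on integral kernels through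
  Fubini, where all functions are mere L^2 classes. The pointwise notions in the statement need
  separate bridges: epsilon-delta absolute continuity with \<open>deriv\<close> requires a
  fundamental theorem of calculus, proved from Vitali's theorem, and a trace defined by difference
  quotients in L^2(0,T) requires exchanging a time average with a normal derivative at 1.\<close>

text \<open>A segment with endpoints x and x + h is the ball about x + h/2 of radius |h|/2, so the
  ball version of Vitali's theorem applies although the tags are endpoints and not centres.
  Difference quotients need endpoint tags, with h of either sign.\<close>

lemma Vitali_signed_intervals:
  fixes S :: "real set" and K :: "(real \<times> real) set"
  assumes "\<And>x h. (x, h) \<in> K \<Longrightarrow> h \<noteq> 0"
    and "\<And>x d. x \<in> S \<Longrightarrow> 0 < d \<Longrightarrow> \<exists>h. (x, h) \<in> K \<and> \<bar>h\<bar> < d"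
  obtains C where "countable C" "C \<subseteq> K"
    "pairwise (\<lambda>p q. disjnt (closed_segment (fst p) (fst p + snd p)) (closed_segment (fst q) (fst q + snd q))) C"
    "negligible (S - (\<Union>p\<in>C. closed_segment (fst p) (fst p + snd p)))"
proof -
  have seg: "cball (fst p + snd p / 2) (\<bar>snd p\<bar> / 2) = closed_segment (fst p) (fst p + snd p)" for p :: "real \<times> real"
    by (auto simp: closed_segment_eq_real_ivl cball_eq_atLeastAtMost abs_if field_simps)
  show ?thesis
  proof (rule Vitali_covering_theorem_cballs[of K "\<lambda>p. \<bar>snd p\<bar> / 2" S "\<lambda>p. fst p + snd p / 2"])
    show "0 < \<bar>snd p\<bar> / 2" if "p \<in> K" for p
      using assms(1)[of "fst p" "snd p"] that by simp
    fix x d :: real assume "x \<in> S" "0 < d"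
    then obtain h where "(x, h) \<in> K" "\<bar>h\<bar> < d"
      using assms(2) by blast
    then show "\<exists>p. p \<in> K \<and> x \<in> cball (fst p + snd p / 2) (\<bar>snd p\<bar> / 2) \<and> \<bar>snd p\<bar> / 2 < d"
      by (intro exI[of _ "(x, h)"]) (simp add: dist_real_def)
  qed (use that seg in auto)
qed

lemma integral_difference_closed_segment:
  fixes f :: "real \<Rightarrow> real"
  assumes f: "f integrable_on {a..b}" and "x \<in> {a..b}" "x + h \<in> {a..b}"
  shows "integral {a..x + h} f - integral {a..x} f = sgn h * integral (closed_segment x (x + h)) f"
proof (cases "h \<ge> 0")
  case True
  have "integral {a..x} f + integral {x..x+h} f = integral {a..x+h} f"
    using assms True by (intro Henstock_Kurzweil_Integration.integral_combine)
      (auto intro: integrable_subinterval_real)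
  then show ?thesis
    using True by (auto simp: closed_segment_eq_real_ivl sgn_if)
next
  case False
  have "integral {a..x+h} f + integral {x+h..x} f = integral {a..x} f"
    using assms False by (intro Henstock_Kurzweil_Integration.integral_combine)
      (auto intro: integrable_subinterval_real)
  then show ?thesis
    using False by (auto simp: closed_segment_eq_real_ivl sgn_if)
qed

text \<open>By Henstock's lemma the errors of f(x) |k| against the integral of f over k, summed over
  a gauge-fine tagged partial division, stay below e \<eta>. Each bad segment contributes at least
  \<eta> times its length, so disjoint bad segments have total length at most e; Vitali selects such
  segments covering the bad set up to a null set.\<close>

lemma negligible_bad_difference_quotient:
  fixes f :: "real \<Rightarrow> real"
  assumes f: "f integrable_on {a..b}" and "\<eta> > 0"
  shows "negligible {x\<in>{a<..<b}. \<forall>d>0. \<exists>h. h \<noteq> 0 \<and> \<bar>h\<bar> < d \<and>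
           \<eta> * \<bar>h\<bar> < \<bar>integral {a..x + h} f - integral {a..x} f - h * f x\<bar>}"
    (is "negligible ?E")
  unfolding negligible_outer_le
proof (intro allI impI)
  fix e :: real assume "e > 0"
  define seg where "seg = (\<lambda>p::real\<times>real. closed_segment (fst p) (fst p + snd p))"
  obtain \<gamma> where "gauge \<gamma>" and \<gamma>:
    "\<And>p. \<lbrakk>p tagged_partial_division_of (cbox a b); \<gamma> fine p\<rbrakk> \<Longrightarrow>
             sum (\<lambda>(x,k). norm (measure lborel k *\<^sub>R f x - integral k f)) p < e * \<eta>"
    using Henstock_lemma[of f a b "e * \<eta>"] f \<open>e > 0\<close> \<open>\<eta> > 0\<close> by (auto simp: cbox_interval)
  \<comment> \<open>Keeping each segment inside \<gamma> x makes every finite disjoint subfamily a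
    fine tagged partial division with tag x.\<close>
  define K where "K = {(x, h). x \<in> {a<..<b} \<and> h \<noteq> 0 \<and> seg (x, h) \<subseteq> {a..b} \<and> seg (x, h) \<subseteq> \<gamma> x \<and>
    \<eta> * \<bar>h\<bar> < \<bar>integral {a..x + h} f - integral {a..x} f - h * f x\<bar>}"
  have K: "\<exists>h. (x, h) \<in> K \<and> \<bar>h\<bar> < d" if x: "x \<in> ?E" and "0 < d" for x d
  proof -
    have "open (\<gamma> x)" "x \<in> \<gamma> x"
      using \<open>gauge \<gamma>\<close> by (auto simp: gauge_def)
    then have "open (\<gamma> x \<inter> {a<..<b})" "x \<in> \<gamma> x \<inter> {a<..<b}"
      using x by auto
    then obtain r where r: "r > 0" "ball x r \<subseteq> \<gamma> x \<inter> {a<..<b}"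
      by (meson openE)
    have "min d r > 0" using r \<open>0 < d\<close> by simp
    with x obtain h where h: "h \<noteq> 0" "\<bar>h\<bar> < min d r" 
      "\<eta> * \<bar>h\<bar> < \<bar>integral {a..x + h} f - integral {a..x} f - h * f x\<bar>"
      by blast
    have "seg (x, h) \<subseteq> ball x r"
      using h by (auto simp: seg_def closed_segment_eq_real_ivl dist_real_def split: if_splits)
    then show ?thesis
      using r h x by (intro exI[of _ h]) (auto simp: K_def)
  qed
  obtain C where C: "countable C" "C \<subseteq> K" "pairwise (\<lambda>p q. disjnt (seg p) (seg q)) C"
    "negligible (?E - (\<Union>p\<in>C. seg p))"
    using Vitali_signed_intervals[of K ?E] K unfolding seg_def by (auto simp: K_def)
  have fin: "measure lebesgue (\<Union>p\<in>D. seg p) \<le> e" if D: "D \<subseteq> C" "finite D" for D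
  proof -
    have inj: "inj_on (\<lambda>p. (fst p, seg p)) D"
    proof (rule inj_onI)
      fix p q assume "p \<in> D" "q \<in> D" "(fst p, seg p) = (fst q, seg q)"
      moreover have "fst p \<in> seg p" for p by (simp add: seg_def)
      ultimately show "p = q"
        using C(3) D(1) unfolding pairwise_def disjnt_def by blast
    qed
    have "(\<lambda>p. (fst p, seg p)) ` D tagged_partial_division_of cbox a b"
      unfolding tagged_partial_division_of_def
    proof (intro conjI allI impI)
      show "finite ((\<lambda>p. (fst p, seg p)) ` D)" using D by simp
      fix x k assume "(x, k) \<in> (\<lambda>p. (fst p, seg p)) ` D"
      then obtain p where p: "p \<in> D" "x = fst p" "k = seg p" by auto
      show "x \<in> k" using p by (simp add: seg_def)
      show "k \<subseteq> cbox a b" using p D C by (auto simp: K_def cbox_interval)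
      show "\<exists>a b. k = cbox a b" 
        unfolding p seg_def closed_segment_eq_real_ivl cbox_interval[symmetric] by metis
    next
      fix x1 K1 x2 K2
      assume "(x1, K1) \<in> (\<lambda>p. (fst p, seg p)) ` D \<and> (x2, K2) \<in> (\<lambda>p. (fst p, seg p)) ` D \<and> (x1, K1) \<noteq> (x2, K2)"
      then obtain p q where "p \<in> D" "q \<in> D" "K1 = seg p" "K2 = seg q" "p \<noteq> q" by auto
      then have "K1 \<inter> K2 = {}"
        using C(3) D(1) unfolding pairwise_def disjnt_def by blast
      then show "interior K1 \<inter> interior K2 = {}"
        using interior_subset by blast
    qed
    moreover have "\<gamma> fine (\<lambda>p. (fst p, seg p)) ` D"
    proof -
      have "seg p \<subseteq> \<gamma> (fst p)" if "p \<in> D" for p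
        using that D(1) C(2) by (cases p) (auto simp: K_def)
      then show ?thesis by (auto simp: fine_def)
    qed
    ultimately have "sum (\<lambda>(x,k). norm (measure lborel k *\<^sub>R f x - integral k f)) ((\<lambda>p. (fst p, seg p)) ` D) < e * \<eta>"
      using \<gamma> by blast
    then have *: "(\<Sum>p\<in>D. \<bar>measure lborel (seg p) * f (fst p) - integral (seg p) f\<bar>) < e * \<eta>"
      by (subst (asm) sum.reindex[OF inj]) (simp add: o_def)
    have content_seg: "measure lborel (seg p) = \<bar>snd p\<bar>" for p
      by (auto simp: seg_def closed_segment_eq_real_ivl)
    have "\<eta> * \<bar>snd p\<bar> \<le> \<bar>measure lborel (seg p) * f (fst p) - integral (seg p) f\<bar>" if "p \<in> D" for p
    proof -
      obtain x h where p: "p = (x, h)" by fastforce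
      have "(x, h) \<in> K" using that D C p by auto
      then have xh: "h \<noteq> 0" "x \<in> {a..b}" "x + h \<in> {a..b}"
        "\<eta> * \<bar>h\<bar> < \<bar>integral {a..x + h} f - integral {a..x} f - h * f x\<bar>"
        by (auto simp: K_def seg_def)
      have "integral {a..x + h} f - integral {a..x} f - h * f x
          = sgn h * (integral (seg p) f - \<bar>h\<bar> * f x)"
        using integral_difference_closed_segment[OF f xh(2,3)] xh(1)
        by (auto simp: p seg_def algebra_simps sgn_if)
      then have "\<bar>integral {a..x + h} f - integral {a..x} f - h * f x\<bar>
          = \<bar>measure lborel (seg p) * f (fst p) - integral (seg p) f\<bar>"
        using xh(1) by (simp add: content_seg abs_mult abs_sgn_eq abs_minus_commute) (simp add: p)
      then show ?thesis using xh(4) p by simp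
    qed
    then have "\<eta> * (\<Sum>p\<in>D. \<bar>snd p\<bar>) \<le> (\<Sum>p\<in>D. \<bar>measure lborel (seg p) * f (fst p) - integral (seg p) f\<bar>)"
      by (simp add: sum_distrib_left sum_mono)
    also note *
    finally have "(\<Sum>p\<in>D. \<bar>snd p\<bar>) \<le> e"
      using \<open>\<eta> > 0\<close> by (simp add: mult.commute)
    moreover have "measure lebesgue (\<Union>p\<in>D. seg p) \<le> (\<Sum>p\<in>D. measure lebesgue (seg p))"
      using D by (intro measure_UNION_le) (auto simp: seg_def)
    ultimately show ?thesis
      using content_seg by (simp add: seg_def closed_segment_eq_real_ivl measure_completion split: if_splits)
  qed
  have segm: "seg p \<in> lmeasurable" for p
    by (auto simp: seg_def intro!: lmeasurable_compact)
  have U: "(\<Union>p\<in>C. seg p) \<in> lmeasurable" "measure lebesgue (\<Union>p\<in>C. seg p) \<le> e"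
    by (rule fmeasurable_UN_bound[OF C(1) segm fin] measure_UN_bound[OF C(1) segm fin]; assumption)+
  have N: "?E - (\<Union>p\<in>C. seg p) \<in> lmeasurable" "measure lebesgue (?E - (\<Union>p\<in>C. seg p)) = 0"
    using C(4) by (auto simp: negligible_imp_measurable negligible_imp_measure0)
  show "\<exists>T. ?E \<subseteq> T \<and> T \<in> lmeasurable \<and> measure lebesgue T \<le> e"
  proof (intro exI conjI)
    show "?E \<subseteq> (?E - (\<Union>p\<in>C. seg p)) \<union> (\<Union>p\<in>C. seg p)" by blast
    show "(?E - (\<Union>p\<in>C. seg p)) \<union> (\<Union>p\<in>C. seg p) \<in> lmeasurable"
      using U N by (intro fmeasurable.Un)
    show "measure lebesgue ((?E - (\<Union>p\<in>C. seg p)) \<union> (\<Union>p\<in>C. seg p)) \<le> e"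
      using U N measure_Un_le[of "?E - (\<Union>p\<in>C. seg p)" lebesgue "\<Union>p\<in>C. seg p"] by (auto dest: fmeasurableD)
  qed
qed

theorem Lebesgue_differentiation:
  fixes f :: "real \<Rightarrow> real"
  assumes f: "f integrable_on {a..b}"
  shows "negligible {x\<in>{a<..<b}. \<not> ((\<lambda>x. integral {a..x} f) has_real_derivative f x) (at x)}"
proof -
  let ?F = "\<lambda>x. integral {a..x} f"
  let ?E = "\<lambda>n::nat. {x\<in>{a<..<b}. \<forall>d>0. \<exists>h. h \<noteq> 0 \<and> \<bar>h\<bar> < d \<and>
           inverse (Suc n) * \<bar>h\<bar> < \<bar>?F (x + h) - ?F x - h * f x\<bar>}"
  have "negligible (\<Union>n. ?E n)"
    by (intro negligible_Union_nat negligible_bad_difference_quotient f) simp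
  moreover have "{x\<in>{a<..<b}. \<not> (?F has_real_derivative f x) (at x)} \<subseteq> (\<Union>n. ?E n)"
  proof clarify
    fix x assume x: "x \<in> {a<..<b}" and nd: "\<not> (?F has_real_derivative f x) (at x)"
    show "x \<in> (\<Union>n. ?E n)"
    proof (rule ccontr)
      assume *: "x \<notin> (\<Union>n. ?E n)"
      have "(\<lambda>h. (?F (x + h) - ?F x) / h) \<midarrow>0\<rightarrow> f x"
      proof (rule LIM_I)
        fix r :: real assume "0 < r"
        then obtain n where n: "inverse (Suc n) < r"
          using reals_Archimedean by auto
        from * x obtain d where d: "d > 0"
          "\<And>h. h \<noteq> 0 \<Longrightarrow> \<bar>h\<bar> < d \<Longrightarrow> \<bar>?F (x + h) - ?F x - h * f x\<bar> \<le> inverse (Suc n) * \<bar>h\<bar>"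
        proof -
          have "x \<notin> ?E n" using * by blast
          then have "\<exists>d>0. \<forall>h. h \<noteq> 0 \<longrightarrow> \<bar>h\<bar> < d \<longrightarrow> \<bar>?F (x + h) - ?F x - h * f x\<bar> \<le> inverse (Suc n) * \<bar>h\<bar>"
            using x unfolding mem_Collect_eq by (meson not_less)
          then show ?thesis using that by blast
        qed
        show "\<exists>s>0. \<forall>h. h \<noteq> 0 \<and> norm (h - 0) < s \<longrightarrow> norm ((?F (x + h) - ?F x) / h - f x) < r"
        proof (intro exI conjI allI impI)
          fix h :: real assume h: "h \<noteq> 0 \<and> norm (h - 0) < d"
          have "norm ((?F (x + h) - ?F x) / h - f x) = \<bar>?F (x + h) - ?F x - h * f x\<bar> / \<bar>h\<bar>"
            using h by (simp add: abs_divide[symmetric] diff_divide_distrib)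
          also have "\<dots> \<le> inverse (Suc n)"
            using d(2)[of h] h by (simp add: field_simps)
          finally show "norm ((?F (x + h) - ?F x) / h - f x) < r" using n by simp
        qed (use d in auto)
      qed
      then show False using nd by (simp add: DERIV_def)
    qed
  qed
  ultimately show ?thesis
    using negligible_subset by blast
qed

section \<open>Absolute continuity: stability properties and indefinite integrals\<close>

definition nonoverlapping_in :: "real \<Rightarrow> real \<Rightarrow> (real \<times> real) set \<Rightarrow> bool" where
  "nonoverlapping_in a b P \<longleftrightarrow> finite P \<and> (\<forall>(c, d)\<in>P. a \<le> c \<and> c \<le> d \<and> d \<le> b) \<and>
     (\<forall>p\<in>P. \<forall>q\<in>P. p \<noteq> q \<longrightarrow> {fst p<..<snd p} \<inter> {fst q<..<snd q} = {})"

lemma abs_cont_on_iff: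
  "abs_cont_on a b u \<longleftrightarrow> (\<forall>\<epsilon>>0. \<exists>\<delta>>0. \<forall>P. nonoverlapping_in a b P \<longrightarrow>
     (\<Sum>(c, d)\<in>P. d - c) < \<delta> \<longrightarrow> (\<Sum>(c, d)\<in>P. \<bar>u d - u c\<bar>) < \<epsilon>)"
  unfolding abs_cont_on_def nonoverlapping_in_def by (simp only: imp_conjL conj_assoc)

lemma nonoverlapping_in_mono:
  "nonoverlapping_in c d P \<Longrightarrow> a \<le> c \<Longrightarrow> d \<le> b \<Longrightarrow> nonoverlapping_in a b P"
  unfolding nonoverlapping_in_def by fastforce

lemma abs_cont_on_subinterval:
  "abs_cont_on a b u \<Longrightarrow> a \<le> c \<Longrightarrow> d \<le> b \<Longrightarrow> abs_cont_on c d u"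
  unfolding abs_cont_on_iff using nonoverlapping_in_mono by meson

lemma abs_cont_on_cong:
  assumes "abs_cont_on a b u" "\<And>x. x \<in> {a..b} \<Longrightarrow> u x = v x"
  shows "abs_cont_on a b v"
proof -
  have "(\<Sum>(c, d)\<in>P. \<bar>u d - u c\<bar>) = (\<Sum>(c, d)\<in>P. \<bar>v d - v c\<bar>)" if "nonoverlapping_in a b P" for P
    using that assms(2) unfolding nonoverlapping_in_def by (intro sum.cong) fastforce+
  then show ?thesis
    using assms(1) unfolding abs_cont_on_iff by simp
qed

lemma abs_cont_on_diff:
  assumes "abs_cont_on a b u" "abs_cont_on a b v"
  shows "abs_cont_on a b (\<lambda>x. u x - v x)"
  unfolding abs_cont_on_iff
proof (intro allI impI)
  fix \<epsilon> :: real assume "\<epsilon> > 0"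
  then have e2: "\<epsilon> / 2 > 0" by simp
  obtain \<delta>1 where 1: "\<delta>1 > 0" "\<And>P. nonoverlapping_in a b P \<Longrightarrow> (\<Sum>(c, d)\<in>P. d - c) < \<delta>1 \<Longrightarrow> (\<Sum>(c, d)\<in>P. \<bar>u d - u c\<bar>) < \<epsilon> / 2"
    using assms(1) e2 unfolding abs_cont_on_iff by meson
  obtain \<delta>2 where 2: "\<delta>2 > 0" "\<And>P. nonoverlapping_in a b P \<Longrightarrow> (\<Sum>(c, d)\<in>P. d - c) < \<delta>2 \<Longrightarrow> (\<Sum>(c, d)\<in>P. \<bar>v d - v c\<bar>) < \<epsilon> / 2"
    using assms(2) e2 unfolding abs_cont_on_iff by meson
  have "(\<Sum>(c, d)\<in>P. \<bar>u d - v d - (u c - v c)\<bar>) < \<epsilon>"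
    if P: "nonoverlapping_in a b P" "(\<Sum>(c, d)\<in>P. d - c) < min \<delta>1 \<delta>2" for P
  proof -
    have "(\<Sum>(c, d)\<in>P. \<bar>u d - v d - (u c - v c)\<bar>) \<le> (\<Sum>(c, d)\<in>P. \<bar>u d - u c\<bar>) + (\<Sum>(c, d)\<in>P. \<bar>v d - v c\<bar>)"
      unfolding sum.distrib[symmetric] by (intro sum_mono) auto
    also have "\<dots> < \<epsilon>"
      using 1(2)[OF P(1)] 2(2)[OF P(1)] P(2) by simp
    finally show ?thesis .
  qed
  then show "\<exists>\<delta>>0. \<forall>P. nonoverlapping_in a b P \<longrightarrow> (\<Sum>(c, d)\<in>P. d - c) < \<delta> \<longrightarrow>
           (\<Sum>(c, d)\<in>P. \<bar>u d - v d - (u c - v c)\<bar>) < \<epsilon>"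
    using 1(1) 2(1) by (intro exI[of _ "min \<delta>1 \<delta>2"]) auto
qed

text \<open>Passing to the open intervals does not change the integrals and makes the domains
  disjoint, so that the restrictions of h add up to at most h at each point.\<close>

lemma nonoverlapping_sum_integral_le:
  fixes h :: "real \<Rightarrow> real"
  assumes P: "nonoverlapping_in a b P" and h: "h integrable_on {a..b}" "\<And>x. x \<in> {a..b} \<Longrightarrow> 0 \<le> h x"
  shows "(\<Sum>(c, d)\<in>P. integral {c..d} h) \<le> integral {a..b} h"
proof -
  have fin: "finite P" using P by (simp add: nonoverlapping_in_def)
  let ?r = "\<lambda>p x. if x \<in> {fst p<..<snd p} then h x else 0"
  have hs: "((?r p) has_integral integral {fst p..snd p} h) {a..b}" if "p \<in> P" for p
  proof -
    have sub: "{fst p..snd p} \<subseteq> {a..b}"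
      using that P by (auto simp: nonoverlapping_in_def)
    then have "(h has_integral integral {fst p..snd p} h) {fst p..snd p}"
      using h(1) by (meson integrable_integral integrable_subinterval_real)
    then have "(h has_integral integral {fst p..snd p} h) {fst p<..<snd p}"
      by (simp add: has_integral_Icc_iff_Ioo)
    then show ?thesis
      using sub greaterThanLessThan_subseteq_atLeastAtMost_iff
      by (subst has_integral_restrict) (auto simp: subset_iff less_imp_le)
  qed
  have "((\<lambda>x. \<Sum>p\<in>P. ?r p x) has_integral (\<Sum>p\<in>P. integral {fst p..snd p} h)) {a..b}"
    by (intro has_integral_sum fin hs)
  moreover have "(\<Sum>p\<in>P. ?r p x) \<le> h x" if x: "x \<in> {a..b}" for x
  proof (cases "\<exists>p\<in>P. x \<in> {fst p<..<snd p}")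
    case True
    then obtain p where p: "p \<in> P" "x \<in> {fst p<..<snd p}" by blast
    have "?r q x = 0" if "q \<in> P - {p}" for q
    proof -
      have "{fst p<..<snd p} \<inter> {fst q<..<snd q} = {}"
        using that p(1) P unfolding nonoverlapping_in_def by blast
      then show ?thesis using p(2) by (metis IntI empty_iff)
    qed
    then have "(\<Sum>p\<in>P - {p}. ?r p x) = 0"
      by (intro sum.neutral) auto
    then show ?thesis
      using p by (simp add: sum.remove[OF fin p(1)])
  next
    case False
    then have "(\<Sum>p\<in>P. ?r p x) = 0" by (intro sum.neutral) auto
    then show ?thesis using h(2) x by simp
  qed
  ultimately have "(\<Sum>p\<in>P. integral {fst p..snd p} h) \<le> integral {a..b} h"
    using h(1) has_integral_le integrable_integral by blast
  then show ?thesis by (simp add: case_prod_beta)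
qed

lemma nonoverlapping_length_le:
  assumes "nonoverlapping_in a b P" "a \<le> b"
  shows "(\<Sum>(c, d)\<in>P. d - c) \<le> b - a"
proof -
  have "(\<Sum>(c, d)\<in>P. d - c) = (\<Sum>(c, d)\<in>P. integral {c..d} (\<lambda>x. 1::real))"
    using assms by (intro sum.cong) (auto simp: nonoverlapping_in_def)
  also have "\<dots> \<le> integral {a..b} (\<lambda>x. 1)"
    by (rule nonoverlapping_sum_integral_le[OF assms(1)]) (auto simp: integrable_const_ivl)
  finally show ?thesis using assms(2) by simp
qed

text \<open>Truncation at height n: |f| is the sum of |f| - min |f| n, whose integral over the whole
  interval is below \<epsilon>/2 for large n, and of a function bounded by n, whose integral is at
  most n times the total length.\<close>

lemma abs_cont_on_integral:
  fixes f :: "real \<Rightarrow> real"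
  assumes f: "f absolutely_integrable_on {a..b}"
  shows "abs_cont_on a b (\<lambda>x. integral {a..x} f)"
  unfolding abs_cont_on_iff
proof (intro allI impI)
  fix \<epsilon> :: real assume "\<epsilon> > 0"
  let ?m = "\<lambda>n x. \<bar>f x\<bar> - min \<bar>f x\<bar> (real n)"
  have af: "(\<lambda>x. \<bar>f x\<bar>) absolutely_integrable_on {a..b}"
    using absolutely_integrable_norm[OF f] by (simp add: o_def)
  have mf: "(\<lambda>x. min \<bar>f x\<bar> (real n)) absolutely_integrable_on {a..b}" for n
    by (rule absolutely_integrable_min_1[OF af]) (simp add: absolutely_integrable_on_def integrable_const_ivl)
  have i: "(\<lambda>x. \<bar>f x\<bar>) integrable_on {a..b}" "(\<lambda>x. min \<bar>f x\<bar> (real n)) integrable_on {a..b}" for n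
    using af mf set_lebesgue_integral_eq_integral(1) by blast+
  have "(\<lambda>n. integral {a..b} (?m n)) \<longlonglongrightarrow> integral {a..b} (\<lambda>x. 0)"
  proof (rule dominated_convergence(2))
    show "?m k integrable_on {a..b}" for k by (intro integrable_diff i)
    show "(\<lambda>k. ?m k x) \<longlonglongrightarrow> 0" for x
    proof (rule tendsto_eventually)
      show "\<forall>\<^sub>F k in sequentially. ?m k x = 0"
        using eventually_ge_at_top[of "nat \<lceil>\<bar>f x\<bar>\<rceil>"] by eventually_elim linarith
    qed
    show "norm (?m k x) \<le> \<bar>f x\<bar>" for k x by auto
  qed (use i in auto)
  then have "\<forall>\<^sub>F n in sequentially. integral {a..b} (?m n) < \<epsilon> / 2"
    using \<open>\<epsilon> > 0\<close> by (intro order_tendstoD(2)) auto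
  then obtain n where n: "integral {a..b} (?m n) < \<epsilon> / 2"
    using eventually_happens' sequentially_bot by blast
  define \<delta> where "\<delta> = \<epsilon> / (2 * (real n + 1))"
  have "(\<Sum>(c, d)\<in>P. \<bar>integral {a..d} f - integral {a..c} f\<bar>) < \<epsilon>"
    if P: "nonoverlapping_in a b P" and len: "(\<Sum>(c, d)\<in>P. d - c) < \<delta>" for P
  proof -
    have each: "\<bar>integral {a..d} f - integral {a..c} f\<bar> \<le> integral {c..d} (?m n) + real n * (d - c)"
      if "(c, d) \<in> P" for c d
    proof -
      have cd: "a \<le> c" "c \<le> d" "d \<le> b" using that P by (auto simp: nonoverlapping_in_def)
      have mi: "?m n integrable_on {c..d}"
        by (rule integrable_subinterval_real[OF integrable_diff[OF i(1) i(2)]]) (use cd in auto)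
      have fi: "f integrable_on {a..b}" using f set_lebesgue_integral_eq_integral(1) by blast
      have "integral {a..c} f + integral {c..d} f = integral {a..d} f"
        using cd fi by (intro Henstock_Kurzweil_Integration.integral_combine)
          (auto intro: integrable_subinterval_real)
      then have "\<bar>integral {a..d} f - integral {a..c} f\<bar> = norm (integral {c..d} f)" by simp
      also have "\<dots> \<le> integral {c..d} (\<lambda>x. ?m n x + real n)"
      proof (rule integral_norm_bound_integral)
        show "f integrable_on {c..d}" using fi cd by (auto intro: integrable_subinterval_real)
        show "(\<lambda>x. ?m n x + real n) integrable_on {c..d}"
          using mi by (intro integrable_add) (auto intro: integrable_const_ivl)
      qed auto
      also have "\<dots> = integral {c..d} (?m n) + real n * (d - c)"
        using mi cd by (subst Henstock_Kurzweil_Integration.integral_add) (auto intro: integrable_const_ivl)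
      finally show ?thesis .
    qed
    have "(\<Sum>(c, d)\<in>P. \<bar>integral {a..d} f - integral {a..c} f\<bar>)
        \<le> (\<Sum>(c, d)\<in>P. integral {c..d} (?m n) + real n * (d - c))"
      by (intro sum_mono) (use each in auto)
    also have "\<dots> = (\<Sum>(c, d)\<in>P. integral {c..d} (?m n)) + real n * (\<Sum>(c, d)\<in>P. d - c)"
      by (simp add: case_prod_beta sum.distrib sum_distrib_left)
    also have "(\<Sum>(c, d)\<in>P. integral {c..d} (?m n)) \<le> integral {a..b} (?m n)"
      by (intro nonoverlapping_sum_integral_le P integrable_diff i) auto
    also have "real n * (\<Sum>(c, d)\<in>P. d - c) \<le> real n * \<delta>"
      using len by (intro mult_left_mono) auto
    also have "real n * \<delta> \<le> \<epsilon> / 2"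
      using \<open>\<epsilon> > 0\<close> by (simp add: \<delta>_def divide_simps)
    finally show ?thesis using n by simp
  qed
  then show "\<exists>\<delta>>0. \<forall>P. nonoverlapping_in a b P \<longrightarrow> (\<Sum>(c, d)\<in>P. d - c) < \<delta> \<longrightarrow>
       (\<Sum>(c, d)\<in>P. \<bar>integral {a..d} f - integral {a..c} f\<bar>) < \<epsilon>"
    using \<open>\<epsilon> > 0\<close> by (intro exI[of _ \<delta>]) (auto simp: \<delta>_def)
qed

lemma abs_cont_on_imp_continuous_on:
  assumes "abs_cont_on a b u"
  shows "continuous_on {a..b} u"
  unfolding continuous_on_iff
proof (intro ballI allI impI)
  fix x \<epsilon> :: real assume x: "x \<in> {a..b}" and "\<epsilon> > 0"
  obtain \<delta> where \<delta>: "\<delta> > 0" "\<And>P. nonoverlapping_in a b P \<Longrightarrow> (\<Sum>(c, d)\<in>P. d - c) < \<delta> \<Longrightarrow> (\<Sum>(c, d)\<in>P. \<bar>u d - u c\<bar>) < \<epsilon>"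
    using assms \<open>\<epsilon> > 0\<close> unfolding abs_cont_on_iff by meson
  have "dist (u y) (u x) < \<epsilon>" if "y \<in> {a..b}" "dist y x < \<delta>" for y
    using \<delta>(2)[of "{(x, y)}"] \<delta>(2)[of "{(y, x)}"] x that
    by (cases "x \<le> y") (auto simp: nonoverlapping_in_def dist_real_def abs_minus_commute)
  then show "\<exists>\<delta>>0. \<forall>y\<in>{a..b}. dist y x < \<delta> \<longrightarrow> dist (u y) (u x) < \<epsilon>"
    using \<delta>(1) by blast
qed

section \<open>From absolute continuity to the fundamental theorem of calculus\<close>

text \<open>Filling in the gaps makes increments telescope. The identity is quantified over u
  because one family of gaps is used twice: u = id measures its length, u = w its increments. The
  induction removes the interval with the largest left endpoint; since intervals are nondegenerate,
  all others end at or before that point.\<close>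

lemma gap_family:
  assumes "finite P" "\<And>p. p \<in> P \<Longrightarrow> a \<le> fst p \<and> fst p < snd p \<and> snd p \<le> b"
    "\<And>p q. p \<in> P \<Longrightarrow> q \<in> P \<Longrightarrow> p \<noteq> q \<Longrightarrow> {fst p<..<snd p} \<inter> {fst q<..<snd q} = {}" "a \<le> b"
  shows "\<exists>Q. nonoverlapping_in a b Q \<and>
    (\<forall>u::real\<Rightarrow>real. (\<Sum>(c, d)\<in>Q. u d - u c) = (u b - u a) - (\<Sum>(c, d)\<in>P. u d - u c))"
  using assms
proof (induction "card P" arbitrary: P b)
  case 0
  then show ?case
    by (intro exI[of _ "{(a, b)}"]) (simp add: nonoverlapping_in_def)
next
  case (Suc n)
  then have ne: "P \<noteq> {}" by auto
  obtain p where p: "p \<in> P" "\<And>q. q \<in> P \<Longrightarrow> fst q \<le> fst p"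
    using Max_in[of "fst ` P"] Max_ge[of "fst ` P"] ne Suc.prems(1) by fastforce
  obtain c d where cd: "p = (c, d)" by fastforce
  have c: "a \<le> c" "c < d" "d \<le> b" using Suc.prems(2)[OF p(1)] cd by auto
  have le: "snd q \<le> c" if q: "q \<in> P - {p}" for q
  proof (rule ccontr)
    assume "\<not> snd q \<le> c"
    then have "c < min (snd q) d" using c by simp
    then obtain y where "c < y" "y < min (snd q) d" using dense by blast
    moreover have "fst q \<le> c" using p(2) q cd by auto
    ultimately have "y \<in> {fst p<..<snd p} \<inter> {fst q<..<snd q}" using cd by auto
    then show False using Suc.prems(3)[of p q] q p(1) by auto
  qed
  have "\<exists>Q. nonoverlapping_in a c Q \<and>
    (\<forall>u::real\<Rightarrow>real. (\<Sum>(c, d)\<in>Q. u d - u c) = (u c - u a) - (\<Sum>(c, d)\<in>P - {p}. u d - u c))"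
  proof (rule Suc.hyps(1))
    show "n = card (P - {p})" using Suc.hyps(2) p(1) Suc.prems(1) by simp
  qed (use Suc.prems le c in auto)
  then obtain Q where Q: "nonoverlapping_in a c Q"
    "\<And>u::real\<Rightarrow>real. (\<Sum>(c, d)\<in>Q. u d - u c) = (u c - u a) - (\<Sum>(c, d)\<in>P - {p}. u d - u c)" by blast
  have fQ: "finite Q" "(d, b) \<notin> Q" using Q(1) c by (auto simp: nonoverlapping_in_def)
  have "nonoverlapping_in a b (insert (d, b) Q)"
    using Q(1) c unfolding nonoverlapping_in_def by fastforce
  moreover have "(\<Sum>(c, d)\<in>insert (d, b) Q. u d - u c) = (u b - u a) - (\<Sum>(c, d)\<in>P. u d - u c)" for u :: "real \<Rightarrow> real"
    using fQ Q(2)[of u] by (simp add: sum.remove[OF Suc.prems(1) p(1)] cd)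
  ultimately show ?case by blast
qed

text \<open>Vitali's theorem covers \<open>(a, b)\<close> up to small measure by intervals on which \<open>w\<close> hardly
  decreases; absolute continuity controls the remaining gaps.\<close>

lemma abs_cont_on_nondecreasing:
  assumes ac: "abs_cont_on a b w" and "a \<le> b" and N: "negligible N"
    and ev: "\<And>x \<epsilon> d. x \<in> {a<..<b} - N \<Longrightarrow> 0 < \<epsilon> \<Longrightarrow> 0 < d \<Longrightarrow> \<exists>h>0. h < d \<and> - \<epsilon> * h \<le> w (x + h) - w x"
  shows "w a \<le> w b"
proof (rule field_le_epsilon)
  fix e :: real assume "e > 0"
  \<comment> \<open>The covered part loses at most \<epsilon> (b - a) and the gaps less than
    \<epsilon>; the 1 in the denominator pays for the gaps and keeps the quotient meaningful when a
    = b.\<close>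
  define \<epsilon> where "\<epsilon> = e / (1 + (b - a))"
  have \<epsilon>: "\<epsilon> > 0" "\<epsilon> * (b - a) + \<epsilon> = e" 
  proof -
    have p: "1 + (b - a) > 0" using \<open>a \<le> b\<close> by simp
    then show "\<epsilon> > 0" using \<open>e > 0\<close> by (simp add: \<epsilon>_def)
    have "\<epsilon> * (b - a) + \<epsilon> = \<epsilon> * (1 + (b - a))" by (simp add: algebra_simps)
    then show "\<epsilon> * (b - a) + \<epsilon> = e" using p by (simp add: \<epsilon>_def)
  qed
  obtain \<delta> where \<delta>: "\<delta> > 0" "\<And>P. nonoverlapping_in a b P \<Longrightarrow> (\<Sum>(c, d)\<in>P. d - c) < \<delta> \<Longrightarrow> (\<Sum>(c, d)\<in>P. \<bar>w d - w c\<bar>) < \<epsilon>"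
    using ac \<epsilon> unfolding abs_cont_on_iff by meson
  define seg where "seg = (\<lambda>p::real\<times>real. closed_segment (fst p) (fst p + snd p))"
  define K where "K = {(x, h). 0 < h \<and> a < x \<and> x + h < b \<and> - \<epsilon> * h \<le> w (x + h) - w x}"
  have seg_eq: "seg p = {fst p..fst p + snd p}" if "p \<in> K" for p
    using that by (auto simp: seg_def K_def closed_segment_eq_real_ivl)
  have "\<exists>h. (x, h) \<in> K \<and> \<bar>h\<bar> < d" if x: "x \<in> {a<..<b} - N" "0 < d" for x d
  proof -
    obtain h where "h > 0" "h < min d (b - x)" "- \<epsilon> * h \<le> w (x + h) - w x"
      using ev[OF x(1) \<epsilon>(1), of "min d (b - x)"] x by auto
    then show ?thesis using x by (intro exI[of _ h]) (simp add: K_def)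
  qed
  then obtain C where C: "countable C" "C \<subseteq> K" "pairwise (\<lambda>p q. disjnt (seg p) (seg q)) C"
    "negligible (({a<..<b} - N) - (\<Union>p\<in>C. seg p))"
    using Vitali_signed_intervals[of K "{a<..<b} - N"] unfolding seg_def by (auto simp: K_def)
  have "seg p \<subseteq> {a<..<b}" if "p \<in> C" for p
  proof -
    have "p \<in> K" using that C(2) by blast
    then show ?thesis using seg_eq[of p] by (cases p) (auto simp: K_def)
  qed
  then have sub: "(\<Union>p\<in>C. seg p) \<subseteq> {a<..<b}" by blast
  have segm: "S \<in> lmeasurable" if "S \<in> seg ` C" for S
    using that by (auto simp: seg_def intro!: lmeasurable_compact)
  have Um: "\<Union>(seg ` C) \<in> sets lebesgue"
    using C(1) segm by (intro sets.countable_Union) (auto intro: fmeasurableD)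
  have neg: "negligible ({a<..<b} - \<Union>(seg ` C))"
    by (rule negligible_subset[OF negligible_Un[OF C(4) N]]) auto
  have mU: "measure lebesgue (\<Union>(seg ` C)) = b - a"
  proof -
    have "measure lebesgue (\<Union>(seg ` C)) = measure lebesgue {a<..<b}"
    proof (rule measure_negligible_symdiff)
      show "{a<..<b} \<in> lmeasurable" by simp
      show "negligible (({a<..<b} - \<Union>(seg ` C)) \<union> (\<Union>(seg ` C) - {a<..<b}))"
        using neg sub by (simp add: Diff_eq_empty_iff[THEN iffD2])
    qed
    then show ?thesis using \<open>a \<le> b\<close> by simp
  qed
  \<comment> \<open>Finitely many segments already leave less than measure \<delta> uncovered, so
    absolute continuity controls the gaps between them.\<close>
  obtain D' where D': "D' \<subseteq> seg ` C" "finite D'" "measure lebesgue (\<Union>(seg ` C)) - \<delta> < measure lebesgue (\<Union>D')"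
  proof (rule measure_countable_Union_approachable[of "seg ` C" \<delta> "b - a"])
    show "measure lebesgue (\<Union>E) \<le> b - a" if "E \<subseteq> seg ` C" "finite E" for E
    proof -
      have "\<Union>E \<in> lmeasurable" using that segm by (intro fmeasurable.finite_Union) auto
      then have "measure lebesgue (\<Union>E) \<le> measure lebesgue {a<..<b}"
        using that sub by (intro measure_mono_fmeasurable) (auto intro: fmeasurableD)
      then show ?thesis using \<open>a \<le> b\<close> by simp
    qed
  qed (use C \<delta> segm in auto)
  then obtain D where D: "D \<subseteq> C" "finite D" "D' = seg ` D"
    by (meson finite_subset_image)
  define P where "P = (\<lambda>p. (fst p, fst p + snd p)) ` D"
  have inj: "inj_on (\<lambda>p. (fst p, fst p + snd p)) D" by (auto simp: inj_on_def prod_eq_iff)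
  have PK: "\<exists>q\<in>D. p = (fst q, fst q + snd q) \<and> q \<in> K \<and> seg q = {fst p..snd p}" if pP: "p \<in> P" for p
  proof -
    obtain q where q: "q \<in> D" "p = (fst q, fst q + snd q)" using pP unfolding P_def by blast
    then have "q \<in> K" using D(1) C(2) by blast
    then show ?thesis using q seg_eq[of q] by (intro bexI[of _ q]) simp_all
  qed
  have "\<exists>Q. nonoverlapping_in a b Q \<and>
    (\<forall>u::real\<Rightarrow>real. (\<Sum>(c, d)\<in>Q. u d - u c) = (u b - u a) - (\<Sum>(c, d)\<in>P. u d - u c))"
  proof (rule gap_family)
    show "finite P" using D by (simp add: P_def)
    show "a \<le> fst p \<and> fst p < snd p \<and> snd p \<le> b" if "p \<in> P" for p
      using PK[OF that] by (auto simp: K_def)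
    show "{fst p<..<snd p} \<inter> {fst q<..<snd q} = {}" if pq: "p \<in> P" "q \<in> P" "p \<noteq> q" for p q
    proof -
      obtain p' q' where "p' \<in> D" "q' \<in> D" "p' \<noteq> q'" "seg p' = {fst p..snd p}" "seg q' = {fst q..snd q}"
        using PK[OF pq(1)] PK[OF pq(2)] pq(3) by metis
      then have "{fst p..snd p} \<inter> {fst q..snd q} = {}"
        using C(3) D(1) unfolding pairwise_def disjnt_def by (metis subsetD)
      then show ?thesis using greaterThanLessThan_subseteq_atLeastAtMost_iff by fastforce
    qed
  qed (rule \<open>a \<le> b\<close>)
  then obtain Q where Q: "nonoverlapping_in a b Q"
    "\<And>u::real\<Rightarrow>real. (\<Sum>(c, d)\<in>Q. u d - u c) = (u b - u a) - (\<Sum>(c, d)\<in>P. u d - u c)" by blast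
  have lenP: "(\<Sum>(c, d)\<in>P. d - c) = (\<Sum>p\<in>D. snd p)"
    unfolding P_def by (subst sum.reindex[OF inj]) simp
  have "measure lebesgue (\<Union>D') \<le> (\<Sum>p\<in>D. measure lebesgue (seg p))"
    unfolding D(3) using D(2) by (intro measure_UNION_le) (auto simp: seg_def)
  also have "\<dots> = (\<Sum>p\<in>D. snd p)"
    using D(1) C(2) seg_eq by (intro sum.cong) (auto simp: K_def)
  finally have "b - a - \<delta> < (\<Sum>p\<in>D. snd p)" using D'(3) mU by simp
  then have "(\<Sum>(c, d)\<in>Q. d - c) < \<delta>"
    using Q(2)[of "\<lambda>x. x"] lenP by simp
  then have "(\<Sum>(c, d)\<in>Q. \<bar>w d - w c\<bar>) < \<epsilon>" using \<delta>(2) Q(1) by blast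
  moreover have "\<bar>\<Sum>(c, d)\<in>Q. w d - w c\<bar> \<le> (\<Sum>(c, d)\<in>Q. \<bar>w d - w c\<bar>)"
    by (simp add: case_prod_beta sum_abs)
  ultimately have gap: "- \<epsilon> < (\<Sum>(c, d)\<in>Q. w d - w c)" by simp
  have "(\<Sum>(c, d)\<in>Q. d - c) \<ge> 0"
    using Q(1) unfolding nonoverlapping_in_def by (intro sum_nonneg) fastforce
  then have "(\<Sum>p\<in>D. snd p) \<le> b - a"
    using Q(2)[of "\<lambda>x. x"] lenP by simp
  then have "\<epsilon> * (\<Sum>p\<in>D. snd p) \<le> \<epsilon> * (b - a)" using \<epsilon> by simp
  then have "- \<epsilon> * (b - a) \<le> (\<Sum>p\<in>D. - \<epsilon> * snd p)" by (simp add: sum_distrib_left sum_negf)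
  also have "\<dots> \<le> (\<Sum>p\<in>D. w (fst p + snd p) - w (fst p))"
    using D(1) C(2) by (intro sum_mono) (auto simp: K_def)
  also have "\<dots> = (\<Sum>(c, d)\<in>P. w d - w c)"
    unfolding P_def by (subst sum.reindex[OF inj]) simp
  finally have "- \<epsilon> * (b - a) \<le> (\<Sum>(c, d)\<in>P. w d - w c)" .
  with gap Q(2)[of w] \<epsilon>(2) show "w a \<le> w b + e" by (simp add: algebra_simps)
qed

text \<open>Cut [a, b] into N cells of length h and exchange sum and integral: for each offset s in
  [0, h] the increments between the points a + k h + s form one variation sum, bounded by 1, and s
  ranges over a set of length h.\<close>

lemma integral_difference_le_of_bounded_variation:
  assumes ab: "a < b" and u: "continuous_on {a..b} u" and "N > 0"
    and bv: "\<And>P. nonoverlapping_in a b P \<Longrightarrow> (\<Sum>(c, d)\<in>P. \<bar>u d - u c\<bar>) \<le> 1"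
    and h: "h = (b - a) / real N"
  shows "integral {a..b} (\<lambda>x. \<bar>u (min (x + h) b) - u x\<bar>) \<le> h"
proof -
  define g where "g = (\<lambda>x. \<bar>u (min (x + h) b) - u x\<bar>)"
  have hpos: "h > 0" using ab \<open>N > 0\<close> h by simp
  have hN: "real N * h = b - a" using \<open>N > 0\<close> h by simp
  have cont: "continuous_on {a..b} g"
    unfolding g_def using hpos by (intro continuous_intros continuous_on_compose2[OF u] u) (auto simp: min_def)
  then have gi: "g integrable_on {c..d}" if "a \<le> c" "d \<le> b" for c d
    using that by (meson integrable_continuous_interval integrable_subinterval_real atLeastatMost_subset_iff)
  have le: "a + real n * h \<le> b" if "n \<le> N" for n
  proof -
    have "real n * h \<le> real N * h" using that hpos by (intro mult_right_mono) auto
    then show ?thesis using hN by simp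
  qed
  have le': "a + (real k * h + h) \<le> b" if "k < N" for k
    using le[of "Suc k"] that by (simp add: algebra_simps)
  have split: "integral {a..a + real n * h} g = (\<Sum>k<n. integral {0..h} (\<lambda>s. g (a + real k * h + s)))"
    if "n \<le> N" for n
    using that
  proof (induction n)
    case (Suc n)
    have "integral {a..a + real n * h} g + integral {a + real n * h..a + real (Suc n) * h} g
        = integral {a..a + real (Suc n) * h} g"
      using le[OF Suc.prems] hpos by (intro Henstock_Kurzweil_Integration.integral_combine gi) (auto simp: algebra_simps)
    moreover have "integral {a + real n * h..a + real (Suc n) * h} g = integral {0..h} (\<lambda>s. g (a + real n * h + s))"
      using integral_shift_Icc_real[of 0 h g "a + real n * h"] by (simp add: o_def algebra_simps)
    ultimately show ?case using Suc by simp
  qed simp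
  have "integral {a..b} g = (\<Sum>k<N. integral {0..h} (\<lambda>s. g (a + real k * h + s)))"
    using split[of N] hN by simp
  also have "\<dots> = integral {0..h} (\<lambda>s. \<Sum>k<N. g (a + real k * h + s))"
  proof (rule Henstock_Kurzweil_Integration.integral_sum[symmetric])
    fix k assume k: "k \<in> {..<N}"
    have "continuous_on {0..h} (\<lambda>s. g (a + real k * h + s))"
      using k le'[of k] hpos by (intro continuous_on_compose2[OF cont] continuous_intros) auto
    then show "(\<lambda>s. g (a + real k * h + s)) integrable_on {0..h}"
      by (rule integrable_continuous_interval)
  qed simp
  also have "\<dots> \<le> integral {0..h} (\<lambda>s. 1)"
  proof (rule integral_le)
    show "(\<lambda>s. \<Sum>k<N. g (a + real k * h + s)) integrable_on {0..h}"
    proof (intro integrable_sum)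
      fix k assume k: "k \<in> {..<N}"
      have "continuous_on {0..h} (\<lambda>s. g (a + real k * h + s))"
        using k le'[of k] hpos by (intro continuous_on_compose2[OF cont] continuous_intros) auto
      then show "(\<lambda>s. g (a + real k * h + s)) integrable_on {0..h}"
        by (rule integrable_continuous_interval)
    qed simp
    show "(\<Sum>k<N. g (a + real k * h + s)) \<le> 1" if s: "s \<in> {0..h}" for s
    proof -
      \<comment> \<open>Consecutive points of the grid shifted by s; the minimum clips the last
        interval at b.\<close>
      define I where "I = (\<lambda>k::nat. (a + real k * h + s, min (a + real k * h + s + h) b))"
      have inj: "inj_on I {..<N}"
        using hpos by (auto simp: I_def inj_on_def)
      have "nonoverlapping_in a b (I ` {..<N})"
        unfolding nonoverlapping_in_def
      proof (intro conjI ballI impI)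
        fix p assume "p \<in> I ` {..<N}"
        then obtain k where k: "k < N" "p = I k" by auto
        show "case p of (c, d) \<Rightarrow> a \<le> c \<and> c \<le> d \<and> d \<le> b"
          using k le'[of k] s hpos by (auto simp: I_def)
      next
        fix p q assume "p \<in> I ` {..<N}" "q \<in> I ` {..<N}" "p \<noteq> q"
        then obtain k j where kj: "p = I k" "q = I j" "k \<noteq> j" by auto
        have "real k * h + h \<le> real j * h" if "k < j" for k j :: nat
        proof -
          have "(real k + 1) * h \<le> real j * h" using that hpos by (intro mult_right_mono) auto
          then show ?thesis by (simp add: algebra_simps)
        qed
        then have "real k * h + h \<le> real j * h \<or> real j * h + h \<le> real k * h"
          using kj(3) by (meson linorder_neqE_nat)
        then show "{fst p<..<snd p} \<inter> {fst q<..<snd q} = {}"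
          using kj by (auto simp: I_def)
      qed simp
      from bv[OF this] show ?thesis
        by (simp add: sum.reindex[OF inj] g_def) (simp add: I_def)
    qed
  qed (simp add: integrable_const_ivl)
  also have "\<dots> = h" using hpos by simp
  finally show ?thesis by (simp add: g_def)
qed

lemma frequently_less_of_liminf_less:
  fixes X :: "nat \<Rightarrow> ennreal"
  assumes "liminf X < c"
  shows "\<exists>\<^sub>F n in sequentially. X n < c"
proof (rule ccontr)
  assume "\<not> (\<exists>\<^sub>F n in sequentially. X n < c)"
  then have "\<forall>\<^sub>F n in sequentially. c \<le> X n"
    by (simp add: not_frequently not_less)
  then show False using Liminf_bounded assms leD by blast
qed

text \<open>Along a subsequence |q n| tends to A, so A or -A is a cluster point of q, and the liminf
  of |q n - A| decides which. Choosing l by lower limits alone makes it a measurable function when q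
  depends on a parameter.\<close>

lemma cluster_point_of_liminf_abs:
  fixes q :: "nat \<Rightarrow> real"
  assumes fin: "liminf (\<lambda>n. ennreal \<bar>q n\<bar>) < \<infinity>" and "\<epsilon> > 0"
    and A: "A = enn2real (liminf (\<lambda>n. ennreal \<bar>q n\<bar>))"
    and l: "l = (if liminf (\<lambda>n. ennreal \<bar>q n - A\<bar>) = 0 then A else - A)"
  shows "\<exists>\<^sub>F n in sequentially. \<bar>q n - l\<bar> < \<epsilon>"
proof (cases "liminf (\<lambda>n. ennreal \<bar>q n - A\<bar>) = 0")
  case True
  then have "liminf (\<lambda>n. ennreal \<bar>q n - A\<bar>) < ennreal \<epsilon>" using \<open>\<epsilon> > 0\<close> by simp
  then have "\<exists>\<^sub>F n in sequentially. ennreal \<bar>q n - A\<bar> < ennreal \<epsilon>"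
    by (rule frequently_less_of_liminf_less)
  then show ?thesis
    using True l \<open>\<epsilon> > 0\<close> by (simp add: ennreal_less_iff)
next
  case False
  then have "0 < liminf (\<lambda>n. ennreal \<bar>q n - A\<bar>)" by (simp add: zero_less_iff_neq_zero)
  then obtain c where c: "0 < c" "c < liminf (\<lambda>n. ennreal \<bar>q n - A\<bar>)" using dense by blast
  then have "c < \<infinity>" using top.not_eq_extremum by fastforce
  then obtain r where r: "c = ennreal r" "r > 0" using c(1) by (cases c) auto
  have ev: "\<forall>\<^sub>F n in sequentially. r < \<bar>q n - A\<bar>"
    using less_LiminfD[OF c(2)] r by (simp add: ennreal_less_iff)
  define e where "e = min \<epsilon> r"
  have e: "e > 0" using r \<open>\<epsilon> > 0\<close> by (simp add: e_def)
  have lim: "liminf (\<lambda>n. ennreal \<bar>q n\<bar>) = ennreal A" and A0: "A \<ge> 0"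
    using fin A by (auto simp: less_top)
  have "\<exists>\<^sub>F n in sequentially. ennreal \<bar>q n\<bar> < ennreal (A + e)"
    using lim A0 e by (intro frequently_less_of_liminf_less) (simp add: ennreal_less_iff)
  then have f1: "\<exists>\<^sub>F n in sequentially. \<bar>q n\<bar> < A + e" by (simp add: ennreal_less_iff)
  have f2: "\<forall>\<^sub>F n in sequentially. A - e < \<bar>q n\<bar>"
  proof (cases "A - e < 0")
    case True
    then have "A - e < \<bar>q n\<bar>" for n using abs_ge_zero[of "q n"] by linarith
    then show ?thesis by (intro always_eventually) auto
  next
    case False
    then have "ennreal (A - e) < liminf (\<lambda>n. ennreal \<bar>q n\<bar>)"
      using lim e by (simp add: ennreal_less_iff)
    from less_LiminfD[OF this] False show ?thesis by (simp add: ennreal_less_iff)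
  qed
  have "\<exists>\<^sub>F n in sequentially. \<bar>q n\<bar> < A + e \<and> A - e < \<bar>q n\<bar> \<and> r < \<bar>q n - A\<bar>"
    using frequently_eventually_frequently[OF f1 eventually_conj[OF f2 ev]] by (simp add: conj_commute)
  then show ?thesis
  proof (rule frequently_elim1)
    fix n assume "\<bar>q n\<bar> < A + e \<and> A - e < \<bar>q n\<bar> \<and> r < \<bar>q n - A\<bar>"
    then show "\<bar>q n - l\<bar> < \<epsilon>"
      using False l A0 unfolding e_def by (auto simp: abs_if split: if_splits)
  qed
qed

text \<open>By Fatou's lemma some cluster point \<open>f\<close> of the difference quotients is integrable, and the
  monotonicity criterion applies to both \<open>u - \<integral>f\<close> and \<open>\<integral>f - u\<close>.\<close>

lemma abs_cont_on_eq_integral_of_bounded_variation: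
  assumes ab: "a < b" and ac: "abs_cont_on a b u"
    and bv: "\<And>P. nonoverlapping_in a b P \<Longrightarrow> (\<Sum>(c, d)\<in>P. \<bar>u d - u c\<bar>) \<le> 1"
  obtains f where "f absolutely_integrable_on {a..b}" "\<And>x. x \<in> {a..b} \<Longrightarrow> u x = u a + integral {a..x} f"
proof -
  define M where "M = lebesgue_on {a..b}"
  define h where "h = (\<lambda>n. (b - a) / real (Suc n))"
  \<comment> \<open>Clipping at b keeps \<open>q n\<close> defined and continuous on all of [a, b];
    at a fixed x < b it is the true quotient as soon as h n < b - x.\<close>
  define q where "q = (\<lambda>n x. (u (min (x + h n) b) - u x) / h n)"
  define L where "L = (\<lambda>x. liminf (\<lambda>n. ennreal \<bar>q n x\<bar>))"
  define A where "A = (\<lambda>x. enn2real (L x))"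
  define f where "f = (\<lambda>x. if liminf (\<lambda>n. ennreal \<bar>q n x - A x\<bar>) = 0 then A x else - A x)"
  have hpos: "h n > 0" for n using ab by (simp add: h_def)
  have cu: "continuous_on {a..b} u" using ac by (rule abs_cont_on_imp_continuous_on)
  have cq: "continuous_on {a..b} (q n)" for n
    unfolding q_def using hpos[of n] 
    by (intro continuous_intros continuous_on_compose2[OF cu] cu) (auto simp: min_def)
  have iq: "integrable M (q n)" for n
    unfolding M_def by (rule continuous_imp_integrable_real[OF cq])
  then have mq[measurable]: "q n \<in> borel_measurable M" for n by auto
  have mL[measurable]: "L \<in> borel_measurable M"
    unfolding L_def by measurable
  have mA[measurable]: "A \<in> borel_measurable M"
    unfolding A_def by measurable
  have mf[measurable]: "f \<in> borel_measurable M"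
    unfolding f_def by measurable
  have nq: "(\<integral>\<^sup>+x. ennreal \<bar>q n x\<bar> \<partial>M) \<le> 1" for n
  proof -
    have "(\<integral>\<^sup>+x. ennreal \<bar>q n x\<bar> \<partial>M) = ennreal (\<integral>x. \<bar>q n x\<bar> \<partial>M)"
      using iq by (intro nn_integral_eq_integral) auto
    also have "(\<integral>x. \<bar>q n x\<bar> \<partial>M) = integral {a..b} (\<lambda>x. \<bar>q n x\<bar>)"
      using iq unfolding M_def by (intro lebesgue_integral_eq_integral) auto
    also have "\<dots> = integral {a..b} (\<lambda>x. \<bar>u (min (x + h n) b) - u x\<bar>) / h n"
      using hpos[of n] by (simp add: q_def abs_divide)
    finally have e: "(\<integral>\<^sup>+x. ennreal \<bar>q n x\<bar> \<partial>M) = ennreal (integral {a..b} (\<lambda>x. \<bar>u (min (x + h n) b) - u x\<bar>) / h n)" .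
    have "integral {a..b} (\<lambda>x. \<bar>u (min (x + h n) b) - u x\<bar>) / h n \<le> 1"
    proof -
      have "integral {a..b} (\<lambda>x. \<bar>u (min (x + h n) b) - u x\<bar>) \<le> h n"
        by (rule integral_difference_le_of_bounded_variation[OF ab cu, of "Suc n"]) (use bv in \<open>auto simp: h_def\<close>)
      then show ?thesis using hpos[of n] by (simp add: divide_le_eq)
    qed
    then show ?thesis unfolding e using ennreal_leI by fastforce
  qed
  have "(\<integral>\<^sup>+x. L x \<partial>M) \<le> liminf (\<lambda>n. \<integral>\<^sup>+x. ennreal \<bar>q n x\<bar> \<partial>M)"
    unfolding L_def by (rule nn_integral_liminf) measurable
  also have "\<dots> \<le> 1"
    using nq by (intro order_trans[OF Liminf_le_Limsup] Limsup_bounded) auto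
  finally have L1: "(\<integral>\<^sup>+x. L x \<partial>M) \<le> 1" .
  have Lfin: "AE x in M. L x \<noteq> \<infinity>"
    using L1 by (intro nn_integral_noteq_infinite) (auto simp: top_unique)
  have "integrable M f"
  proof (rule integrableI_bounded)
    have "ennreal (norm (f x)) \<le> L x" for x
      by (auto simp: f_def A_def ennreal_enn2real_if)
    then have "(\<integral>\<^sup>+x. ennreal (norm (f x)) \<partial>M) \<le> (\<integral>\<^sup>+x. L x \<partial>M)"
      by (intro nn_integral_mono) auto
    also note L1
    finally show "(\<integral>\<^sup>+x. ennreal (norm (f x)) \<partial>M) < \<infinity>"
      by (simp add: order_le_less_trans)
  qed measurable
  then have fabs: "f absolutely_integrable_on {a..b}"
    by (simp add: M_def set_integrable_def integrable_restrict_space)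
  then have fi: "f integrable_on {a..b}" using set_lebesgue_integral_eq_integral(1) by blast
  define F where "F = (\<lambda>x. integral {a..x} f)"
  have acF: "abs_cont_on a b F" unfolding F_def by (rule abs_cont_on_integral[OF fabs])
  define Z where "Z = {x\<in>{a..b}. L x = \<infinity>} \<union> {x\<in>{a<..<b}. \<not> (F has_real_derivative f x) (at x)}"
  have "negligible {x\<in>{a..b}. L x = \<infinity>}"
  proof -
    have eq: "{x\<in>{a..b}. L x = \<infinity>} = L -` {\<infinity>} \<inter> space M" by (auto simp: M_def)
    have "{x\<in>{a..b}. L x = \<infinity>} \<in> sets M" unfolding eq by (rule measurable_sets[OF mL]) simp
    then have "{x\<in>{a..b}. L x = \<infinity>} \<in> null_sets M"
      using Lfin by (subst AE_iff_null_sets) auto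
    then show ?thesis 
      unfolding M_def by (subst (asm) null_sets_restrict_space) (auto simp: negligible_iff_null_sets)
  qed
  then have Z: "negligible Z"
    unfolding Z_def F_def using Lebesgue_differentiation[OF fi] by (intro negligible_Un) auto
  \<comment> \<open>Almost everywhere f x is both the derivative of F and a cluster point of
    \<open>q n x\<close>, so for infinitely many n the increments of u and F over h n differ by at
    most \<epsilon> h n.\<close>
  have small: "\<exists>k>0. k < d \<and> \<bar>(u (x + k) - u x) - (F (x + k) - F x)\<bar> \<le> \<epsilon> * k"
    if x: "x \<in> {a<..<b} - Z" and "\<epsilon> > 0" "d > 0" for x \<epsilon> d
  proof -
    have "(F has_real_derivative f x) (at x)" using x by (auto simp: Z_def)
    then have Fx: "(\<lambda>k. (F (x + k) - F x) / k) \<midarrow>0\<rightarrow> f x" by (simp add: DERIV_def)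
    obtain s where s: "s > 0" "\<And>k. k \<noteq> 0 \<Longrightarrow> \<bar>k\<bar> < s \<Longrightarrow> \<bar>(F (x + k) - F x) / k - f x\<bar> < \<epsilon> / 2"
      using LIM_D[OF Fx, of "\<epsilon> / 2"] \<open>\<epsilon> > 0\<close> by auto
    have "L x < \<infinity>" using x by (auto simp: Z_def less_top)
    then have fr: "\<exists>\<^sub>F n in sequentially. \<bar>q n x - f x\<bar> < \<epsilon> / 2"
      using \<open>\<epsilon> > 0\<close> by (intro cluster_point_of_liminf_abs[of _ _ "A x"]) (auto simp: L_def A_def f_def)
    have "h \<longlonglongrightarrow> 0"
      using tendsto_mult_right_zero[OF LIMSEQ_inverse_real_of_nat, of "b - a"] by (simp add: h_def divide_inverse)
    then have "\<forall>\<^sub>F n in sequentially. h n < min (min d s) (b - x)"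
      using \<open>d > 0\<close> s x by (intro order_tendstoD(2)) auto
    from frequently_ex[OF frequently_eventually_frequently[OF fr this]]
    obtain n where n: "\<bar>q n x - f x\<bar> < \<epsilon> / 2" "h n < min (min d s) (b - x)"
      by blast
    have "\<bar>(F (x + h n) - F x) / h n - f x\<bar> < \<epsilon> / 2" using s(2)[of "h n"] n(2) hpos[of n] by simp
    with n(1) have "\<bar>q n x - (F (x + h n) - F x) / h n\<bar> \<le> \<epsilon>" by linarith
    moreover have "q n x = (u (x + h n) - u x) / h n"
    proof -
      have "x + h n \<le> b" using n(2) by simp
      then show ?thesis by (simp add: q_def min_absorb1)
    qed
    ultimately have "\<bar>((u (x + h n) - u x) - (F (x + h n) - F x)) / h n\<bar> \<le> \<epsilon>"
      by (simp add: diff_divide_distrib)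
    then have "\<bar>(u (x + h n) - u x) - (F (x + h n) - F x)\<bar> \<le> \<epsilon> * h n"
      using hpos[of n] by (simp add: abs_divide divide_le_eq)
    then show ?thesis using hpos[of n] n(2) by auto
  qed
  have "u x = u a + F x" if x: "x \<in> {a..b}" for x
  proof (rule antisym)
    have "u a - F a \<le> u x - F x"
    proof (rule abs_cont_on_nondecreasing[of a x "\<lambda>y. u y - F y" Z])
      show "abs_cont_on a x (\<lambda>y. u y - F y)"
        using x by (intro abs_cont_on_diff abs_cont_on_subinterval[OF ac] abs_cont_on_subinterval[OF acF]) auto
      show "\<exists>h>0. h < d \<and> - \<epsilon> * h \<le> (u (y + h) - F (y + h)) - (u y - F y)"
        if "y \<in> {a<..<x} - Z" "0 < \<epsilon>" "0 < d" for y \<epsilon> d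
      proof -
        have "y \<in> {a<..<b} - Z" using that x by auto
        from small[OF this that(2,3)] obtain k where "k>0" "k < d" "\<bar>(u (y + k) - u y) - (F (y + k) - F y)\<bar> \<le> \<epsilon> * k"
          by blast
        then show ?thesis by (intro exI[of _ k]) (auto simp: abs_le_iff)
      qed
    qed (use x Z in auto)
    then show "u a + F x \<le> u x" by (simp add: F_def)
    have "F a - u a \<le> F x - u x"
    proof (rule abs_cont_on_nondecreasing[of a x "\<lambda>y. F y - u y" Z])
      show "abs_cont_on a x (\<lambda>y. F y - u y)"
        using x by (intro abs_cont_on_diff abs_cont_on_subinterval[OF ac] abs_cont_on_subinterval[OF acF]) auto
      show "\<exists>h>0. h < d \<and> - \<epsilon> * h \<le> (F (y + h) - u (y + h)) - (F y - u y)"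
        if "y \<in> {a<..<x} - Z" "0 < \<epsilon>" "0 < d" for y \<epsilon> d
      proof -
        have "y \<in> {a<..<b} - Z" using that x by auto
        from small[OF this that(2,3)] obtain k where "k>0" "k < d" "\<bar>(u (y + k) - u y) - (F (y + k) - F y)\<bar> \<le> \<epsilon> * k"
          by blast
        then show ?thesis by (intro exI[of _ k]) (auto simp: abs_le_iff)
      qed
    qed (use x Z in auto)
    then show "u x \<le> u a + F x" by (simp add: F_def)
  qed
  then have "u x = u a + integral {a..x} f" if "x \<in> {a..b}" for x
    using that unfolding F_def .
  then show ?thesis by (rule that[OF fabs])
qed

lemma has_real_derivative_of_eq_integral:
  fixes f :: "real \<Rightarrow> real"
  assumes f: "f integrable_on {a..b}" and u: "\<And>x. x \<in> {a..b} \<Longrightarrow> u x = C + integral {a..x} f"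
  shows "negligible {x\<in>{a..b}. \<not> (u has_real_derivative f x) (at x)}"
proof -
  have "(u has_real_derivative f x) (at x)"
    if x: "x \<in> {a<..<b}" "((\<lambda>x. integral {a..x} f) has_real_derivative f x) (at x)" for x
  proof (rule DERIV_cong_ev[THEN iffD1, OF refl _ refl])
    show "((\<lambda>x. C + integral {a..x} f) has_real_derivative f x) (at x)"
      using DERIV_add[OF DERIV_const[of C] x(2)] by simp
    show "\<forall>\<^sub>F y in nhds x. C + integral {a..y} f = u y"
      by (rule eventually_mono[OF eventually_nhds_in_open[of "{a<..<b}" x]]) (use x(1) u in auto)
  qed
  then have "{x\<in>{a..b}. \<not> (u has_real_derivative f x) (at x)} \<subseteq>
      {x\<in>{a<..<b}. \<not> ((\<lambda>x. integral {a..x} f) has_real_derivative f x) (at x)} \<union> {a, b}"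
    by force
  then show ?thesis
    using Lebesgue_differentiation[OF f] by (meson negligible_Un negligible_finite negligible_subset finite.intros)
qed

text \<open>The variation bound 1 holds only on intervals shorter than the \<delta> belonging to
  \<epsilon> = 1. There u is an integral of some f, and \<open>deriv u\<close> agrees with f off a
  null set. Bolzano's bisection principle glues the short intervals together.\<close>

theorem abs_cont_on_fundamental_theorem:
  assumes ac: "abs_cont_on a b u" and "a \<le> b"
  shows "(deriv u has_integral (u b - u a)) {a..b}"
proof -
  let ?P = "\<lambda>c d. a \<le> c \<and> c \<le> d \<and> d \<le> b \<longrightarrow> (deriv u has_integral (u d - u c)) {c..d}"
  obtain \<delta> where \<delta>: "\<delta> > 0" "\<And>P. nonoverlapping_in a b P \<Longrightarrow> (\<Sum>(c, d)\<in>P. d - c) < \<delta> \<Longrightarrow> (\<Sum>(c, d)\<in>P. \<bar>u d - u c\<bar>) < 1"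
    using ac unfolding abs_cont_on_iff by (meson zero_less_one)
  have short: "(deriv u has_integral (u d - u c)) {c..d}"
    if cd: "a \<le> c" "c < d" "d \<le> b" "d - c < \<delta>" for c d
  proof -
    have bv: "(\<Sum>(s, t)\<in>P. \<bar>u t - u s\<bar>) \<le> 1" if P: "nonoverlapping_in c d P" for P
      using \<delta>(2)[OF nonoverlapping_in_mono[OF P cd(1,3)]] nonoverlapping_length_le[OF P] cd by simp
    obtain f where f: "f absolutely_integrable_on {c..d}" "\<And>x. x \<in> {c..d} \<Longrightarrow> u x = u c + integral {c..x} f"
      using abs_cont_on_eq_integral_of_bounded_variation[OF cd(2) abs_cont_on_subinterval[OF ac cd(1,3)] bv] by blast
    have fi: "f integrable_on {c..d}" using f(1) set_lebesgue_integral_eq_integral(1) by blast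
    have "(f has_integral (u d - u c)) {c..d}"
      using f(2)[of d] cd(2) integrable_integral[OF fi] by simp
    then show ?thesis
    proof (rule has_integral_spike[rotated 2])
      show "negligible {x\<in>{c..d}. \<not> (u has_real_derivative f x) (at x)}"
        using has_real_derivative_of_eq_integral[OF fi f(2)] by simp
    qed (auto intro: DERIV_imp_deriv)
  qed
  have "?P a b"
  proof (induction rule: Bolzano[OF \<open>a \<le> b\<close>, of ?P])
    case (1 c m d)
    then show ?case using has_integral_combine[of c m d "deriv u" "u m - u c" "u d - u m"] by auto
  next
    case (2 x)
    show ?case
    proof (intro exI[of _ \<delta>] conjI allI impI \<delta>(1))
      fix c d assume cd: "c \<le> x \<and> x \<le> d \<and> d - c < \<delta>" "a \<le> c \<and> c \<le> d \<and> d \<le> b"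
      show "(deriv u has_integral (u d - u c)) {c..d}"
        by (cases "c = d") (use short[of c d] cd in auto)
    qed
  qed
  then show ?thesis using \<open>a \<le> b\<close> by simp
qed

section \<open>The Hilbert space \<open>L\<^sup>2(0,1)\<close>\<close>

definition sq_borel :: "(real \<Rightarrow> real) set" where
  "sq_borel = {f. f \<in> borel_measurable borel \<and> integrable (lebesgue_on I01) (\<lambda>x. (f x)\<^sup>2)}"

lemma measurable_ident_lebesgue_on: "(\<lambda>x::real. x) \<in> lebesgue_on S \<rightarrow>\<^sub>M borel"
  by (rule measurable_restrict_space1, rule measurable_completion, simp)

lemma AE_eq_cong_left:
  assumes "AE x in M. f x = h x"
  shows "(AE x in M. f x = g x) \<longleftrightarrow> (AE x in M. h x = g x)"
proof
  assume "AE x in M. f x = g x"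
  with assms show "AE x in M. h x = g x" by eventually_elim simp
next
  assume "AE x in M. h x = g x"
  with assms show "AE x in M. f x = g x" by eventually_elim simp
qed

lemma borel_measurable_lebesgue_onI: "f \<in> borel_measurable borel \<Longrightarrow> f \<in> borel_measurable (lebesgue_on (S::real set))"
  by (rule measurable_compose[OF measurable_ident_lebesgue_on])

lemma finite_measure_lebesgue_on_I01: "finite_measure (lebesgue_on I01)"
  by (rule finite_measure_lebesgue_on) auto

lemma AE_lebesgue_on_borel_version:
  fixes f :: "'a::euclidean_space \<Rightarrow> real"
  assumes "f \<in> borel_measurable (lebesgue_on S)" "S \<in> sets borel"
  obtains g where "g \<in> borel_measurable borel" "AE x in lebesgue_on S. f x = g x"
proof -
  have S: "S \<in> sets lebesgue" using assms(2) by auto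
  have "(\<lambda>x. if x \<in> S then f x else 0) \<in> borel_measurable lebesgue"
    using assms(1) S by (simp add: borel_measurable_if)
  then obtain g where g: "g \<in> borel_measurable lborel" "AE x in lborel. (if x \<in> S then f x else 0) = g x"
    using completion_ex_borel_measurable_real by blast
  have "AE x in lebesgue. (if x \<in> S then f x else 0) = g x"
    using g(2) by (rule AE_completion)
  then have "AE x in lebesgue_on S. f x = g x"
    using S by (subst AE_restrict_space_iff) (auto elim: eventually_mono)
  with g(1) that show ?thesis by simp
qed

lemma L2_measurable [dest]: "f \<in> L2 S \<Longrightarrow> f \<in> borel_measurable (lebesgue_on S)"
  by (simp add: L2_def)

lemma L2_mult_integrable:
  assumes "f \<in> L2 S" "g \<in> L2 S"
  shows "integrable (lebesgue_on S) (\<lambda>x. f x * g x)"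
proof (rule Bochner_Integration.integrable_bound)
  show "integrable (lebesgue_on S) (\<lambda>x. (f x)\<^sup>2 + (g x)\<^sup>2)"
    using assms by (auto simp: L2_def)
  show "(\<lambda>x. f x * g x) \<in> borel_measurable (lebesgue_on S)"
    using assms by (auto simp: L2_def)
  have "\<bar>a * b\<bar> \<le> a\<^sup>2 + b\<^sup>2" for a b :: real
  proof -
    have "2 * \<bar>a * b\<bar> \<le> a\<^sup>2 + b\<^sup>2"
      using zero_le_power2[of "\<bar>a\<bar> - \<bar>b\<bar>"] by (simp add: power2_diff abs_mult)
    then show ?thesis by (smt (verit) zero_le_power2)
  qed
  then show "AE x in lebesgue_on S. norm (f x * g x) \<le> norm ((f x)\<^sup>2 + (g x)\<^sup>2)"
    by simp
qed

lemma L2_add: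
  assumes "f \<in> L2 S" "g \<in> L2 S"
  shows "(\<lambda>x. f x + g x) \<in> L2 S"
proof -
  have "integrable (lebesgue_on S) (\<lambda>x. (f x)\<^sup>2 + (g x)\<^sup>2 + 2 * (f x * g x))"
    using assms L2_mult_integrable[OF assms] by (auto simp: L2_def)
  then show ?thesis using assms by (simp add: L2_def power2_sum mult.assoc borel_measurable_add)
qed

lemma L2_cmult: "f \<in> L2 S \<Longrightarrow> (\<lambda>x. c * f x) \<in> L2 S"
  by (auto simp: L2_def power_mult_distrib)

lemma L2_diff:
  assumes "f \<in> L2 S" "g \<in> L2 S"
  shows "(\<lambda>x. f x - g x) \<in> L2 S"
  using L2_add[OF assms(1) L2_cmult[OF assms(2), of "-1"]] by simp

lemma L2_cong_AE:
  assumes "f \<in> L2 S" "g \<in> borel_measurable (lebesgue_on S)" "AE x in lebesgue_on S. f x = g x"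
  shows "g \<in> L2 S"
proof -
  have "integrable (lebesgue_on S) (\<lambda>x. (g x)\<^sup>2)"
    using assms by (subst integrable_cong_AE[of _ _ "\<lambda>x. (f x)\<^sup>2"]) (auto simp: L2_def elim: eventually_mono)
  then show ?thesis using assms by (simp add: L2_def)
qed

lemma L2_bounded:
  assumes "f \<in> L2 S" "g \<in> borel_measurable (lebesgue_on S)" "AE x in lebesgue_on S. \<bar>g x\<bar> \<le> \<bar>f x\<bar>"
  shows "g \<in> L2 S"
proof -
  have "integrable (lebesgue_on S) (\<lambda>x. (g x)\<^sup>2)"
  proof (rule Bochner_Integration.integrable_bound)
    show "integrable (lebesgue_on S) (\<lambda>x. (f x)\<^sup>2)" using assms(1) by (simp add: L2_def)
    show "AE x in lebesgue_on S. norm ((g x)\<^sup>2) \<le> norm ((f x)\<^sup>2)"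
      using assms(3) by eventually_elim (simp add: abs_le_square_iff)
  qed (use assms(2) in auto)
  then show ?thesis using assms(2) by (simp add: L2_def)
qed

lemma sq_borel_L2: "f \<in> sq_borel \<Longrightarrow> f \<in> L2 I01"
  by (auto simp: sq_borel_def L2_def borel_measurable_lebesgue_onI)

lemma L2_borel_version:
  assumes "f \<in> L2 I01"
  obtains g where "g \<in> sq_borel" "AE x in lebesgue_on I01. f x = g x"
proof -
  obtain g where g: "g \<in> borel_measurable borel" "AE x in lebesgue_on I01. f x = g x"
    using assms AE_lebesgue_on_borel_version[of f I01] by (auto simp: L2_def)
  then have "g \<in> L2 I01" using assms L2_cong_AE borel_measurable_lebesgue_onI by blast
  then have "g \<in> sq_borel" using g(1) by (simp add: sq_borel_def L2_def)
  then show ?thesis using g(2) by (rule that)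
qed

text \<open>The Hilbert space \<open>L\<^sup>2(0,1)\<close>; its elements are represented by Borel functions, so that
  functions of several variables built from representatives are jointly measurable.\<close>

typedef l2 = "{C. \<exists>f\<in>sq_borel. C = {g\<in>sq_borel. AE x in lebesgue_on I01. f x = g x}}"
proof -
  have "(\<lambda>x. 0) \<in> sq_borel" by (simp add: sq_borel_def)
  then show ?thesis by blast
qed

definition cl :: "(real \<Rightarrow> real) \<Rightarrow> l2" where
  "cl f = Abs_l2 {g\<in>sq_borel. AE x in lebesgue_on I01. f x = g x}"

definition rep :: "l2 \<Rightarrow> real \<Rightarrow> real" where
  "rep a = (SOME f. f \<in> Rep_l2 a)"

lemma rep_in_Rep: "rep a \<in> Rep_l2 a"
proof -
  obtain f where "f \<in> sq_borel" "Rep_l2 a = {g\<in>sq_borel. AE x in lebesgue_on I01. f x = g x}"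
    using Rep_l2[of a] by auto
  then have "f \<in> Rep_l2 a" by simp
  then show ?thesis unfolding rep_def by (rule someI[of "\<lambda>f. f \<in> Rep_l2 a"])
qed

text \<open>A function that is only Lebesgue measurable may fail to belong to its own class; a Borel
  version of it generates the same class, as the typedef demands.\<close>

lemma Rep_cl:
  assumes "f \<in> L2 I01"
  shows "Rep_l2 (cl f) = {g\<in>sq_borel. AE x in lebesgue_on I01. f x = g x}"
  unfolding cl_def
proof (rule Abs_l2_inverse)
  obtain h where h: "h \<in> sq_borel" "AE x in lebesgue_on I01. f x = h x"
    using L2_borel_version[OF assms] .
  have "(AE x in lebesgue_on I01. f x = g x) \<longleftrightarrow> (AE x in lebesgue_on I01. h x = g x)" for g
    using h(2) by (rule AE_eq_cong_left)
  then show "{g\<in>sq_borel. AE x in lebesgue_on I01. f x = g x} \<in>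
      {C. \<exists>f\<in>sq_borel. C = {g\<in>sq_borel. AE x in lebesgue_on I01. f x = g x}}"
    using h(1) by auto
qed

lemma rep_sq_borel: "rep a \<in> sq_borel"
  using rep_in_Rep[of a] Rep_l2[of a] by auto

lemma rep_borel: "rep a \<in> borel_measurable borel"
  using rep_sq_borel by (simp add: sq_borel_def)

lemma rep_L2 [simp, intro]: "rep a \<in> L2 I01"
  using rep_sq_borel sq_borel_L2 by blast

lemma rep_measurable [measurable]: "rep a \<in> borel_measurable (lebesgue_on I01)"
  using rep_L2 by (rule L2_measurable)

lemma rep_cl: "f \<in> L2 I01 \<Longrightarrow> AE x in lebesgue_on I01. rep (cl f) x = f x"
  using rep_in_Rep[of "cl f"] by (auto simp: Rep_cl elim: eventually_mono)

lemma l2_eqI: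
  assumes "AE x in lebesgue_on I01. rep a x = rep b x"
  shows "a = b"
proof -
  obtain f where f: "f \<in> sq_borel" "Rep_l2 a = {g\<in>sq_borel. AE x in lebesgue_on I01. f x = g x}"
    using Rep_l2[of a] by auto
  obtain h where h: "h \<in> sq_borel" "Rep_l2 b = {g\<in>sq_borel. AE x in lebesgue_on I01. h x = g x}"
    using Rep_l2[of b] by auto
  have "AE x in lebesgue_on I01. f x = rep a x" "AE x in lebesgue_on I01. h x = rep b x"
    using rep_in_Rep[of a] rep_in_Rep[of b] f h by auto
  with assms have fh: "AE x in lebesgue_on I01. f x = h x"
    by eventually_elim simp
  then have "(AE x in lebesgue_on I01. f x = g x) \<longleftrightarrow> (AE x in lebesgue_on I01. h x = g x)" for g
    by (rule AE_eq_cong_left)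
  then have "Rep_l2 a = Rep_l2 b" using f h by simp
  then show ?thesis by (simp add: Rep_l2_inject)
qed

lemma cl_cong_AE: 
  assumes "AE x in lebesgue_on I01. f x = g x" "f \<in> L2 I01" "g \<in> L2 I01"
  shows "cl f = cl g"
  by (rule l2_eqI) (use assms(1) rep_cl[OF assms(2)] rep_cl[OF assms(3)] in eventually_elim, simp)

lemma cl_rep [simp]: "cl (rep a) = a"
  using rep_cl by (intro l2_eqI) auto

section \<open>Vector space and inner product structure on the classes\<close>

instantiation l2 :: real_vector
begin

definition "zero_l2 = cl (\<lambda>x. 0)"
definition "plus_l2 a b = cl (\<lambda>x. rep a x + rep b x)"
definition "minus_l2 a b = cl (\<lambda>x. rep a x - rep b x)"
definition "uminus_l2 a = cl (\<lambda>x. - rep a x)"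
definition "scaleR_l2 c a = cl (\<lambda>x. c * rep a x)"

lemma rep_zero: "AE x in lebesgue_on I01. rep 0 x = 0"
  unfolding zero_l2_def by (rule rep_cl) (simp add: L2_def)

lemma rep_plus: "AE x in lebesgue_on I01. rep (a + b) x = rep a x + rep b x"
  unfolding plus_l2_def by (rule rep_cl) (intro L2_add rep_L2)

lemma rep_minus: "AE x in lebesgue_on I01. rep (a - b) x = rep a x - rep b x"
  unfolding minus_l2_def by (rule rep_cl) (intro L2_diff rep_L2)

lemma rep_scaleR: "AE x in lebesgue_on I01. rep (c *\<^sub>R a) x = c * rep a x"
  unfolding scaleR_l2_def by (rule rep_cl) (intro L2_cmult rep_L2)

lemma rep_uminus: "AE x in lebesgue_on I01. rep (- a) x = - rep a x"
  unfolding uminus_l2_def using L2_cmult[OF rep_L2, of "-1" a] by (intro rep_cl) simp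

instance
proof
  fix a b c :: l2 and r s :: real
  show "a + b + c = a + (b + c)"
    by (rule l2_eqI)
      (use rep_plus[of "a + b" c] rep_plus[of a b] rep_plus[of a "b + c"] rep_plus[of b c] in eventually_elim, simp)
  show "a + b = b + a"
    by (rule l2_eqI) (use rep_plus[of a b] rep_plus[of b a] in eventually_elim, simp)
  show "0 + a = a"
    by (rule l2_eqI) (use rep_plus[of 0 a] rep_zero in eventually_elim, simp)
  show "- a + a = 0"
    by (rule l2_eqI) (use rep_plus[of "- a" a] rep_uminus[of a] rep_zero in eventually_elim, simp)
  show "a - b = a + - b"
    by (rule l2_eqI) (use rep_plus[of a "- b"] rep_uminus[of b] rep_minus[of a b] in eventually_elim, simp)
  show "r *\<^sub>R (a + b) = r *\<^sub>R a + r *\<^sub>R b"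
    by (rule l2_eqI)
      (use rep_plus[of a b] rep_scaleR[of r "a + b"] rep_scaleR[of r a] rep_scaleR[of r b]
        rep_plus[of "r *\<^sub>R a" "r *\<^sub>R b"] in eventually_elim, simp add: algebra_simps)
  show "(r + s) *\<^sub>R a = r *\<^sub>R a + s *\<^sub>R a"
    by (rule l2_eqI)
      (use rep_scaleR[of "r + s" a] rep_scaleR[of r a] rep_scaleR[of s a]
        rep_plus[of "r *\<^sub>R a" "s *\<^sub>R a"] in eventually_elim, simp add: algebra_simps)
  show "r *\<^sub>R s *\<^sub>R a = (r * s) *\<^sub>R a"
    by (rule l2_eqI)
      (use rep_scaleR[of r "s *\<^sub>R a"] rep_scaleR[of s a] rep_scaleR[of "r * s" a] in eventually_elim, simp)
  show "1 *\<^sub>R a = a"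
    by (rule l2_eqI) (use rep_scaleR[of 1 a] in eventually_elim, simp)
qed

end

instantiation l2 :: real_inner
begin

definition "inner_l2 a b = (\<integral>x. rep a x * rep b x \<partial>lebesgue_on I01)"
definition "norm_l2 (a::l2) = sqrt (\<integral>x. rep a x * rep a x \<partial>lebesgue_on I01)"
definition "sgn_l2 (a::l2) = a /\<^sub>R norm a"
definition "dist_l2 (a::l2) b = norm (a - b)"
definition uniformity_l2 :: "(l2 \<times> l2) filter" where
  "uniformity_l2 = (INF e\<in>{0<..}. principal {(x, y). dist x y < e})"
definition open_l2 :: "l2 set \<Rightarrow> bool" where
  "open_l2 U = (\<forall>x\<in>U. \<forall>\<^sub>F (x', y) in uniformity. x' = x \<longrightarrow> y \<in> U)"

instance
proof
  fix a b c :: l2 and r s :: real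
  show "sgn a = inverse (norm a) *\<^sub>R a" by (simp add: sgn_l2_def divide_inverse)
  show "dist a b = norm (a - b)" by (simp add: dist_l2_def)
  show "(uniformity :: (l2 \<times> l2) filter) = (INF e\<in>{0<..}. principal {(x, y). dist x y < e})"
    by (rule uniformity_l2_def)
  show "open U = (\<forall>x\<in>U. \<forall>\<^sub>F (x', y) in uniformity. x' = x \<longrightarrow> y \<in> U)" for U :: "l2 set"
    by (rule open_l2_def)
  show "inner a b = inner b a" by (simp add: inner_l2_def mult.commute)
  have "(\<integral>x. rep (a + b) x * rep c x \<partial>lebesgue_on I01)
      = (\<integral>x. rep a x * rep c x + rep b x * rep c x \<partial>lebesgue_on I01)"
    by (rule integral_cong_AE) (measurable, use rep_plus[of a b] in eventually_elim, simp add: algebra_simps)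
  then show "inner (a + b) c = inner a c + inner b c"
    by (simp add: inner_l2_def L2_mult_integrable)
  have "(\<integral>x. rep (r *\<^sub>R a) x * rep b x \<partial>lebesgue_on I01) = (\<integral>x. r * (rep a x * rep b x) \<partial>lebesgue_on I01)"
    by (rule integral_cong_AE) (measurable, use rep_scaleR[of r a] in eventually_elim, simp)
  then show "inner (r *\<^sub>R a) b = r * inner a b" by (simp add: inner_l2_def)
  show "0 \<le> inner a a" by (simp add: inner_l2_def)
  show "inner a a = 0 \<longleftrightarrow> a = 0"
  proof
    assume "inner a a = 0"
    then have "AE x in lebesgue_on I01. rep a x * rep a x = 0"
      using L2_mult_integrable[OF rep_L2 rep_L2, of a a]
      by (subst (asm) inner_l2_def, subst (asm) integral_nonneg_eq_0_iff_AE) auto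
    with rep_zero have "AE x in lebesgue_on I01. rep a x = rep 0 x" by eventually_elim simp
    then show "a = 0" by (rule l2_eqI)
  next
    assume "a = 0"
    have "(\<integral>x. rep 0 x * rep 0 x \<partial>lebesgue_on I01) = (\<integral>x. 0 \<partial>lebesgue_on I01)"
      by (rule integral_cong_AE) (measurable, use rep_zero in eventually_elim, simp)
    then show "inner a a = 0" using \<open>a = 0\<close> by (simp add: inner_l2_def)
  qed
  show "norm a = sqrt (inner a a)" by (simp add: norm_l2_def inner_l2_def)
qed

end

lemma inner_eq_integral_AE:
  assumes "AE x in lebesgue_on I01. rep a x = f x" "AE x in lebesgue_on I01. rep b x = g x"
    "f \<in> borel_measurable (lebesgue_on I01)" "g \<in> borel_measurable (lebesgue_on I01)"
  shows "a \<bullet> b = (\<integral>x. f x * g x \<partial>lebesgue_on I01)"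
  unfolding inner_l2_def
  by (rule integral_cong_AE) (use assms(3,4) in measurable, use assms(1,2) in eventually_elim, simp)

lemma inner_cl:
  assumes "f \<in> L2 I01" "g \<in> L2 I01"
  shows "cl f \<bullet> cl g = (\<integral>x. f x * g x \<partial>lebesgue_on I01)"
  using assms by (intro inner_eq_integral_AE rep_cl) auto

lemma norm_cl: "f \<in> L2 I01 \<Longrightarrow> norm (cl f) = L2_nrm I01 f"
  by (simp add: norm_eq_sqrt_inner inner_cl L2_nrm_def power2_eq_square)

lemma cl_add: "f \<in> L2 I01 \<Longrightarrow> g \<in> L2 I01 \<Longrightarrow> cl (\<lambda>x. f x + g x) = cl f + cl g"
  by (rule l2_eqI) (use rep_cl[of f] rep_cl[of g] rep_cl[OF L2_add[of f I01 g]] rep_plus[of "cl f" "cl g"] in \<open>auto elim: eventually_elim2\<close>)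

lemma norm_l2_power2: "(norm (a::l2))\<^sup>2 = (\<integral>x. (rep a x)\<^sup>2 \<partial>lebesgue_on I01)"
  unfolding power2_norm_eq_inner inner_l2_def by (simp add: power2_eq_square)

lemma nn_integral_rep_power2: "(\<integral>\<^sup>+x. ennreal ((rep a x)\<^sup>2) \<partial>lebesgue_on I01) = ennreal ((norm a)\<^sup>2)"
  unfolding norm_l2_power2 using rep_L2[of a] by (intro nn_integral_eq_integral) (auto simp: L2_def)

lemma one_L2: "(\<lambda>x. 1) \<in> L2 I01"
  using finite_measure.integrable_const[OF finite_measure_lebesgue_on_I01] by (simp add: L2_def)

lemma norm_cl_one: "norm (cl (\<lambda>x. 1)) = 1"
proof -
  have "(\<integral>x. 1 \<partial>lebesgue_on I01) = (1::real)"
    by (simp add: measure_restrict_space)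
  then show ?thesis by (simp add: norm_cl one_L2 L2_nrm_def)
qed

lemma nn_integral_rep_le: "(\<integral>\<^sup>+x. ennreal \<bar>rep a x\<bar> \<partial>lebesgue_on I01) \<le> ennreal (norm a)"
proof -
  have abs: "(\<lambda>x. \<bar>rep a x\<bar>) \<in> L2 I01"
    by (rule L2_bounded[OF rep_L2[of a]]) auto
  have int: "integrable (lebesgue_on I01) (\<lambda>x. \<bar>rep a x\<bar>)"
    using L2_mult_integrable[OF abs one_L2] by simp
  have "(\<integral>\<^sup>+x. ennreal \<bar>rep a x\<bar> \<partial>lebesgue_on I01) = ennreal (\<integral>x. \<bar>rep a x\<bar> \<partial>lebesgue_on I01)"
    using int by (intro nn_integral_eq_integral) auto
  also have "(\<integral>x. \<bar>rep a x\<bar> \<partial>lebesgue_on I01) = cl (\<lambda>x. \<bar>rep a x\<bar>) \<bullet> cl (\<lambda>x. 1)"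
    by (simp add: inner_cl abs one_L2)
  also have "\<dots> \<le> norm (cl (\<lambda>x. \<bar>rep a x\<bar>)) * norm (cl (\<lambda>x. 1))"
    by (rule norm_cauchy_schwarz)
  also have "norm (cl (\<lambda>x. \<bar>rep a x\<bar>)) = norm a"
    using norm_cl[OF rep_L2[of a]] by (simp add: norm_cl abs L2_nrm_def)
  finally show ?thesis by (simp add: norm_cl_one ennreal_leI)
qed

section \<open>Completeness and Riesz representation\<close>

text \<open>Riesz--Fischer: a rapidly converging subsequence converges almost everywhere, and Fatou's
  lemma identifies its limit in the norm.\<close>

instance l2 :: complete_space
proof
  fix X :: "nat \<Rightarrow> l2" assume "Cauchy X"
  have "\<exists>r::nat\<Rightarrow>nat. strict_mono r \<and> (\<forall>n. \<forall>i\<ge>r n. \<forall>j\<ge>r n. norm (X i - X j) \<le> (1/2)^n)"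
  proof -
    have "\<exists>M. \<forall>i\<ge>M. \<forall>j\<ge>M. norm (X i - X j) < (1/2)^n" for n
      using CauchyD[OF \<open>Cauchy X\<close>, of "(1/2)^n"] by simp
    then obtain M where M: "\<And>n i j. i \<ge> M n \<Longrightarrow> j \<ge> M n \<Longrightarrow> norm (X i - X j) < (1/2)^n" by metis
    \<comment> \<open>The maximum makes r strictly increasing while keeping r n beyond the Cauchy
      threshold M n.\<close>
    define r where "r = rec_nat (M 0) (\<lambda>n k. max (Suc k) (M (Suc n)))"
    have "strict_mono r" by (rule strict_monoI_Suc) (simp add: r_def)
    moreover have "M n \<le> r n" for n by (cases n) (auto simp: r_def)
    ultimately show ?thesis
      using M by (intro exI[of _ r]) (meson less_imp_le order_trans)
  qed
  then obtain r :: "nat \<Rightarrow> nat" where r: "strict_mono r"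
    "\<And>n i j. i \<ge> r n \<Longrightarrow> j \<ge> r n \<Longrightarrow> norm (X i - X j) \<le> (1/2)^n" by blast
  define Y where "Y = X \<circ> r"
  have rn: "r n \<le> r m" if "n \<le> m" for n m using r(1) that by (simp add: strict_mono_less_eq)
  have Y: "norm (Y i - Y j) \<le> (1/2)^n" if "n \<le> i" "n \<le> j" for n i j
    using r(2)[of n "r i" "r j"] rn that by (simp add: Y_def)
  define d where "d = (\<lambda>n. rep (Y (Suc n) - Y n))"
  have dm[measurable]: "d n \<in> borel_measurable (lebesgue_on I01)" for n unfolding d_def by measurable
  have "(\<integral>\<^sup>+x. (\<Sum>n. ennreal \<bar>d n x\<bar>) \<partial>lebesgue_on I01) = (\<Sum>n. \<integral>\<^sup>+x. ennreal \<bar>d n x\<bar> \<partial>lebesgue_on I01)"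
    by (rule nn_integral_suminf) measurable
  also have "\<dots> \<le> (\<Sum>n. ennreal ((1/2)^n))"
  proof (rule suminf_le)
    fix n show "(\<integral>\<^sup>+x. ennreal \<bar>d n x\<bar> \<partial>lebesgue_on I01) \<le> ennreal ((1/2)^n)"
      using nn_integral_rep_le[of "Y (Suc n) - Y n"] Y[of n "Suc n" n] 
      unfolding d_def by (meson ennreal_leI le_SucI order_refl order_trans)
  qed auto
  also have "\<dots> = ennreal (\<Sum>n. (1/2)^n)"
    by (rule suminf_ennreal2) (auto simp: summable_geometric)
  also have "\<dots> < \<infinity>" by simp
  finally have "AE x in lebesgue_on I01. (\<Sum>n. ennreal \<bar>d n x\<bar>) \<noteq> \<infinity>"
    by (intro nn_integral_PInf_AE) (auto simp: less_top)
  then have sum: "AE x in lebesgue_on I01. summable (\<lambda>n. \<bar>d n x\<bar>)"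
    by eventually_elim (rule summable_suminf_not_top, auto)
  have dd: "AE x in lebesgue_on I01. \<forall>n. d n x = rep (Y (Suc n)) x - rep (Y n) x"
    unfolding d_def AE_all_countable using rep_minus by blast
  \<comment> \<open>\<open>lim\<close> has an arbitrary value where the sequence diverges, which
    happens only on a null set, and Z is measurable all the same.\<close>
  define Z where "Z = (\<lambda>x. lim (\<lambda>n. rep (Y n) x))"
  have Zm[measurable]: "Z \<in> borel_measurable (lebesgue_on I01)" unfolding Z_def by measurable
  have conv: "AE x in lebesgue_on I01. (\<lambda>n. rep (Y n) x) \<longlonglongrightarrow> Z x"
    using sum dd
  proof eventually_elim
    case (elim x)
    have "summable (\<lambda>n. d n x)" by (rule summable_rabs_cancel[OF elim(1)])
    then have "(\<lambda>n. \<Sum>k<n. d k x) \<longlonglongrightarrow> (\<Sum>k. d k x)" by (rule summable_LIMSEQ)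
    then have "(\<lambda>n. rep (Y n) x - rep (Y 0) x) \<longlonglongrightarrow> (\<Sum>k. d k x)"
      using elim(2) sum_lessThan_telescope[of "\<lambda>n. rep (Y n) x"] by simp
    from tendsto_add[OF this tendsto_const[of "rep (Y 0) x"]]
    have "convergent (\<lambda>n. rep (Y n) x)" by (auto simp: convergent_def)
    then show ?case unfolding Z_def by (rule convergent_LIMSEQ_iff[THEN iffD1])
  qed
  have Zn: "(\<integral>\<^sup>+x. ennreal ((Z x - rep (Y n) x)\<^sup>2) \<partial>lebesgue_on I01) \<le> ennreal (((1/2)^n)\<^sup>2)" for n
  proof -
    have "(\<integral>\<^sup>+x. ennreal ((Z x - rep (Y n) x)\<^sup>2) \<partial>lebesgue_on I01)
        = (\<integral>\<^sup>+x. liminf (\<lambda>m. ennreal ((rep (Y m) x - rep (Y n) x)\<^sup>2)) \<partial>lebesgue_on I01)"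
    proof (rule nn_integral_cong_AE, use conv in eventually_elim)
      case (elim x)
      have "(\<lambda>m. ennreal ((rep (Y m) x - rep (Y n) x)\<^sup>2)) \<longlonglongrightarrow> ennreal ((Z x - rep (Y n) x)\<^sup>2)"
        by (intro tendsto_ennrealI tendsto_power tendsto_diff elim tendsto_const)
      then show ?case by (rule lim_imp_Liminf[OF sequentially_bot, symmetric])
    qed
    also have "\<dots> \<le> liminf (\<lambda>m. \<integral>\<^sup>+x. ennreal ((rep (Y m) x - rep (Y n) x)\<^sup>2) \<partial>lebesgue_on I01)"
      by (rule nn_integral_liminf) measurable
    also have "\<dots> \<le> ennreal (((1/2)^n)\<^sup>2)"
    proof (rule order_trans[OF Liminf_le_Limsup Limsup_bounded])
      have "(\<integral>\<^sup>+x. ennreal ((rep (Y m) x - rep (Y n) x)\<^sup>2) \<partial>lebesgue_on I01) \<le> ennreal (((1/2)^n)\<^sup>2)" if "n \<le> m" for m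
      proof -
        have "(\<integral>\<^sup>+x. ennreal ((rep (Y m) x - rep (Y n) x)\<^sup>2) \<partial>lebesgue_on I01)
            = (\<integral>\<^sup>+x. ennreal ((rep (Y m - Y n) x)\<^sup>2) \<partial>lebesgue_on I01)"
          by (rule nn_integral_cong_AE, use rep_minus[of "Y m" "Y n"] in eventually_elim) simp
        also have "\<dots> \<le> ennreal (((1/2)^n)\<^sup>2)"
          unfolding nn_integral_rep_power2 using Y[of n m n] that by (intro ennreal_leI power_mono) auto
        finally show ?thesis .
      qed
      then show "\<forall>\<^sub>F m in sequentially. (\<integral>\<^sup>+x. ennreal ((rep (Y m) x - rep (Y n) x)\<^sup>2) \<partial>lebesgue_on I01) \<le> ennreal (((1/2)^n)\<^sup>2)"
        using eventually_ge_at_top[of n] by (elim eventually_mono)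
    qed simp
    finally show ?thesis .
  qed
  have ZL: "(\<lambda>x. Z x - rep (Y n) x) \<in> L2 I01" for n
  proof -
    have "integrable (lebesgue_on I01) (\<lambda>x. (Z x - rep (Y n) x)\<^sup>2)"
      using Zn[of n] by (intro integrableI_bounded) (auto simp: order_le_less_trans)
    then show ?thesis by (simp add: L2_def)
  qed
  then have "Z \<in> L2 I01" using L2_add[OF ZL[of 0] rep_L2[of "Y 0"]] by simp
  have "norm (Y n - cl Z) \<le> (1/2)^n" for n
  proof -
    have "ennreal ((norm (cl Z - Y n))\<^sup>2) = (\<integral>\<^sup>+x. ennreal ((Z x - rep (Y n) x)\<^sup>2) \<partial>lebesgue_on I01)"
      unfolding nn_integral_rep_power2[symmetric]
      by (rule nn_integral_cong_AE, use rep_minus[of "cl Z" "Y n"] rep_cl[OF \<open>Z \<in> L2 I01\<close>] in eventually_elim) simp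
    also note Zn[of n]
    finally have "(norm (cl Z - Y n))\<^sup>2 \<le> ((1/2)^n)\<^sup>2" by (subst (asm) ennreal_le_iff) auto
    then have "norm (cl Z - Y n) \<le> (1/2)^n" by (rule power2_le_imp_le) simp
    then show ?thesis by (simp add: norm_minus_commute)
  qed
  then have "\<forall>\<^sub>F n in sequentially. norm (Y n - cl Z) \<le> (1/2)^n"
    by (intro always_eventually allI)
  then have "(\<lambda>n. Y n - cl Z) \<longlonglongrightarrow> 0"
    by (rule Lim_null_comparison) (rule LIMSEQ_power_zero, simp)
  then have "Y \<longlonglongrightarrow> cl Z" by (rule LIM_zero_cancel)
  then have "X \<longlonglongrightarrow> cl Z"
    unfolding Y_def by (rule Cauchy_converges_subseq[OF \<open>Cauchy X\<close> r(1)])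
  then show "convergent X" by (auto simp: convergent_def)
qed

instance l2 :: banach ..

text \<open>Minimising \<open>|S g|\<^sup>2 / 2 - \<phi> g\<close> produces the representing element as a limit of \<open>S g\<^sub>n\<close>.\<close>

lemma Riesz_representation_on_range:
  fixes S :: "'a::real_vector \<Rightarrow> 'b::{real_inner,complete_space}" and \<phi> :: "'a \<Rightarrow> real"
  assumes S: "linear S" and \<phi>: "linear \<phi>" and bound: "\<And>g. \<bar>\<phi> g\<bar> \<le> C * norm (S g)"
  shows "\<exists>z. \<forall>g. \<phi> g = z \<bullet> S g"
proof -
  interpret S: linear S by (rule S)
  interpret \<phi>: linear \<phi> by (rule \<phi>)
  define J where "J = (\<lambda>g. (norm (S g))\<^sup>2 / 2 - \<phi> g)"
  have "- (C\<^sup>2 / 2) \<le> J g" for g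
  proof -
    have "0 \<le> (norm (S g) - C)\<^sup>2" by simp
    then show ?thesis using bound[of g] by (simp add: J_def power2_diff mult.commute)
  qed
  then have bdd: "bdd_below (range J)" by (meson bdd_belowI2)
  define m where "m = Inf (range J)"
  have m: "m \<le> J g" for g unfolding m_def by (intro cINF_lower bdd) simp
  have "\<exists>g. J g < m + 1 / Suc n" for n
    using cINF_less_iff[OF _ bdd, of "m + 1 / Suc n"] by (auto simp: m_def)
  then obtain g where g: "\<And>n. J (g n) < m + 1 / Suc n" by metis
  \<comment> \<open>J at the midpoint is at least m; with the parallelogram law this bounds |S x - S
    y| by the excess of J over its infimum, so minimising sequences have Cauchy images.\<close>
  have par: "(norm (S x - S y))\<^sup>2 \<le> 4 * ((J x - m) + (J y - m))" for x y
  proof -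
    have eq: "(norm ((1/2) *\<^sub>R (S x + S y)))\<^sup>2 = ((norm (S x))\<^sup>2 + (norm (S y))\<^sup>2) / 2 - (norm (S x - S y))\<^sup>2 / 4"
      by (simp add: power2_norm_eq_inner inner_add_left inner_add_right inner_diff_left inner_diff_right inner_commute[of "S y" "S x"] field_simps)
    have "J ((1/2) *\<^sub>R (x + y)) = (J x + J y) / 2 - (norm (S x - S y))\<^sup>2 / 8"
      unfolding J_def S.scaleR S.add eq by (simp add: \<phi>.scaleR \<phi>.add field_simps)
    then show ?thesis using m[of "(1/2) *\<^sub>R (x + y)"] by (simp add: field_simps)
  qed
  have "Cauchy (\<lambda>n. S (g n))"
  proof (rule CauchyI)
    fix e :: real assume "0 < e"
    obtain N :: nat where N: "8 / e\<^sup>2 < N" using reals_Archimedean2 by blast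
    show "\<exists>M. \<forall>m\<ge>M. \<forall>n\<ge>M. norm (S (g m) - S (g n)) < e"
    proof (intro exI[of _ N] allI impI)
      fix p q assume pq: "N \<le> p" "N \<le> q"
      have small: "J (g n) - m < e\<^sup>2 / 8" if "N \<le> n" for n
      proof -
        have "8 / e\<^sup>2 < Suc n" using N that by simp
        then have "1 / Suc n < e\<^sup>2 / 8" using \<open>0 < e\<close> by (simp add: field_simps)
        then show ?thesis using g[of n] by linarith
      qed
      have "(norm (S (g p) - S (g q)))\<^sup>2 < e\<^sup>2"
        using order_le_less_trans[OF par[of "g p" "g q"], of "4 * (e\<^sup>2 / 8 + e\<^sup>2 / 8)"]
          small[OF pq(1)] small[OF pq(2)] by simp
      then show "norm (S (g p) - S (g q)) < e" using \<open>0 < e\<close> by (simp add: power2_less_imp_less)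
    qed
  qed
  then obtain z where z: "(\<lambda>n. S (g n)) \<longlonglongrightarrow> z" using Cauchy_convergent convergent_def by blast
  have J_lim: "(\<lambda>n. J (g n)) \<longlonglongrightarrow> m"
  proof (rule tendsto_sandwich[of "\<lambda>n. m" _ _ "\<lambda>n. m + 1 / Suc n"])
    show "(\<lambda>n. m + 1 / Suc n) \<longlonglongrightarrow> m"
      using tendsto_add[OF tendsto_const[of m] LIMSEQ_inverse_real_of_nat] by (simp add: divide_inverse)
    show "\<forall>\<^sub>F n in sequentially. J (g n) \<le> m + 1 / Suc n"
      using g less_imp_le by (intro always_eventually allI) blast
  qed (use m in auto)
  have "\<phi> x = z \<bullet> S x" for x
  proof -
    define d where "d = z \<bullet> S x - \<phi> x"
    \<comment> \<open>The variation t = -d/k gives 0 \<le> -d^2/(2k). The summand 1 keeps k positive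
      even if S x = 0.\<close>
    define k where "k = 1 + (norm (S x))\<^sup>2"
    have k: "k > 0" unfolding k_def by (simp add: add_pos_nonneg)
    have var: "0 \<le> t * d + t\<^sup>2 / 2 * (norm (S x))\<^sup>2" for t
    proof (rule LIMSEQ_le_const)
      show "(\<lambda>n. (J (g n) - m) + (t * (S (g n) \<bullet> S x - \<phi> x) + t\<^sup>2 / 2 * (norm (S x))\<^sup>2))
          \<longlonglongrightarrow> t * d + t\<^sup>2 / 2 * (norm (S x))\<^sup>2"
        unfolding d_def by (rule tendsto_eq_intros z J_lim refl | simp)+
      have "J (g n + t *\<^sub>R x) = J (g n) + (t * (S (g n) \<bullet> S x - \<phi> x) + t\<^sup>2 / 2 * (norm (S x))\<^sup>2)" for n
      proof -
        have "(norm (S (g n) + t *\<^sub>R S x))\<^sup>2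
            = (norm (S (g n)))\<^sup>2 + 2 * t * (S (g n) \<bullet> S x) + t\<^sup>2 * (norm (S x))\<^sup>2"
          unfolding power2_norm_eq_inner
          by (simp add: inner_add_left inner_add_right inner_commute[of "S x" "S (g n)"] power2_eq_square algebra_simps)
        then show ?thesis
          by (simp add: J_def S.add S.scaleR \<phi>.add \<phi>.scaleR field_simps)
      qed
      then show "\<exists>N. \<forall>n\<ge>N. 0 \<le> (J (g n) - m) + (t * (S (g n) \<bullet> S x - \<phi> x) + t\<^sup>2 / 2 * (norm (S x))\<^sup>2)"
        using m by (metis add_diff_cancel_left' diff_ge_0_iff_ge add.commute add_diff_eq)
    qed
    have "(d / k)\<^sup>2 / 2 * (norm (S x))\<^sup>2 \<le> (d / k)\<^sup>2 / 2 * k"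
      by (intro mult_left_mono) (auto simp: k_def)
    also have "\<dots> = d\<^sup>2 / k / 2" using k by (simp add: power2_eq_square)
    finally have "0 \<le> - (d\<^sup>2 / k / 2)" using var[of "- (d / k)"] by (simp add: power2_eq_square)
    then have "d\<^sup>2 / k \<le> 0" by simp
    then have "d = 0" using k by (simp add: divide_le_0_iff)
    then show ?thesis by (simp add: d_def)
  qed
  then show ?thesis by blast
qed

section \<open>The degenerate operator and its inverse\<close>

abbreviation "M01 \<equiv> lebesgue_on I01"

interpretation M01: finite_measure M01 by (rule finite_measure_lebesgue_on_I01)
interpretation M01: sigma_finite_measure M01 ..
interpretation M01_pair: pair_sigma_finite M01 M01 ..

lemma borel_pair_lebesgue_on:
  fixes k :: "real \<Rightarrow> real \<Rightarrow> real" and S R :: "real set"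
  assumes "case_prod k \<in> borel_measurable (borel \<Otimes>\<^sub>M borel)"
  shows "case_prod k \<in> borel_measurable (lebesgue_on S \<Otimes>\<^sub>M lebesgue_on R)"
proof -
  have "fst \<in> lebesgue_on S \<Otimes>\<^sub>M lebesgue_on R \<rightarrow>\<^sub>M borel"
    by (rule measurable_compose[OF measurable_fst measurable_ident_lebesgue_on])
  moreover have "snd \<in> lebesgue_on S \<Otimes>\<^sub>M lebesgue_on R \<rightarrow>\<^sub>M borel"
    by (rule measurable_compose[OF measurable_snd measurable_ident_lebesgue_on])
  ultimately have "(\<lambda>z. (fst z, snd z)) \<in> lebesgue_on S \<Otimes>\<^sub>M lebesgue_on R \<rightarrow>\<^sub>M borel \<Otimes>\<^sub>M borel"
    by (rule measurable_Pair)
  from measurable_compose[OF this assms] show ?thesis by simp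
qed

lemma Lebesgue_section:
  fixes k :: "real \<Rightarrow> real \<Rightarrow> real"
  assumes "case_prod k \<in> borel_measurable (borel \<Otimes>\<^sub>M borel)"
  shows "(\<lambda>y. k x y) \<in> borel_measurable (lebesgue_on (S::real set))" "(\<lambda>x. k x y) \<in> borel_measurable (lebesgue_on S)"
proof -
  note [measurable] = assms
  have "(\<lambda>y. k x y) \<in> borel_measurable borel" by measurable
  then show "(\<lambda>y. k x y) \<in> borel_measurable (lebesgue_on S)" by (rule borel_measurable_lebesgue_onI)
  have "(\<lambda>x. k x y) \<in> borel_measurable borel" by measurable
  then show "(\<lambda>x. k x y) \<in> borel_measurable (lebesgue_on S)" by (rule borel_measurable_lebesgue_onI)
qed

text \<open>The indicator of the triangle x < y. Integrals over (x,1) and (0,x) become integrals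
  over all of (0,1) against this kernel, so that exchanging them is Fubini on one fixed product
  space.\<close>

definition hv :: "real \<Rightarrow> real \<Rightarrow> real" where
  "hv x y = (if x < y then 1 else 0)"

lemma hv_borel [measurable]: "case_prod hv \<in> borel_measurable (borel \<Otimes>\<^sub>M borel)"
  unfolding hv_def by measurable

lemma hv_bounds [simp]: "0 \<le> hv x y" "hv x y \<le> 1" "\<bar>hv x y\<bar> = hv x y" "hv x y * hv x y = hv x y"
  by (auto simp: hv_def)

lemma integrable_hv_mult:
  assumes "integrable M01 f"
  shows "integrable M01 (\<lambda>y. hv x y * f y)" "integrable M01 (\<lambda>y. hv y x * f y)"
  by (rule Bochner_Integration.integrable_bound[OF assms];
      use assms Lebesgue_section[OF hv_borel] in \<open>auto simp: hv_def\<close>)+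

lemma integrable_on_subinterval_iff:
  fixes f :: "real \<Rightarrow> real"
  assumes S: "{a<..<b} \<subseteq> I01" and H: "\<And>y. y \<in> I01 \<Longrightarrow> H y = indicator {a<..<b} y"
  shows "integrable M01 (\<lambda>y. H y * f y) \<longleftrightarrow> f absolutely_integrable_on {a..b}" (is ?A)
    and "f absolutely_integrable_on {a..b} \<Longrightarrow> (\<integral>y. H y * f y \<partial>M01) = integral {a..b} f"
proof -
  have "integrable M01 (\<lambda>y. H y * f y) \<longleftrightarrow> integrable M01 (\<lambda>y. indicator {a<..<b} y * f y)"
    by (rule Bochner_Integration.integrable_cong) (use H in auto)
  also have "\<dots> \<longleftrightarrow> integrable lebesgue (\<lambda>y. indicator I01 y *\<^sub>R (indicator {a<..<b} y * f y))"
    by (rule integrable_restrict_space) auto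
  also have "(\<lambda>y. indicator I01 y *\<^sub>R (indicator {a<..<b} y * f y)) = (\<lambda>y. indicator {a<..<b} y *\<^sub>R f y)"
    using S by (auto simp: indicator_def fun_eq_iff)
  also have "integrable lebesgue \<dots> \<longleftrightarrow> f absolutely_integrable_on {a<..<b}" by (simp add: set_integrable_def)
  finally show ?A unfolding absolutely_integrable_on_Icc_iff_Ioo .
  assume f: "f absolutely_integrable_on {a..b}"
  have "(\<integral>y. H y * f y \<partial>M01) = (\<integral>y. indicator {a<..<b} y * f y \<partial>M01)"
    by (rule Bochner_Integration.integral_cong) (use H in auto)
  also have "\<dots> = (\<integral>y. indicator I01 y *\<^sub>R (indicator {a<..<b} y * f y) \<partial>lebesgue)"
    by (rule integral_restrict_space) auto
  also have "(\<lambda>y. indicator I01 y *\<^sub>R (indicator {a<..<b} y * f y)) = (\<lambda>y. indicator {a<..<b} y *\<^sub>R f y)"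
    using S by (auto simp: indicator_def fun_eq_iff)
  also have "integral\<^sup>L lebesgue \<dots> = set_lebesgue_integral lebesgue {a<..<b} f"
    by (simp add: set_lebesgue_integral_def)
  also have "\<dots> = integral {a<..<b} f"
    using f by (intro set_lebesgue_integral_eq_integral) (simp add: absolutely_integrable_on_Icc_iff_Ioo)
  also have "\<dots> = integral {a..b} f"
    by (simp add: integral_open_interval_real)
  finally show "(\<integral>y. H y * f y \<partial>M01) = integral {a..b} f" .
qed

lemma integrable_hv_tail_iff:
  fixes f :: "real \<Rightarrow> real"
  assumes "0 \<le> x" "x \<le> 1"
  shows "integrable M01 (\<lambda>y. hv x y * f y) \<longleftrightarrow> f absolutely_integrable_on {x..1}"
    and "f absolutely_integrable_on {x..1} \<Longrightarrow> (\<integral>y. hv x y * f y \<partial>M01) = integral {x..1} f"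
  by (rule integrable_on_subinterval_iff; use assms in \<open>auto simp: hv_def\<close>)+

lemma integrable_hv_head_iff:
  fixes f :: "real \<Rightarrow> real"
  assumes "0 \<le> x" "x \<le> 1"
  shows "integrable M01 (\<lambda>y. hv y x * f y) \<longleftrightarrow> f absolutely_integrable_on {0..x}"
    and "f absolutely_integrable_on {0..x} \<Longrightarrow> (\<integral>y. hv y x * f y \<partial>M01) = integral {0..x} f"
  by (rule integrable_on_subinterval_iff; use assms in \<open>auto simp: hv_def\<close>)+

lemma integrable_M01_iff:
  fixes f :: "real \<Rightarrow> real"
  shows "integrable M01 f \<longleftrightarrow> f absolutely_integrable_on {0..1}"
    and "f absolutely_integrable_on {0..1} \<Longrightarrow> (\<integral>y. f y \<partial>M01) = integral {0..1} f"
  using integrable_on_subinterval_iff[of 0 1 "\<lambda>y. 1"] by auto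

lemma powr_absolutely_integrable:
  fixes \<beta> :: real
  assumes "\<beta> > -1" "0 \<le> x"
  shows "(\<lambda>y. y powr \<beta>) absolutely_integrable_on {0..x}" "integral {0..x} (\<lambda>y. y powr \<beta>) = x powr (\<beta> + 1) / (\<beta> + 1)"
  using has_integral_powr_from_0[OF assms]
  by (auto intro!: nonnegative_absolutely_integrable_1 simp: has_integral_iff)

lemma integral_powr_tail:
  fixes \<beta> :: real
  assumes "\<beta> \<noteq> -1" "0 < x" "x \<le> 1"
  shows "(\<integral>y. hv x y * y powr \<beta> \<partial>M01) = (1 - x powr (\<beta> + 1)) / (\<beta> + 1)"
proof -
  have "((\<lambda>y. y powr \<beta>) has_integral (1 powr (\<beta> + 1) / (\<beta> + 1) - x powr (\<beta> + 1) / (\<beta> + 1))) {x..1}"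
  proof (rule fundamental_theorem_of_calculus[OF \<open>x \<le> 1\<close>])
    fix y assume "y \<in> {x..1}"
    then have "y > 0" using assms by simp
    then have "((\<lambda>y. y powr (\<beta> + 1)) has_real_derivative (\<beta> + 1) * y powr (\<beta> + 1 - 1)) (at y)"
      by (rule has_real_derivative_powr)
    from DERIV_cdivide[OF this, of "\<beta> + 1"]
    have "((\<lambda>y. y powr (\<beta> + 1) / (\<beta> + 1)) has_real_derivative y powr \<beta>) (at y)"
      using assms(1) by simp
    then show "((\<lambda>y. y powr (\<beta> + 1) / (\<beta> + 1)) has_vector_derivative y powr \<beta>) (at y within {x..1})"
      using has_field_derivative_at_within has_real_derivative_iff_has_vector_derivative by blast
  qed
  then have "(\<lambda>y. y powr \<beta>) absolutely_integrable_on {x..1}" "integral {x..1} (\<lambda>y. y powr \<beta>) = (1 - x powr (\<beta> + 1)) / (\<beta> + 1)"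
    by (auto intro!: nonnegative_absolutely_integrable_1 simp: has_integral_iff diff_divide_distrib)
  then show ?thesis using integrable_hv_tail_iff(2)[of x "\<lambda>y. y powr \<beta>"] assms by simp
qed

lemma integrable_powr_M01:
  fixes \<beta> :: real
  assumes "\<beta> > -1"
  shows "integrable M01 (\<lambda>y. y powr \<beta>)"
  using powr_absolutely_integrable[OF assms, of 1] by (simp add: integrable_M01_iff)

lemma integral_powr_head:
  fixes \<beta> :: real
  assumes "\<beta> > -1" "0 \<le> x" "x \<le> 1"
  shows "(\<integral>y. hv y x * y powr \<beta> \<partial>M01) = x powr (\<beta> + 1) / (\<beta> + 1)"
  using powr_absolutely_integrable[OF assms(1,2)] integrable_hv_head_iff(2)[of x "\<lambda>y. y powr \<beta>"] assms by simp

lemma AE_M01_neq: "AE y in M01. y \<noteq> (x::real)"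
proof -
  have "AE y in lebesgue. y \<noteq> x" by (rule AE_completion) (rule AE_lborel_singleton)
  then show ?thesis by (subst AE_restrict_space_iff) (auto elim: eventually_mono)
qed

text \<open>The product is an integral over the square, split into the triangles on either side of
  the diagonal, which is a null set. This is integration by parts for two indefinite
  integrals.\<close>

lemma integral_mult_integral_eq:
  assumes f: "integrable M01 f" and g: "integrable M01 g"
  shows "(\<integral>x. f x \<partial>M01) * (\<integral>y. g y \<partial>M01)
    = (\<integral>x. f x * (\<integral>y. hv x y * g y \<partial>M01) \<partial>M01) + (\<integral>y. g y * (\<integral>x. hv y x * f x \<partial>M01) \<partial>M01)"
proof -
  have [measurable]: "f \<in> borel_measurable M01" "g \<in> borel_measurable M01" using f g by auto
  have [measurable]: "case_prod hv \<in> borel_measurable (M01 \<Otimes>\<^sub>M M01)" by (rule borel_pair_lebesgue_on[OF hv_borel])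
  have [measurable]: "(\<lambda>(x, y). hv y x) \<in> borel_measurable (M01 \<Otimes>\<^sub>M M01)"
    by (rule borel_pair_lebesgue_on) measurable
  have fg: "integrable (M01 \<Otimes>\<^sub>M M01) (\<lambda>(x, y). f x * g y)"
  proof (rule M01_pair.Fubini_integrable)
    show "integrable M01 (\<lambda>x. \<integral>y. norm (case (x, y) of (x, y) \<Rightarrow> f x * g y) \<partial>M01)"
      using f g by (simp add: abs_mult)
    show "AE x in M01. integrable M01 (\<lambda>y. case (x, y) of (x, y) \<Rightarrow> f x * g y)" using g by simp
  qed measurable
  have 1: "integrable (M01 \<Otimes>\<^sub>M M01) (\<lambda>(x, y). f x * (hv x y * g y))"
    by (rule Bochner_Integration.integrable_bound[OF fg]) (measurable, auto simp: hv_def)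
  have 2: "integrable (M01 \<Otimes>\<^sub>M M01) (\<lambda>(x, y). g y * (hv y x * f x))"
    by (rule Bochner_Integration.integrable_bound[OF fg]) (measurable, auto simp: hv_def abs_mult mult.commute)
  have "(\<integral>x. f x \<partial>M01) * (\<integral>y. g y \<partial>M01) = (\<integral>x. (\<integral>y. f x * g y \<partial>M01) \<partial>M01)"
    using g by simp
  also have "\<dots> = (\<integral>x. (\<integral>y. f x * (hv x y * g y) \<partial>M01) + (\<integral>y. g y * (hv y x * f x) \<partial>M01) \<partial>M01)"
  proof (rule Bochner_Integration.integral_cong[OF refl])
    fix x
    have "(\<integral>y. f x * g y \<partial>M01) = (\<integral>y. f x * (hv x y * g y) + f x * (hv y x * g y) \<partial>M01)"
    proof (rule integral_cong_AE)
      show "AE y in M01. f x * g y = f x * (hv x y * g y) + f x * (hv y x * g y)"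
        using AE_M01_neq[of x] by eventually_elim (auto simp: hv_def)
      show "(\<lambda>y. f x * (hv x y * g y) + f x * (hv y x * g y)) \<in> borel_measurable M01"
        using Lebesgue_section[OF hv_borel] by (intro borel_measurable_add borel_measurable_times) auto
    qed measurable
    also have "\<dots> = (\<integral>y. f x * (hv x y * g y) \<partial>M01) + (\<integral>y. f x * (hv y x * g y) \<partial>M01)"
      using integrable_hv_mult[OF g, of x] by (intro Bochner_Integration.integral_add integrable_mult_right) auto
    finally show "(\<integral>y. f x * g y \<partial>M01) = (\<integral>y. f x * (hv x y * g y) \<partial>M01) + (\<integral>y. g y * (hv y x * f x) \<partial>M01)"
      by (simp add: mult.left_commute mult.commute)
  qed
  also have "\<dots> = (\<integral>x. (\<integral>y. f x * (hv x y * g y) \<partial>M01) \<partial>M01) + (\<integral>x. (\<integral>y. g y * (hv y x * f x) \<partial>M01) \<partial>M01)"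
    using M01_pair.integrable_fst'[OF 1] M01_pair.integrable_fst'[OF 2] by simp
  also have "(\<integral>x. (\<integral>y. g y * (hv y x * f x) \<partial>M01) \<partial>M01) = (\<integral>y. (\<integral>x. g y * (hv y x * f x) \<partial>M01) \<partial>M01)"
    using 2 by (intro M01_pair.Fubini_integral[symmetric]) simp
  finally show ?thesis by simp
qed

section \<open>Hilbert-Schmidt kernels\<close>

text \<open>Sections are required to be square integrable at every interior point and not merely
  almost everywhere: \<open>kernel_fun k f x\<close> is then an inner product at each x, and
  pointwise arguments about traces and absolute continuity can evaluate it there.\<close>

definition HS_kernel :: "(real \<Rightarrow> real \<Rightarrow> real) \<Rightarrow> bool" where
  "HS_kernel k \<longleftrightarrow> case_prod k \<in> borel_measurable (borel \<Otimes>\<^sub>M borel) \<and>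
     integrable (M01 \<Otimes>\<^sub>M M01) (\<lambda>(x, y). (k x y)\<^sup>2) \<and>
     (\<forall>x\<in>I01. k x \<in> L2 I01) \<and> (\<forall>y\<in>I01. (\<lambda>x. k x y) \<in> L2 I01)"

definition kernel_fun :: "(real \<Rightarrow> real \<Rightarrow> real) \<Rightarrow> (real \<Rightarrow> real) \<Rightarrow> real \<Rightarrow> real" where
  "kernel_fun k f x = (\<integral>y. k x y * f y \<partial>M01)"

definition kernel_op :: "(real \<Rightarrow> real \<Rightarrow> real) \<Rightarrow> l2 \<Rightarrow> l2" where
  "kernel_op k a = cl (kernel_fun k (rep a))"

lemma HS_kernel_transpose:
  assumes "HS_kernel k"
  shows "HS_kernel (\<lambda>x y. k y x)"
proof -
  have [measurable]: "case_prod k \<in> borel_measurable (borel \<Otimes>\<^sub>M borel)" using assms by (simp add: HS_kernel_def)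
  have "(\<lambda>(x, y). k y x) \<in> borel_measurable (borel \<Otimes>\<^sub>M borel)" by measurable
  moreover have "integrable (M01 \<Otimes>\<^sub>M M01) (\<lambda>(x, y). (k y x)\<^sup>2)"
    using M01_pair.integrable_product_swap[of "\<lambda>(x, y). (k x y)\<^sup>2"] assms by (simp add: HS_kernel_def)
  ultimately show ?thesis using assms by (simp add: HS_kernel_def)
qed

lemma kernel_fun_cong_AE:
  assumes "HS_kernel k" "x \<in> I01" "AE y in M01. f y = g y" "f \<in> borel_measurable M01" "g \<in> borel_measurable M01"
  shows "kernel_fun k f x = kernel_fun k g x"
  unfolding kernel_fun_def
proof (rule integral_cong_AE)
  have "k x \<in> borel_measurable M01" using assms(1,2) by (auto simp: HS_kernel_def)
  then show "(\<lambda>y. k x y * f y) \<in> borel_measurable M01" "(\<lambda>y. k x y * g y) \<in> borel_measurable M01"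
    using assms(4,5) by auto
  show "AE y in M01. k x y * f y = k x y * g y" using assms(3) by eventually_elim simp
qed

lemma kernel_fun_eq_inner:
  assumes "HS_kernel k" "x \<in> I01" "f \<in> L2 I01"
  shows "kernel_fun k f x = cl (k x) \<bullet> cl f"
  using assms by (simp add: kernel_fun_def HS_kernel_def inner_cl)

lemma kernel_fun_square_le:
  assumes k: "HS_kernel k" and x: "x \<in> I01"
  shows "(kernel_fun k (rep a) x)\<^sup>2 \<le> (\<integral>y. (k x y)\<^sup>2 \<partial>M01) * (norm a)\<^sup>2"
proof -
  have kx: "k x \<in> L2 I01" using k x by (simp add: HS_kernel_def)
  have "(kernel_fun k (rep a) x)\<^sup>2 = (cl (k x) \<bullet> a)\<^sup>2" using kernel_fun_eq_inner[OF k x rep_L2[of a]] by simp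
  also have "\<dots> \<le> (norm (cl (k x)) * norm a)\<^sup>2"
    by (rule abs_le_square_iff[THEN iffD1]) (simp add: Cauchy_Schwarz_ineq2)
  also have "\<dots> = (norm (cl (k x)))\<^sup>2 * (norm a)\<^sup>2" by (simp add: power_mult_distrib)
  also have "(norm (cl (k x)))\<^sup>2 = (\<integral>y. (k x y)\<^sup>2 \<partial>M01)"
    unfolding power2_norm_eq_inner using inner_cl[OF kx kx] by (simp add: power2_eq_square)
  finally show ?thesis .
qed

lemma kernel_fun_measurable:
  assumes "HS_kernel k" "f \<in> borel_measurable M01"
  shows "kernel_fun k f \<in> borel_measurable M01"
proof -
  have [measurable]: "case_prod k \<in> borel_measurable (M01 \<Otimes>\<^sub>M M01)"
    using assms(1) by (intro borel_pair_lebesgue_on) (simp add: HS_kernel_def)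
  note [measurable] = assms(2)
  have "(\<lambda>(x, y). k x y * f y) \<in> borel_measurable (M01 \<Otimes>\<^sub>M M01)" by measurable
  then have "(\<lambda>x. \<integral>y. k x y * f y \<partial>M01) \<in> borel_measurable M01"
    by (rule M01.borel_measurable_lebesgue_integral)
  then show ?thesis unfolding kernel_fun_def[abs_def] .
qed

lemma kernel_fun_L2:
  assumes k: "HS_kernel k"
  shows "kernel_fun k (rep a) \<in> L2 I01"
    and "(\<integral>x. (kernel_fun k (rep a) x)\<^sup>2 \<partial>M01) \<le> (\<integral>x. (\<integral>y. (k x y)\<^sup>2 \<partial>M01) \<partial>M01) * (norm a)\<^sup>2"
proof -
  have int: "integrable M01 (\<lambda>x. (\<integral>y. (k x y)\<^sup>2 \<partial>M01) * (norm a)\<^sup>2)"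
    using M01_pair.integrable_fst'[of "\<lambda>(x, y). (k x y)\<^sup>2"] k by (simp add: HS_kernel_def)
  have m: "kernel_fun k (rep a) \<in> borel_measurable M01"
    by (rule kernel_fun_measurable[OF k rep_measurable])
  have le: "AE x in M01. (kernel_fun k (rep a) x)\<^sup>2 \<le> (\<integral>y. (k x y)\<^sup>2 \<partial>M01) * (norm a)\<^sup>2"
    using kernel_fun_square_le[OF k] by (intro AE_I2) simp
  have i: "integrable M01 (\<lambda>x. (kernel_fun k (rep a) x)\<^sup>2)"
    by (rule Bochner_Integration.integrable_bound[OF int]) (use m le in auto)
  then show "kernel_fun k (rep a) \<in> L2 I01" using m by (simp add: L2_def)
  have "(\<integral>x. (kernel_fun k (rep a) x)\<^sup>2 \<partial>M01) \<le> (\<integral>x. (\<integral>y. (k x y)\<^sup>2 \<partial>M01) * (norm a)\<^sup>2 \<partial>M01)"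
    by (rule integral_mono_AE[OF i int le])
  then show "(\<integral>x. (kernel_fun k (rep a) x)\<^sup>2 \<partial>M01) \<le> (\<integral>x. (\<integral>y. (k x y)\<^sup>2 \<partial>M01) \<partial>M01) * (norm a)\<^sup>2"
    by simp
qed

lemma kernel_op_norm_le:
  assumes k: "HS_kernel k"
  shows "norm (kernel_op k a) \<le> sqrt (\<integral>x. (\<integral>y. (k x y)\<^sup>2 \<partial>M01) \<partial>M01) * norm a"
proof -
  have "norm (kernel_op k a) = sqrt (\<integral>x. (kernel_fun k (rep a) x)\<^sup>2 \<partial>M01)"
    by (simp add: kernel_op_def norm_cl kernel_fun_L2(1)[OF k] L2_nrm_def)
  also have "\<dots> \<le> sqrt ((\<integral>x. (\<integral>y. (k x y)\<^sup>2 \<partial>M01) \<partial>M01) * (norm a)\<^sup>2)"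
    by (intro real_sqrt_le_mono kernel_fun_L2(2)[OF k])
  finally show ?thesis by (simp add: real_sqrt_mult)
qed

text \<open>Fubini; the integrand b k a is dominated by k^2 + b^2 a^2, where the first term is
  integrable by the Hilbert-Schmidt condition and the second is a product of integrable functions of
  one variable.\<close>

lemma kernel_op_adjoint:
  assumes k: "HS_kernel k"
  shows "kernel_op k a \<bullet> b = a \<bullet> kernel_op (\<lambda>x y. k y x) b"
proof -
  have kT: "HS_kernel (\<lambda>x y. k y x)" by (rule HS_kernel_transpose[OF k])
  have [measurable]: "case_prod k \<in> borel_measurable (M01 \<Otimes>\<^sub>M M01)"
    using k by (intro borel_pair_lebesgue_on) (simp add: HS_kernel_def)
  have k2: "integrable (M01 \<Otimes>\<^sub>M M01) (\<lambda>(x, y). (k x y)\<^sup>2)" using k by (simp add: HS_kernel_def)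
  have sq: "integrable M01 (\<lambda>x. (rep a x)\<^sup>2)" for a using rep_L2[of a] by (simp add: L2_def)
  have ab: "integrable (M01 \<Otimes>\<^sub>M M01) (\<lambda>(x, y). (rep b x)\<^sup>2 * (rep a y)\<^sup>2)"
  proof (rule M01_pair.Fubini_integrable)
    show "integrable M01 (\<lambda>x. \<integral>y. norm (case (x, y) of (x, y) \<Rightarrow> (rep b x)\<^sup>2 * (rep a y)\<^sup>2) \<partial>M01)"
      using sq[of b] by (simp add: abs_mult)
    show "AE x in M01. integrable M01 (\<lambda>y. case (x, y) of (x, y) \<Rightarrow> (rep b x)\<^sup>2 * (rep a y)\<^sup>2)"
      using sq[of a] by simp
  qed measurable
  have i: "integrable (M01 \<Otimes>\<^sub>M M01) (\<lambda>(x, y). rep b x * (k x y * rep a y))"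
  proof (rule Bochner_Integration.integrable_bound[OF Bochner_Integration.integrable_add[OF k2 ab]])
    have "\<bar>b * (k * a)\<bar> \<le> k\<^sup>2 + b\<^sup>2 * a\<^sup>2" for a b k :: real
    proof -
      have "2 * \<bar>k * (b * a)\<bar> \<le> k\<^sup>2 + (b * a)\<^sup>2"
        using zero_le_power2[of "\<bar>k\<bar> - \<bar>b * a\<bar>"] by (simp add: power2_diff abs_mult[of k "b * a"])
      then have "\<bar>k * (b * a)\<bar> \<le> k\<^sup>2 + (b * a)\<^sup>2" using abs_ge_zero[of "k * (b * a)"] by linarith
      then show ?thesis by (simp add: power_mult_distrib mult.left_commute)
    qed
    then show "AE z in M01 \<Otimes>\<^sub>M M01. norm (case z of (x, y) \<Rightarrow> rep b x * (k x y * rep a y))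
        \<le> norm ((case z of (x, y) \<Rightarrow> (k x y)\<^sup>2) + (case z of (x, y) \<Rightarrow> (rep b x)\<^sup>2 * (rep a y)\<^sup>2))"
      by (intro AE_I2) (auto split: prod.split)
  qed measurable
  have "kernel_op k a \<bullet> b = (\<integral>x. kernel_fun k (rep a) x * rep b x \<partial>M01)"
    using inner_cl[OF kernel_fun_L2(1)[OF k, of a] rep_L2[of b]] by (simp add: kernel_op_def)
  also have "\<dots> = (\<integral>x. (\<integral>y. rep b x * (k x y * rep a y) \<partial>M01) \<partial>M01)"
    by (simp add: kernel_fun_def mult.commute)
  also have "\<dots> = (\<integral>y. (\<integral>x. rep b x * (k x y * rep a y) \<partial>M01) \<partial>M01)"
    using i by (intro M01_pair.Fubini_integral[symmetric]) simp
  also have "\<dots> = (\<integral>y. rep a y * kernel_fun (\<lambda>x y. k y x) (rep b) y \<partial>M01)"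
  proof (rule Bochner_Integration.integral_cong[OF refl])
    fix y
    have "(\<integral>x. rep b x * (k x y * rep a y) \<partial>M01) = (\<integral>x. (k x y * rep b x) * rep a y \<partial>M01)"
      by (simp add: ac_simps)
    then show "(\<integral>x. rep b x * (k x y * rep a y) \<partial>M01) = rep a y * kernel_fun (\<lambda>x y. k y x) (rep b) y"
      by (simp add: kernel_fun_def mult.commute)
  qed
  also have "\<dots> = a \<bullet> kernel_op (\<lambda>x y. k y x) b"
    using inner_cl[OF rep_L2[of a] kernel_fun_L2(1)[OF kT, of b]] by (simp add: kernel_op_def)
  finally show ?thesis .
qed

text \<open>Linearity is read off from the adjoint identity by testing with an arbitrary c, which
  settles the choice of representatives hidden in \<open>rep\<close>.\<close>

lemma bounded_linear_kernel_op:
  assumes k: "HS_kernel k"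
  shows "bounded_linear (kernel_op k)"
proof (rule bounded_linear_intro)
  have eqI: "x = y" if "\<And>c. x \<bullet> c = y \<bullet> c" for x y :: l2
  proof -
    have "(x - y) \<bullet> (x - y) = 0" using that[of "x - y"] by (simp only: inner_diff_left diff_self)
    then show ?thesis by simp
  qed
  show "kernel_op k (a + b) = kernel_op k a + kernel_op k b" for a b
    by (rule eqI) (simp add: kernel_op_adjoint[OF k] inner_add_left)
  show "kernel_op k (r *\<^sub>R a) = r *\<^sub>R kernel_op k a" for r a
    by (rule eqI) (simp add: kernel_op_adjoint[OF k])
  show "norm (kernel_op k a) \<le> norm a * sqrt (\<integral>x. (\<integral>y. (k x y)\<^sup>2 \<partial>M01) \<partial>M01)" for a
    using kernel_op_norm_le[OF k] by (simp add: mult.commute)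
qed

lemma weighted_Fubini:
  fixes \<kappa> :: "real \<Rightarrow> real \<Rightarrow> real"
  assumes \<kappa>: "case_prod \<kappa> \<in> borel_measurable (borel \<Otimes>\<^sub>M borel)" "\<And>x y. 0 \<le> \<kappa> x y"
    and int: "\<And>y. y \<in> I01 \<Longrightarrow> integrable M01 (\<lambda>x. \<kappa> x y)"
    and h: "h \<in> borel_measurable M01" "integrable M01 (\<lambda>y. (\<integral>x. \<kappa> x y \<partial>M01) * \<bar>h y\<bar>)"
  shows "(\<integral>x. (\<integral>y. \<kappa> x y * h y \<partial>M01) \<partial>M01) = (\<integral>y. (\<integral>x. \<kappa> x y \<partial>M01) * h y \<partial>M01)"
proof -
  have "(\<lambda>(x, y). \<kappa> y x) \<in> borel_measurable (borel \<Otimes>\<^sub>M borel)"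
    using \<kappa>(1) by measurable
  then have [measurable]: "(\<lambda>(x, y). \<kappa> y x) \<in> borel_measurable (M01 \<Otimes>\<^sub>M M01)" by (rule borel_pair_lebesgue_on)
  note [measurable] = h(1)
  have i: "integrable (M01 \<Otimes>\<^sub>M M01) (\<lambda>(y, x). \<kappa> x y * h y)"
  proof (rule M01_pair.Fubini_integrable)
    show "integrable M01 (\<lambda>y. \<integral>x. norm (case (y, x) of (y, x) \<Rightarrow> \<kappa> x y * h y) \<partial>M01)"
      using h(2) \<kappa>(2) by (simp add: abs_mult)
    show "AE y in M01. integrable M01 (\<lambda>x. case (y, x) of (y, x) \<Rightarrow> \<kappa> x y * h y)"
      using int by (intro AE_I2) simp
  qed measurable
  have "(\<integral>x. (\<integral>y. \<kappa> x y * h y \<partial>M01) \<partial>M01) = (\<integral>y. (\<integral>x. \<kappa> x y * h y \<partial>M01) \<partial>M01)"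
    using i by (intro M01_pair.Fubini_integral) simp
  then show ?thesis by simp
qed

text \<open>For f = g both triangles contribute equally. With F(x) the integral of f over (x,1),
  this is the integrated form of (F^2)' = 2 F F'.\<close>

lemma integral_square_eq_tail:
  assumes "integrable M01 f"
  shows "(\<integral>x. f x \<partial>M01)\<^sup>2 = 2 * (\<integral>x. f x * (\<integral>y. hv x y * f y \<partial>M01) \<partial>M01)"
  using integral_mult_integral_eq[OF assms assms] by (simp add: power2_eq_square)

lemma tail_integral_square:
  assumes f: "integrable M01 (\<lambda>y. hv x y * f y)"
  shows "(\<integral>y. hv x y * f y \<partial>M01)\<^sup>2 = 2 * (\<integral>y. hv x y * (f y * (\<integral>z. hv y z * f z \<partial>M01)) \<partial>M01)"
proof -
  have eq: "(hv x y * f y) * (\<integral>z. hv y z * (hv x z * f z) \<partial>M01) = hv x y * (f y * (\<integral>z. hv y z * f z \<partial>M01))" for y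
  proof (cases "x < y")
    case True
    then have "(\<integral>z. hv y z * (hv x z * f z) \<partial>M01) = (\<integral>z. hv y z * f z \<partial>M01)"
      by (intro Bochner_Integration.integral_cong) (auto simp: hv_def)
    then show ?thesis by (simp add: mult.assoc)
  qed (simp add: hv_def)
  show ?thesis unfolding integral_square_eq_tail[OF f] eq ..
qed

lemma integral_split_at:
  assumes f: "integrable M01 f"
  shows "(\<integral>x. f x \<partial>M01) = (\<integral>x. hv x y * f x \<partial>M01) + (\<integral>x. hv y x * f x \<partial>M01)"
proof -
  have "(\<integral>x. f x \<partial>M01) = (\<integral>x. hv x y * f x + hv y x * f x \<partial>M01)"
  proof (rule integral_cong_AE)
    show "AE x in M01. f x = hv x y * f x + hv y x * f x"
      using AE_M01_neq[of y] by eventually_elim (auto simp: hv_def)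
  qed (use f integrable_hv_mult[OF f, of y] in \<open>auto intro!: borel_measurable_add\<close>)
  then show ?thesis using integrable_hv_mult[OF f, of y] by simp
qed

lemma integrable_rep: "integrable M01 (rep a)"
  using L2_mult_integrable[OF rep_L2[of a] one_L2] by simp

section \<open>The inverse operator in factored form\<close>

locale degenerate_wave =
  fixes \<alpha> :: real
  assumes alpha_pos: "0 < \<alpha>" and alpha_less: "\<alpha> < 2"
begin

text \<open>The integral of -y^(-\<alpha>/2) z(y) over (x,1) is the function u with x^(\<alpha>/2)
  u_x = z and u(1) = 0; this is its kernel.\<close>

definition wker :: "real \<Rightarrow> real \<Rightarrow> real" where
  "wker x y = hv x y * - (y powr (- \<alpha> / 2))"

lemma wker_borel: "case_prod wker \<in> borel_measurable (borel \<Otimes>\<^sub>M borel)"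
  unfolding wker_def by measurable

lemma powr_half_square: "0 < y \<Longrightarrow> (y powr (- \<alpha> / 2))\<^sup>2 = y powr (- \<alpha>)"
  by (simp add: power2_eq_square powr_add[symmetric])

lemma integral_hv_left:
  assumes "y \<in> I01"
  shows "(\<integral>x. hv x y \<partial>M01) = y"
proof -
  have "(\<integral>x. hv x y \<partial>M01) = (\<integral>x. hv x y * x powr 0 \<partial>M01)"
    by (intro Bochner_Integration.integral_cong) auto
  also have "\<dots> = y" using integral_powr_head[of 0 y] assms by simp
  finally show ?thesis .
qed

lemma integrable_hv: "integrable M01 (\<lambda>x. hv x y)" "integrable M01 (\<lambda>x. hv y x)"
  using integrable_hv_mult[of "\<lambda>x. 1"] by simp_all

text \<open>Integrating the squared kernel in x first gives y^(1 - \<alpha>), which is integrable on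
  (0,1) because \<alpha> < 2. For fixed x the section is bounded by x^(-\<alpha>/2), for fixed y by
  y^(-\<alpha>/2).\<close>

lemma HS_wker: "HS_kernel wker"
  unfolding HS_kernel_def
proof (intro conjI ballI)
  show "case_prod wker \<in> borel_measurable (borel \<Otimes>\<^sub>M borel)" by (rule wker_borel)
  have "(\<lambda>(y, x). wker x y) \<in> borel_measurable (borel \<Otimes>\<^sub>M borel)" using wker_borel by measurable
  then have [measurable]: "(\<lambda>(y, x). wker x y) \<in> borel_measurable (M01 \<Otimes>\<^sub>M M01)"
    by (rule borel_pair_lebesgue_on)
  have sq: "(wker x y)\<^sup>2 = hv x y * y powr (- \<alpha>)" if "y \<in> I01" for x y
    using that powr_half_square[of y] by (auto simp: wker_def hv_def)
  have "integrable (M01 \<Otimes>\<^sub>M M01) (\<lambda>(y, x). (wker x y)\<^sup>2)"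
  proof (rule M01_pair.Fubini_integrable)
    have "integrable M01 (\<lambda>y. y powr (1 - \<alpha>))" using alpha_less by (intro integrable_powr_M01) simp
    moreover have "(\<integral>x. norm ((wker x y)\<^sup>2) \<partial>M01) = y powr (1 - \<alpha>)" if "y \<in> I01" for y
    proof -
      have "(\<integral>x. norm ((wker x y)\<^sup>2) \<partial>M01) = y powr (- \<alpha>) * (\<integral>x. hv x y \<partial>M01)"
        using sq[OF that] by (simp add: mult.commute)
      also have "\<dots> = y powr (1 - \<alpha>)"
        using that integral_hv_left[OF that] by (simp add: powr_diff powr_minus_divide)
      finally show ?thesis .
    qed
    ultimately show "integrable M01 (\<lambda>y. \<integral>x. norm (case (y, x) of (y, x) \<Rightarrow> (wker x y)\<^sup>2) \<partial>M01)"
      by (subst Bochner_Integration.integrable_cong[where g="\<lambda>y. y powr (1 - \<alpha>)"]) auto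
    show "AE y in M01. integrable M01 (\<lambda>x. case (y, x) of (y, x) \<Rightarrow> (wker x y)\<^sup>2)"
    proof (rule AE_I2)
      fix y assume "y \<in> space M01"
      then have "y \<in> I01" by simp
      then show "integrable M01 (\<lambda>x. case (y, x) of (y, x) \<Rightarrow> (wker x y)\<^sup>2)"
        using integrable_hv by (simp add: sq)
    qed
  qed measurable
  then show "integrable (M01 \<Otimes>\<^sub>M M01) (\<lambda>(x, y). (wker x y)\<^sup>2)"
    using M01_pair.integrable_product_swap[of "\<lambda>(y, x). (wker x y)\<^sup>2"] by simp
  fix x assume x: "x \<in> I01"
  show "wker x \<in> L2 I01"
  proof (rule L2_bounded[OF L2_cmult[OF one_L2, of "x powr (- \<alpha> / 2)"]])
    show "wker x \<in> borel_measurable M01" using Lebesgue_section(1)[OF wker_borel, of x] by simp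
    show "AE y in M01. \<bar>wker x y\<bar> \<le> \<bar>x powr (- \<alpha> / 2) * 1\<bar>"
      using x alpha_pos by (intro AE_I2) (auto simp: wker_def hv_def intro!: powr_mono2')
  qed
next
  fix y assume y: "y \<in> I01"
  show "(\<lambda>x. wker x y) \<in> L2 I01"
  proof (rule L2_bounded[OF L2_cmult[OF one_L2, of "y powr (- \<alpha> / 2)"]])
    show "(\<lambda>x. wker x y) \<in> borel_measurable M01" by (rule Lebesgue_section(2)[OF wker_borel])
    show "AE x in M01. \<bar>wker x y\<bar> \<le> \<bar>y powr (- \<alpha> / 2) * 1\<bar>"
      by (intro AE_I2) (auto simp: wker_def hv_def)
  qed
qed

text \<open>\<open>R\<close> inverts \<open>x powr (\<alpha> / 2) * d/dx\<close> with zero value at \<open>1\<close>.  For \<open>\<alpha> < 1\<close> the condition \<open>u 0 = 0\<close> on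
  \<open>u = R z\<close> says that \<open>z\<close> is orthogonal to \<open>mvec\<close>, so \<open>H1 \<alpha>\<close> is the image under \<open>R\<close> of the range of the projection \<open>Pi\<close>
  (for \<open>1 \<le> \<alpha>\<close>, \<open>mvec = 0\<close> and \<open>x / 0 = 0\<close> make \<open>Pi\<close> the identity).  \<open>Kop\<close> is the inverse of
  \<open>A u = - (x\<^sup>\<alpha> u\<^sub>x)\<^sub>x\<close>, and for \<open>u = Kop q\<close> one has \<open>x powr (\<alpha> / 2) * u\<^sub>x = S q\<close>, \<open>x u\<^sub>x = Mx (S q)\<close>
  and \<open>u\<^sub>x(1) = tau q\<close>.\<close>

definition R :: "l2 \<Rightarrow> l2" where "R = kernel_op wker"
definition Rst :: "l2 \<Rightarrow> l2" where "Rst = kernel_op (\<lambda>x y. wker y x)"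
definition mvec :: l2 where "mvec = (if \<alpha> < 1 then cl (\<lambda>y. y powr (- \<alpha> / 2)) else 0)"
definition Pi :: "l2 \<Rightarrow> l2" where "Pi a = a - ((a \<bullet> mvec) / (mvec \<bullet> mvec)) *\<^sub>R mvec"
definition S :: "l2 \<Rightarrow> l2" where "S q = Pi (Rst q)"
definition Kop :: "l2 \<Rightarrow> l2" where "Kop q = R (S q)"
definition Mx :: "l2 \<Rightarrow> l2" where "Mx a = cl (\<lambda>x. x powr (1 - \<alpha> / 2) * rep a x)"
definition tau :: "l2 \<Rightarrow> real" where
  "tau q = - ((Rst q \<bullet> mvec) / (mvec \<bullet> mvec)) - q \<bullet> cl (\<lambda>x. 1)"

lemma bounded_linear_R: "bounded_linear R"
  unfolding R_def by (rule bounded_linear_kernel_op[OF HS_wker])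

lemma bounded_linear_Rst: "bounded_linear Rst"
  unfolding Rst_def by (rule bounded_linear_kernel_op[OF HS_kernel_transpose[OF HS_wker]])

lemma R_adjoint: "R a \<bullet> b = a \<bullet> Rst b"
  unfolding R_def Rst_def by (rule kernel_op_adjoint[OF HS_wker])

lemma bounded_linear_Pi: "bounded_linear Pi"
  unfolding Pi_def[abs_def]
  by (intro bounded_linear_sub bounded_linear_ident
      bounded_linear_compose[OF bounded_linear_scaleR_left]
      bounded_linear_compose[OF bounded_linear_divide] bounded_linear_inner_left)

lemma Pi_adjoint: "Pi a \<bullet> b = a \<bullet> Pi b"
  by (simp add: Pi_def inner_diff_left inner_diff_right inner_commute)

lemma Pi_idem: "Pi (Pi a) = Pi a"
proof (cases "mvec = 0")
  case False
  then have "Pi a \<bullet> mvec = 0" by (simp add: Pi_def inner_diff_left)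
  then show ?thesis by (simp add: Pi_def[of "Pi a"])
qed (simp add: Pi_def)

lemma bounded_linear_S: "bounded_linear S"
  unfolding S_def[abs_def] by (rule bounded_linear_compose[OF bounded_linear_Pi bounded_linear_Rst])

lemma bounded_linear_Kop: "bounded_linear Kop"
  unfolding Kop_def[abs_def] by (rule bounded_linear_compose[OF bounded_linear_R bounded_linear_S])

lemma Pi_S: "Pi (S q) = S q" by (simp add: S_def Pi_idem)

text \<open>\<open>Kop\<close> is \<open>R\<close> after \<open>Pi\<close> after \<open>Rst\<close>,
  with \<open>Rst\<close> adjoint to \<open>R\<close> and \<open>Pi\<close> an orthogonal
  projection; hence it is symmetric and nonnegative, and the form of the inverse is carried by
  \<open>S\<close>.\<close>

lemma Kop_inner: "Kop a \<bullet> b = S a \<bullet> S b"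
proof -
  have "Kop a \<bullet> b = Pi (S a) \<bullet> Rst b" by (simp add: Kop_def R_adjoint Pi_S)
  then show ?thesis by (simp add: Pi_adjoint S_def)
qed

lemma Kop_adjoint: "Kop a \<bullet> b = a \<bullet> Kop b"
  by (metis Kop_inner inner_commute)

lemma bounded_linear_tau: "bounded_linear tau"
  unfolding tau_def[abs_def]
  by (intro bounded_linear_sub bounded_linear_minus bounded_linear_compose[OF bounded_linear_divide]
      bounded_linear_compose[OF bounded_linear_inner_left bounded_linear_Rst] bounded_linear_inner_left)

lemma powr_weight_L2:
  assumes "f \<in> L2 I01"
  shows "(\<lambda>x. x powr (1 - \<alpha> / 2) * f x) \<in> L2 I01"
proof (rule L2_bounded[OF assms])
  have "(\<lambda>x::real. x powr (1 - \<alpha> / 2)) \<in> borel_measurable M01"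
    by (rule borel_measurable_lebesgue_onI) measurable
  then show "(\<lambda>x. x powr (1 - \<alpha> / 2) * f x) \<in> borel_measurable M01" using assms by auto
  show "AE x in M01. \<bar>x powr (1 - \<alpha> / 2) * f x\<bar> \<le> \<bar>f x\<bar>"
  proof (rule AE_I2)
    fix x assume "x \<in> space M01"
    then have "x powr (1 - \<alpha> / 2) \<le> 1 powr (1 - \<alpha> / 2)"
      using alpha_less by (intro powr_mono2) auto
    then show "\<bar>x powr (1 - \<alpha> / 2) * f x\<bar> \<le> \<bar>f x\<bar>"
      by (simp add: abs_mult mult_left_le_one_le)
  qed
qed

lemma rep_Mx: "AE x in M01. rep (Mx a) x = x powr (1 - \<alpha> / 2) * rep a x"
  unfolding Mx_def by (intro rep_cl powr_weight_L2 rep_L2)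

lemma rep_R: "AE x in M01. rep (R z) x = kernel_fun wker (rep z) x"
  unfolding R_def kernel_op_def by (intro rep_cl kernel_fun_L2(1) HS_wker)

lemma Mx_norm_le: "norm (Mx a) \<le> norm a"
proof (rule power2_le_imp_le)
  show "(norm (Mx a))\<^sup>2 \<le> (norm a)\<^sup>2"
    unfolding norm_l2_power2
  proof (rule integral_mono_AE)
    show "AE x in M01. (rep (Mx a) x)\<^sup>2 \<le> (rep a x)\<^sup>2"
      using rep_Mx[of a] AE_space
    proof eventually_elim
      case (elim x)
      then have "x powr (1 - \<alpha> / 2) \<le> 1 powr (1 - \<alpha> / 2)"
        using alpha_less by (intro powr_mono2) auto
      then have "\<bar>rep (Mx a) x\<bar> \<le> \<bar>rep a x\<bar>"
        using elim by (simp add: abs_mult mult_left_le_one_le)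
      then show ?case by (simp add: abs_le_square_iff)
    qed
  qed (use rep_L2 in \<open>auto simp: L2_def\<close>)
qed simp

lemma bounded_linear_Mx: "bounded_linear Mx"
proof (rule bounded_linear_intro[where K=1])
  show "Mx (a + b) = Mx a + Mx b" for a b
    by (rule l2_eqI)
      (use rep_Mx[of "a + b"] rep_Mx[of a] rep_Mx[of b] rep_plus[of a b] rep_plus[of "Mx a" "Mx b"] in eventually_elim,
        simp add: algebra_simps)
  show "Mx (r *\<^sub>R a) = r *\<^sub>R Mx a" for r a
    by (rule l2_eqI)
      (use rep_Mx[of "r *\<^sub>R a"] rep_Mx[of a] rep_scaleR[of r a] rep_scaleR[of r "Mx a"] in eventually_elim, simp)
qed (simp add: Mx_norm_le)

lemma kernel_fun_wker: "kernel_fun wker f x = - (\<integral>y. hv x y * (y powr (- \<alpha> / 2) * f y) \<partial>M01)"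
  by (simp add: kernel_fun_def wker_def mult.assoc)

text \<open>With w = R z, the weighted factor is x w_x, so the left side is the integral of x w w_x,
  that is, of x (w^2)_x / 2, without boundary terms. Here w^2 is written as a tail integral of -2 w
  w_x, and Fubini produces the factor x as the length of (0, x).\<close>

lemma R_inner_Mx: "R z \<bullet> Mx z = - (norm (R z))\<^sup>2 / 2"
proof -
  define f where "f = (\<lambda>y. y powr (- \<alpha> / 2) * rep z y)"
  define w where "w = kernel_fun wker (rep z)"
  have wL: "w \<in> L2 I01" unfolding w_def by (rule kernel_fun_L2(1)[OF HS_wker])
  have [measurable]: "(\<lambda>x::real. x powr c) \<in> borel_measurable M01" for c
    by (rule borel_measurable_lebesgue_onI) measurable
  have fm[measurable]: "f \<in> borel_measurable M01" unfolding f_def by measurable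
  have wm[measurable]: "w \<in> borel_measurable M01" using wL by auto
  have w_eq: "w x = - (\<integral>y. hv x y * f y \<partial>M01)" for x
    by (simp add: w_def f_def kernel_fun_wker)
  have yf: "y * f y = y powr (1 - \<alpha> / 2) * rep z y" if "y \<in> I01" for y
    using that by (simp add: f_def powr_diff powr_minus_divide)
  have yfw: "integrable M01 (\<lambda>y. y * (f y * w y))"
  proof -
    have "integrable M01 (\<lambda>y. (y powr (1 - \<alpha> / 2) * rep z y) * w y)"
      by (intro L2_mult_integrable powr_weight_L2 rep_L2 wL)
    then show ?thesis
      by (subst Bochner_Integration.integrable_cong[OF refl, where g="\<lambda>y. (y powr (1 - \<alpha> / 2) * rep z y) * w y"])
        (auto simp: yf[symmetric])
  qed
  have sq: "(w x)\<^sup>2 = -2 * (\<integral>y. hv x y * (f y * w y) \<partial>M01)" if x: "x \<in> I01" for x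
  proof -
    have "integrable M01 (\<lambda>y. wker x y * rep z y)"
      using HS_wker x by (intro L2_mult_integrable rep_L2) (simp add: HS_kernel_def)
    then have "integrable M01 (\<lambda>y. - (wker x y * rep z y))" by simp
    then have "integrable M01 (\<lambda>y. hv x y * f y)" by (simp add: wker_def f_def mult.assoc)
    from tail_integral_square[OF this] show ?thesis by (simp add: w_eq)
  qed
  have "(norm (R z))\<^sup>2 = (\<integral>x. (w x)\<^sup>2 \<partial>M01)"
    unfolding norm_l2_power2
    by (rule integral_cong_AE) (use rep_R[of z] in \<open>auto simp: w_def[symmetric] elim: eventually_mono\<close>)
  also have "\<dots> = (\<integral>x. -2 * (\<integral>y. hv x y * (f y * w y) \<partial>M01) \<partial>M01)"
    by (rule Bochner_Integration.integral_cong) (simp_all add: sq)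
  also have "\<dots> = -2 * (\<integral>x. (\<integral>y. hv x y * (f y * w y) \<partial>M01) \<partial>M01)" by simp
  also have "(\<integral>x. (\<integral>y. hv x y * (f y * w y) \<partial>M01) \<partial>M01) = (\<integral>y. (\<integral>x. hv x y \<partial>M01) * (f y * w y) \<partial>M01)"
  proof (rule weighted_Fubini[OF hv_borel])
    have "integrable M01 (\<lambda>y. \<bar>y * (f y * w y)\<bar>)" using yfw by simp
    then show "integrable M01 (\<lambda>y. (\<integral>x. hv x y \<partial>M01) * \<bar>f y * w y\<bar>)"
      by (subst Bochner_Integration.integrable_cong[OF refl, where g="\<lambda>y. \<bar>y * (f y * w y)\<bar>"])
        (auto simp: integral_hv_left abs_mult)
  qed (use integrable_hv in auto)
  also have "\<dots> = (\<integral>y. (y powr (1 - \<alpha> / 2) * rep z y) * w y \<partial>M01)"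
    by (rule Bochner_Integration.integral_cong) (auto simp: integral_hv_left yf[symmetric])
  also have "\<dots> = Mx z \<bullet> R z"
    by (rule inner_eq_integral_AE[symmetric]) (use rep_Mx[of z] rep_R[of z] in \<open>auto simp: w_def[symmetric]\<close>)
  finally show ?thesis by (simp add: inner_commute)
qed

end

lemma AE_eq_imp_eq_on_I01:
  fixes f g :: "real \<Rightarrow> real"
  assumes "continuous_on I01 f" "continuous_on I01 g" "AE x in M01. f x = g x" "x \<in> I01"
  shows "f x = g x"
proof (rule ccontr)
  assume ne: "f x \<noteq> g x"
  have "continuous_on I01 (\<lambda>y. f y - g y)" using assms by (intro continuous_intros)
  then obtain d where d: "d > 0" "\<And>y. y \<in> I01 \<Longrightarrow> dist y x < d \<Longrightarrow> dist (f y - g y) (f x - g x) < \<bar>f x - g x\<bar>"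
    using assms(4) ne unfolding continuous_on_iff by (metis zero_less_abs_iff right_minus_eq)
  define r where "r = min d (1 - x)"
  have r: "r > 0" using d assms(4) by (simp add: r_def)
  have sub: "{x<..<x + r} \<subseteq> I01" using assms(4) by (auto simp: r_def)
  have "f y \<noteq> g y" if "y \<in> {x<..<x + r}" for y
  proof -
    have "y \<in> I01" using that sub by blast
    moreover have "dist y x < d" using that by (auto simp: dist_real_def r_def)
    ultimately show ?thesis
      using d(2)[of y] abs_minus_commute[of "f x" "g x"] by (auto simp: dist_real_def)
  qed
  with assms(3) have "AE y in M01. y \<notin> {x<..<x + r}" by (auto elim: eventually_mono)
  then have "{x<..<x + r} \<in> null_sets M01"
    using sub by (subst AE_iff_null_sets) (auto simp: sets_restrict_space_iff)
  then have "emeasure lebesgue {x<..<x + r} = 0"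
    using sub by (simp add: null_sets_def emeasure_restrict_space)
  then show False using r by simp
qed

lemma AE_M01_of_negligible:
  assumes "negligible N"
  shows "AE x in M01. x \<notin> N"
proof -
  have "AE x in lebesgue. x \<notin> N"
    using assms by (intro AE_not_in) (simp add: negligible_iff_null_sets)
  then show ?thesis by (subst AE_restrict_space_iff) (auto elim: eventually_mono)
qed

lemma abs_cont_on_of_eq_integral:
  assumes "f absolutely_integrable_on {a..b}" "\<And>x. x \<in> {a..b} \<Longrightarrow> u x = C + integral {a..x} f"
  shows "abs_cont_on a b u"
proof (rule abs_cont_on_cong)
  have "abs_cont_on a b (\<lambda>x. - C)" by (auto simp: abs_cont_on_iff case_prod_beta intro: exI[of _ 1])
  then show "abs_cont_on a b (\<lambda>x. integral {a..x} f - (- C))"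
    by (intro abs_cont_on_diff abs_cont_on_integral assms)
qed (use assms(2) in simp)

section \<open>The flux of \<open>Kop q\<close> and the multiplier identity\<close>

context degenerate_wave
begin

text \<open>\<open>pf q\<close> is the flux \<open>x\<^sup>\<alpha> u\<^sub>x\<close> of \<open>u = Kop q\<close>.\<close>

definition cc :: "l2 \<Rightarrow> real" where "cc q = - ((Rst q \<bullet> mvec) / (mvec \<bullet> mvec))"

definition pf :: "l2 \<Rightarrow> real \<Rightarrow> real" where
  "pf q y = cc q - (\<integral>x. hv x y * rep q x \<partial>M01)"

lemma tau_eq_pf: "tau q = pf q 1"
proof -
  have "(\<integral>x. hv x 1 * rep q x \<partial>M01) = (\<integral>x. rep q x * 1 \<partial>M01)"
    by (rule Bochner_Integration.integral_cong) (auto simp: hv_def)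
  also have "\<dots> = q \<bullet> cl (\<lambda>x. 1)" using inner_cl[OF rep_L2[of q] one_L2] by simp
  finally show ?thesis by (simp add: tau_def pf_def cc_def)
qed

lemma powr_measurable [measurable]: "(\<lambda>x::real. x powr c) \<in> borel_measurable M01"
  by (rule borel_measurable_lebesgue_onI) measurable

lemma powr_half_square': "0 < y \<Longrightarrow> (y powr - (\<alpha> / 2))\<^sup>2 = y powr - \<alpha>"
  using powr_half_square[of y] by simp

lemma powr_half_L2:
  assumes "\<alpha> < 1"
  shows "(\<lambda>y. y powr (- \<alpha> / 2)) \<in> L2 I01"
proof -
  have "integrable M01 (\<lambda>y. (y powr (- \<alpha> / 2))\<^sup>2)"
    using integrable_powr_M01[of "- \<alpha>"] assms
    by (subst Bochner_Integration.integrable_cong[OF refl, where g="\<lambda>y. y powr - \<alpha>"]) (auto simp: powr_half_square')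
  then show ?thesis by (simp add: L2_def)
qed

lemma rep_mvec: "\<alpha> < 1 \<Longrightarrow> AE y in M01. rep mvec y = y powr (- \<alpha> / 2)"
  using powr_half_L2 rep_cl by (simp add: mvec_def)

text \<open>\<open>cc q\<close> is the value of the flux at 0. For \<alpha> \<ge> 1 the vector
  \<open>mvec\<close> is 0 and 0 / 0 = 0, so the formula encodes the boundary condition that
  x^\<alpha> u_x vanishes at 0.\<close>

lemma cc_eq_0: "1 \<le> \<alpha> \<Longrightarrow> cc q = 0"
  by (simp add: cc_def mvec_def)

lemma rep_S: "AE y in M01. rep (S q) y = y powr (- \<alpha> / 2) * pf q y"
proof -
  have 1: "AE y in M01. rep (Rst q) y = y powr (- \<alpha> / 2) * - (\<integral>x. hv x y * rep q x \<partial>M01)"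
  proof -
    have "kernel_fun (\<lambda>x y. wker y x) (rep q) y = y powr (- \<alpha> / 2) * - (\<integral>x. hv x y * rep q x \<partial>M01)" for y
    proof -
      have "kernel_fun (\<lambda>x y. wker y x) (rep q) y = (\<integral>x. - (y powr (- \<alpha> / 2)) * (hv x y * rep q x) \<partial>M01)"
        by (simp add: kernel_fun_def wker_def mult.assoc mult.left_commute)
      then show ?thesis by simp
    qed
    then show ?thesis
      unfolding Rst_def kernel_op_def
      using rep_cl[OF kernel_fun_L2(1)[OF HS_kernel_transpose[OF HS_wker], of q]] by simp
  qed
  have 2: "AE y in M01. rep (S q) y = rep (Rst q) y - rep ((- cc q) *\<^sub>R mvec) y"
    unfolding S_def Pi_def cc_def using rep_minus[of "Rst q"] by simp
  have 3: "AE y in M01. rep ((- cc q) *\<^sub>R mvec) y = - cc q * y powr (- \<alpha> / 2)"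
  proof (cases "\<alpha> < 1")
    case True
    show ?thesis using rep_mvec[OF True] rep_scaleR[of "- cc q" mvec] by eventually_elim simp
  next
    case False
    then show ?thesis using rep_zero cc_eq_0[of q] by simp
  qed
  show ?thesis
    using 1 2 3 by eventually_elim (simp add: pf_def algebra_simps)
qed

lemma pf_bounded: "\<bar>pf q y\<bar> \<le> \<bar>cc q\<bar> + (\<integral>x. \<bar>rep q x\<bar> \<partial>M01)"
proof -
  have "\<bar>\<integral>x. hv x y * rep q x \<partial>M01\<bar> \<le> (\<integral>x. \<bar>hv x y * rep q x\<bar> \<partial>M01)"
    using integral_norm_bound[of M01 "\<lambda>x. hv x y * rep q x"] by simp
  also have "\<dots> \<le> (\<integral>x. \<bar>rep q x\<bar> \<partial>M01)"
    using integrable_hv_mult[OF integrable_rep[of q]] integrable_rep[of q]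
    by (intro integral_mono) (auto simp: hv_def)
  finally show ?thesis unfolding pf_def by linarith
qed

lemma pf_measurable [measurable]: "pf q \<in> borel_measurable M01"
proof -
  have "(\<lambda>(y, x). hv x y) \<in> borel_measurable (borel \<Otimes>\<^sub>M borel)" using hv_borel by measurable
  then have [measurable]: "(\<lambda>(y, x). hv x y) \<in> borel_measurable (M01 \<Otimes>\<^sub>M M01)" by (rule borel_pair_lebesgue_on)
  have "(\<lambda>(y, x). hv x y * rep q x) \<in> borel_measurable (M01 \<Otimes>\<^sub>M M01)" by measurable
  then have "(\<lambda>y. \<integral>x. hv x y * rep q x \<partial>M01) \<in> borel_measurable M01"
    by (rule M01.borel_measurable_lebesgue_integral)
  then show ?thesis unfolding pf_def[abs_def] by measurable
qed

lemma integrable_pf_mult: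
  assumes "integrable M01 f"
  shows "integrable M01 (\<lambda>x. f x * pf q x)"
proof (rule Bochner_Integration.integrable_bound)
  show "integrable M01 (\<lambda>x. (\<bar>cc q\<bar> + (\<integral>x. \<bar>rep q x\<bar> \<partial>M01)) * \<bar>f x\<bar>)" using assms by simp
  show "AE x in M01. norm (f x * pf q x) \<le> norm ((\<bar>cc q\<bar> + (\<integral>x. \<bar>rep q x\<bar> \<partial>M01)) * \<bar>f x\<bar>)"
  proof (intro AE_I2)
    fix x
    have "\<bar>f x\<bar> * \<bar>pf q x\<bar> \<le> \<bar>f x\<bar> * (\<bar>cc q\<bar> + (\<integral>x. \<bar>rep q x\<bar> \<partial>M01))"
      by (intro mult_left_mono pf_bounded) simp
    also have "\<dots> \<le> \<bar>(\<bar>cc q\<bar> + (\<integral>x. \<bar>rep q x\<bar> \<partial>M01)) * \<bar>f x\<bar>\<bar>" by (simp add: mult.commute)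
    finally show "norm (f x * pf q x) \<le> norm ((\<bar>cc q\<bar> + (\<integral>x. \<bar>rep q x\<bar> \<partial>M01)) * \<bar>f x\<bar>)"
      by (simp add: abs_mult)
  qed
qed (use assms in measurable)

lemma pf_eq_tail: "pf q y = tau q + (\<integral>x. hv y x * rep q x \<partial>M01)"
proof -
  have "(\<integral>x. hv x 1 * rep q x \<partial>M01) = (\<integral>x. rep q x \<partial>M01)"
    by (rule Bochner_Integration.integral_cong) (auto simp: hv_def)
  then show ?thesis
    using integral_split_at[OF integrable_rep[of q], of y] by (simp add: tau_eq_pf pf_def)
qed

text \<open>The flux p has derivative -q, so this is (p^2)' = -2 q p integrated from y to 1, where p
  equals \<open>tau q\<close>.\<close>

lemma pf_square: "(pf q y)\<^sup>2 = (tau q)\<^sup>2 + 2 * (\<integral>x. hv y x * (rep q x * pf q x) \<partial>M01)"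
proof -
  let ?q = "rep q" and ?T = "\<integral>x. hv y x * rep q x \<partial>M01"
  have i1: "integrable M01 (\<lambda>x. hv y x * ?q x)" by (rule integrable_hv_mult(1)[OF integrable_rep])
  have i2: "integrable M01 (\<lambda>x. hv y x * (?q x * pf q x))"
    by (rule integrable_hv_mult(1)[OF integrable_pf_mult[OF integrable_rep]])
  have "?T\<^sup>2 = 2 * (\<integral>x. hv y x * (?q x * (\<integral>z. hv x z * ?q z \<partial>M01)) \<partial>M01)"
    by (rule tail_integral_square[OF i1])
  also have "(\<integral>x. hv y x * (?q x * (\<integral>z. hv x z * ?q z \<partial>M01)) \<partial>M01)
      = (\<integral>x. hv y x * (?q x * pf q x) - tau q * (hv y x * ?q x) \<partial>M01)"
    by (rule Bochner_Integration.integral_cong[OF refl]) (simp add: pf_eq_tail[of q] algebra_simps)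
  also have "\<dots> = (\<integral>x. hv y x * (?q x * pf q x) \<partial>M01) - tau q * ?T"
    using i1 i2 by simp
  finally show ?thesis by (simp add: pf_eq_tail[of q y] power2_sum algebra_simps)
qed

lemma S_norm_square: 
  shows "integrable M01 (\<lambda>y. y powr (- \<alpha>) * (pf q y)\<^sup>2)"
    and "(norm (S q))\<^sup>2 = (\<integral>y. y powr (- \<alpha>) * (pf q y)\<^sup>2 \<partial>M01)"
proof -
  have eq: "AE y in M01. (rep (S q) y)\<^sup>2 = y powr (- \<alpha>) * (pf q y)\<^sup>2"
    using rep_S[of q] AE_space by eventually_elim (simp add: power_mult_distrib powr_half_square')
  have "integrable M01 (\<lambda>y. (rep (S q) y)\<^sup>2)" using rep_L2[of "S q"] by (simp add: L2_def)
  then show "integrable M01 (\<lambda>y. y powr (- \<alpha>) * (pf q y)\<^sup>2)"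
    by (subst integrable_cong_AE[where g="\<lambda>y. (rep (S q) y)\<^sup>2"]) (use eq in \<open>auto elim: eventually_mono\<close>)
  show "(norm (S q))\<^sup>2 = (\<integral>y. y powr (- \<alpha>) * (pf q y)\<^sup>2 \<partial>M01)"
    unfolding norm_l2_power2 by (rule integral_cong_AE) (use eq in auto)
qed

lemma inner_Mx_S:
  shows "integrable M01 (\<lambda>x. x powr (1 - \<alpha>) * (rep q x * pf q x))"
    and "q \<bullet> Mx (S q) = (\<integral>x. x powr (1 - \<alpha>) * (rep q x * pf q x) \<partial>M01)"
proof -
  have eq: "AE x in M01. rep q x * rep (Mx (S q)) x = x powr (1 - \<alpha>) * (rep q x * pf q x)"
    using rep_S[of q] rep_Mx[of "S q"]
  proof eventually_elim
    case (elim x)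
    have "rep q x * rep (Mx (S q)) x = (x powr (1 - \<alpha> / 2) * x powr (- \<alpha> / 2)) * (rep q x * pf q x)"
      unfolding elim by (simp only: ac_simps)
    also have "x powr (1 - \<alpha> / 2) * x powr (- \<alpha> / 2) = x powr (1 - \<alpha>)"
      by (simp add: powr_add[symmetric])
    finally show ?case .
  qed
  have "integrable M01 (\<lambda>x. rep q x * rep (Mx (S q)) x)" by (intro L2_mult_integrable rep_L2)
  then show "integrable M01 (\<lambda>x. x powr (1 - \<alpha>) * (rep q x * pf q x))"
    by (subst integrable_cong_AE[where g="\<lambda>x. rep q x * rep (Mx (S q)) x"]) (use eq in \<open>auto elim: eventually_mono\<close>)
  show "q \<bullet> Mx (S q) = (\<integral>x. x powr (1 - \<alpha>) * (rep q x * pf q x) \<partial>M01)"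
    unfolding inner_l2_def by (rule integral_cong_AE) (use eq in auto)
qed

text \<open>With p the flux, x u_x = x^(1-\<alpha>) p and q = -p_x, so the left side is -1/2 times
  the integral of x^(1-\<alpha>) (p^2)_x; integrate by parts. At 1 the boundary term is
  \<open>tau q\<close> squared. At 0 it vanishes, for \<alpha> < 1 through the weight and for
  \<alpha> \<ge> 1 because the flux starts from 0.\<close>

lemma multiplier_identity: "q \<bullet> Mx (S q) = - (tau q)\<^sup>2 / 2 + (1 - \<alpha>) / 2 * (norm (S q))\<^sup>2"
proof -
  define h where "h = (\<lambda>x. rep q x * pf q x)"
  have hi: "integrable M01 h" unfolding h_def by (rule integrable_pf_mult[OF integrable_rep])
  have hm[measurable]: "h \<in> borel_measurable M01" using hi by auto
  have xh: "integrable M01 (\<lambda>x. x powr (1 - \<alpha>) * h x)" and q: "q \<bullet> Mx (S q) = (\<integral>x. x powr (1 - \<alpha>) * h x \<partial>M01)"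
    unfolding h_def by (rule inner_Mx_S)+
  have sq: "(pf q y)\<^sup>2 = (tau q)\<^sup>2 + 2 * (\<integral>x. hv y x * h x \<partial>M01)" for y
    unfolding h_def by (rule pf_square)
  \<comment> \<open>For \<alpha> \<ge> 1 the flux vanishes at 0, so p^2 is also an integral over (0,
    y); this moves the base point from 1 to 0.\<close>
  have head: "(tau q)\<^sup>2 = - 2 * (\<integral>x. h x \<partial>M01)" "(pf q y)\<^sup>2 = - 2 * (\<integral>x. hv x y * h x \<partial>M01)" if "1 \<le> \<alpha>" for y
  proof -
    have "pf q 0 = 0" using cc_eq_0[OF that]
      by (simp add: pf_def) (intro integral_eq_zero_AE AE_I2, simp add: hv_def)
    moreover have "(\<integral>x. hv 0 x * h x \<partial>M01) = (\<integral>x. h x \<partial>M01)"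
      by (rule Bochner_Integration.integral_cong) (auto simp: hv_def)
    ultimately show 1: "(tau q)\<^sup>2 = - 2 * (\<integral>x. h x \<partial>M01)" using sq[of 0] by simp
    show "(pf q y)\<^sup>2 = - 2 * (\<integral>x. hv x y * h x \<partial>M01)"
      using 1 sq[of y] integral_split_at[OF hi, of y] by simp
  qed
  have "(1 - \<alpha>) * (norm (S q))\<^sup>2 = (tau q)\<^sup>2 + 2 * (\<integral>x. x powr (1 - \<alpha>) * h x \<partial>M01)"
  proof (cases "\<alpha> = 1")
    case True
    have "(\<integral>x. x powr 0 * h x \<partial>M01) = (\<integral>x. h x \<partial>M01)"
      by (rule Bochner_Integration.integral_cong) auto
    then show ?thesis using True head(1) by simp
  next
    case ne: False
    show ?thesis
    proof (cases "\<alpha> < 1")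
      case True
      \<comment> \<open>For \<alpha> < 1 the weight y^(-\<alpha>) is integrable at 0, so the
        representation of p^2 based at 1 can be integrated against it.\<close>
      have int\<kappa>: "(\<integral>y. y powr (- \<alpha>) * hv y x \<partial>M01) = x powr (1 - \<alpha>) / (1 - \<alpha>)" if "x \<in> I01" for x
        using integral_powr_head[of "- \<alpha>" x] that True by (simp add: mult.commute)
      have one: "(\<integral>y. y powr (- \<alpha>) \<partial>M01) = 1 / (1 - \<alpha>)"
      proof -
        have "(\<integral>y. y powr (- \<alpha>) \<partial>M01) = (\<integral>y. hv y 1 * y powr (- \<alpha>) \<partial>M01)"
          by (rule Bochner_Integration.integral_cong) (auto simp: hv_def)
        then show ?thesis using integral_powr_head[of "- \<alpha>" 1] True by simp
      qed
      have ip: "integrable M01 (\<lambda>y. y powr (- \<alpha>))" using True by (intro integrable_powr_M01) simp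
      have Fub: "(\<integral>y. (\<integral>x. (y powr (- \<alpha>) * hv y x) * h x \<partial>M01) \<partial>M01) = (\<integral>x. (\<integral>y. y powr (- \<alpha>) * hv y x \<partial>M01) * h x \<partial>M01)"
      proof (rule weighted_Fubini)
        show "(\<lambda>(y, x). y powr (- \<alpha>) * hv y x) \<in> borel_measurable (borel \<Otimes>\<^sub>M borel)" by measurable
        show "integrable M01 (\<lambda>y. y powr (- \<alpha>) * hv y x)" for x
          using integrable_hv_mult(2)[OF ip, of x] by (simp add: mult.commute)
        have "integrable M01 (\<lambda>x. \<bar>x powr (1 - \<alpha>) * h x\<bar> / (1 - \<alpha>))" using xh by simp
        then show "integrable M01 (\<lambda>x. (\<integral>y. y powr (- \<alpha>) * hv y x \<partial>M01) * \<bar>h x\<bar>)"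
          by (subst Bochner_Integration.integrable_cong[OF refl, where g="\<lambda>x. \<bar>x powr (1 - \<alpha>) * h x\<bar> / (1 - \<alpha>)"])
            (auto simp: int\<kappa> abs_mult)
      qed auto
      also have "\<dots> = (\<integral>x. (x powr (1 - \<alpha>) * h x) / (1 - \<alpha>) \<partial>M01)"
        by (rule Bochner_Integration.integral_cong) (auto simp: int\<kappa>)
      finally have F: "(\<integral>y. y powr (- \<alpha>) * (\<integral>x. hv y x * h x \<partial>M01) \<partial>M01) = (\<integral>x. x powr (1 - \<alpha>) * h x \<partial>M01) / (1 - \<alpha>)"
        by (simp add: mult.assoc)
      have e: "y powr (- \<alpha>) * (pf q y)\<^sup>2 = (tau q)\<^sup>2 * y powr (- \<alpha>) + 2 * (y powr (- \<alpha>) * (\<integral>x. hv y x * h x \<partial>M01))" for y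
        by (simp add: sq algebra_simps)
      have i2: "integrable M01 (\<lambda>y. y powr (- \<alpha>) * (\<integral>x. hv y x * h x \<partial>M01))"
      proof -
        have "integrable M01 (\<lambda>y. (y powr (- \<alpha>) * (pf q y)\<^sup>2 - (tau q)\<^sup>2 * y powr (- \<alpha>)) / 2)"
          using S_norm_square(1)[of q] ip by simp
        then show ?thesis by (simp add: e)
      qed
      have "(norm (S q))\<^sup>2 = (\<integral>y. (tau q)\<^sup>2 * y powr (- \<alpha>) + 2 * (y powr (- \<alpha>) * (\<integral>x. hv y x * h x \<partial>M01)) \<partial>M01)"
        unfolding S_norm_square(2) e ..
      also have "\<dots> = (tau q)\<^sup>2 / (1 - \<alpha>) + 2 * ((\<integral>x. x powr (1 - \<alpha>) * h x \<partial>M01) / (1 - \<alpha>))"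
        using ip i2 by (simp add: one F)
      finally have "(norm (S q))\<^sup>2 = ((tau q)\<^sup>2 + 2 * (\<integral>x. x powr (1 - \<alpha>) * h x \<partial>M01)) / (1 - \<alpha>)"
        by (simp add: add_divide_distrib)
      then show ?thesis using True by simp
    next
      case False
      \<comment> \<open>Now y^(-\<alpha>) is not integrable at 0. The representation based at 0
        meets it only on y > x, where it is bounded.\<close>
      with ne have a: "1 < \<alpha>" by simp
      have int\<kappa>: "(\<integral>y. y powr (- \<alpha>) * hv x y \<partial>M01) = (1 - x powr (1 - \<alpha>)) / (1 - \<alpha>)" if "x \<in> I01" for x
        using integral_powr_tail[of "- \<alpha>" x] that a by (simp add: mult.commute)
      have Fub: "(\<integral>y. (\<integral>x. (y powr (- \<alpha>) * hv x y) * h x \<partial>M01) \<partial>M01) = (\<integral>x. (\<integral>y. y powr (- \<alpha>) * hv x y \<partial>M01) * h x \<partial>M01)"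
      proof (rule weighted_Fubini)
        show "(\<lambda>(y, x). y powr (- \<alpha>) * hv x y) \<in> borel_measurable (borel \<Otimes>\<^sub>M borel)" using hv_borel by measurable
        show "integrable M01 (\<lambda>y. y powr (- \<alpha>) * hv x y)" if "x \<in> I01" for x
        proof (rule Bochner_Integration.integrable_bound[of _ "\<lambda>y. x powr (- \<alpha>) * 1"])
          show "(\<lambda>y. y powr (- \<alpha>) * hv x y) \<in> borel_measurable M01"
            using Lebesgue_section(1)[OF hv_borel, of x] by measurable
          show "AE y in M01. norm (y powr (- \<alpha>) * hv x y) \<le> norm (x powr (- \<alpha>) * 1)"
            using that a by (intro AE_I2) (auto simp: hv_def intro!: powr_mono2')
        qed simp
        have "integrable M01 (\<lambda>x. \<bar>(h x - x powr (1 - \<alpha>) * h x) / (1 - \<alpha>)\<bar>)" using xh hi by simp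
        moreover have "(\<integral>y. y powr (- \<alpha>) * hv x y \<partial>M01) * \<bar>h x\<bar> = \<bar>(h x - x powr (1 - \<alpha>) * h x) / (1 - \<alpha>)\<bar>"
          if x: "x \<in> I01" for x
        proof -
          have "0 \<le> (\<integral>y. y powr (- \<alpha>) * hv x y \<partial>M01)" by (intro integral_nonneg_AE AE_I2) simp
          then have "0 \<le> (1 - x powr (1 - \<alpha>)) / (1 - \<alpha>)" by (simp add: int\<kappa>[OF x])
          then have "(1 - x powr (1 - \<alpha>)) / (1 - \<alpha>) * \<bar>h x\<bar> = \<bar>(1 - x powr (1 - \<alpha>)) / (1 - \<alpha>) * h x\<bar>"
            by (simp only: abs_mult abs_of_nonneg)
          then show ?thesis by (simp add: int\<kappa>[OF x] left_diff_distrib)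
        qed
        ultimately show "integrable M01 (\<lambda>x. (\<integral>y. y powr (- \<alpha>) * hv x y \<partial>M01) * \<bar>h x\<bar>)"
          by (subst Bochner_Integration.integrable_cong[OF refl,
                where g="\<lambda>x. \<bar>(h x - x powr (1 - \<alpha>) * h x) / (1 - \<alpha>)\<bar>"]) auto
      qed auto
      also have "\<dots> = (\<integral>x. (h x - x powr (1 - \<alpha>) * h x) / (1 - \<alpha>) \<partial>M01)"
        by (rule Bochner_Integration.integral_cong) (auto simp: int\<kappa> left_diff_distrib)
      also have "\<dots> = ((\<integral>x. h x \<partial>M01) - (\<integral>x. x powr (1 - \<alpha>) * h x \<partial>M01)) / (1 - \<alpha>)"
        using hi xh by simp
      finally have F: "(\<integral>y. y powr (- \<alpha>) * (\<integral>x. hv x y * h x \<partial>M01) \<partial>M01)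
          = ((\<integral>x. h x \<partial>M01) - (\<integral>x. x powr (1 - \<alpha>) * h x \<partial>M01)) / (1 - \<alpha>)"
        by (simp add: mult.assoc)
      have "(norm (S q))\<^sup>2 = (\<integral>y. - 2 * (y powr (- \<alpha>) * (\<integral>x. hv x y * h x \<partial>M01)) \<partial>M01)"
        unfolding S_norm_square(2) using head(2) a by (intro Bochner_Integration.integral_cong) simp_all
      also have "\<dots> = - 2 * (((\<integral>x. h x \<partial>M01) - (\<integral>x. x powr (1 - \<alpha>) * h x \<partial>M01)) / (1 - \<alpha>))"
        by (simp only: integral_mult_right_zero F)
      finally show ?thesis using head(1) a by simp
    qed
  qed
  then show ?thesis using q by (simp add: field_simps)
qed

end

text \<open>Lebesgue measure is complete, so preimages under f and g differ by a measurable null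
  set. This gives measurability of functions built from \<open>deriv\<close> and of slices of v,
  which are only known to agree almost everywhere with measurable functions.\<close>

lemma lebesgue_on_measurable_cong_AE:
  fixes f g :: "real \<Rightarrow> real"
  assumes f: "f \<in> borel_measurable (lebesgue_on S)" and ae: "AE x in lebesgue_on S. f x = g x" and S: "S \<in> sets lebesgue"
  shows "g \<in> borel_measurable (lebesgue_on S)"
proof (rule measurableI)
  fix A :: "real set" assume A: "A \<in> sets borel"
  have "f -` A \<inter> S \<in> sets (lebesgue_on S)" using measurable_sets[OF f A] by simp
  then have fA: "f -` A \<inter> S \<in> sets lebesgue" using S by (simp add: sets_restrict_space_iff)
  have "AE x in lebesgue. x \<in> S \<longrightarrow> f x = g x"
    using ae S by (simp add: AE_restrict_space_iff)
  then have "AE x in lebesgue. x \<in> f -` A \<inter> S \<longleftrightarrow> x \<in> g -` A \<inter> S"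
    by eventually_elim auto
  then have "g -` A \<inter> S \<in> sets lebesgue"
    using fA by (rule completion.in_sets_AE) simp
  then show "g -` A \<inter> space (lebesgue_on S) \<in> sets (lebesgue_on S)"
    using S by (simp add: sets_restrict_space_iff)
qed simp

section \<open>\<open>H1 \<alpha>\<close> as the image under \<open>R\<close> of the range of
  \<open>Pi\<close>\<close>

context degenerate_wave
begin

lemma pf_eq_integral:
  assumes "y \<in> {0..1}"
  shows "pf q y = cc q - integral {0..y} (rep q)"
proof -
  have "rep q absolutely_integrable_on {0..y}"
    using integrable_hv_head_iff(1)[of y "rep q"] integrable_hv_mult(2)[OF integrable_rep] assms by auto
  then show ?thesis using integrable_hv_head_iff(2)[of y "rep q"] assms by (simp add: pf_def)
qed

lemma rep_integrable_on: "rep q integrable_on {0..1}"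
  using integrable_rep[of q] integrable_M01_iff(1) set_lebesgue_integral_eq_integral(1) by blast

lemma pf_continuous_on: "continuous_on {0..1} (pf q)"
proof -
  have "continuous_on {0..1} (\<lambda>y. cc q - integral {0..y} (rep q))"
    by (intro continuous_intros indefinite_integral_continuous_1 rep_integrable_on)
  then show ?thesis by (rule continuous_on_eq) (simp add: pf_eq_integral)
qed

text \<open>\<open>Kop q = 0\<close> forces \<open>S q = 0\<close>, so the flux vanishes almost
  everywhere and, by continuity, on all of (0,1). The integral of q over (0,y) is then constant in
  y, and Lebesgue differentiation gives q = 0.\<close>

lemma Kop_injective:
  assumes "Kop q = 0"
  shows "q = 0"
proof -
  have "S q \<bullet> S q = 0" using Kop_inner[of q q] assms by simp
  then have "S q = 0" by simp
  have "AE y in M01. pf q y = 0"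
    using rep_S[of q, unfolded \<open>S q = 0\<close>] rep_zero AE_space by eventually_elim auto
  then have pf0: "pf q y = 0" if "y \<in> I01" for y
  proof -
    have "continuous_on I01 (pf q)" by (rule continuous_on_subset[OF pf_continuous_on]) auto
    from AE_eq_imp_eq_on_I01[OF this continuous_on_const \<open>AE y in M01. pf q y = 0\<close> that] show ?thesis .
  qed
  have q0: "rep q y = 0" if y: "y \<in> I01" "((\<lambda>x. integral {0..x} (rep q)) has_real_derivative rep q y) (at y)" for y
  proof -
    have "((\<lambda>x. cc q) has_real_derivative rep q y) (at y)"
    proof (rule DERIV_cong_ev[THEN iffD1, OF refl _ refl y(2)])
      show "\<forall>\<^sub>F x in nhds y. integral {0..x} (rep q) = cc q"
      proof (rule eventually_mono[OF eventually_nhds_in_open[of I01 y]])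
        fix x assume "x \<in> I01"
        then show "integral {0..x} (rep q) = cc q" using pf0[of x] pf_eq_integral[of x q] by simp
      qed (use y(1) in simp_all)
    qed
    then show ?thesis using DERIV_const DERIV_unique by blast
  qed
  have "AE y in M01. y \<notin> {x\<in>I01. \<not> ((\<lambda>x. integral {0..x} (rep q)) has_real_derivative rep q x) (at x)}"
    by (intro AE_M01_of_negligible Lebesgue_differentiation rep_integrable_on)
  then have "AE y in M01. rep q y = rep 0 y"
    using rep_zero AE_space
  proof eventually_elim
    case (elim x)
    then have "x \<in> I01" by simp
    then show ?case using q0[of x] elim(1,2) by force
  qed
  then show ?thesis by (rule l2_eqI)
qed

definition hat :: "(real \<Rightarrow> real) \<Rightarrow> real \<Rightarrow> real" where
  "hat w x = x powr (\<alpha> / 2) * deriv w x"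

lemma H1_L2: "w \<in> H1 \<alpha> \<Longrightarrow> w \<in> L2 I01" and H1_hat_L2: "w \<in> H1 \<alpha> \<Longrightarrow> hat w \<in> L2 I01"
  by (auto simp: H1_def hat_def[abs_def])

lemma powr_half_cancel: "0 < y \<Longrightarrow> y powr (- \<alpha> / 2) * y powr (\<alpha> / 2) = 1"
  by (simp add: powr_add[symmetric])

lemma powr_half_hat: "y \<in> I01 \<Longrightarrow> y powr (- \<alpha> / 2) * hat w y = deriv w y"
  using powr_half_cancel[of y] by (simp add: hat_def mult.assoc[symmetric])

lemma powr_half_cancel': "0 < y \<Longrightarrow> y powr - (\<alpha> / 2) * y powr (\<alpha> / 2) = 1"
  using powr_half_cancel[of y] by simp

lemma powr_half_hat': "0 < y \<Longrightarrow> y < 1 \<Longrightarrow> y powr - (\<alpha> / 2) * hat w y = deriv w y"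
  using powr_half_hat[of y w] by simp

text \<open>The fundamental theorem on [x,1] with w(1) = 0. It ties the pointwise definition of
  \<open>H1\<close> to the operator \<open>R\<close> at every point of (0,1].\<close>

lemma H1_eq_kernel:
  assumes w: "w \<in> H1 \<alpha>" and x: "x \<in> {0<..1}"
  shows "w x = kernel_fun wker (hat w) x"
proof (cases "x = 1")
  case True
  have "(\<integral>y. hv 1 y * (y powr (- \<alpha> / 2) * hat w y) \<partial>M01) = 0"
    by (intro integral_eq_zero_AE AE_I2) (simp add: hv_def)
  then show ?thesis using True w by (simp add: kernel_fun_wker H1_def)
next
  case False
  then have x: "x \<in> I01" using x by simp
  have ac: "abs_cont_on x 1 w"
  proof (cases "\<alpha> < 1")
    case True
    then have "abs_cont_on 0 1 w" using w by (simp add: H1_def)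
    then show ?thesis using x by (auto intro: abs_cont_on_subinterval)
  qed (use w x in \<open>simp add: H1_def\<close>)
  have FTC: "(deriv w has_integral (w 1 - w x)) {x..1}"
    using x by (intro abs_cont_on_fundamental_theorem ac) simp
  have "integrable M01 (\<lambda>y. - (wker x y * hat w y))"
    using L2_mult_integrable[of "wker x" I01 "hat w"] HS_wker x H1_hat_L2[OF w] by (simp add: HS_kernel_def)
  then have "integrable M01 (\<lambda>y. hv x y * (y powr (- \<alpha> / 2) * hat w y))" by (simp add: wker_def mult.assoc)
  then have "integrable M01 (\<lambda>y. hv x y * deriv w y)"
    by (rule Bochner_Integration.integrable_cong[THEN iffD1, OF refl, rotated]) (simp add: powr_half_hat')
  then have "(\<integral>y. hv x y * deriv w y \<partial>M01) = integral {x..1} (deriv w)"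
    using integrable_hv_tail_iff[of x "deriv w"] x by simp
  also have "\<dots> = w 1 - w x" using FTC by (simp add: has_integral_iff)
  finally have 1: "(\<integral>y. hv x y * deriv w y \<partial>M01) = - w x" using w by (simp add: H1_def)
  have "(\<integral>y. hv x y * (y powr (- \<alpha> / 2) * hat w y) \<partial>M01) = (\<integral>y. hv x y * deriv w y \<partial>M01)"
    by (rule Bochner_Integration.integral_cong[OF refl]) (simp add: powr_half_hat')
  with 1 show ?thesis by (simp add: kernel_fun_wker)
qed

text \<open>For \<alpha> < 1 the pairing of \<open>hat w\<close> with \<open>mvec\<close> is the
  integral of w_x over (0,1), that is w(1) - w(0) = 0: the Dirichlet conditions are the
  orthogonality that \<open>Pi\<close> enforces.\<close>

lemma H1_hat_Pi:
  assumes w: "w \<in> H1 \<alpha>"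
  shows "Pi (cl (hat w)) = cl (hat w)"
proof (cases "\<alpha> < 1")
  case True
  have "integrable M01 (\<lambda>y. y powr (- \<alpha> / 2) * hat w y)"
    by (intro L2_mult_integrable powr_half_L2 True H1_hat_L2 w)
  then have "integrable M01 (deriv w)"
    by (rule Bochner_Integration.integrable_cong[THEN iffD1, OF refl, rotated]) (simp add: powr_half_hat')
  then have i: "deriv w absolutely_integrable_on {0..1}" by (simp add: integrable_M01_iff)
  have "cl (hat w) \<bullet> mvec = (\<integral>y. hat w y * y powr (- \<alpha> / 2) \<partial>M01)"
    using inner_cl[OF H1_hat_L2[OF w] powr_half_L2[OF True]] True by (simp add: mvec_def)
  also have "\<dots> = (\<integral>y. deriv w y \<partial>M01)"
    using powr_half_hat by (intro Bochner_Integration.integral_cong[OF refl]) (simp add: mult.commute)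
  also have "\<dots> = integral {0..1} (deriv w)" by (rule integrable_M01_iff(2)[OF i])
  also have "\<dots> = w 1 - w 0"
    using abs_cont_on_fundamental_theorem[of 0 1 w] w True by (simp add: H1_def has_integral_iff)
  finally show ?thesis using w True by (simp add: H1_def Pi_def)
qed (simp add: Pi_def mvec_def)

lemma H1_eq_R:
  assumes w: "w \<in> H1 \<alpha>"
  shows "cl w = R (cl (hat w))"
proof (rule l2_eqI)
  show "AE x in M01. rep (cl w) x = rep (R (cl (hat w))) x"
    using rep_cl[OF H1_L2[OF w]] rep_R[of "cl (hat w)"] AE_space
  proof eventually_elim
    case (elim x)
    then have x: "x \<in> I01" by simp
    have "kernel_fun wker (rep (cl (hat w))) x = kernel_fun wker (hat w) x"
      using rep_cl[OF H1_hat_L2[OF w]] L2_measurable[OF H1_hat_L2[OF w]] x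
      by (intro kernel_fun_cong_AE HS_wker) auto
    then show ?case using elim H1_eq_kernel[OF w, of x] x by simp
  qed
qed

lemma flux_form_eq_inner:
  assumes "u \<in> H1 \<alpha>" "w \<in> H1 \<alpha>"
  shows "flux_form \<alpha> u w = cl (hat u) \<bullet> cl (hat w)"
proof -
  have "x powr \<alpha> * deriv u x * deriv w x = hat u x * hat w x" for x
  proof -
    have "hat u x * hat w x = (x powr (\<alpha> / 2) * x powr (\<alpha> / 2)) * (deriv u x * deriv w x)"
      by (simp only: hat_def ac_simps)
    then show ?thesis by (simp add: powr_add[symmetric])
  qed
  then show ?thesis
    unfolding flux_form_def inner_cl[OF H1_hat_L2[OF assms(1)] H1_hat_L2[OF assms(2)]] by simp
qed

text \<open>The base point may be any a > 0, and also 0 when \<alpha> < 1, because y^(-\<alpha>/2)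
  is then square integrable. This matches the two cases of absolute continuity in
  \<open>H1\<close>.\<close>

lemma kernel_tail_integral:
  fixes z :: l2
  defines "f \<equiv> \<lambda>y. y powr (- \<alpha> / 2) * rep z y"
  assumes "0 \<le> a" "a < 1" "0 < a \<or> \<alpha> < 1"
  shows "f absolutely_integrable_on {a..1}"
    and "\<And>x. x \<in> {a..1} \<Longrightarrow> kernel_fun wker (rep z) x = kernel_fun wker (rep z) a + integral {a..x} f"
proof -
  have hva: "integrable M01 (\<lambda>y. hv a y * f y)"
  proof (cases "0 < a")
    case True
    then have "integrable M01 (\<lambda>y. - (wker a y * rep z y))"
      using L2_mult_integrable[of "wker a" I01 "rep z"] HS_wker assms(3) by (simp add: HS_kernel_def)
    then show ?thesis by (simp add: wker_def mult.assoc f_def)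
  next
    case False
    then have "integrable M01 f"
      unfolding f_def using assms(4) by (intro L2_mult_integrable powr_half_L2 rep_L2) auto
    then show ?thesis by (rule integrable_hv_mult)
  qed
  then show fa: "f absolutely_integrable_on {a..1}"
    using integrable_hv_tail_iff(1)[of a f] assms by simp
  have w: "kernel_fun wker (rep z) x = - integral {x..1} f" if "x \<in> {a..1}" for x
  proof -
    have "f absolutely_integrable_on {x..1}" using fa that by (auto intro: absolutely_integrable_on_subinterval)
    then show ?thesis
      using integrable_hv_tail_iff(2)[of x f] that assms by (simp add: kernel_fun_wker f_def)
  qed
  fix x assume x: "x \<in> {a..1}"
  have "f integrable_on {a..1}" using fa set_lebesgue_integral_eq_integral(1) by blast
  then have "integral {a..x} f + integral {x..1} f = integral {a..1} f"
    using x by (intro Henstock_Kurzweil_Integration.integral_combine) auto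
  then show "kernel_fun wker (rep z) x = kernel_fun wker (rep z) a + integral {a..x} f"
    using w[OF x] w[of a] assms(3) by simp
qed

lemma kernel_has_derivative_AE:
  "AE x in M01. (kernel_fun wker (rep z) has_real_derivative x powr (- \<alpha> / 2) * rep z x) (at x)"
proof -
  let ?f = "\<lambda>y. y powr (- \<alpha> / 2) * rep z y" and ?w = "kernel_fun wker (rep z)"
  \<comment> \<open>The intervals [1/(n+2), 1] exhaust (0,1]; the shift by 2 keeps the left end
    below 1 already for n = 0.\<close>
  let ?N = "\<lambda>n::nat. {x\<in>{1 / (real n + 2)..1}. \<not> (?w has_real_derivative ?f x) (at x)}"
  have "negligible (?N n)" for n
  proof (rule has_real_derivative_of_eq_integral)
    have a: "0 \<le> 1 / (real n + 2)" "1 / (real n + 2) < 1" "0 < 1 / (real n + 2) \<or> \<alpha> < 1" by (auto simp: field_simps)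
    show "?f integrable_on {1 / (real n + 2)..1}"
      using kernel_tail_integral(1)[OF a] set_lebesgue_integral_eq_integral(1) by blast
    show "?w x = ?w (1 / (real n + 2)) + integral {1 / (real n + 2)..x} ?f" if "x \<in> {1 / (real n + 2)..1}" for x
      by (rule kernel_tail_integral(2)[OF a that])
  qed
  then have "AE x in M01. x \<notin> (\<Union>n. ?N n)"
    by (intro AE_M01_of_negligible negligible_Union_nat)
  then show ?thesis
    using AE_space
  proof eventually_elim
    case (elim x)
    then have x: "0 < x" "x < 1" by simp_all
    obtain n :: nat where "1 / x < n" using reals_Archimedean2 by blast
    then have "1 / (real n + 2) \<le> x" using x by (simp add: field_simps)
    then show ?case using elim(1) x by auto
  qed
qed

text \<open>The converse of \<open>H1_eq_R\<close>. A fixed point of \<open>Pi\<close> is orthogonal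
  to \<open>mvec\<close>, and for \<alpha> < 1 this says that the kernel function vanishes at
  0.\<close>

lemma kernel_H1:
  assumes z: "Pi z = z"
  shows "kernel_fun wker (rep z) \<in> H1 \<alpha>" and "AE x in M01. hat (kernel_fun wker (rep z)) x = rep z x"
proof -
  let ?f = "\<lambda>y. y powr (- \<alpha> / 2) * rep z y" and ?w = "kernel_fun wker (rep z)"
  show hat: "AE x in M01. hat ?w x = rep z x"
    using kernel_has_derivative_AE[of z] AE_space
  proof eventually_elim
    case (elim x)
    have "hat ?w x = (x powr (- \<alpha> / 2) * x powr (\<alpha> / 2)) * rep z x"
      using DERIV_imp_deriv[OF elim(1)] by (simp add: hat_def)
    then show ?case using elim(2) by (simp add: powr_half_cancel')
  qed
  have w1: "?w 1 = 0"
  proof -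
    have "(\<integral>y. hv 1 y * (y powr (- \<alpha> / 2) * rep z y) \<partial>M01) = 0"
      by (intro integral_eq_zero_AE AE_I2) (simp add: hv_def)
    then show ?thesis by (simp add: kernel_fun_wker)
  qed
  have ac: "abs_cont_on a 1 ?w" if "0 \<le> a" "a < 1" "0 < a \<or> \<alpha> < 1" for a
    by (rule abs_cont_on_of_eq_integral[OF kernel_tail_integral(1)[OF that] kernel_tail_integral(2)[OF that]])
  have w0: "?w 0 = 0" if "\<alpha> < 1"
  proof -
    have "z \<bullet> mvec = z \<bullet> Pi mvec" using z by (metis Pi_adjoint)
    also have "Pi mvec = 0" by (simp add: Pi_def)
    finally have "(\<integral>y. rep z y * y powr (- \<alpha> / 2) \<partial>M01) = 0"
      using inner_cl[OF rep_L2[of z] powr_half_L2[OF that]] that by (simp add: mvec_def)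
    moreover have "(\<integral>y. hv 0 y * (y powr (- \<alpha> / 2) * rep z y) \<partial>M01) = (\<integral>y. rep z y * y powr (- \<alpha> / 2) \<partial>M01)"
      by (rule Bochner_Integration.integral_cong) (auto simp: hv_def)
    ultimately show ?thesis by (simp add: kernel_fun_wker)
  qed
  have "hat ?w \<in> L2 I01"
  proof (rule L2_cong_AE[OF rep_L2[of z]])
    show "AE x in M01. rep z x = hat ?w x" using hat by eventually_elim simp
    then show "hat ?w \<in> borel_measurable M01"
      by (rule lebesgue_on_measurable_cong_AE[OF rep_measurable]) simp
  qed
  then show "?w \<in> H1 \<alpha>"
    using kernel_fun_L2(1)[OF HS_wker] w0 w1 ac by (auto simp: H1_def hat_def[abs_def])
qed

text \<open>Near 1 this function is minus the integral over (x,1) of x^(-\<alpha>) times the flux,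
  which is continuous up to 1 with value \<open>tau q\<close>. It vanishes at 1, so the quotient is
  its difference quotient there; the base point 1/2 keeps the singularity at 0 away.\<close>

lemma kernel_S_trace:
  "((\<lambda>x. kernel_fun wker (rep (S q)) x / (x - 1)) \<longlongrightarrow> tau q) (at_left 1)"
proof -
  define g where "g = (\<lambda>y. y powr (- \<alpha> / 2) * (y powr (- \<alpha> / 2) * pf q y))"
  define w where "w = kernel_fun wker (rep (S q))"
  have cg: "continuous_on {1/2..1} g" unfolding g_def
    by (intro continuous_intros continuous_on_subset[OF pf_continuous_on]) auto
  have gi: "g absolutely_integrable_on {1/2..1}" by (rule absolutely_integrable_continuous_real[OF cg])
  have w: "w x = integral {1/2..x} g - integral {1/2..1} g" if x: "x \<in> {1/2..<1}" for x
  proof -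
    have gx: "g absolutely_integrable_on {x..1}" using gi x by (auto intro: absolutely_integrable_on_subinterval)
    have "w x = kernel_fun wker (\<lambda>y. y powr (- \<alpha> / 2) * pf q y) x"
      unfolding w_def using x rep_S[of q] by (intro kernel_fun_cong_AE HS_wker) auto
    also have "\<dots> = - integral {x..1} g"
      using integrable_hv_tail_iff(2)[OF _ _ gx] x by (simp add: kernel_fun_wker g_def)
    finally have "w x = - integral {x..1} g" .
    moreover have "integral {1/2..x} g + integral {x..1} g = integral {1/2..1} g"
      using x gi set_lebesgue_integral_eq_integral(1)[OF gi] by (intro Henstock_Kurzweil_Integration.integral_combine) auto
    ultimately show ?thesis by simp
  qed
  have "((\<lambda>x. integral {1/2..x} g) has_real_derivative g 1) (at 1 within {1/2..1})"
    by (rule integral_has_real_derivative[OF cg]) simp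
  then have "((\<lambda>x. (integral {1/2..x} g - integral {1/2..1} g) / (x - 1)) \<longlongrightarrow> g 1) (at_left 1)"
    by (simp add: has_field_derivative_iff at_within_Icc_at_left)
  moreover have "\<forall>\<^sub>F x in at_left 1. (integral {1/2..x} g - integral {1/2..1} g) / (x - 1) = w x / (x - 1)"
    by (rule eventually_mono[OF eventually_at_left_real[of "1/2"]]) (simp_all add: w)
  ultimately have "((\<lambda>x. w x / (x - 1)) \<longlongrightarrow> g 1) (at_left 1)"
    by (rule Lim_transform_eventually)
  then show ?thesis by (simp add: w_def g_def tau_eq_pf)
qed

end

section \<open>Observability and hidden regularity\<close>

lemma has_vector_derivative_inner:
  fixes f g :: "real \<Rightarrow> 'a::real_inner"
  assumes "(f has_vector_derivative f') (at t within A)" "(g has_vector_derivative g') (at t within A)"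
  shows "((\<lambda>s. f s \<bullet> g s) has_real_derivative f t \<bullet> g' + f' \<bullet> g t) (at t within A)"
  using has_derivative_inner[OF assms[unfolded has_vector_derivative_def]]
  unfolding has_field_derivative_def
  by (rule has_derivative_eq_rhs) (simp add: fun_eq_iff algebra_simps)

context degenerate_wave
begin

text \<open>The multiplier is \<open>x u\<^sub>x + (\<alpha>/4) u\<close>; with \<open>u = - Kop (u'')\<close> one has \<open>x u\<^sub>x = - Mx (S u'')\<close>.\<close>

lemma observability:
  fixes u u1 u2 u3 :: "real \<Rightarrow> l2"
  assumes L: "0 \<le> L"
    and du: "\<And>t. t \<in> {0..L} \<Longrightarrow> (u has_vector_derivative u1 t) (at t within {0..L})"
    and du1: "\<And>t. t \<in> {0..L} \<Longrightarrow> (u1 has_vector_derivative u2 t) (at t within {0..L})"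
    and du2: "\<And>t. t \<in> {0..L} \<Longrightarrow> (u2 has_vector_derivative u3 t) (at t within {0..L})"
    and eq: "\<And>t. t \<in> {0..L} \<Longrightarrow> u t = - Kop (u2 t)"
    and eq1: "\<And>t. t \<in> {0..L} \<Longrightarrow> u1 t = - Kop (u3 t)"
    and C: "\<And>z. norm (R z) \<le> C * norm z" "0 \<le> C"
  shows "(L * (2 - \<alpha>) / 2 - 2 * (1 + C)) * (((norm (u1 0))\<^sup>2 + (norm (S (u2 0)))\<^sup>2) / 2)
    \<le> integral {0..L} (\<lambda>t. (tau (u2 t))\<^sup>2) / 2"
proof -
  \<comment> \<open>The energy: since u = -Kop u2, the weighted derivative x^(\<alpha>/2) u_x is -S
    u2, so the second term is the potential energy.\<close>
  define E where "E = (\<lambda>t. (u1 t \<bullet> u1 t + S (u2 t) \<bullet> S (u2 t)) / 2)"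
  define \<Phi> where "\<Phi> = (\<lambda>t. u1 t \<bullet> (- Mx (S (u2 t)) + (\<alpha> / 4) *\<^sub>R u t))"
  have dS: "((\<lambda>t. S (u2 t)) has_vector_derivative S (u3 t)) (at t within {0..L})" if "t \<in> {0..L}" for t
    by (rule bounded_linear.has_vector_derivative[OF bounded_linear_S du2[OF that]])
  have dM: "((\<lambda>t. Mx (S (u2 t))) has_vector_derivative Mx (S (u3 t))) (at t within {0..L})" if "t \<in> {0..L}" for t
    by (rule bounded_linear.has_vector_derivative[OF bounded_linear_Mx dS[OF that]])
  \<comment> \<open>By \<open>Kop_inner\<close> and u1 = -Kop u3 the derivative of the potential
    part is -u1 \<bullet> u2, which cancels that of the kinetic part.\<close>
  have dE: "(E has_real_derivative 0) (at t within {0..L})" if t: "t \<in> {0..L}" for t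
  proof -
    have "S (u2 t) \<bullet> S (u3 t) = - (u1 t \<bullet> u2 t)"
      using Kop_inner[of "u3 t" "u2 t"] eq1[OF t] by (simp add: inner_commute)
    then show ?thesis
      unfolding E_def
      using DERIV_cdivide[OF DERIV_add[OF has_vector_derivative_inner[OF du1[OF t] du1[OF t]]
            has_vector_derivative_inner[OF dS[OF t] dS[OF t]]], of 2]
      by (simp add: inner_commute)
  qed
  have E_const: "E t = E 0" if "t \<in> {0..L}" for t
    using has_field_derivative_zero_constant[of "{0..L}" E] dE that L by (metis atLeastAtMost_iff convex_real_interval(5) order_refl)
  \<comment> \<open>The multiplier x u_x alone weighs |u1|^2 and |S u2|^2 by -1/2 and
    -(1-\<alpha>)/2. Adding \<alpha>/4 times u shifts these by \<alpha>/4 and -\<alpha>/4, so that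
    both become -(2-\<alpha>)/4 and combine into the conserved energy.\<close>
  have d\<Phi>: "(\<Phi> has_real_derivative (tau (u2 t))\<^sup>2 / 2 - (2 - \<alpha>) / 2 * E 0) (at t within {0..L})" if t: "t \<in> {0..L}" for t
  proof -
    have i1: "u2 t \<bullet> Mx (S (u2 t)) = - (tau (u2 t))\<^sup>2 / 2 + (1 - \<alpha>) / 2 * (norm (S (u2 t)))\<^sup>2"
      by (rule multiplier_identity)
    have i2: "u1 t \<bullet> Mx (S (u3 t)) = (norm (u1 t))\<^sup>2 / 2"
      using R_inner_Mx[of "S (u3 t)"] eq1[OF t] by (simp add: Kop_def)
    have i3: "u2 t \<bullet> u t = - (norm (S (u2 t)))\<^sup>2"
      using Kop_inner[of "u2 t" "u2 t"] eq[OF t] by (simp add: inner_commute power2_norm_eq_inner)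
    have "((\<lambda>t. - Mx (S (u2 t)) + (\<alpha> / 4) *\<^sub>R u t) has_vector_derivative - Mx (S (u3 t)) + (\<alpha> / 4) *\<^sub>R u1 t) (at t within {0..L})"
      using dM[OF t] du[OF t] by (auto intro!: derivative_eq_intros)
    from has_vector_derivative_inner[OF du1[OF t] this]
    have "(\<Phi> has_real_derivative u1 t \<bullet> (- Mx (S (u3 t)) + (\<alpha> / 4) *\<^sub>R u1 t) + u2 t \<bullet> (- Mx (S (u2 t)) + (\<alpha> / 4) *\<^sub>R u t)) (at t within {0..L})"
      unfolding \<Phi>_def .
    moreover have "u1 t \<bullet> (- Mx (S (u3 t)) + (\<alpha> / 4) *\<^sub>R u1 t) + u2 t \<bullet> (- Mx (S (u2 t)) + (\<alpha> / 4) *\<^sub>R u t)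
        = (tau (u2 t))\<^sup>2 / 2 - (2 - \<alpha>) / 2 * E t"
      unfolding inner_add_right inner_minus_right inner_scaleR_right i1 i2 i3
      by (simp add: E_def power2_norm_eq_inner field_simps)
    ultimately show ?thesis using E_const[OF t] by simp
  qed
  \<comment> \<open>Uses \<open>Mx_norm_le\<close>, the bound C for \<open>R\<close> and the crude
    estimate \<alpha>/4 \<le> 1. The two endpoints of the time interval account for the loss 2 (1 +
    C) in the conclusion.\<close>
  have \<Phi>_bound: "\<bar>\<Phi> t\<bar> \<le> (1 + C) * E 0" if t: "t \<in> {0..L}" for t
  proof -
    define a b where "a = norm (u1 t)" and "b = norm (S (u2 t))"
    have "\<bar>\<Phi> t\<bar> \<le> a * norm (- Mx (S (u2 t)) + (\<alpha> / 4) *\<^sub>R u t)"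
      unfolding \<Phi>_def a_def by (rule Cauchy_Schwarz_ineq2)
    also have "norm (- Mx (S (u2 t)) + (\<alpha> / 4) *\<^sub>R u t) \<le> norm (Mx (S (u2 t))) + (\<alpha> / 4) * norm (u t)"
      using norm_triangle_ineq[of "- Mx (S (u2 t))" "(\<alpha> / 4) *\<^sub>R u t"] alpha_pos by simp
    also have "norm (Mx (S (u2 t))) \<le> b" unfolding b_def by (rule Mx_norm_le)
    also have "norm (u t) \<le> C * b" using C(1)[of "S (u2 t)"] eq[OF t] by (simp add: b_def Kop_def)
    also have "\<alpha> / 4 * (C * b) \<le> 1 * (C * b)"
      using alpha_less C(2) by (intro mult_right_mono) (auto simp: b_def)
    finally have "\<bar>\<Phi> t\<bar> \<le> a * (b + 1 * (C * b))" using alpha_pos by (simp add: a_def mult_left_mono)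
    also have "\<dots> = (1 + C) * (a * b)" by (simp add: algebra_simps)
    also have "a * b \<le> (a\<^sup>2 + b\<^sup>2) / 2"
      using zero_le_power2[of "a - b"] by (simp add: power2_diff)
    also have "(a\<^sup>2 + b\<^sup>2) / 2 = E t" by (simp add: a_def b_def E_def power2_norm_eq_inner)
    finally show ?thesis using E_const[OF t] C(2) by (simp add: mult_left_mono)
  qed
  have c2: "continuous_on {0..L} u2"
    by (rule continuous_on_vector_derivative) (rule du2)
  have ct: "(\<lambda>t. (tau (u2 t))\<^sup>2) integrable_on {0..L}"
    by (intro integrable_continuous_interval continuous_intros bounded_linear.continuous_on[OF bounded_linear_tau] c2)
  have "((\<lambda>t. (tau (u2 t))\<^sup>2 / 2 - (2 - \<alpha>) / 2 * E 0) has_integral (\<Phi> L - \<Phi> 0)) {0..L}"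
    using d\<Phi> L by (intro fundamental_theorem_of_calculus) (auto simp: has_real_derivative_iff_has_vector_derivative)
  moreover have "((\<lambda>t. (tau (u2 t))\<^sup>2 / 2 - (2 - \<alpha>) / 2 * E 0) has_integral
      (integral {0..L} (\<lambda>t. (tau (u2 t))\<^sup>2) / 2 - L * ((2 - \<alpha>) / 2 * E 0))) {0..L}"
    using has_integral_diff[OF has_integral_divide[OF integrable_integral[OF ct], of 2]
        has_integral_const_real[of "(2 - \<alpha>) / 2 * E 0" 0 L]] L by simp
  ultimately have "\<Phi> L - \<Phi> 0 = integral {0..L} (\<lambda>t. (tau (u2 t))\<^sup>2) / 2 - L * ((2 - \<alpha>) / 2 * E 0)"
    by (rule has_integral_unique)
  moreover have "- ((1 + C) * E 0) \<le> \<Phi> L" "\<Phi> 0 \<le> (1 + C) * E 0"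
    using \<Phi>_bound[of L] \<Phi>_bound[of 0] L by (auto simp: abs_le_iff)
  moreover have "(L * (2 - \<alpha>) / 2 - 2 * (1 + C)) * E 0 = L * ((2 - \<alpha>) / 2 * E 0) - 2 * ((1 + C) * E 0)"
    by (simp add: algebra_simps)
  ultimately have "(L * (2 - \<alpha>) / 2 - 2 * (1 + C)) * E 0 \<le> integral {0..L} (\<lambda>t. (tau (u2 t))\<^sup>2) / 2"
    by linarith
  then show ?thesis by (simp add: E_def power2_norm_eq_inner)
qed

end

section \<open>Smooth mollifiers\<close>

text \<open>Smooth bump functions are products of two flat functions; \<open>bumps\<close> is a set of such combinations
  closed under differentiation.\<close>

definition flat :: "nat \<Rightarrow> real \<Rightarrow> real" where
  "flat n x = (if 0 < x then exp (- (1 / x)) / x ^ n else 0)"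

lemma flat_tendsto_0: "(flat n \<longlongrightarrow> 0) (at 0)"
proof -
  have "((\<lambda>x::real. x ^ n / exp x) \<longlongrightarrow> 0) at_top" by (rule tendsto_power_div_exp_0)
  then have "((\<lambda>x::real. (inverse x) ^ n / exp (inverse x)) \<longlongrightarrow> 0) (at_right 0)"
    by (rule filterlim_compose[OF _ filterlim_inverse_at_top_right])
  then have "(flat n \<longlongrightarrow> 0) (at_right 0)"
    by (rule Lim_transform_eventually)
      (auto simp: flat_def eventually_at_right_field exp_minus field_simps intro!: exI[of _ 1])
  moreover have "(flat n \<longlongrightarrow> 0) (at_left 0)"
    by (rule tendsto_eventually) (auto simp: flat_def eventually_at_left_field intro!: exI[of _ "-1"])
  ultimately show ?thesis by (simp add: filterlim_at_split)
qed

lemma has_real_derivative_transform_nhds: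
  assumes "(f has_real_derivative d) (at x)" "\<forall>\<^sub>F y in nhds x. f y = g y"
  shows "(g has_real_derivative d) (at x)"
  using assms DERIV_cong_ev[OF refl assms(2) refl] by blast

text \<open>The free exponent in the denominator keeps derivatives inside the family. At 0 the
  difference quotient of \<open>flat n\<close> is \<open>flat (n + 1)\<close>, which tends to
  0.\<close>

lemma flat_has_derivative:
  "(flat n has_real_derivative (flat (n + 2) x - real n * flat (n + 1) x)) (at x)"
proof -
  consider "x < 0" | "x = 0" | "x > 0" by linarith
  then show ?thesis
  proof cases
    case 1
    have "((\<lambda>x. 0) has_real_derivative 0) (at x)" by simp
    moreover have "\<forall>\<^sub>F y in nhds x. 0 = flat n y"
      using eventually_nhds_in_open[of "{..<0}" x] 1 by (auto elim!: eventually_mono simp: flat_def)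
    ultimately have "(flat n has_real_derivative 0) (at x)"
      by (rule has_real_derivative_transform_nhds)
    then show ?thesis using 1 by (simp add: flat_def)
  next
    case 2
    have "((\<lambda>h. flat (n + 1) h) \<longlongrightarrow> 0) (at 0)" using flat_tendsto_0[of "n + 1"] by simp
    then have "((\<lambda>h. (flat n (0 + h) - flat n 0) / h) \<longlongrightarrow> 0) (at 0)"
      by (rule Lim_transform_eventually) (auto simp: flat_def field_simps eventually_at_filter)
    then show ?thesis using 2 by (simp add: DERIV_def flat_def)
  next
    case 3
    have "((\<lambda>x. exp (- (1 / x)) / x ^ n) has_real_derivative
        (exp (- (1 / x)) * (1 / x\<^sup>2) * x ^ n - exp (- (1 / x)) * (real n * x ^ (n - 1))) / (x ^ n * x ^ n)) (at x)"
      using 3 by (auto intro!: derivative_eq_intros simp: power2_eq_square)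
    also have "(exp (- (1 / x)) * (1 / x\<^sup>2) * x ^ n - exp (- (1 / x)) * (real n * x ^ (n - 1))) / (x ^ n * x ^ n)
        = flat (n + 2) x - real n * flat (n + 1) x"
      using 3 by (cases n) (auto simp: flat_def field_simps power2_eq_square)
    finally have d: "((\<lambda>x. exp (- (1 / x)) / x ^ n) has_real_derivative flat (n + 2) x - real n * flat (n + 1) x) (at x)" .
    have "\<forall>\<^sub>F y in nhds x. exp (- (1 / y)) / y ^ n = flat n y"
      using eventually_nhds_in_open[of "{0<..}" x] 3 by (auto elim!: eventually_mono simp: flat_def)
    with d show ?thesis by (rule has_real_derivative_transform_nhds)
  qed
qed

inductive_set bumps :: "real \<Rightarrow> real \<Rightarrow> (real \<Rightarrow> real) set" for a c where
  base: "(\<lambda>s. k * (flat i (s - a) * flat j (c - s))) \<in> bumps a c"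
| add: "f \<in> bumps a c \<Longrightarrow> g \<in> bumps a c \<Longrightarrow> (\<lambda>s. f s + g s) \<in> bumps a c"

lemma bumps_derivative:
  assumes "f \<in> bumps a c"
  shows "\<exists>f'\<in>bumps a c. \<forall>s. (f has_real_derivative f' s) (at s)"
  using assms
proof induction
  case (base k i j)
  have 1: "((\<lambda>s. flat i (s - a)) has_real_derivative (flat (i + 2) (s - a) - real i * flat (i + 1) (s - a))) (at s)" for s
  proof -
    have "((\<lambda>s. s - a) has_real_derivative 1) (at s)" by (auto intro!: derivative_eq_intros)
    from DERIV_chain2[where f="flat i" and g="\<lambda>s. s - a", OF flat_has_derivative this] show ?thesis by simp
  qed
  have 2: "((\<lambda>s. flat j (c - s)) has_real_derivative - (flat (j + 2) (c - s) - real j * flat (j + 1) (c - s))) (at s)" for s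
  proof -
    have "((\<lambda>s. c - s) has_real_derivative - 1) (at s)" by (auto intro!: derivative_eq_intros)
    from DERIV_chain2[where f="flat j" and g="\<lambda>s. c - s", OF flat_has_derivative this] show ?thesis by simp
  qed
  let ?B = "\<lambda>k i j s. k * (flat i (s - a) * flat j (c - s))"
  have "(?B k i j has_real_derivative
      (?B k (i + 2) j s + ?B (- k * real i) (i + 1) j s) + (?B (- k) i (j + 2) s + ?B (k * real j) i (j + 1) s)) (at s)" for s
    by (rule DERIV_cong[OF DERIV_cmult[OF DERIV_mult[OF 1 2]]]) (simp add: algebra_simps)
  note d = this
  have m: "(\<lambda>s. (?B k (i + 2) j s + ?B (- k * real i) (i + 1) j s) + (?B (- k) i (j + 2) s + ?B (k * real j) i (j + 1) s)) \<in> bumps a c"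
    by (intro bumps.add bumps.base)
  show ?case by (rule bexI[OF _ m]) (intro allI d)
next
  case (add f g)
  then obtain f' g' where "f' \<in> bumps a c" "g' \<in> bumps a c"
    "\<And>s. (f has_real_derivative f' s) (at s)" "\<And>s. (g has_real_derivative g' s) (at s)" by blast
  then show ?case
    by (intro bexI[of _ "\<lambda>s. f' s + g' s"]) (auto intro!: bumps.add DERIV_add)
qed

lemma bumps_vanish: "f \<in> bumps a c \<Longrightarrow> s \<le> a \<or> c \<le> s \<Longrightarrow> f s = 0"
  by (induction rule: bumps.induct) (auto simp: flat_def)

text \<open>b lists all derivatives of a single bump. A derivative is only known to exist within
  \<open>bumps\<close>, so it is selected by choice and iterated. Support in the middle third of
  [0,h] leaves room for compact support in (0,T) of translates starting at t = 0.\<close>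

lemma exists_smooth_mollifier:
  fixes h :: real
  assumes "h > 0"
  obtains b :: "nat \<Rightarrow> real \<Rightarrow> real" where
    "\<And>k x. (b k has_real_derivative b (Suc k) x) (at x)" "\<And>x. 0 \<le> b 0 x"
    "\<And>k x. x \<le> h / 3 \<or> 2 * h / 3 \<le> x \<Longrightarrow> b k x = 0" "integral {0..h} (b 0) = 1"
proof -
  let ?a = "h / 3" and ?c = "2 * h / 3"
  define \<rho> where "\<rho> = (\<lambda>s. flat 0 (s - ?a) * flat 0 (?c - s))"
  have \<rho>B: "\<rho> \<in> bumps ?a ?c"
    using bumps.base[of 1 0 ?a 0 ?c] by (simp add: \<rho>_def)
  then have cont: "continuous_on S \<rho>" for S
    using bumps_derivative[OF \<rho>B] by (meson DERIV_isCont continuous_at_imp_continuous_on)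
  have pos: "\<rho> s \<ge> 0" for s by (simp add: \<rho>_def flat_def)
  define I where "I = integral {0..h} \<rho>"
  have "I \<ge> 0" unfolding I_def
    by (intro Henstock_Kurzweil_Integration.integral_nonneg integrable_continuous_interval cont) (simp add: pos)
  moreover have "I \<noteq> 0"
  proof
    assume "I = 0"
    then have "(\<rho> has_integral 0) {0..h}"
      using integrable_integral[OF integrable_continuous_interval[OF cont], of 0 h] by (simp add: I_def)
    then have "(\<rho> has_integral 0) (cbox 0 h)" by simp
    then have "\<rho> (h / 2) = 0"
      using has_integral_0_cbox_imp_0[of 0 h \<rho> "h / 2"] cont pos assms by auto
    then show False using assms by (simp add: \<rho>_def flat_def)
  qed
  ultimately have I: "I > 0" by simp
  define D where "D = (\<lambda>f. SOME f'. f' \<in> bumps ?a ?c \<and> (\<forall>s. (f has_real_derivative f' s) (at s)))"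
  have D: "D f \<in> bumps ?a ?c \<and> (\<forall>s. (f has_real_derivative D f s) (at s))" if "f \<in> bumps ?a ?c" for f
    using someI_ex[of "\<lambda>f'. f' \<in> bumps ?a ?c \<and> (\<forall>s. (f has_real_derivative f' s) (at s))"]
      bumps_derivative[OF that] unfolding D_def by blast
  define b where "b = (\<lambda>k. (D ^^ k) (\<lambda>s. (1 / I) * \<rho> s))"
  have bB: "b k \<in> bumps ?a ?c" for k
  proof (induction k)
    case 0
    then show ?case using bumps.base[of "1 / I" 0 ?a 0 ?c] by (simp add: b_def \<rho>_def)
  qed (simp add: b_def D)
  show ?thesis
  proof (rule that[of b])
    show "(b k has_real_derivative b (Suc k) x) (at x)" for k x
      using D[OF bB[of k]] by (simp add: b_def)
    show "0 \<le> b 0 x" for x using pos I by (simp add: b_def)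
    show "x \<le> h / 3 \<or> 2 * h / 3 \<le> x \<Longrightarrow> b k x = 0" for k x by (rule bumps_vanish[OF bB])
    show "integral {0..h} (b 0) = 1" using I by (simp add: b_def I_def[symmetric])
  qed
qed

text \<open>The support lies to the right of 0, so averaging against b 0 (s - t) sees only times
  between t and t + h. Time 0 can be reached, at the price of shortening the interval to
  [0, T - h].\<close>

locale mollifier =
  fixes h :: real and b :: "nat \<Rightarrow> real \<Rightarrow> real"
  assumes h_pos: "0 < h"
    and b_deriv: "\<And>k x. (b k has_real_derivative b (Suc k) x) (at x)"
    and b_nonneg: "\<And>x. 0 \<le> b 0 x"
    and b_vanish: "\<And>k x. x \<le> h / 3 \<or> 2 * h / 3 \<le> x \<Longrightarrow> b k x = 0"
    and b_unit: "integral {0..h} (b 0) = 1"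
begin

lemma b_continuous: "continuous_on A (b k)"
  using b_deriv by (meson DERIV_isCont continuous_at_imp_continuous_on)

lemma b_shift_continuous: "continuous_on A (\<lambda>s. b k (s - t))"
  by (rule continuous_on_compose2[OF b_continuous[of UNIV]]) (auto intro!: continuous_intros)

lemma b_shift_deriv: "((\<lambda>s. b k (s - t)) has_real_derivative b (Suc k) (s - t)) (at s within A)"
proof -
  have "((\<lambda>s. s - t) has_real_derivative 1) (at s within A)" by (auto intro!: derivative_eq_intros)
  from DERIV_chain2[where f="b k" and g="\<lambda>s. s - t", OF b_deriv this] show ?thesis by simp
qed

lemma b_shift_deriv_left: "((\<lambda>t. b k (s - t)) has_real_derivative - b (Suc k) (s - t)) (at t within A)"
proof -
  have "((\<lambda>t. s - t) has_real_derivative -1) (at t within A)" by (auto intro!: derivative_eq_intros)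
  from DERIV_chain2[where f="b k" and g="\<lambda>t. s - t", OF b_deriv this] show ?thesis by simp
qed

lemma iterated_deriv_shift: "(deriv ^^ n) (\<lambda>s. b 0 (s - t)) = (\<lambda>s. b n (s - t))"
proof (induction n)
  case (Suc n)
  have "deriv (\<lambda>s. b n (s - t)) = (\<lambda>s. b (Suc n) (s - t))"
    using DERIV_imp_deriv[OF b_shift_deriv] by blast
  then show ?case using Suc by simp
qed simp

lemma deriv_shift: "deriv (\<lambda>s. b 0 (s - t)) s = b 1 (s - t)"
  using DERIV_imp_deriv[OF b_shift_deriv[of 0 t s UNIV]] by simp

lemma test_fun_shift:
  assumes "0 \<le> t" "t + h \<le> T"
  shows "test_fun T (\<lambda>s. b 0 (s - t))"
proof -
  have sub: "{s. b 0 (s - t) \<noteq> 0} \<subseteq> {t + h / 3..t + 2 * h / 3}"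
  proof
    fix s assume "s \<in> {s. b 0 (s - t) \<noteq> 0}"
    then have "\<not> (s - t \<le> h / 3 \<or> 2 * h / 3 \<le> s - t)" using b_vanish by blast
    then show "s \<in> {t + h / 3..t + 2 * h / 3}" by auto
  qed
  then have "closure {s. b 0 (s - t) \<noteq> 0} \<subseteq> {t + h / 3..t + 2 * h / 3}"
    by (rule closure_minimal) simp
  moreover have "{t + h / 3..t + 2 * h / 3} \<subseteq> {0<..<T}" using assms h_pos by auto
  moreover have "bounded {s. b 0 (s - t) \<noteq> 0}" using sub bounded_closed_interval bounded_subset by blast
  moreover have "(deriv ^^ n) (\<lambda>s. b 0 (s - t)) differentiable (at x)" for n x
    unfolding iterated_deriv_shift
    using b_shift_deriv[of n t x UNIV] real_differentiable_def by blast
  ultimately show ?thesis by (auto simp: test_fun_def)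
qed

lemma b_shift_unit:
  assumes "0 \<le> t" "t + h \<le> T"
  shows "((\<lambda>s. b 0 (s - t)) has_integral 1) {0..T}"
proof -
  have "(b 0 has_integral 1) {0..h}"
    using b_unit integrable_integral[OF integrable_continuous_interval[OF b_continuous[of "{0..h}" 0]]] by simp
  then have "(b 0 has_integral 1) {- t..T - t}"
    by (rule has_integral_on_superset) (use assms h_pos b_vanish in auto)
  from has_integral_shift_real_ivl[OF this, of "- t"] show ?thesis by simp
qed

lemma b_reflect_integral_le: "integral {0..L} (\<lambda>t. b 0 (s - t)) \<le> 1"
proof -
  have "integral {0..L} (\<lambda>t. b 0 (s - t)) = integral {- L..0} (\<lambda>x. b 0 (x + s))"
    using Henstock_Kurzweil_Integration.integral_reflect_real[of 0 "- L" "\<lambda>x. b 0 (x + s)"] by simp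
  also have "\<dots> = integral {s - L..s} (b 0)"
    using integral_shift_Icc_real[of "- L" 0 "b 0" s] by (simp add: o_def add.commute)
  also have "\<dots> \<le> integral {min 0 (s - L)..max h s} (b 0)"
    by (intro integral_subset_le integrable_continuous_interval b_continuous) (auto simp: b_nonneg)
  also have "\<dots> = 1"
  proof -
    have "(b 0 has_integral 1) {0..h}"
      using b_unit integrable_integral[OF integrable_continuous_interval[OF b_continuous[of "{0..h}" 0]]] by simp
    then have "(b 0 has_integral 1) {min 0 (s - L)..max h s}"
      by (rule has_integral_on_superset) (use h_pos b_vanish in auto)
    then show ?thesis by (rule integral_unique)
  qed
  finally show ?thesis .
qed

text \<open>The conditions on t put 0 and T outside the support of the translate, so the boundary
  terms vanish.\<close>

lemma b_parts:
  fixes f f' :: "real \<Rightarrow> real"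
  assumes t: "0 \<le> t" "t + h \<le> T"
    and f: "\<And>s. s \<in> {0..T} \<Longrightarrow> (f has_real_derivative f' s) (at s within {0..T})"
    and f': "continuous_on {0..T} f'"
  shows "integral {0..T} (\<lambda>s. b (Suc k) (s - t) * f s) = - integral {0..T} (\<lambda>s. b k (s - t) * f' s)"
proof -
  have T: "0 \<le> T" using t h_pos by simp
  have cf: "continuous_on {0..T} f" using f DERIV_continuous_on by blast
  have "((\<lambda>s. b (Suc k) (s - t) * f s + f' s * b k (s - t)) has_integral
      (b k (T - t) * f T - b k (0 - t) * f 0)) {0..T}"
    using DERIV_mult[OF b_shift_deriv f] T
    by (intro fundamental_theorem_of_calculus) (auto simp: has_real_derivative_iff_has_vector_derivative)
  moreover have "b k (T - t) = 0" "b k (0 - t) = 0" using t h_pos by (auto intro!: b_vanish)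
  ultimately have "((\<lambda>s. b (Suc k) (s - t) * f s + b k (s - t) * f' s) has_integral 0) {0..T}"
    by (simp add: mult.commute)
  moreover have i: "(\<lambda>s. b (Suc k) (s - t) * f s) integrable_on {0..T}" "(\<lambda>s. b k (s - t) * f' s) integrable_on {0..T}"
    by (intro integrable_continuous_interval continuous_intros b_shift_continuous cf f')+
  ultimately have "integral {0..T} (\<lambda>s. b (Suc k) (s - t) * f s) + integral {0..T} (\<lambda>s. b k (s - t) * f' s) = 0"
    using Henstock_Kurzweil_Integration.integral_add[OF i] by (simp add: integral_unique)
  then show ?thesis by simp
qed

lemma b_approx:
  fixes f :: "real \<Rightarrow> real"
  assumes "continuous_on {0..T} f" "h \<le> T" "\<And>s. s \<in> {0..h} \<Longrightarrow> \<bar>f s - f 0\<bar> \<le> e"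
  shows "\<bar>integral {0..T} (\<lambda>s. b 0 (s - 0) * f s) - f 0\<bar> \<le> e"
proof -
  have u: "((\<lambda>s. b 0 (s - 0)) has_integral 1) {0..T}" using b_shift_unit[of 0 T] assms(2) by simp
  have i: "(\<lambda>s. b 0 (s - 0) * f s) integrable_on {0..T}"
    by (intro integrable_continuous_interval continuous_intros b_shift_continuous assms)
  have "((\<lambda>s. b 0 (s - 0) * f s - b 0 (s - 0) * f 0) has_integral
      (integral {0..T} (\<lambda>s. b 0 (s - 0) * f s) - 1 * f 0)) {0..T}"
    by (intro has_integral_diff has_integral_mult_left u integrable_integral i)
  then have eq: "integral {0..T} (\<lambda>s. b 0 (s - 0) * f s) - f 0 = integral {0..T} (\<lambda>s. b 0 (s - 0) * f s - b 0 (s - 0) * f 0)"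
    by (simp add: has_integral_iff)
  have "norm (integral {0..T} (\<lambda>s. b 0 (s - 0) * f s - b 0 (s - 0) * f 0)) \<le> integral {0..T} (\<lambda>s. b 0 (s - 0) * e)"
  proof (rule integral_norm_bound_integral)
    show "(\<lambda>s. b 0 (s - 0) * f s - b 0 (s - 0) * f 0) integrable_on {0..T}" "(\<lambda>s. b 0 (s - 0) * e) integrable_on {0..T}"
      by (intro integrable_continuous_interval continuous_intros b_shift_continuous assms)+
    fix s assume s: "s \<in> {0..T}"
    show "norm (b 0 (s - 0) * f s - b 0 (s - 0) * f 0) \<le> b 0 (s - 0) * e"
    proof (cases "s \<le> h")
      case True
      then have "b 0 s * \<bar>f s - f 0\<bar> \<le> b 0 s * e" using assms(3)[of s] s by (intro mult_left_mono b_nonneg) auto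
      then show ?thesis by (simp add: right_diff_distrib[symmetric] abs_mult b_nonneg)
    next
      case False
      then have "b 0 s = 0" using h_pos by (intro b_vanish) auto
      then show ?thesis by simp
    qed
  qed
  also have "\<dots> = e" using has_integral_mult_left[OF u, of e] by (simp add: has_integral_iff)
  finally show ?thesis using eq by simp
qed

text \<open>Young's inequality for a probability density: Jensen at each t, then Tonelli, where b 0
  (s - t) has mass at most 1 as a function of t in [0,L]. The bound does not depend on h.\<close>

lemma b_convolution_L2_bound:
  assumes g: "g \<in> L2 {0<..<T}" and L: "0 \<le> L" "L + h \<le> T"
  shows "(\<integral>\<^sup>+t. ennreal ((\<integral>s. g s * b 0 (s - t) \<partial>lebesgue_on {0<..<T})\<^sup>2) \<partial>lebesgue_on {0..L})
    \<le> ennreal (\<integral>s. (g s)\<^sup>2 \<partial>lebesgue_on {0<..<T})"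
proof -
  let ?Mt = "lebesgue_on {0..L}" and ?Ms = "lebesgue_on {0<..<T}"
  interpret Mt: finite_measure ?Mt by (rule finite_measure_lebesgue_on) auto
  interpret Ms: finite_measure ?Ms by (rule finite_measure_lebesgue_on) auto
  interpret P: pair_sigma_finite ?Mt ?Ms ..
  have gm[measurable]: "g \<in> borel_measurable ?Ms" and g2: "integrable ?Ms (\<lambda>s. (g s)\<^sup>2)" using g by (auto simp: L2_def)
  have bm[measurable]: "b 0 \<in> borel_measurable borel" by (intro borel_measurable_continuous_onI b_continuous)
  have "(\<lambda>(t, s). b 0 (s - t)) \<in> borel_measurable (borel \<Otimes>\<^sub>M borel)" by measurable
  then have km[measurable]: "(\<lambda>(t, s). b 0 (s - t)) \<in> borel_measurable (?Mt \<Otimes>\<^sub>M ?Ms)" by (rule borel_pair_lebesgue_on)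
  have sm[measurable]: "(\<lambda>s. b 0 (s - t)) \<in> borel_measurable ?Ms" for t
    by (rule borel_measurable_lebesgue_onI) measurable
  have "bounded (b 0 ` {0..h})" by (intro compact_imp_bounded compact_continuous_image b_continuous) simp
  then obtain B where "\<forall>x\<in>{0..h}. \<bar>b 0 x\<bar> \<le> B" by (auto simp: bounded_iff)
  then have B: "\<bar>b 0 x\<bar> \<le> max B 0" for x
    using b_vanish[of x 0] h_pos by (cases "x \<in> {0..h}") (auto simp: le_max_iff_disj)
  have bint: "integrable ?Ms (\<lambda>s. f s * b 0 (s - t))" if f: "integrable ?Ms f" for f t
  proof (rule Bochner_Integration.integrable_bound)
    show "integrable ?Ms (\<lambda>s. max B 0 * f s)" using f by simp
    show "(\<lambda>s. f s * b 0 (s - t)) \<in> borel_measurable ?Ms" using f by measurable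
    show "AE s in ?Ms. norm (f s * b 0 (s - t)) \<le> norm (max B 0 * f s)"
      using B by (intro AE_I2) (auto simp: abs_mult mult.commute intro!: mult_left_mono)
  qed
  have one: "(\<lambda>s. 1) \<in> L2 {0<..<T}" by (simp add: L2_def)
  have g1: "integrable ?Ms g" using L2_mult_integrable[OF g one] by simp
  have sq: "(\<integral>s. g s * b 0 (s - t) \<partial>?Ms)\<^sup>2 \<le> (\<integral>s. (g s)\<^sup>2 * b 0 (s - t) \<partial>?Ms)" if t: "t \<in> {0..L}" for t
  proof -
    define c where "c = (\<integral>s. g s * b 0 (s - t) \<partial>?Ms)"
    have u: "(\<integral>s. 1 * b 0 (s - t) \<partial>?Ms) = 1"
    proof -
      have "(\<integral>s. 1 * b 0 (s - t) \<partial>?Ms) = integral {0<..<T} (\<lambda>s. 1 * b 0 (s - t))"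
        by (intro lebesgue_integral_eq_integral bint) auto
      also have "\<dots> = 1"
      proof -
        have "((\<lambda>s. b 0 (s - t)) has_integral 1) {0..T}" using t L by (intro b_shift_unit) auto
        from integral_unique[OF this] show ?thesis by (simp add: integral_open_interval_real)
      qed
      finally show ?thesis .
    qed
    \<comment> \<open>Jensen for the square: the variance of g under the density b 0 (s - t) is
      nonnegative.\<close>
    have "0 \<le> (\<integral>s. (g s - c)\<^sup>2 * b 0 (s - t) \<partial>?Ms)" by (intro integral_nonneg_AE AE_I2) (simp add: b_nonneg)
    also have "\<dots> = (\<integral>s. (g s)\<^sup>2 * b 0 (s - t) - (2 * c) * (g s * b 0 (s - t)) + c\<^sup>2 * (1 * b 0 (s - t)) \<partial>?Ms)"
      by (intro Bochner_Integration.integral_cong refl) (simp add: power2_diff algebra_simps)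
    also have "\<dots> = (\<integral>s. (g s)\<^sup>2 * b 0 (s - t) \<partial>?Ms) - (2 * c) * c + c\<^sup>2 * 1"
      using bint[OF g2, of t] bint[OF g1, of t] bint[of "\<lambda>s. 1" t] u by (simp add: c_def)
    finally show ?thesis by (simp add: c_def power2_eq_square)
  qed
  have "(\<integral>\<^sup>+t. ennreal ((\<integral>s. g s * b 0 (s - t) \<partial>?Ms)\<^sup>2) \<partial>?Mt) \<le> (\<integral>\<^sup>+t. (\<integral>\<^sup>+s. ennreal ((g s)\<^sup>2 * b 0 (s - t)) \<partial>?Ms) \<partial>?Mt)"
  proof (rule nn_integral_mono)
    fix t assume "t \<in> space ?Mt"
    then have t: "t \<in> {0..L}" by simp
    have "(\<integral>\<^sup>+s. ennreal ((g s)\<^sup>2 * b 0 (s - t)) \<partial>?Ms) = ennreal (\<integral>s. (g s)\<^sup>2 * b 0 (s - t) \<partial>?Ms)"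
      using bint[OF g2, of t] by (intro nn_integral_eq_integral) (auto simp: b_nonneg)
    then show "ennreal ((\<integral>s. g s * b 0 (s - t) \<partial>?Ms)\<^sup>2) \<le> (\<integral>\<^sup>+s. ennreal ((g s)\<^sup>2 * b 0 (s - t)) \<partial>?Ms)"
      using sq[OF t] by (simp add: ennreal_leI)
  qed
  also have "\<dots> = (\<integral>\<^sup>+s. (\<integral>\<^sup>+t. ennreal ((g s)\<^sup>2 * b 0 (s - t)) \<partial>?Mt) \<partial>?Ms)"
    by (rule P.Fubini'[symmetric]) measurable
  also have "\<dots> \<le> (\<integral>\<^sup>+s. ennreal ((g s)\<^sup>2) \<partial>?Ms)"
  proof (rule nn_integral_mono)
    fix s
    have c: "continuous_on {0..L} (\<lambda>t. b 0 (s - t))"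
      by (rule continuous_on_compose2[OF b_continuous[of UNIV]]) (auto intro!: continuous_intros)
    have bt: "integrable ?Mt (\<lambda>t. b 0 (s - t))" by (rule continuous_imp_integrable_real[OF c])
    have "(\<integral>\<^sup>+t. ennreal ((g s)\<^sup>2 * b 0 (s - t)) \<partial>?Mt) = ennreal (\<integral>t. (g s)\<^sup>2 * b 0 (s - t) \<partial>?Mt)"
      using bt by (intro nn_integral_eq_integral) (auto simp: b_nonneg)
    also have "(\<integral>t. (g s)\<^sup>2 * b 0 (s - t) \<partial>?Mt) = (g s)\<^sup>2 * integral {0..L} (\<lambda>t. b 0 (s - t))"
      using lebesgue_integral_eq_integral[OF bt] by simp
    also have "\<dots> \<le> (g s)\<^sup>2 * 1" by (intro mult_left_mono b_reflect_integral_le) simp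
    finally show "(\<integral>\<^sup>+t. ennreal ((g s)\<^sup>2 * b 0 (s - t)) \<partial>?Mt) \<le> ennreal ((g s)\<^sup>2)"
      by (simp add: ennreal_leI)
  qed
  also have "\<dots> = ennreal (\<integral>s. (g s)\<^sup>2 \<partial>?Ms)" using g2 by (intro nn_integral_eq_integral) auto
  finally show ?thesis .
qed

end

section \<open>Regularity of the data by mollification in time\<close>

context degenerate_wave
begin

text \<open>The hypothesis \<open>weak\<close> is the twice integrated equation \<open>V'' = - A V\<close> with data \<open>(\<xi>, v0)\<close>, tested against
  the range of \<open>Kop = A\<^sup>-\<^sup>1\<close>; \<open>trace\<close> says that \<open>V\<^sub>x(\<cdot>, 1)\<close> has the distributional derivative \<open>g\<close>.
  Mollifying \<open>V'\<close> in time gives a solution smooth enough for the observability estimate, whose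
  energy at time 0 stays bounded as the mollification parameter tends to 0.\<close>

lemma mollified_bounds:
  assumes C: "\<And>z. norm (R z) \<le> C * norm z" "0 \<le> C"
    and V: "continuous_on {0..T} V" and g: "g \<in> L2 {0<..<T}"
    and weak: "\<And>\<tau> w. \<tau> \<in> {0..T} \<Longrightarrow> V \<tau> \<bullet> Kop w = \<xi> \<bullet> Kop w + \<tau> * (v0 \<bullet> Kop w)
        - integral {0..\<tau>} (\<lambda>s. integral {0..s} (\<lambda>r. V r \<bullet> w))"
    and trace: "\<And>\<phi> q. test_fun T \<phi> \<Longrightarrow> Kop q = integral {0..T} (\<lambda>s. deriv \<phi> s *\<^sub>R V s)
        \<Longrightarrow> tau q = - (\<integral>s. g s * \<phi> s \<partial>lebesgue_on {0<..<T})"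
    and moll: "mollifier h b" and h: "h \<le> T"
  defines "\<chi>1 \<equiv> \<lambda>w s. v0 \<bullet> Kop w - integral {0..s} (\<lambda>r. V r \<bullet> w)"
  shows "\<exists>p q. ((T - h) * (2 - \<alpha>) / 2 - 2 * (1 + C)) * (((norm p)\<^sup>2 + (norm q)\<^sup>2) / 2) \<le> (\<integral>s. (g s)\<^sup>2 \<partial>lebesgue_on {0<..<T}) / 2
     \<and> (\<forall>w. p \<bullet> Kop w = - integral {0..T} (\<lambda>s. b 0 (s - 0) * (V s \<bullet> w)))
     \<and> (\<forall>w. q \<bullet> S (Kop w) = integral {0..T} (\<lambda>s. b 0 (s - 0) * \<chi>1 w s))"
proof -
  interpret mollifier h b by (rule moll)
  define L where "L = T - h"
  have L: "0 \<le> L" "L + h \<le> T" using h by (auto simp: L_def)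
  have T: "0 < T" using h h_pos by simp
  \<comment> \<open>Up to the sign (-1)^k the k-th time derivative of the mollified V, since
    differentiating b k (s - t) in t gives -b (Suc k) (s - t).\<close>
  define U where "U = (\<lambda>k t. integral {0..T} (\<lambda>s. b k (s - t) *\<^sub>R V s))"
  have ci: "continuous_on {0..T} (\<lambda>s. V s \<bullet> w)" for w by (intro continuous_intros V)
  have bV: "(\<lambda>s. b k (s - t) *\<^sub>R V s) integrable_on {0..T}" for k t
    by (intro integrable_continuous_interval continuous_intros b_shift_continuous V)
  have U_inner: "U k t \<bullet> w = integral {0..T} (\<lambda>s. b k (s - t) * (V s \<bullet> w))" for k t w
    using integral_linear[OF bV bounded_linear_inner_left[of w], of k t] by (simp add: U_def o_def)
  have dU: "(U k has_vector_derivative - U (Suc k) t) (at t within {0..L})" if t: "t \<in> {0..L}" for k t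
  proof -
    have "((\<lambda>t. integral (cbox 0 T) (\<lambda>s. b k (s - t) *\<^sub>R V s)) has_vector_derivative
        integral (cbox 0 T) (\<lambda>s. (- b (Suc k) (s - t)) *\<^sub>R V s)) (at t within {0..L})"
    proof (rule leibniz_rule_vector_derivative)
      show "((\<lambda>t. b k (s - t) *\<^sub>R V s) has_vector_derivative (- b (Suc k) (s - t)) *\<^sub>R V s) (at t within {0..L})" for t s
        using b_shift_deriv_left[of k s t "{0..L}"]
        by (intro has_vector_derivative_scaleR[where g'=0, THEN has_vector_derivative_eq_rhs]) auto
      show "(\<lambda>s. b k (s - t) *\<^sub>R V s) integrable_on cbox 0 T" for t using bV by simp
      show "continuous_on ({0..L} \<times> cbox 0 T) (\<lambda>(t, s). (- b (Suc k) (s - t)) *\<^sub>R V s)"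
        unfolding case_prod_beta
        by (intro continuous_intros continuous_on_compose2[OF b_continuous[of UNIV "Suc k"]] continuous_on_compose2[OF V]) auto
    qed (use t in auto)
    then show ?thesis by (simp add: U_def[abs_def])
  qed
  have iV: "(\<lambda>r. V r \<bullet> w) integrable_on {0..T}" for w by (intro integrable_continuous_interval ci)
  have d0: "((\<lambda>s. integral {0..s} (\<lambda>r. V r \<bullet> w)) has_real_derivative V s \<bullet> w) (at s within {0..T})" if "s \<in> {0..T}" for s w
    by (rule integral_has_real_derivative[OF ci that])
  then have c1: "continuous_on {0..T} (\<lambda>s. integral {0..s} (\<lambda>r. V r \<bullet> w))" for w by (rule DERIV_continuous_on)
  have c\<chi>: "continuous_on {0..T} (\<chi>1 w)" for w unfolding \<chi>1_def by (intro continuous_intros c1)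
  have d1: "(\<chi>1 w has_real_derivative - (V s \<bullet> w)) (at s within {0..T})" if "s \<in> {0..T}" for s w
    unfolding \<chi>1_def using DERIV_diff[OF DERIV_const d0[OF that]] by simp
  \<comment> \<open>Paired with \<open>Kop w\<close>, the merely continuous V is twice
    differentiable: its derivative is \<chi>1, and by \<open>d1\<close> the second one is -(V s
    \<bullet> w).\<close>
  have d2: "((\<lambda>s. V s \<bullet> Kop w) has_real_derivative \<chi>1 w s) (at s within {0..T})" if s: "s \<in> {0..T}" for s w
  proof -
    have "((\<lambda>s. \<xi> \<bullet> Kop w + s * (v0 \<bullet> Kop w) - integral {0..s} (\<lambda>s. integral {0..s} (\<lambda>r. V r \<bullet> w)))
        has_real_derivative \<chi>1 w s) (at s within {0..T})"
      unfolding \<chi>1_def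
      by (rule DERIV_cong[OF DERIV_diff[OF DERIV_add[OF DERIV_const DERIV_cmult_right[OF DERIV_ident]]
            integral_has_real_derivative[OF c1 s]]]) simp
    then show ?thesis
      unfolding has_field_derivative_def
      by (rule has_derivative_transform[OF s, rotated]) (simp add: weak)
  qed
  \<comment> \<open>Two integrations by parts move two derivatives from the mollifier to V \<bullet>
    Kop w; this is the equation V'' = -A V with the inverse of A applied.\<close>
  have K_U: "Kop (U (Suc (Suc k)) t) = - U k t" if t: "t \<in> {0..L}" for k t
  proof -
    have t': "0 \<le> t" "t + h \<le> T" using t L by auto
    have "Kop (U (Suc (Suc k)) t) \<bullet> w = - U k t \<bullet> w" for w
    proof -
      have "Kop (U (Suc (Suc k)) t) \<bullet> w = integral {0..T} (\<lambda>s. b (Suc (Suc k)) (s - t) * (V s \<bullet> Kop w))"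
        by (simp add: Kop_adjoint U_inner)
      also have "\<dots> = - integral {0..T} (\<lambda>s. b (Suc k) (s - t) * \<chi>1 w s)"
        by (rule b_parts[OF t' d2 c\<chi>])
      also have "integral {0..T} (\<lambda>s. b (Suc k) (s - t) * \<chi>1 w s) = - integral {0..T} (\<lambda>s. b k (s - t) * - (V s \<bullet> w))"
        by (rule b_parts[OF t' d1]) (auto intro!: continuous_intros V)
      finally show ?thesis by (simp add: U_inner)
    qed
    then show ?thesis by (metis vector_eq_rdot)
  qed
  have tau_U: "tau (- U 3 t) = - (\<integral>s. g s * b 0 (s - t) \<partial>lebesgue_on {0<..<T})" if t: "t \<in> {0..L}" for t
  proof (rule trace)
    show "test_fun T (\<lambda>s. b 0 (s - t))" using t L by (intro test_fun_shift) auto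
    have "Kop (- U 3 t) = U 1 t"
      using K_U[OF t, of 1] bounded_linear.linear[OF bounded_linear_Kop]
      by (simp add: linear_neg numeral_3_eq_3)
    then show "Kop (- U 3 t) = integral {0..T} (\<lambda>s. deriv (\<lambda>s. b 0 (s - t)) s *\<^sub>R V s)"
      unfolding deriv_shift by (simp add: U_def)
  qed
  have dU3: "((\<lambda>t. - U 3 t) has_vector_derivative U 4 t) (at t within {0..L})" if "t \<in> {0..L}" for t
    using has_vector_derivative_minus[OF dU[OF that, of 3]] by simp
  have obs: "(L * (2 - \<alpha>) / 2 - 2 * (1 + C)) * (((norm (U 2 0))\<^sup>2 + (norm (S (- U 3 0)))\<^sup>2) / 2)
    \<le> integral {0..L} (\<lambda>t. (tau (- U 3 t))\<^sup>2) / 2"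
  \<comment> \<open>The observed solution is -U 1, the time derivative of the mollified V and thus a
    regularisation of v. Its derivatives are U 2, -U 3 and U 4.\<close>
  proof (rule observability[where u="\<lambda>t. - U 1 t" and ?u3.0="U 4"])
    fix t assume t: "t \<in> {0..L}"
    show "((\<lambda>t. - U 1 t) has_vector_derivative U 2 t) (at t within {0..L})"
      using has_vector_derivative_minus[OF dU[OF t, of 1]] by (simp add: numeral_2_eq_2)
    show "(U 2 has_vector_derivative - U 3 t) (at t within {0..L})"
      using dU[OF t, of 2] by (simp add: numeral_3_eq_3 numeral_2_eq_2)
    show "- U 1 t = - Kop (- U 3 t)"
      using K_U[OF t, of 1] bounded_linear.linear[OF bounded_linear_Kop]
      by (simp add: linear_neg numeral_3_eq_3)
    show "U 2 t = - Kop (U 4 t)"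
      using K_U[OF t, of 2] by (simp add: numeral_eq_Suc)
  qed (use L dU3 C in auto)
  have c3: "continuous_on {0..L} (\<lambda>t. (tau (- U 3 t))\<^sup>2)"
    by (intro continuous_intros bounded_linear.continuous_on[OF bounded_linear_tau]
        continuous_on_vector_derivative[OF dU3])
  have int_le: "integral {0..L} (\<lambda>t. (tau (- U 3 t))\<^sup>2) \<le> (\<integral>s. (g s)\<^sup>2 \<partial>lebesgue_on {0<..<T})"
  proof -
    have i: "integrable (lebesgue_on {0..L}) (\<lambda>t. (tau (- U 3 t))\<^sup>2)" by (rule continuous_imp_integrable_real[OF c3])
    have "ennreal (integral {0..L} (\<lambda>t. (tau (- U 3 t))\<^sup>2)) = (\<integral>\<^sup>+t. ennreal ((tau (- U 3 t))\<^sup>2) \<partial>lebesgue_on {0..L})"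
      using nn_integral_eq_integral[OF i] lebesgue_integral_eq_integral[OF i] by simp
    also have "\<dots> = (\<integral>\<^sup>+t. ennreal ((\<integral>s. g s * b 0 (s - t) \<partial>lebesgue_on {0<..<T})\<^sup>2) \<partial>lebesgue_on {0..L})"
      by (intro nn_integral_cong) (simp add: tau_U)
    also have "\<dots> \<le> ennreal (\<integral>s. (g s)\<^sup>2 \<partial>lebesgue_on {0<..<T})"
      by (rule b_convolution_L2_bound[OF g L])
    finally show ?thesis by (subst (asm) ennreal_le_iff) (auto intro: integral_nonneg_AE)
  qed
  have z: "0 \<in> {0..L}" using L by simp
  show ?thesis
  \<comment> \<open>The witnesses stand for -A \<xi> and for the weighted derivative of v0: their
    pairings below are mollifications at time 0 of -V \<bullet> w and of \<chi>1, hence tend to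
    -(\<xi> \<bullet> w) and v0 \<bullet> Kop w as h tends to 0.\<close>
  proof (rule exI[of _ "U 2 0"], rule exI[of _ "S (U 3 0)"], intro conjI allI)
    have "norm (S (- U 3 0)) = norm (S (U 3 0))"
      using bounded_linear.linear[OF bounded_linear_S] by (simp add: linear_neg)
    then show "((T - h) * (2 - \<alpha>) / 2 - 2 * (1 + C)) * (((norm (U 2 0))\<^sup>2 + (norm (S (U 3 0)))\<^sup>2) / 2)
        \<le> (\<integral>s. (g s)\<^sup>2 \<partial>lebesgue_on {0<..<T}) / 2"
      using obs int_le by (simp add: L_def)
    show "U 2 0 \<bullet> Kop w = - integral {0..T} (\<lambda>s. b 0 (s - 0) * (V s \<bullet> w))" for w
      using Kop_adjoint[of "U 2 0" w] K_U[OF z, of 0] U_inner[of 0 0 w] by (simp add: numeral_2_eq_2)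
    have "S (U 3 0) \<bullet> S (Kop w) = - (U 1 0 \<bullet> Kop w)" for w
      using Kop_inner[of "U 3 0" "Kop w"] K_U[OF z, of 1] by (simp add: numeral_3_eq_3)
    moreover have "U 1 0 \<bullet> Kop w = - integral {0..T} (\<lambda>s. b 0 (s - 0) * \<chi>1 w s)" for w
      using b_parts[OF _ _ d2 c\<chi>, of 0 0 w] L(2) h U_inner[of 1 0 "Kop w"] by simp
    ultimately show "S (U 3 0) \<bullet> S (Kop w) = integral {0..T} (\<lambda>s. b 0 (s - 0) * \<chi>1 w s)" for w
      by simp
  qed
qed

text \<open>The first conclusion says that \<xi> lies in the domain of A, so that v1 = -A \<xi> is
  an L^2 function; the second that v0 has a representative in \<open>H1 \<alpha>\<close>. Both are
  Riesz representations of functionals on the range of \<open>Kop\<close>, bounded by limits of the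
  mollified estimates.\<close>

theorem hidden_regularity:
  assumes C: "\<And>z. norm (R z) \<le> C * norm z" "0 \<le> C"
    and T: "T > 8 * (1 + C) / (2 - \<alpha>)"
    and V: "continuous_on {0..T} V" and g: "g \<in> L2 {0<..<T}"
    and weak: "\<And>\<tau> w. \<tau> \<in> {0..T} \<Longrightarrow> V \<tau> \<bullet> Kop w = \<xi> \<bullet> Kop w + \<tau> * (v0 \<bullet> Kop w)
        - integral {0..\<tau>} (\<lambda>s. integral {0..s} (\<lambda>r. V r \<bullet> w))"
    and trace: "\<And>\<phi> q. test_fun T \<phi> \<Longrightarrow> Kop q = integral {0..T} (\<lambda>s. deriv \<phi> s *\<^sub>R V s)
        \<Longrightarrow> tau q = - (\<integral>s. g s * \<phi> s \<partial>lebesgue_on {0<..<T})"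
  shows "\<exists>z. \<xi> = Kop z" and "\<exists>z. v0 = R (Pi z)"
proof -
  have "0 < 8 * (1 + C) / (2 - \<alpha>)" using C(2) alpha_less by simp
  then have Tpos: "0 < T" using T by simp
  \<comment> \<open>The observability coefficient in the worst case h = T/2; the hypothesis on T
    makes it positive.\<close>
  define \<kappa> where "\<kappa> = T * (2 - \<alpha>) / 4 - 2 * (1 + C)"
  have \<kappa>: "\<kappa> > 0" using T alpha_less by (simp add: \<kappa>_def field_simps)
  define N where "N = (\<integral>s. (g s)\<^sup>2 \<partial>lebesgue_on {0<..<T})"
  define B where "B = sqrt (N / \<kappa>)"
  define \<chi>1 where "\<chi>1 = (\<lambda>w s. v0 \<bullet> Kop w - integral {0..s} (\<lambda>r. V r \<bullet> w))"
  have ci: "continuous_on {0..T} (\<lambda>s. V s \<bullet> w)" for w by (intro continuous_intros V)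
  have "continuous_on {0..T} (\<lambda>s. integral {0..s} (\<lambda>r. V r \<bullet> w))" for w
    by (intro indefinite_integral_continuous_1 integrable_continuous_interval ci)
  then have c\<chi>: "continuous_on {0..T} (\<chi>1 w)" for w unfolding \<chi>1_def by (intro continuous_intros)
  \<comment> \<open>\<open>Kop\<close> is symmetric and injective, so its range separates
    points.\<close>
  have inj: "x = y" if "\<And>w. x \<bullet> Kop w = y \<bullet> Kop w" for x y
  proof -
    have "Kop (x - y) \<bullet> w = 0" for w using that[of w] by (simp add: Kop_adjoint inner_diff_left)
    from this[of "Kop (x - y)"] have "x - y = 0" by (rule Kop_injective[OF inner_eq_zero_iff[THEN iffD1]])
    then show ?thesis by simp
  qed
  have V0: "V 0 = \<xi>" by (rule inj) (use weak[of 0] Tpos in simp)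
  have modulus: "\<exists>d>0. \<forall>s\<in>{0..T}. s < d \<longrightarrow> \<bar>f s - f 0\<bar> \<le> e"
    if f: "continuous_on {0..T} f" and e: "e > 0" for f :: "real \<Rightarrow> real" and e
  proof -
    have "0 \<in> {0..T}" using Tpos by simp
    from f[unfolded continuous_on_iff, rule_format, OF this e]
    obtain d where "d > 0" "\<forall>s\<in>{0..T}. dist s 0 < d \<longrightarrow> dist (f s) (f 0) < e" by blast
    then show ?thesis by (intro exI[of _ d]) (auto simp: dist_real_def less_imp_le)
  qed
  \<comment> \<open>The width h depends on w and e, the constant B does not; therefore e may tend to
    0 separately for each w.\<close>
  have bounds: "\<bar>\<xi> \<bullet> w\<bar> \<le> B * norm (Kop w) + e \<and> \<bar>v0 \<bullet> Kop w\<bar> \<le> B * norm (S (Kop w)) + e" if e: "e > 0" for w e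
  proof -
    obtain d1 where d1: "d1 > 0" "\<forall>s\<in>{0..T}. s < d1 \<longrightarrow> \<bar>V s \<bullet> w - V 0 \<bullet> w\<bar> \<le> e" using modulus[OF ci e] by blast
    obtain d2 where d2: "d2 > 0" "\<forall>s\<in>{0..T}. s < d2 \<longrightarrow> \<bar>\<chi>1 w s - \<chi>1 w 0\<bar> \<le> e" using modulus[OF c\<chi> e] by blast
    define h where "h = min (min d1 d2) T / 2"
    have h: "0 < h" "h \<le> T / 2" "h \<le> T" "h < d1" "h < d2" using d1(1) d2(1) Tpos by (auto simp: h_def)
    obtain b :: "nat \<Rightarrow> real \<Rightarrow> real" where bb:
      "\<And>k x. (b k has_real_derivative b (Suc k) x) (at x)" "\<And>x. 0 \<le> b 0 x"
      "\<And>k x. x \<le> h / 3 \<or> 2 * h / 3 \<le> x \<Longrightarrow> b k x = 0" "integral {0..h} (b 0) = 1"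
      by (rule exists_smooth_mollifier[OF h(1)]) blast
    have b: "mollifier h b" by (rule mollifier.intro) (fact h(1) bb)+
    interpret mollifier h b by (rule b)
    obtain p q where pq: "((T - h) * (2 - \<alpha>) / 2 - 2 * (1 + C)) * (((norm p)\<^sup>2 + (norm q)\<^sup>2) / 2) \<le> N / 2"
      "p \<bullet> Kop w = - integral {0..T} (\<lambda>s. b 0 (s - 0) * (V s \<bullet> w))"
      "q \<bullet> S (Kop w) = integral {0..T} (\<lambda>s. b 0 (s - 0) * \<chi>1 w s)"
      using mollified_bounds[OF C V g weak trace b h(3)] unfolding N_def \<chi>1_def by blast
    have "T * (2 - \<alpha>) / 4 \<le> (T - h) * (2 - \<alpha>) / 2"
      using mult_right_mono[of "T / 2" "T - h" "2 - \<alpha>"] h(2) alpha_less by simp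
    then have "\<kappa> * (((norm p)\<^sup>2 + (norm q)\<^sup>2) / 2) \<le> ((T - h) * (2 - \<alpha>) / 2 - 2 * (1 + C)) * (((norm p)\<^sup>2 + (norm q)\<^sup>2) / 2)"
      unfolding \<kappa>_def by (intro mult_right_mono) auto
    with pq(1) have "(norm p)\<^sup>2 + (norm q)\<^sup>2 \<le> N / \<kappa>"
      using \<kappa> by (simp add: field_simps)
    then have "(norm p)\<^sup>2 \<le> N / \<kappa>" "(norm q)\<^sup>2 \<le> N / \<kappa>"
      using zero_le_power2[of "norm p"] zero_le_power2[of "norm q"] by linarith+
    then have nb: "norm p \<le> B" "norm q \<le> B" unfolding B_def by (auto intro: real_le_rsqrt)
    have "\<bar>integral {0..T} (\<lambda>s. b 0 (s - 0) * (V s \<bullet> w)) - V 0 \<bullet> w\<bar> \<le> e"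
      by (rule b_approx[OF ci h(3)]) (use d1(2) h in auto)
    moreover have "\<bar>p \<bullet> Kop w\<bar> \<le> B * norm (Kop w)"
      by (rule order_trans[OF Cauchy_Schwarz_ineq2 mult_right_mono[OF nb(1)]]) simp
    ultimately have 1: "\<bar>\<xi> \<bullet> w\<bar> \<le> B * norm (Kop w) + e" unfolding V0[symmetric] using pq(2) by linarith
    have "\<bar>integral {0..T} (\<lambda>s. b 0 (s - 0) * \<chi>1 w s) - \<chi>1 w 0\<bar> \<le> e"
      by (rule b_approx[OF c\<chi> h(3)]) (use d2(2) h in auto)
    moreover have "\<bar>q \<bullet> S (Kop w)\<bar> \<le> B * norm (S (Kop w))"
      by (rule order_trans[OF Cauchy_Schwarz_ineq2 mult_right_mono[OF nb(2)]]) simp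
    moreover have "\<chi>1 w 0 = v0 \<bullet> Kop w" by (simp add: \<chi>1_def)
    ultimately have "\<bar>v0 \<bullet> Kop w\<bar> \<le> B * norm (S (Kop w)) + e" using pq(3) by linarith
    with 1 show ?thesis by blast
  qed
  have b1: "\<bar>\<xi> \<bullet> w\<bar> \<le> B * norm (Kop w)" for w
    by (rule field_le_epsilon) (use bounds in blast)
  have b2: "\<bar>v0 \<bullet> Kop w\<bar> \<le> B * norm (S (Kop w))" for w
    by (rule field_le_epsilon) (use bounds in blast)
  have lK: "linear Kop" by (rule bounded_linear.linear[OF bounded_linear_Kop])
  have lSK: "linear (\<lambda>w. S (Kop w))"
    by (rule bounded_linear.linear[OF bounded_linear_compose[OF bounded_linear_S bounded_linear_Kop]])
  obtain z where z: "\<forall>w. \<xi> \<bullet> w = z \<bullet> Kop w"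
    using Riesz_representation_on_range[OF lK bounded_linear.linear[OF bounded_linear_inner_right] b1] by blast
  have "\<xi> = Kop z" by (rule inj) (use z in \<open>simp add: Kop_adjoint\<close>)
  then show "\<exists>z. \<xi> = Kop z" by blast
  have lv: "linear (\<lambda>w. v0 \<bullet> Kop w)"
    by (rule bounded_linear.linear[OF bounded_linear_compose[OF bounded_linear_inner_right bounded_linear_Kop]])
  obtain y where y: "\<forall>w. v0 \<bullet> Kop w = y \<bullet> S (Kop w)"
    using Riesz_representation_on_range[OF lSK lv b2] by blast
  have "v0 = R (Pi y)"
    by (rule inj) (simp add: y[rule_format] R_adjoint Pi_adjoint S_def)
  then show "\<exists>z. v0 = R (Pi z)" by blast
qed

end

section \<open>Solutions by transposition\<close>

text \<open>Exchanging the two quantifiers requires a measurable exceptional set. The set where P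
  fails need not be one, so it is enlarged to a measurable null set N first.\<close>

lemma AE_lborel_sections:
  assumes "AE z in (lborel :: (real \<times> real) measure). P z"
  shows "AE x in lborel. AE y in lborel. P (x, y)" and "AE y in lborel. AE x in lborel. P (x, y)"
proof -
  have ae: "AE z in lborel \<Otimes>\<^sub>M lborel. P z" by (subst lborel_prod) (rule assms)
  then show "AE x in lborel. AE y in lborel. P (x, y)" by (rule lborel_pair.AE_pair)
  obtain N where N: "N \<in> null_sets (lborel \<Otimes>\<^sub>M lborel)" "{z \<in> space (lborel \<Otimes>\<^sub>M lborel). \<not> P z} \<subseteq> N"
    using ae unfolding eventually_ae_filter by blast
  have "AE z in lborel \<Otimes>\<^sub>M lborel. z \<notin> N" using N(1) by (rule AE_not_in)
  then have "AE x in lborel. AE y in lborel. (x, y) \<notin> N" by (rule lborel_pair.AE_pair)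
  moreover have "N \<in> sets (lborel \<Otimes>\<^sub>M lborel)" using N(1) by auto
  then have "{z \<in> space (lborel \<Otimes>\<^sub>M lborel). (fst z, snd z) \<notin> N} \<in> sets (lborel \<Otimes>\<^sub>M lborel)"
    using sets.compl_sets[of N "lborel \<Otimes>\<^sub>M lborel"] by (simp add: space_pair_measure Compl_eq_Diff_UNIV[symmetric] Compl_eq)
  ultimately have "AE y in lborel. AE x in lborel. (x, y) \<notin> N"
    using lborel_pair.AE_commute[of "\<lambda>x y. (x, y) \<notin> N"] by simp
  then show "AE y in lborel. AE x in lborel. P (x, y)"
    by (elim eventually_mono) (use N(2) in \<open>auto simp: space_pair_measure\<close>)
qed

lemma AE_lebesgue_on_iff:
  assumes "S \<in> sets lebesgue"
  shows "(AE x in lebesgue_on S. P x) \<longleftrightarrow> (AE x in lborel. x \<in> S \<longrightarrow> P x)"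
  using assms by (subst AE_restrict_space_iff) (simp_all add: AE_completion_iff)

lemma integral_lebesgue_on_subset:
  fixes f :: "real \<Rightarrow> real"
  assumes "S \<subseteq> A" "S \<in> sets lebesgue" "A \<in> sets lebesgue" "\<And>x. x \<in> A \<Longrightarrow> H x = indicator S x"
  shows "(\<integral>x. f x \<partial>lebesgue_on S) = (\<integral>x. H x * f x \<partial>lebesgue_on A)"
proof -
  have "(\<integral>x. f x \<partial>lebesgue_on S) = (\<integral>x. indicator S x *\<^sub>R f x \<partial>lebesgue)"
    using assms by (intro integral_restrict_space) simp
  also have "\<dots> = (\<integral>x. indicator A x *\<^sub>R (H x * f x) \<partial>lebesgue)"
    using assms by (intro Bochner_Integration.integral_cong) (auto simp: indicator_def)
  also have "\<dots> = (\<integral>x. H x * f x \<partial>lebesgue_on A)"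
    using assms by (intro integral_restrict_space[symmetric]) simp
  finally show ?thesis .
qed

lemma integral_lebesgue_on_Ioo_continuous:
  fixes f :: "real \<Rightarrow> real"
  assumes "continuous_on {a..b} f"
  shows "integrable (lebesgue_on {a<..<b}) f" "(\<integral>x. f x \<partial>lebesgue_on {a<..<b}) = integral {a..b} f"
proof -
  have "f absolutely_integrable_on {a<..<b}"
    using absolutely_integrable_continuous_real[OF assms] by (simp add: absolutely_integrable_on_Icc_iff_Ioo)
  then show i: "integrable (lebesgue_on {a<..<b}) f" by (simp add: absolutely_integrable_imp_integrable)
  show "(\<integral>x. f x \<partial>lebesgue_on {a<..<b}) = integral {a..b} f"
    using lebesgue_integral_eq_integral[OF i] by (simp add: integral_open_interval_real)
qed

text \<open>The type \<open>l2\<close> is tied to (0,1), whereas time integrals live on (0,T). The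
  case d = 0 is separate because the minimiser c = -b/d of the quadratic does not exist there; a
  suitable c would make the expression -1.\<close>

lemma L2_Cauchy_Schwarz:
  assumes f: "f \<in> L2 S" and g: "g \<in> L2 S"
  shows "\<bar>\<integral>x. f x * g x \<partial>lebesgue_on S\<bar> \<le> L2_nrm S f * L2_nrm S g"
proof -
  define a b d where "a = (\<integral>x. (f x)\<^sup>2 \<partial>lebesgue_on S)" and "b = (\<integral>x. f x * g x \<partial>lebesgue_on S)"
    and "d = (\<integral>x. (g x)\<^sup>2 \<partial>lebesgue_on S)"
  have i: "integrable (lebesgue_on S) (\<lambda>x. (f x)\<^sup>2)" "integrable (lebesgue_on S) (\<lambda>x. (g x)\<^sup>2)"
    "integrable (lebesgue_on S) (\<lambda>x. f x * g x)"
    using f g L2_mult_integrable[OF f g] by (auto simp: L2_def)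
  have q: "0 \<le> a + 2 * c * b + c\<^sup>2 * d" for c
  proof -
    have "0 \<le> (\<integral>x. (f x + c * g x)\<^sup>2 \<partial>lebesgue_on S)" by (intro integral_nonneg_AE AE_I2) simp
    also have "\<dots> = (\<integral>x. (f x)\<^sup>2 + (2 * c) * (f x * g x) + c\<^sup>2 * (g x)\<^sup>2 \<partial>lebesgue_on S)"
      by (intro Bochner_Integration.integral_cong refl) (simp add: power2_sum power_mult_distrib algebra_simps)
    also have "\<dots> = a + 2 * c * b + c\<^sup>2 * d"
      using i by (simp add: a_def b_def d_def)
    finally show ?thesis .
  qed
  have nn: "0 \<le> a" "0 \<le> d" unfolding a_def d_def by (intro integral_nonneg_AE AE_I2, simp)+
  have "b\<^sup>2 \<le> a * d"
  proof (cases "d = 0")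
    case True
    have "b = 0"
    proof (rule ccontr)
      assume "b \<noteq> 0"
      then have "a + 2 * (- (a + 1) / (2 * b)) * b = - 1" by (simp add: field_simps)
      then show False using q[of "- (a + 1) / (2 * b)"] True by simp
    qed
    then show ?thesis using nn by simp
  next
    case False
    then have d: "d > 0" using nn by simp
    have "0 \<le> a + 2 * (- b / d) * b + (- b / d)\<^sup>2 * d" by (rule q)
    also have "\<dots> = a - b\<^sup>2 / d" using d by (simp add: power2_eq_square field_simps)
    finally show ?thesis using d by (simp add: field_simps)
  qed
  then have "\<bar>b\<bar> \<le> sqrt (a * d)" by (intro real_le_rsqrt) simp
  then show ?thesis by (simp add: L2_nrm_def a_def b_def d_def real_sqrt_mult)
qed

lemma integral_abs_le_norm_cl:
  assumes "f \<in> L2 I01"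
  shows "integrable M01 (\<lambda>x. \<bar>f x\<bar>)" "(\<integral>x. \<bar>f x\<bar> \<partial>M01) \<le> norm (cl f)"
proof -
  have a: "(\<lambda>x. \<bar>f x\<bar>) \<in> L2 I01" by (rule L2_bounded[OF assms]) (use assms in auto)
  then show "integrable M01 (\<lambda>x. \<bar>f x\<bar>)" using L2_mult_integrable[OF a one_L2] by simp
  have "(\<integral>x. \<bar>f x\<bar> \<partial>M01) = cl (\<lambda>x. \<bar>f x\<bar>) \<bullet> cl (\<lambda>x. 1)" by (simp add: inner_cl a one_L2)
  also have "\<dots> \<le> norm (cl (\<lambda>x. \<bar>f x\<bar>)) * norm (cl (\<lambda>x. 1))" by (rule norm_cauchy_schwarz)
  also have "\<dots> = norm (cl f)" using norm_cl[OF a] norm_cl[OF assms] by (simp add: norm_cl_one L2_nrm_def)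
  finally show "(\<integral>x. \<bar>f x\<bar> \<partial>M01) \<le> norm (cl f)" .
qed

lemma inner_cl_rep:
  assumes "f \<in> L2 I01"
  shows "cl f \<bullet> w = (\<integral>x. f x * rep w x \<partial>M01)"
  using inner_cl[OF assms rep_L2[of w]] by simp

lemma time_Fubini:
  fixes k :: "real \<Rightarrow> real \<Rightarrow> real" and \<beta> :: "real \<Rightarrow> real"
  assumes k: "case_prod k \<in> borel_measurable (borel \<Otimes>\<^sub>M borel)"
    and B: "\<And>t s. t \<in> {0<..<T} \<Longrightarrow> s \<in> {0<..<S} \<Longrightarrow> \<bar>k t s\<bar> \<le> B"
    and \<beta>: "integrable (lebesgue_on {0<..<T}) \<beta>"
  shows "(\<integral>t. \<beta> t * (\<integral>s. k t s \<partial>lebesgue_on {0<..<S}) \<partial>lebesgue_on {0<..<T})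
    = (\<integral>s. (\<integral>t. \<beta> t * k t s \<partial>lebesgue_on {0<..<T}) \<partial>lebesgue_on {0<..<S})"
proof -
  let ?Mt = "lebesgue_on {0<..<T}" and ?Ms = "lebesgue_on {0<..<S}"
  interpret Mt: finite_measure ?Mt by (rule finite_measure_lebesgue_on) auto
  interpret Ms: finite_measure ?Ms by (rule finite_measure_lebesgue_on) auto
  interpret P: pair_sigma_finite ?Mt ?Ms ..
  have [measurable]: "case_prod k \<in> borel_measurable (?Mt \<Otimes>\<^sub>M ?Ms)" by (rule borel_pair_lebesgue_on[OF k])
  have bm[measurable]: "\<beta> \<in> borel_measurable ?Mt" using \<beta> by auto
  have m: "(\<lambda>(t, s). \<beta> t * k t s) \<in> borel_measurable (?Mt \<Otimes>\<^sub>M ?Ms)" by measurable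
  have c: "integrable (?Mt \<Otimes>\<^sub>M ?Ms) (\<lambda>(t, s). B * \<beta> t)"
  proof (rule P.Fubini_integrable)
    show "integrable ?Mt (\<lambda>t. \<integral>s. norm (case (t, s) of (t, s) \<Rightarrow> B * \<beta> t) \<partial>?Ms)" using \<beta> by (simp add: abs_mult)
  qed auto
  have i: "integrable (?Mt \<Otimes>\<^sub>M ?Ms) (\<lambda>(t, s). \<beta> t * k t s)"
  proof (rule Bochner_Integration.integrable_bound[OF c m])
    show "AE z in ?Mt \<Otimes>\<^sub>M ?Ms. norm (case z of (t, s) \<Rightarrow> \<beta> t * k t s) \<le> norm (case z of (t, s) \<Rightarrow> B * \<beta> t)"
    proof (rule AE_I2)
      fix z assume "z \<in> space (?Mt \<Otimes>\<^sub>M ?Ms)"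
      then obtain t s where z: "z = (t, s)" "t \<in> {0<..<T}" "s \<in> {0<..<S}" by (auto simp: space_pair_measure)
      have "\<bar>\<beta> t\<bar> * \<bar>k t s\<bar> \<le> \<bar>\<beta> t\<bar> * \<bar>B\<bar>" using B[OF z(2,3)] by (intro mult_left_mono) auto
      then show "norm (case z of (t, s) \<Rightarrow> \<beta> t * k t s) \<le> norm (case z of (t, s) \<Rightarrow> B * \<beta> t)"
        using z by (simp add: abs_mult mult.commute)
    qed
  qed
  have "(\<integral>s. (\<integral>t. \<beta> t * k t s \<partial>?Mt) \<partial>?Ms) = (\<integral>t. (\<integral>s. \<beta> t * k t s \<partial>?Ms) \<partial>?Mt)"
    using i by (intro P.Fubini_integral) simp
  then show ?thesis by simp
qed

text \<open>The error of the difference quotient is at most |s - t|, also across the corner at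
  \<sigma>. This is the time regularity that \<open>C1_L2\<close> asks of the explicit backward
  solutions.\<close>

lemma positive_part_square_difference_quotient:
  fixes \<sigma> :: real
  shows "((\<lambda>s. ((max (s - \<sigma>) 0)\<^sup>2 / 2 - (max (t - \<sigma>) 0)\<^sup>2 / 2) / (s - t) - max (t - \<sigma>) 0) \<longlongrightarrow> 0) (at t within A)"
proof (rule Lim_null_comparison)
  show "((\<lambda>s. \<bar>s - t\<bar>) \<longlongrightarrow> 0) (at t within A)"
    by (rule tendsto_eq_intros refl | simp)+
  have "\<bar>((max (s - \<sigma>) 0)\<^sup>2 / 2 - (max (t - \<sigma>) 0)\<^sup>2 / 2) / (s - t) - max (t - \<sigma>) 0\<bar> \<le> \<bar>s - t\<bar>" if "s \<noteq> t" for s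
  proof -
    define a b where "a = max (s - \<sigma>) 0" and "b = max (t - \<sigma>) 0"
    have ab: "0 \<le> a" "0 \<le> b" "\<bar>a - b\<bar> \<le> \<bar>s - t\<bar>" by (auto simp: a_def b_def max_def)
    have sq: "(s - t)\<^sup>2 = \<bar>s - t\<bar> * \<bar>s - t\<bar>" by (simp add: power2_eq_square)
    have "\<bar>a\<^sup>2 / 2 - b\<^sup>2 / 2 - b * (s - t)\<bar> \<le> \<bar>s - t\<bar> * \<bar>s - t\<bar>"
    proof -
      consider "\<sigma> \<le> s" "\<sigma> \<le> t" | "s < \<sigma>" "t < \<sigma>" | "s < \<sigma>" "\<sigma> \<le> t" | "\<sigma> \<le> s" "t < \<sigma>" by linarith
      then show ?thesis
      proof cases
        case 1
        then have "a\<^sup>2 / 2 - b\<^sup>2 / 2 - b * (s - t) = (s - t)\<^sup>2 / 2"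
          by (simp add: a_def b_def power2_eq_square field_simps)
        then show ?thesis unfolding sq[symmetric] by (simp only:) simp
      next
        case 3
        then have a: "a = 0" and b: "b = t - \<sigma>" "0 \<le> b" "b \<le> t - s" by (auto simp: a_def b_def)
        have "a\<^sup>2 / 2 - b\<^sup>2 / 2 - b * (s - t) = b * ((t - s) - b / 2)" by (simp add: a power2_eq_square algebra_simps)
        moreover have "0 \<le> b * ((t - s) - b / 2)" using b by simp
        moreover have "b * ((t - s) - b / 2) \<le> (t - s) * (t - s)" using b by (intro mult_mono) auto
        ultimately have "\<bar>a\<^sup>2 / 2 - b\<^sup>2 / 2 - b * (s - t)\<bar> \<le> (t - s) * (t - s)" by (simp only: abs_of_nonneg)
        moreover have "\<bar>s - t\<bar> = t - s" using 3 by simp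
        ultimately show ?thesis by (simp only:)
      next
        case 4
        then have b: "b = 0" and a: "0 \<le> a" "a \<le> s - t" by (auto simp: a_def b_def)
        have "a\<^sup>2 / 2 \<le> (s - t)\<^sup>2" using power_mono[OF a(2,1), of 2] zero_le_power2[of a] by linarith
        then show ?thesis unfolding sq[symmetric] by (simp add: b)
      qed (simp add: a_def b_def)
    qed
    moreover have "(a\<^sup>2 / 2 - b\<^sup>2 / 2) / (s - t) - b = (a\<^sup>2 / 2 - b\<^sup>2 / 2 - b * (s - t)) / (s - t)"
      using that by (simp add: diff_divide_distrib)
    ultimately show ?thesis
      using that by (simp add: a_def[symmetric] b_def[symmetric] abs_divide divide_le_eq)
  qed
  then show "\<forall>\<^sub>F s in at t within A. norm (((max (s - \<sigma>) 0)\<^sup>2 / 2 - (max (t - \<sigma>) 0)\<^sup>2 / 2) / (s - t) - max (t - \<sigma>) 0) \<le> \<bar>s - t\<bar>"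
    by (simp add: eventually_at_filter)
qed

text \<open>The first conclusion is the weak form of the second derivative of (t - \<sigma>)_+^2 / 2
  being the indicator of t > \<sigma>. On [\<sigma>,T] the boundary terms vanish since t - \<sigma>
  is 0 at \<sigma> and \<phi> is 0 at T.\<close>

lemma test_fun_parts:
  fixes \<phi> :: "real \<Rightarrow> real" and T \<sigma> :: real
  assumes \<phi>: "test_fun T \<phi>" and \<sigma>: "0 \<le> \<sigma>" "\<sigma> \<le> T"
  shows "(\<integral>t. - max (t - \<sigma>) 0 * deriv \<phi> t - hv \<sigma> t * \<phi> t \<partial>lebesgue_on {0<..<T}) = 0"
    and "continuous_on A \<phi>" and "continuous_on A (deriv \<phi>)"
proof -
  have d0: "\<phi> differentiable (at t)" and d1: "deriv \<phi> differentiable (at t)" for t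
    using \<phi>[unfolded test_fun_def, THEN conjunct1, rule_format, of 0 t]
      \<phi>[unfolded test_fun_def, THEN conjunct1, rule_format, of 1 t] by simp_all
  show c0: "continuous_on A \<phi>" for A
    using d0 by (auto intro!: continuous_at_imp_continuous_on differentiable_imp_continuous_within)
  show c1: "continuous_on A (deriv \<phi>)" for A
    using d1 by (auto intro!: continuous_at_imp_continuous_on differentiable_imp_continuous_within)
  have "T \<notin> closure {t. \<phi> t \<noteq> 0}" using \<phi> by (auto simp: test_fun_def)
  then have \<phi>T: "\<phi> T = 0" using closure_subset[of "{t. \<phi> t \<noteq> 0}"] by blast
  let ?D = "\<lambda>t. - max (t - \<sigma>) 0 * deriv \<phi> t - hv \<sigma> t * \<phi> t"
  have "(?D has_integral 0) {0..\<sigma>}"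
    by (rule has_integral_is_0) (auto simp: hv_def)
  moreover have "(?D has_integral 0) {\<sigma>..T}"
  proof -
    have "((\<lambda>t. (t - \<sigma>) * deriv \<phi> t + \<phi> t) has_integral ((T - \<sigma>) * \<phi> T - (\<sigma> - \<sigma>) * \<phi> \<sigma>)) {\<sigma>..T}"
    proof (rule fundamental_theorem_of_calculus[OF \<sigma>(2)])
      fix t
      have "(\<phi> has_real_derivative deriv \<phi> t) (at t)" using d0[of t] by (simp add: DERIV_deriv_iff_real_differentiable)
      from DERIV_mult[OF DERIV_diff[OF DERIV_ident DERIV_const[of \<sigma>]] this]
      have "((\<lambda>t. (t - \<sigma>) * \<phi> t) has_real_derivative (t - \<sigma>) * deriv \<phi> t + \<phi> t) (at t)"
        by (simp add: ac_simps)
      then have "((\<lambda>t. (t - \<sigma>) * \<phi> t) has_real_derivative (t - \<sigma>) * deriv \<phi> t + \<phi> t) (at t within {\<sigma>..T})"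
        by (rule has_field_derivative_at_within)
      then show "((\<lambda>t. (t - \<sigma>) * \<phi> t) has_vector_derivative (t - \<sigma>) * deriv \<phi> t + \<phi> t) (at t within {\<sigma>..T})"
        by (simp add: has_real_derivative_iff_has_vector_derivative)
    qed
    then have "((\<lambda>t. - ((t - \<sigma>) * deriv \<phi> t + \<phi> t)) has_integral - 0) {\<sigma>..T}"
      using \<phi>T by (intro has_integral_neg) simp
    then have "((\<lambda>t. - ((t - \<sigma>) * deriv \<phi> t + \<phi> t)) has_integral 0) {\<sigma>..T}" by simp
    then show ?thesis
      by (rule has_integral_spike_finite[of "{\<sigma>}", rotated 2]) (auto simp: hv_def max_def algebra_simps)
  qed
  ultimately have D: "(?D has_integral 0) {0..T}"
    using has_integral_combine[of 0 \<sigma> T ?D 0 0] \<sigma> by simp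
  have i: "integrable (lebesgue_on {0<..<T}) (\<lambda>t. - max (t - \<sigma>) 0 * deriv \<phi> t)" "integrable (lebesgue_on {0<..<T}) \<phi>"
    by (intro integral_lebesgue_on_Ioo_continuous(1) continuous_intros c0 c1)+
  have "integrable (lebesgue_on {0<..<T}) (\<lambda>t. hv \<sigma> t * \<phi> t)"
    by (rule Bochner_Integration.integrable_bound[OF i(2)])
      (use i(2) Lebesgue_section(1)[OF hv_borel, of \<sigma> "{0<..<T}"] in \<open>auto simp: hv_def\<close>)
  then have "integrable (lebesgue_on {0<..<T}) ?D" using i(1) by simp
  from lebesgue_integral_eq_integral[OF this]
  have "(\<integral>t. ?D t \<partial>lebesgue_on {0<..<T}) = integral {0..T} ?D" by (simp add: integral_open_interval_real)
  then show "(\<integral>t. ?D t \<partial>lebesgue_on {0<..<T}) = 0" using D by (simp add: integral_unique)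
qed

lemma L2_nrm_cmult: "L2_nrm S (\<lambda>x. c * f x) = \<bar>c\<bar> * L2_nrm S f"
  by (simp add: L2_nrm_def power_mult_distrib real_sqrt_mult)

lemma L2_abs: "f \<in> L2 S \<Longrightarrow> (\<lambda>x. \<bar>f x\<bar>) \<in> L2 S"
  by (rule L2_bounded[of f]) auto

section \<open>Explicit backward solutions\<close>

context degenerate_wave
begin

lemma kernel_fun_scaleR: "kernel_fun wker (rep (c *\<^sub>R z)) x = c * kernel_fun wker (rep z) x"
proof -
  have m: "wker x \<in> borel_measurable M01" by (rule Lebesgue_section(1)[OF wker_borel])
  have "kernel_fun wker (rep (c *\<^sub>R z)) x = (\<integral>y. c * (wker x y * rep z y) \<partial>M01)"
    unfolding kernel_fun_def
    by (rule integral_cong_AE) (use m rep_scaleR[of c z] in \<open>auto elim: eventually_mono\<close>)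
  then show ?thesis by (simp add: kernel_fun_def)
qed

lemma cl_kernel: "cl (kernel_fun wker (rep z)) = R z"
  by (simp add: R_def kernel_op_def)

lemma kernel_L2: "kernel_fun wker (rep z) \<in> L2 I01"
  by (rule kernel_fun_L2(1)[OF HS_wker])

lemma cl_hat_kernel:
  assumes "Pi z = z"
  shows "cl (hat (kernel_fun wker (rep z))) = z"
  by (rule l2_eqI)
    (use rep_cl[OF H1_hat_L2[OF kernel_H1(1)[OF assms]]] kernel_H1(2)[OF assms] in eventually_elim, simp)

lemma H1_nrm_kernel:
  assumes "Pi z = z"
  shows "H1_nrm \<alpha> (kernel_fun wker (rep z)) = sqrt ((norm (R z))\<^sup>2 + (norm z)\<^sup>2)"
proof -
  have "L2_nrm I01 (\<lambda>x. x powr (\<alpha> / 2) * deriv (kernel_fun wker (rep z)) x) = norm z"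
    using norm_cl[OF H1_hat_L2[OF kernel_H1(1)[OF assms]]] cl_hat_kernel[OF assms] by (simp add: hat_def[abs_def])
  moreover have "L2_nrm I01 (kernel_fun wker (rep z)) = norm (R z)"
    using norm_cl[OF kernel_L2[of z]] by (simp add: cl_kernel)
  ultimately show ?thesis by (simp add: H1_nrm_def)
qed

lemma Pi_scaleR: "Pi z = z \<Longrightarrow> Pi (c *\<^sub>R z) = c *\<^sub>R z"
  using bounded_linear.linear[OF bounded_linear_Pi] by (simp add: linear_scale)

text \<open>The weak form of A (Kop w) = w: the left side is the flux form of \<open>Kop w\<close>
  and \<omega>. The projection inside \<open>S\<close> is absorbed because
  \<open>hat \<omega>\<close> is a fixed point of it.\<close>

lemma S_inner_hat:
  assumes "\<omega> \<in> H1 \<alpha>"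
  shows "S w \<bullet> cl (hat \<omega>) = w \<bullet> cl \<omega>"
proof -
  have "S w \<bullet> cl (hat \<omega>) = Rst w \<bullet> cl (hat \<omega>)" by (simp add: S_def Pi_adjoint H1_hat_Pi[OF assms])
  also have "\<dots> = R (cl (hat \<omega>)) \<bullet> w"
    using R_adjoint[of "cl (hat \<omega>)" w] by (simp add: inner_commute)
  finally show ?thesis by (simp only: H1_eq_R[OF assms, symmetric] inner_commute[of _ w])
qed

lemma kernel_fun_borel: "kernel_fun wker (rep z) \<in> borel_measurable borel"
proof -
  have "(\<lambda>w::real \<times> real. (fst w, snd w)) \<in> borel \<Otimes>\<^sub>M M01 \<rightarrow>\<^sub>M borel \<Otimes>\<^sub>M borel"
    by (rule measurable_Pair[OF measurable_fst measurable_compose[OF measurable_snd measurable_ident_lebesgue_on]])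
  moreover note [measurable] = wker_borel rep_borel[of z]
  have "(\<lambda>(x, y). wker x y * rep z y) \<in> borel_measurable (borel \<Otimes>\<^sub>M borel)" by measurable
  ultimately have "(\<lambda>w. case (fst w, snd w) of (x, y) \<Rightarrow> wker x y * rep z y) \<in> borel_measurable (borel \<Otimes>\<^sub>M M01)"
    by (rule measurable_compose)
  then have "(\<lambda>(x, y). wker x y * rep z y) \<in> borel_measurable (borel \<Otimes>\<^sub>M M01)" by (simp add: case_prod_beta)
  then have "(\<lambda>x. \<integral>y. wker x y * rep z y \<partial>M01) \<in> borel_measurable borel"
    by (rule M01.borel_measurable_lebesgue_integral)
  then show ?thesis unfolding kernel_fun_def[abs_def] .
qed

text \<open>For the source \<open>1\<^bsub>t < \<tau>\<^esub> Kop w + (\<tau> - t)\<^sub>+\<^sup>2 / 2 * w\<close> the backward problem has the explicit solution \<open>(\<tau> - t)\<^sub>+\<^sup>2 / 2 * Kop w\<close>.\<close>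

lemma backward_solution_kernel:
  fixes w :: l2 and T \<tau> :: real
  assumes \<tau>: "0 < \<tau>" "\<tau> \<le> T"
  defines "e \<equiv> kernel_fun wker (rep (S w))"
  shows "backward_solution \<alpha> T (\<lambda>t x. hv t \<tau> * e x + (max (\<tau> - t) 0)\<^sup>2 / 2 * rep w x)
     (\<lambda>t x. (max (\<tau> - t) 0)\<^sup>2 / 2 * e x) (\<lambda>t x. - max (\<tau> - t) 0 * e x)"
proof -
  define z where "z = S w"
  have z: "Pi z = z" unfolding z_def by (rule Pi_S)
  \<comment> \<open>The backward problem is defined by reflecting time, which turns (\<tau> - t)_+
    into (t - \<sigma>)_+.\<close>
  define \<sigma> where "\<sigma> = T - \<tau>"
  define Y Y1 where "Y = (\<lambda>t. (max (t - \<sigma>) 0)\<^sup>2 / 2)" and "Y1 = (\<lambda>t. max (t - \<sigma>) 0)"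
  have Y: "(max (\<tau> - (T - t)) 0)\<^sup>2 / 2 = Y t" "max (\<tau> - (T - t)) 0 = Y1 t" "hv (T - t) \<tau> = hv \<sigma> t" for t
    by (auto simp: Y_def Y1_def \<sigma>_def hv_def)
  have Y0: "Y 0 = 0" "Y1 0 = 0" using \<tau> by (auto simp: Y_def Y1_def \<sigma>_def)
  have cY: "continuous_on A Y" "continuous_on A Y1" for A unfolding Y_def Y1_def by (intro continuous_intros; simp)+
  have ye: "(\<lambda>x. c * e x) = kernel_fun wker (rep (c *\<^sub>R z))" for c
    by (simp add: fun_eq_iff kernel_fun_scaleR e_def z_def)
  have yH1: "(\<lambda>x. c * e x) \<in> H1 \<alpha>" for c unfolding ye by (rule kernel_H1(1)[OF Pi_scaleR[OF z]])
  have eL2: "e \<in> L2 I01" unfolding e_def by (rule kernel_L2)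
  have cle: "cl e = Kop w" by (simp add: e_def cl_kernel Kop_def)
  have C0: "C0_H1 \<alpha> T (\<lambda>t x. Y t * e x)"
    unfolding C0_H1_def
  proof (intro ballI conjI yH1)
    fix t assume t: "t \<in> {0..T}"
    have eq: "H1_nrm \<alpha> (\<lambda>x. Y s * e x - Y t * e x) = \<bar>Y s - Y t\<bar> * sqrt ((norm (R z))\<^sup>2 + (norm z)\<^sup>2)" for s
    proof -
      have "(\<lambda>x. Y s * e x - Y t * e x) = kernel_fun wker (rep ((Y s - Y t) *\<^sub>R z))"
        using ye[of "Y s - Y t"] by (simp add: left_diff_distrib)
      then have "H1_nrm \<alpha> (\<lambda>x. Y s * e x - Y t * e x) = sqrt ((norm (R ((Y s - Y t) *\<^sub>R z)))\<^sup>2 + (norm ((Y s - Y t) *\<^sub>R z))\<^sup>2)"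
        by (simp only: H1_nrm_kernel[OF Pi_scaleR[OF z]])
      also have "\<dots> = sqrt ((Y s - Y t)\<^sup>2 * ((norm (R z))\<^sup>2 + (norm z)\<^sup>2))"
        by (simp only: linear_scale[OF bounded_linear.linear[OF bounded_linear_R]] norm_scaleR
            power_mult_distrib power2_abs distrib_left)
      finally show ?thesis by (simp add: real_sqrt_mult)
    qed
    have "(Y \<longlongrightarrow> Y t) (at t within {0..T})" using cY(1)[of "{0..T}"] t by (simp add: continuous_on_def)
    then have "((\<lambda>s. \<bar>Y s - Y t\<bar>) \<longlongrightarrow> 0) (at t within {0..T})"
      using LIM_zero tendsto_rabs_zero by blast
    then show "((\<lambda>s. H1_nrm \<alpha> (\<lambda>x. Y s * e x - Y t * e x)) \<longlongrightarrow> 0) (at t within {0..T})"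
      unfolding eq by (rule tendsto_mult_left_zero)
  qed
  have C1: "C1_L2 T (\<lambda>t x. Y t * e x) (\<lambda>t x. Y1 t * e x)"
    unfolding C1_L2_def
  proof (intro ballI conjI L2_cmult eL2)
    fix t assume t: "t \<in> {0..T}"
    have "((\<lambda>s. \<bar>(Y s - Y t) / (s - t) - Y1 t\<bar>) \<longlongrightarrow> 0) (at t within {0..T})"
      unfolding Y_def Y1_def by (rule tendsto_rabs_zero[OF positive_part_square_difference_quotient])
    from tendsto_mult_left_zero[OF this, of "L2_nrm I01 e"]
    have "((\<lambda>s. L2_nrm I01 (\<lambda>x. ((Y s - Y t) / (s - t) - Y1 t) * e x)) \<longlongrightarrow> 0) (at t within {0..T})"
      by (simp only: L2_nrm_cmult)
    moreover have "(Y s * e x - Y t * e x) / (s - t) - Y1 t * e x = ((Y s - Y t) / (s - t) - Y1 t) * e x" for s x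
      by (simp add: left_diff_distrib[symmetric] times_divide_eq_left[symmetric] del: times_divide_eq_left)
    ultimately show "((\<lambda>s. L2_nrm I01 (\<lambda>x. (Y s * e x - Y t * e x) / (s - t) - Y1 t * e x)) \<longlongrightarrow> 0) (at t within {0..T})"
      by simp
    have "(Y1 \<longlongrightarrow> Y1 t) (at t within {0..T})" using cY(2)[of "{0..T}"] t by (simp add: continuous_on_def)
    then have "((\<lambda>s. \<bar>Y1 s - Y1 t\<bar>) \<longlongrightarrow> 0) (at t within {0..T})"
      using LIM_zero tendsto_rabs_zero by blast
    from tendsto_mult_left_zero[OF this, of "L2_nrm I01 e"]
    have "((\<lambda>s. L2_nrm I01 (\<lambda>x. (Y1 s - Y1 t) * e x)) \<longlongrightarrow> 0) (at t within {0..T})"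
      by (simp only: L2_nrm_cmult)
    then show "((\<lambda>s. L2_nrm I01 (\<lambda>x. Y1 s * e x - Y1 t * e x)) \<longlongrightarrow> 0) (at t within {0..T})"
      by (simp add: left_diff_distrib)
  qed
  have weak: "(\<integral>t. (\<integral>x. - (Y1 t * e x) * \<omega> x * deriv \<phi> t
                    + x powr \<alpha> * deriv (\<lambda>x. Y t * e x) x * deriv \<omega> x * \<phi> t \<partial>M01) \<partial>lebesgue_on {0<..<T})
      = (\<integral>t. (\<integral>x. (hv \<sigma> t * e x + Y t * rep w x) * \<omega> x * \<phi> t \<partial>M01) \<partial>lebesgue_on {0<..<T})"
    if \<omega>: "\<omega> \<in> H1 \<alpha>" and \<phi>: "test_fun T \<phi>" for \<omega> \<phi>
  proof -
    \<comment> \<open>Integrating in x leaves a scalar identity in a and c. The terms with c agree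
      because A (Kop w) = w, those with a by \<open>test_fun_parts\<close>.\<close>
    define a c where "a = Kop w \<bullet> cl \<omega>" and "c = w \<bullet> cl \<omega>"
    have \<omega>L: "\<omega> \<in> L2 I01" by (rule H1_L2[OF \<omega>])
    have i1: "integrable M01 (\<lambda>x. e x * \<omega> x)" "(\<integral>x. e x * \<omega> x \<partial>M01) = a"
      using L2_mult_integrable[OF eL2 \<omega>L] inner_cl[OF eL2 \<omega>L] by (simp_all add: a_def cle)
    have i2: "integrable M01 (\<lambda>x. rep w x * \<omega> x)" "(\<integral>x. rep w x * \<omega> x \<partial>M01) = c"
      using L2_mult_integrable[OF rep_L2 \<omega>L, of w] inner_cl[OF rep_L2 \<omega>L, of w] by (simp_all add: c_def)
    have fl: "integrable M01 (\<lambda>x. x powr \<alpha> * deriv (\<lambda>x. Y t * e x) x * deriv \<omega> x)"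
      "(\<integral>x. x powr \<alpha> * deriv (\<lambda>x. Y t * e x) x * deriv \<omega> x \<partial>M01) = Y t * c" for t
    proof -
      have eq: "x powr \<alpha> * deriv u x * deriv \<omega> x = hat u x * hat \<omega> x" for x u
      proof -
        have "hat u x * hat \<omega> x = (x powr (\<alpha> / 2) * x powr (\<alpha> / 2)) * (deriv u x * deriv \<omega> x)"
          by (simp only: hat_def ac_simps)
        then show ?thesis by (simp add: powr_add[symmetric])
      qed
      show "integrable M01 (\<lambda>x. x powr \<alpha> * deriv (\<lambda>x. Y t * e x) x * deriv \<omega> x)"
        unfolding eq by (intro L2_mult_integrable H1_hat_L2 yH1 \<omega>)
      have "(\<integral>x. x powr \<alpha> * deriv (\<lambda>x. Y t * e x) x * deriv \<omega> x \<partial>M01) = cl (hat (\<lambda>x. Y t * e x)) \<bullet> cl (hat \<omega>)"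
        using flux_form_eq_inner[OF yH1 \<omega>] by (simp add: flux_form_def)
      also have "cl (hat (\<lambda>x. Y t * e x)) = Y t *\<^sub>R z"
        unfolding ye by (rule cl_hat_kernel[OF Pi_scaleR[OF z]])
      finally show "(\<integral>x. x powr \<alpha> * deriv (\<lambda>x. Y t * e x) x * deriv \<omega> x \<partial>M01) = Y t * c"
        using S_inner_hat[OF \<omega>, of w] by (simp add: z_def c_def)
    qed
    have lhs: "(\<integral>x. - (Y1 t * e x) * \<omega> x * deriv \<phi> t + x powr \<alpha> * deriv (\<lambda>x. Y t * e x) x * deriv \<omega> x * \<phi> t \<partial>M01)
        = (- Y1 t * deriv \<phi> t) * a + (Y t * \<phi> t) * c" for t
    proof -
      have "(\<integral>x. - (Y1 t * e x) * \<omega> x * deriv \<phi> t + x powr \<alpha> * deriv (\<lambda>x. Y t * e x) x * deriv \<omega> x * \<phi> t \<partial>M01)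
          = (\<integral>x. (- Y1 t * deriv \<phi> t) * (e x * \<omega> x) + \<phi> t * (x powr \<alpha> * deriv (\<lambda>x. Y t * e x) x * deriv \<omega> x) \<partial>M01)"
        by (intro Bochner_Integration.integral_cong refl) (simp add: ac_simps)
      also have "\<dots> = (- Y1 t * deriv \<phi> t) * a + \<phi> t * (Y t * c)"
        using i1 fl[of t] by (subst Bochner_Integration.integral_add) auto
      finally show ?thesis by (simp add: ac_simps)
    qed
    have rhs: "(\<integral>x. (hv \<sigma> t * e x + Y t * rep w x) * \<omega> x * \<phi> t \<partial>M01) = (hv \<sigma> t * \<phi> t) * a + (Y t * \<phi> t) * c" for t
    proof -
      have "(\<integral>x. (hv \<sigma> t * e x + Y t * rep w x) * \<omega> x * \<phi> t \<partial>M01)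
          = (\<integral>x. (hv \<sigma> t * \<phi> t) * (e x * \<omega> x) + (Y t * \<phi> t) * (rep w x * \<omega> x) \<partial>M01)"
        by (intro Bochner_Integration.integral_cong refl) (simp add: algebra_simps)
      also have "\<dots> = (hv \<sigma> t * \<phi> t) * a + (Y t * \<phi> t) * c"
        using i1 i2 by (subst Bochner_Integration.integral_add) auto
      finally show ?thesis .
    qed
    have \<sigma>: "0 \<le> \<sigma>" "\<sigma> \<le> T" using \<tau> by (auto simp: \<sigma>_def)
    note P = test_fun_parts[OF \<phi> \<sigma>]
    have j: "integrable (lebesgue_on {0<..<T}) (\<lambda>t. - Y1 t * deriv \<phi> t)" "integrable (lebesgue_on {0<..<T}) \<phi>"
      "integrable (lebesgue_on {0<..<T}) (\<lambda>t. Y t * \<phi> t)"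
      by (intro integral_lebesgue_on_Ioo_continuous(1) continuous_intros P(2,3) cY)+
    have j2: "integrable (lebesgue_on {0<..<T}) (\<lambda>t. hv \<sigma> t * \<phi> t)"
      by (rule Bochner_Integration.integrable_bound[OF j(2)])
        (use j(2) Lebesgue_section(1)[OF hv_borel, of \<sigma> "{0<..<T}"] in \<open>auto simp: hv_def\<close>)
    have E: "(\<integral>t. - Y1 t * deriv \<phi> t \<partial>lebesgue_on {0<..<T}) = (\<integral>t. hv \<sigma> t * \<phi> t \<partial>lebesgue_on {0<..<T})"
      using P(1) j(1) j2 unfolding Y1_def by simp
    show ?thesis
      unfolding lhs rhs using j j2 E[symmetric] by simp
  qed
  show ?thesis
    unfolding backward_solution_def weak_solution_def Y(1) unfolding Y(2,3)
    using C0 C1 weak Y0 by simp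
qed

end

lemma cl_cmult: "f \<in> L2 I01 \<Longrightarrow> cl (\<lambda>x. c * f x) = c *\<^sub>R cl f"
  by (rule l2_eqI) (use rep_cl[of f] rep_cl[OF L2_cmult[of f I01 c]] rep_scaleR[of c "cl f"] in \<open>auto elim: eventually_elim2\<close>)

text \<open>\<open>meas_Q\<close> refers to the completed plane measure, whereas Fubini is applied
  on the product sigma-algebra; a Borel version is measurable for the latter. Both kinds of slices
  are recorded: fixed t for the L^2 bounds, fixed x for the formula that defines V.\<close>

lemma borel_version_on_rectangle:
  assumes "meas_Q T f"
  obtains h :: "real \<Rightarrow> real \<Rightarrow> real" where "case_prod h \<in> borel_measurable (borel \<Otimes>\<^sub>M borel)"
    "AE t in lebesgue_on {0<..<T}. AE x in M01. f t x = h t x"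
    "AE x in M01. AE t in lebesgue_on {0<..<T}. f t x = h t x"
proof -
  let ?Q = "{0<..<T} \<times> I01"
  have Q: "?Q \<in> sets borel" by (rule borel_open) (intro open_Times open_greaterThanLessThan)
  have m: "(\<lambda>(t, x). f t x) \<in> borel_measurable (lebesgue_on ?Q)" using assms by (simp add: meas_Q_def)
  obtain g where g: "g \<in> borel_measurable borel" "AE z in lebesgue_on ?Q. (\<lambda>(t, x). f t x) z = g z"
    by (rule AE_lebesgue_on_borel_version[OF m Q])
  define h where "h = (\<lambda>t x. g (t, x))"
  have "case_prod h \<in> borel_measurable (borel \<Otimes>\<^sub>M borel)" using g(1) by (simp add: h_def borel_prod)
  moreover have ae: "AE z in lborel. z \<in> ?Q \<longrightarrow> f (fst z) (snd z) = h (fst z) (snd z)"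
    using g(2) Q by (subst (asm) AE_lebesgue_on_iff) (auto simp: h_def case_prod_beta)
  have "AE t in lebesgue_on {0<..<T}. AE x in M01. f t x = h t x"
  proof -
    have "AE t in lborel. t \<in> {0<..<T} \<longrightarrow> (AE x in lborel. x \<in> I01 \<longrightarrow> f t x = h t x)"
      using AE_lborel_sections(1)[OF ae] by eventually_elim (auto elim: eventually_mono)
    then show ?thesis by (simp add: AE_lebesgue_on_iff)
  qed
  moreover have "AE x in M01. AE t in lebesgue_on {0<..<T}. f t x = h t x"
  proof -
    have "AE x in lborel. x \<in> I01 \<longrightarrow> (AE t in lborel. t \<in> {0<..<T} \<longrightarrow> f t x = h t x)"
      using AE_lborel_sections(2)[OF ae] by eventually_elim (auto elim: eventually_mono)
    then show ?thesis by (simp add: AE_lebesgue_on_iff)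
  qed
  ultimately show ?thesis by (rule that)
qed

lemma meas_QI:
  assumes "case_prod f \<in> borel_measurable (borel \<Otimes>\<^sub>M borel)"
  shows "meas_Q T f"
proof -
  have "(\<lambda>(t, x). f t x) \<in> borel_measurable (borel :: (real \<times> real) measure)" using assms by (simp add: borel_prod)
  then have "(\<lambda>(t, x). f t x) \<in> borel_measurable (lebesgue :: (real \<times> real) measure)"
    by (intro measurable_completion) simp
  then show ?thesis unfolding meas_Q_def by (rule measurable_restrict_space1)
qed

lemma integral_hv_time:
  assumes "0 \<le> t" "t \<le> T"
  shows "(\<integral>r. hv r t \<partial>lebesgue_on {0<..<T}) = t" and "integrable (lebesgue_on {0<..<T}) (\<lambda>r. hv r t)"
proof -
  have "(\<integral>r. hv r t * 1 \<partial>lebesgue_on {0<..<T}) = (\<integral>r. 1 \<partial>lebesgue_on {0<..<t})"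
    using assms by (intro integral_lebesgue_on_subset[symmetric]) (auto simp: hv_def indicator_def)
  then show "(\<integral>r. hv r t \<partial>lebesgue_on {0<..<T}) = t" using assms by (simp add: measure_restrict_space)
  interpret finite_measure "lebesgue_on {0<..<T}" by (rule finite_measure_lebesgue_on) auto
  show "integrable (lebesgue_on {0<..<T}) (\<lambda>r. hv r t)"
    by (rule integrable_const_bound[of _ 1]) (use Lebesgue_section(2)[OF hv_borel] in auto)
qed

lemma integral_hv_from:
  assumes "0 < t" "0 \<le> s"
  shows "(\<integral>r. hv t r \<partial>lebesgue_on {0<..<s}) = max (s - t) 0"
proof -
  have "(\<integral>r. hv t r * 1 \<partial>lebesgue_on {0<..<s}) = (\<integral>r. 1 \<partial>lebesgue_on {t<..<s})"
    using assms by (intro integral_lebesgue_on_subset[symmetric]) (auto simp: hv_def indicator_def)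
  then show ?thesis using assms by (cases "t \<le> s") (auto simp: measure_restrict_space max_def)
qed

lemma integral_positive_part:
  fixes t \<tau> :: real
  assumes "0 \<le> t" "0 \<le> \<tau>"
  shows "(\<integral>s. max (s - t) 0 \<partial>lebesgue_on {0<..<\<tau>}) = (max (\<tau> - t) 0)\<^sup>2 / 2"
proof -
  have "((\<lambda>s. max (s - t) 0) has_integral ((max (\<tau> - t) 0)\<^sup>2 / 2 - (max (0 - t) 0)\<^sup>2 / 2)) {0..\<tau>}"
  proof (rule fundamental_theorem_of_calculus[OF assms(2)])
    fix x
    have "((\<lambda>s. (max (s - t) 0)\<^sup>2 / 2) has_real_derivative max (x - t) 0) (at x within {0..\<tau>})"
      unfolding has_field_derivative_iff
      by (rule LIM_zero_cancel[OF positive_part_square_difference_quotient])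
    then show "((\<lambda>s. (max (s - t) 0)\<^sup>2 / 2) has_vector_derivative max (x - t) 0) (at x within {0..\<tau>})"
      by (simp add: has_real_derivative_iff_has_vector_derivative)
  qed
  then have "integral {0..\<tau>} (\<lambda>s. max (s - t) 0) = (max (\<tau> - t) 0)\<^sup>2 / 2"
    using assms by (simp add: Henstock_Kurzweil_Integration.integral_unique)
  moreover have "(\<integral>s. max (s - t) 0 \<partial>lebesgue_on {0<..<\<tau>}) = integral {0..\<tau>} (\<lambda>s. max (s - t) 0)"
    by (intro integral_lebesgue_on_Ioo_continuous(2) continuous_intros)
  ultimately show ?thesis by simp
qed

section \<open>The transposition identity and the integrated equation for V\<close>

text \<open>Fixes the objects that the hypotheses only assert to exist; vh stands in for v wherever
  joint measurability in (t,x) matters.\<close>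

locale transposed_wave = degenerate_wave +
  fixes T :: real and v0 :: "real \<Rightarrow> real" and v1 :: "(real \<Rightarrow> real) \<Rightarrow> real" and v V vh :: "real \<Rightarrow> real \<Rightarrow> real"
    and \<xi> :: "real \<Rightarrow> real" and Cb :: real
  assumes T_pos: "0 < T" and v0_L2: "v0 \<in> L2 I01" and v1_dual: "v1 \<in> H1_dual \<alpha>"
    and transposition: "transposition_solution \<alpha> T v0 v1 v"
    and xi_H1: "\<xi> \<in> H1 \<alpha>" and xi_flux: "\<And>w. w \<in> H1 \<alpha> \<Longrightarrow> flux_form \<alpha> \<xi> w = - v1 w"
    and V_H1: "\<And>t. t \<in> {0..T} \<Longrightarrow> V t \<in> H1 \<alpha>"
    and V_eq: "\<And>t. t \<in> {0..T} \<Longrightarrow> AE x in M01. V t x = (\<integral>s. v s x \<partial>lebesgue_on {0<..<t}) + \<xi> x"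
    and vh_borel: "case_prod vh \<in> borel_measurable (borel \<Otimes>\<^sub>M borel)"
    and vh_AE: "AE t in lebesgue_on {0<..<T}. AE x in M01. v t x = vh t x"
    and vh_AE': "AE x in M01. AE t in lebesgue_on {0<..<T}. v t x = vh t x"
    and Cb: "0 \<le> Cb" "AE t in lebesgue_on {0<..<T}. v t \<in> L2 I01 \<and> L2_nrm I01 (v t) \<le> Cb"
begin

abbreviation Mt :: "real measure" where "Mt \<equiv> lebesgue_on {0<..<T}"

sublocale Mt: finite_measure Mt by (rule finite_measure_lebesgue_on) auto
sublocale Mt_M01: pair_sigma_finite Mt M01 ..

text \<open>The pairing of v(t) with w, formed with vh so that it is measurable in t.\<close>

definition beta :: "l2 \<Rightarrow> real \<Rightarrow> real" where "beta w t = (\<integral>x. vh t x * rep w x \<partial>M01)"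

lemma vh_measurable [measurable]: "case_prod vh \<in> borel_measurable (Mt \<Otimes>\<^sub>M M01)"
  by (rule borel_pair_lebesgue_on[OF vh_borel])

lemma vh_slice: "AE t in Mt. v t \<in> L2 I01 \<and> vh t \<in> L2 I01 \<and> cl (v t) = cl (vh t) \<and> L2_nrm I01 (vh t) \<le> Cb"
  using vh_AE Cb(2)
proof eventually_elim
  case (elim t)
  have h: "vh t \<in> L2 I01"
    by (rule L2_cong_AE[of "v t"]) (use elim Lebesgue_section(1)[OF vh_borel] in simp_all)
  moreover have c: "cl (v t) = cl (vh t)" by (rule cl_cong_AE) (use elim h in simp_all)
  moreover have "L2_nrm I01 (vh t) \<le> Cb" using elim c norm_cl[of "v t"] norm_cl[OF h] by simp
  ultimately show ?case using elim by simp
qed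

lemma beta_AE: "AE t in Mt. beta w t = cl (v t) \<bullet> w \<and> \<bar>beta w t\<bar> \<le> Cb * norm w"
  using vh_slice
proof eventually_elim
  case (elim t)
  then have e: "beta w t = cl (vh t) \<bullet> w" by (simp add: beta_def inner_cl_rep)
  have "\<bar>beta w t\<bar> \<le> norm (cl (vh t)) * norm w" unfolding e by (rule Cauchy_Schwarz_ineq2)
  also have "\<dots> \<le> Cb * norm w" using elim norm_cl[of "vh t"] by (intro mult_right_mono) auto
  finally show ?case using e elim by simp
qed

lemma beta_measurable [measurable]: "beta w \<in> borel_measurable Mt"
proof -
  have "(\<lambda>(t, x). vh t x * rep w x) \<in> borel_measurable (Mt \<Otimes>\<^sub>M M01)" by measurable
  then have "(\<lambda>t. \<integral>x. vh t x * rep w x \<partial>M01) \<in> borel_measurable Mt"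
    by (rule M01.borel_measurable_lebesgue_integral)
  then show ?thesis unfolding beta_def[abs_def] .
qed

lemma beta_integrable: "integrable Mt (beta w)"
  by (rule Mt.integrable_const_bound[of _ "Cb * norm w"]) (use beta_AE[of w] in \<open>auto elim: eventually_mono\<close>)

lemma vh_rep_integrable: "integrable (Mt \<Otimes>\<^sub>M M01) (\<lambda>(t, x). vh t x * rep w x)"
proof (rule Mt_M01.Fubini_integrable)
  have m: "(\<lambda>(t, x). \<bar>vh t x * rep w x\<bar>) \<in> borel_measurable (Mt \<Otimes>\<^sub>M M01)" by measurable
  have "(\<lambda>t. \<integral>x. \<bar>vh t x * rep w x\<bar> \<partial>M01) \<in> borel_measurable Mt"
    using M01.borel_measurable_lebesgue_integral[OF m] .
  moreover have "AE t in Mt. norm (\<integral>x. \<bar>vh t x * rep w x\<bar> \<partial>M01) \<le> Cb * norm w"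
    using vh_slice
  proof eventually_elim
    case (elim t)
    then have h: "vh t \<in> L2 I01" by simp
    have "\<bar>\<integral>x. \<bar>vh t x\<bar> * \<bar>rep w x\<bar> \<partial>M01\<bar> \<le> L2_nrm I01 (\<lambda>x. \<bar>vh t x\<bar>) * L2_nrm I01 (\<lambda>x. \<bar>rep w x\<bar>)"
      by (intro L2_Cauchy_Schwarz L2_abs h rep_L2)
    also have "\<dots> = L2_nrm I01 (vh t) * norm w" using norm_cl[OF rep_L2[of w]] by (simp add: L2_nrm_def)
    also have "\<dots> \<le> Cb * norm w" using elim by (intro mult_right_mono) auto
    finally show ?case by (simp add: abs_mult)
  qed
  ultimately show "integrable Mt (\<lambda>t. \<integral>x. norm (case (t, x) of (t, x) \<Rightarrow> vh t x * rep w x) \<partial>M01)"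
    by (intro Mt.integrable_const_bound[of _ "Cb * norm w"]) auto
  show "AE t in Mt. integrable M01 (\<lambda>x. case (t, x) of (t, x) \<Rightarrow> vh t x * rep w x)"
    using vh_slice by eventually_elim (auto intro: L2_mult_integrable rep_L2)
qed measurable

text \<open>The definition of V is pointwise in x and integrates v in time. Fubini turns it into a
  statement about classes: <V, w> is an indefinite integral of <v, w>.\<close>

lemma V_inner:
  assumes \<tau>: "\<tau> \<in> {0..T}"
  shows "cl (V \<tau>) \<bullet> w = cl \<xi> \<bullet> w + (\<integral>r. hv r \<tau> * beta w r \<partial>Mt)"
proof -
  have hm[measurable]: "(\<lambda>r. hv r \<tau>) \<in> borel_measurable Mt" by (rule Lebesgue_section(2)[OF hv_borel])
  have i: "integrable (Mt \<Otimes>\<^sub>M M01) (\<lambda>(t, x). hv t \<tau> * (vh t x * rep w x))"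
    by (rule Bochner_Integration.integrable_bound[OF vh_rep_integrable[of w]]) (measurable, auto simp: hv_def)
  have VL: "V \<tau> \<in> L2 I01" and xL: "\<xi> \<in> L2 I01" using V_H1[OF \<tau>] xi_H1 by (auto intro: H1_L2)
  have "AE x in M01. (\<integral>r. v r x \<partial>lebesgue_on {0<..<\<tau>}) = (\<integral>r. hv r \<tau> * vh r x \<partial>Mt)"
    using vh_AE'
  proof eventually_elim
    case (elim x)
    have vm: "(\<lambda>r. vh r x) \<in> borel_measurable Mt" by (rule Lebesgue_section(2)[OF vh_borel])
    have "AE r in Mt. vh r x = v r x" using elim by eventually_elim simp
    then have vm': "(\<lambda>r. v r x) \<in> borel_measurable Mt" by (rule lebesgue_on_measurable_cong_AE[OF vm]) simp
    have "(\<integral>r. v r x \<partial>lebesgue_on {0<..<\<tau>}) = (\<integral>r. hv r \<tau> * v r x \<partial>Mt)"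
      using \<tau> by (intro integral_lebesgue_on_subset) (auto simp: hv_def indicator_def)
    also have "\<dots> = (\<integral>r. hv r \<tau> * vh r x \<partial>Mt)"
      by (rule integral_cong_AE) (use hm vm vm' elim in \<open>auto elim: eventually_mono\<close>)
    finally show ?case .
  qed
  then have "AE x in M01. V \<tau> x - \<xi> x = (\<integral>r. hv r \<tau> * vh r x \<partial>Mt)"
    using V_eq[OF \<tau>] by eventually_elim simp
  then have ae: "AE x in M01. V \<tau> x * rep w x - \<xi> x * rep w x = (\<integral>r. hv r \<tau> * (vh r x * rep w x) \<partial>Mt)"
  proof eventually_elim
    case (elim x)
    have "V \<tau> x * rep w x - \<xi> x * rep w x = (V \<tau> x - \<xi> x) * rep w x" by (rule left_diff_distrib[symmetric])
    also have "\<dots> = (\<integral>r. hv r \<tau> * vh r x * rep w x \<partial>Mt)" unfolding elim by simp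
    finally show ?case by (simp only: mult.assoc)
  qed
  have "cl (V \<tau>) \<bullet> w - cl \<xi> \<bullet> w = (\<integral>x. V \<tau> x * rep w x - \<xi> x * rep w x \<partial>M01)"
    using L2_mult_integrable[OF VL rep_L2[of w]] L2_mult_integrable[OF xL rep_L2[of w]]
    by (simp add: inner_cl_rep VL xL)
  also have "\<dots> = (\<integral>x. (\<integral>r. hv r \<tau> * (vh r x * rep w x) \<partial>Mt) \<partial>M01)"
  proof (rule integral_cong_AE[OF _ _ ae])
    show "(\<lambda>x. V \<tau> x * rep w x - \<xi> x * rep w x) \<in> borel_measurable M01"
      using VL xL rep_measurable[of w] by (intro borel_measurable_diff borel_measurable_times) auto
    have "(\<lambda>(x, r). hv r \<tau> * (vh r x * rep w x)) \<in> borel_measurable (M01 \<Otimes>\<^sub>M Mt)" by measurable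
    then show "(\<lambda>x. \<integral>r. hv r \<tau> * (vh r x * rep w x) \<partial>Mt) \<in> borel_measurable M01"
      by (rule Mt.borel_measurable_lebesgue_integral)
  qed
  also have "\<dots> = (\<integral>r. (\<integral>x. hv r \<tau> * (vh r x * rep w x) \<partial>M01) \<partial>Mt)"
    by (rule Mt_M01.Fubini_integral[OF i])
  also have "\<dots> = (\<integral>r. hv r \<tau> * beta w r \<partial>Mt)" by (simp add: beta_def)
  finally show ?thesis by simp
qed

lemma hv_beta_integrable: "integrable Mt (\<lambda>r. hv r \<tau> * beta w r)"
  by (rule Bochner_Integration.integrable_bound[OF beta_integrable[of w]])
    (use Lebesgue_section(2)[OF hv_borel, of \<tau>] in \<open>auto simp: hv_def\<close>)

text \<open>Testing with the difference w itself: |w|^2 is the integral of <v, w> over (s,t), hence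
  at most Cb (t - s) |w|.\<close>

lemma V_Lipschitz:
  assumes s: "s \<in> {0..T}" and t: "t \<in> {0..T}"
  shows "norm (cl (V t) - cl (V s)) \<le> Cb * \<bar>t - s\<bar>"
proof -
  have le: "norm (cl (V t) - cl (V s)) \<le> Cb * (t - s)" if st: "s \<le> t" and s: "s \<in> {0..T}" and t: "t \<in> {0..T}" for s t
  proof -
    define w where "w = cl (V t) - cl (V s)"
    have "w \<bullet> w = (\<integral>r. hv r t * beta w r \<partial>Mt) - (\<integral>r. hv r s * beta w r \<partial>Mt)"
      unfolding w_def[THEN arg_cong[of _ _ "\<lambda>z. z \<bullet> w"]] by (simp add: inner_diff_left V_inner[OF s] V_inner[OF t])
    also have "\<dots> = (\<integral>r. hv r t * beta w r - hv r s * beta w r \<partial>Mt)"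
      using hv_beta_integrable by simp
    also have "\<dots> \<le> (\<integral>r. (Cb * norm w) * (hv r t - hv r s) \<partial>Mt)"
    proof (rule integral_mono_AE)
      show "integrable Mt (\<lambda>r. hv r t * beta w r - hv r s * beta w r)" using hv_beta_integrable by simp
      show "integrable Mt (\<lambda>r. (Cb * norm w) * (hv r t - hv r s))"
        using integral_hv_time(2)[of t T] integral_hv_time(2)[of s T] s t by simp
      show "AE r in Mt. hv r t * beta w r - hv r s * beta w r \<le> (Cb * norm w) * (hv r t - hv r s)"
        using beta_AE[of w]
      proof eventually_elim
        case (elim r)
        have "hv r s \<le> hv r t" using st by (auto simp: hv_def)
        then have "beta w r * (hv r t - hv r s) \<le> (Cb * norm w) * (hv r t - hv r s)"
          using elim by (intro mult_right_mono) auto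
        then show ?case by (simp add: algebra_simps)
      qed
    qed
    also have "\<dots> = (Cb * norm w) * (t - s)"
      using integral_hv_time[of t T] integral_hv_time[of s T] s t by simp
    finally have "norm w * norm w \<le> (Cb * (t - s)) * norm w"
      by (simp add: power2_norm_eq_inner[symmetric] power2_eq_square ac_simps)
    then have "norm w \<le> Cb * (t - s)"
      using Cb(1) st by (cases "w = 0") (auto simp: mult_le_cancel_right)
    then show ?thesis by (simp add: w_def)
  qed
  show ?thesis
  proof (cases "s \<le> t")
    case True
    then show ?thesis using le[OF True s t] by simp
  next
    case False
    then show ?thesis using le[OF _ t s] by (simp add: norm_minus_commute)
  qed
qed

lemma V_continuous: "continuous_on {0..T} (\<lambda>t. cl (V t))"
proof (rule lipschitz_on_continuous_on)
  show "Cb-lipschitz_on {0..T} (\<lambda>t. cl (V t))"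
    by (rule lipschitz_onI) (use V_Lipschitz Cb(1) in \<open>auto simp: dist_norm dist_real_def\<close>)
qed

lemma source_L1_L2:
  fixes c h :: "real \<Rightarrow> real"
  assumes e: "e \<in> borel_measurable borel" "e \<in> L2 I01" and c: "c \<in> borel_measurable borel" "h \<in> borel_measurable borel"
    and bound: "\<And>t. t \<in> {0<..<T} \<Longrightarrow> \<bar>h t\<bar> \<le> A \<and> \<bar>c t\<bar> \<le> B"
  shows "(\<lambda>t x. h t * e x + c t * rep w x) \<in> L1_L2 T"
proof -
  let ?F = "\<lambda>t x. h t * e x + c t * rep w x"
  note [measurable] = e(1) c rep_borel[of w]
  have b: "case_prod ?F \<in> borel_measurable (borel \<Otimes>\<^sub>M borel)" by measurable
  have FL: "?F t \<in> L2 I01" for t by (intro L2_add L2_cmult e(2) rep_L2)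
  have "case_prod (\<lambda>t x. (?F t x)\<^sup>2) \<in> borel_measurable (borel \<Otimes>\<^sub>M borel)" by measurable
  then have "(\<lambda>(t, x). (?F t x)\<^sup>2) \<in> borel_measurable (Mt \<Otimes>\<^sub>M M01)" by (rule borel_pair_lebesgue_on)
  then have "(\<lambda>t. \<integral>x. (?F t x)\<^sup>2 \<partial>M01) \<in> borel_measurable Mt"
    by (rule M01.borel_measurable_lebesgue_integral)
  then have m: "(\<lambda>t. L2_nrm I01 (?F t)) \<in> borel_measurable Mt" unfolding L2_nrm_def by simp
  have "norm (L2_nrm I01 (?F t)) \<le> A * norm (cl e) + B * norm w" if t: "t \<in> {0<..<T}" for t
  proof -
    have "cl (?F t) = h t *\<^sub>R cl e + c t *\<^sub>R w"
      using cl_add[OF L2_cmult[OF e(2)] L2_cmult[OF rep_L2]] cl_cmult[OF e(2)] cl_cmult[OF rep_L2] by simp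
    then have "L2_nrm I01 (?F t) \<le> \<bar>h t\<bar> * norm (cl e) + \<bar>c t\<bar> * norm w"
      using norm_cl[OF FL[of t]] norm_triangle_ineq[of "h t *\<^sub>R cl e" "c t *\<^sub>R w"] by simp
    also have "\<dots> \<le> A * norm (cl e) + B * norm w"
      using bound[OF t] by (intro add_mono mult_right_mono) auto
    finally show ?thesis using norm_cl[OF FL[of t], symmetric] by simp
  qed
  then have "integrable Mt (\<lambda>t. L2_nrm I01 (?F t))"
    by (intro Mt.integrable_const_bound[OF AE_I2 m]) simp
  then show ?thesis using meas_QI[OF b, of T] FL by (simp add: L1_L2_def)
qed

text \<open>At time 0 the explicit backward solution is \<tau>^2/2 times \<open>Kop w\<close> and
  its time derivative is -\<tau> times \<open>Kop w\<close>. The term with v1 is evaluated by the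
  flux relation for \<xi>, which gives -(\<xi> \<bullet> w) on \<open>Kop w\<close>.\<close>

lemma transposition_identity:
  assumes \<tau>: "0 < \<tau>" "\<tau> \<le> T"
  shows "(\<integral>t. hv t \<tau> * beta (Kop w) t \<partial>Mt) + (\<integral>t. beta w t * ((max (\<tau> - t) 0)\<^sup>2 / 2) \<partial>Mt)
    = \<tau> * (cl v0 \<bullet> Kop w) - \<tau>\<^sup>2 / 2 * (cl \<xi> \<bullet> w)"
proof -
  define e where "e = kernel_fun wker (rep (S w))"
  define c where "c = (\<lambda>t. (max (\<tau> - t) 0)\<^sup>2 / 2)"
  define F where "F = (\<lambda>t x. hv t \<tau> * e x + c t * rep w x)"
  have eL: "e \<in> L2 I01" unfolding e_def by (rule kernel_L2)
  have cle: "cl e = Kop w" by (simp add: e_def cl_kernel Kop_def)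
  have eH: "e \<in> H1 \<alpha>" unfolding e_def by (rule kernel_H1(1)[OF Pi_S])
  have cb: "c \<in> borel_measurable borel" unfolding c_def by measurable
  have hb: "(\<lambda>t. hv t \<tau>) \<in> borel_measurable borel" unfolding hv_def by measurable
  have cB: "\<bar>c t\<bar> \<le> T\<^sup>2 / 2" if "t \<in> {0<..<T}" for t
    using that \<tau> by (auto simp: c_def max_def intro!: power_mono)
  have FQ: "F \<in> L1_L2 T" unfolding F_def
    by (rule source_L1_L2[where A = 1 and B = "T\<^sup>2 / 2"])
      (use cB cb hb eL in \<open>auto simp: e_def kernel_fun_borel\<close>)
  have bs: "backward_solution \<alpha> T F (\<lambda>t x. c t * e x) (\<lambda>t x. - max (\<tau> - t) 0 * e x)"
    unfolding F_def c_def e_def by (rule backward_solution_kernel[OF \<tau>])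
  have "(\<integral>t. (\<integral>x. v t x * F t x \<partial>M01) \<partial>Mt) = - (\<integral>x. v0 x * (- max (\<tau> - 0) 0 * e x) \<partial>M01) + v1 (\<lambda>x. c 0 * e x)"
    using transposition FQ bs unfolding transposition_solution_def by blast
  also have "(\<integral>x. v0 x * (- max (\<tau> - 0) 0 * e x) \<partial>M01) = - \<tau> * (cl v0 \<bullet> Kop w)"
  proof -
    have "(\<integral>x. v0 x * (- max (\<tau> - 0) 0 * e x) \<partial>M01) = (\<integral>x. - \<tau> * (v0 x * e x) \<partial>M01)"
      using \<tau> by (intro Bochner_Integration.integral_cong refl) (simp add: max_def)
    then show ?thesis using inner_cl[OF v0_L2 eL] by (simp add: cle)
  qed
  also have "v1 (\<lambda>x. c 0 * e x) = - \<tau>\<^sup>2 / 2 * (cl \<xi> \<bullet> w)"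
  proof -
    have "v1 e = - (cl (hat \<xi>) \<bullet> cl (hat e))" using xi_flux[OF eH] flux_form_eq_inner[OF xi_H1 eH] by simp
    also have "cl (hat e) = S w" unfolding e_def by (rule cl_hat_kernel[OF Pi_S])
    also have "cl (hat \<xi>) \<bullet> S w = cl \<xi> \<bullet> w" using S_inner_hat[OF xi_H1, of w] by (simp add: inner_commute)
    finally have "v1 e = - (cl \<xi> \<bullet> w)" .
    moreover have "c 0 = \<tau>\<^sup>2 / 2" using \<tau> by (simp add: c_def max_def)
    ultimately have "c 0 * v1 e = - \<tau>\<^sup>2 / 2 * (cl \<xi> \<bullet> w)" by simp
    moreover have "v1 (\<lambda>x. c 0 * e x) = c 0 * v1 e" using v1_dual eH by (simp add: H1_dual_def)
    ultimately show ?thesis by (rule trans[rotated])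
  qed
  also have "(\<integral>t. (\<integral>x. v t x * F t x \<partial>M01) \<partial>Mt) = (\<integral>t. hv t \<tau> * beta (Kop w) t + beta w t * c t \<partial>Mt)"
  proof -
    have ae: "AE t in Mt. hv t \<tau> * beta (Kop w) t + beta w t * c t = (\<integral>x. v t x * F t x \<partial>M01)"
      using vh_slice beta_AE[of w] beta_AE[of "Kop w"]
    proof eventually_elim
      case (elim t)
      then have vL: "v t \<in> L2 I01" by simp
      have "(\<integral>x. v t x * F t x \<partial>M01) = (\<integral>x. hv t \<tau> * (v t x * e x) + c t * (v t x * rep w x) \<partial>M01)"
        by (intro Bochner_Integration.integral_cong refl) (simp add: F_def algebra_simps)
      also have "\<dots> = hv t \<tau> * (cl (v t) \<bullet> Kop w) + c t * (cl (v t) \<bullet> w)"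
        using L2_mult_integrable[OF vL eL] L2_mult_integrable[OF vL rep_L2[of w]]
          inner_cl[OF vL eL] inner_cl_rep[OF vL, of w] by (simp add: cle)
      finally show ?case using elim by simp
    qed
    have m: "(\<lambda>t. hv t \<tau> * beta (Kop w) t + beta w t * c t) \<in> borel_measurable Mt"
      using borel_measurable_lebesgue_onI[OF hb] borel_measurable_lebesgue_onI[OF cb] beta_measurable
      by (intro borel_measurable_add borel_measurable_times)
    have m': "(\<lambda>t. \<integral>x. v t x * F t x \<partial>M01) \<in> borel_measurable Mt"
      by (rule lebesgue_on_measurable_cong_AE[OF m ae]) simp
    show ?thesis by (rule integral_cong_AE[OF m' m]) (use ae in eventually_elim, simp)
  qed
  also have "\<dots> = (\<integral>t. hv t \<tau> * beta (Kop w) t \<partial>Mt) + (\<integral>t. beta w t * c t \<partial>Mt)"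
  proof (rule Bochner_Integration.integral_add[OF hv_beta_integrable])
    have "integrable Mt (\<lambda>t. T\<^sup>2 / 2 * beta w t)" using beta_integrable by simp
    then show "integrable Mt (\<lambda>t. beta w t * c t)"
    proof (rule Bochner_Integration.integrable_bound)
      show "(\<lambda>t. beta w t * c t) \<in> borel_measurable Mt"
        by (intro borel_measurable_times beta_measurable borel_measurable_lebesgue_onI[OF cb])
      show "AE t in Mt. norm (beta w t * c t) \<le> norm (T\<^sup>2 / 2 * beta w t)"
      proof (rule AE_I2)
        fix t assume "t \<in> space Mt"
        then have "\<bar>c t\<bar> * \<bar>beta w t\<bar> \<le> T\<^sup>2 / 2 * \<bar>beta w t\<bar>" by (intro mult_right_mono cB) simp_all
        then show "norm (beta w t * c t) \<le> norm (T\<^sup>2 / 2 * beta w t)" by (simp add: abs_mult mult.commute)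
      qed
    qed
  qed
  finally show ?thesis by (simp add: c_def)
qed

text \<open>Cauchy's formula for iterated integrals: (\<tau> - t)_+^2 / 2 is the integral of (s -
  t)_+ over 0 < s < \<tau>, and (s - t)_+ that of the indicator of t < r over 0 < r < s. The
  innermost integral is <V(r) - \<xi>, w> by \<open>V_inner\<close>, and \<xi> yields the quadratic
  term.\<close>

lemma beta_positive_part_square:
  assumes \<tau>: "\<tau> \<in> {0..T}"
  shows "(\<integral>t. beta w t * ((max (\<tau> - t) 0)\<^sup>2 / 2) \<partial>Mt)
    = integral {0..\<tau>} (\<lambda>s. integral {0..s} (\<lambda>r. cl (V r) \<bullet> w)) - \<tau>\<^sup>2 / 2 * (cl \<xi> \<bullet> w)"
proof -
  have c: "continuous_on {0..T} (\<lambda>r. cl (V r) \<bullet> w)"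
    by (intro continuous_intros V_continuous)
  have inner: "(\<integral>t. beta w t * max (s - t) 0 \<partial>Mt) = integral {0..s} (\<lambda>r. cl (V r) \<bullet> w) - s * (cl \<xi> \<bullet> w)"
    if s: "s \<in> {0..T}" for s
  proof -
    have "(\<integral>t. beta w t * max (s - t) 0 \<partial>Mt) = (\<integral>t. beta w t * (\<integral>r. hv t r \<partial>lebesgue_on {0<..<s}) \<partial>Mt)"
      using s by (intro Bochner_Integration.integral_cong refl) (simp add: integral_hv_from)
    also have "\<dots> = (\<integral>r. (\<integral>t. beta w t * hv t r \<partial>Mt) \<partial>lebesgue_on {0<..<s})"
      by (rule time_Fubini[where B = 1, OF hv_borel _ beta_integrable]) simp
    also have "\<dots> = (\<integral>r. cl (V r) \<bullet> w - cl \<xi> \<bullet> w \<partial>lebesgue_on {0<..<s})"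
      using s by (intro Bochner_Integration.integral_cong refl) (simp add: V_inner mult.commute)
    also have "\<dots> = integral {0..s} (\<lambda>r. cl (V r) \<bullet> w - cl \<xi> \<bullet> w)"
      using s by (intro integral_lebesgue_on_Ioo_continuous(2) continuous_intros continuous_on_subset[OF c]) auto
    also have "\<dots> = integral {0..s} (\<lambda>r. cl (V r) \<bullet> w) - integral {0..s} (\<lambda>r. cl \<xi> \<bullet> w)"
      using s by (intro Henstock_Kurzweil_Integration.integral_diff integrable_continuous_interval
          continuous_intros continuous_on_subset[OF c]) auto
    finally show ?thesis using s by simp
  qed
  have c2: "continuous_on {0..T} (\<lambda>s. integral {0..s} (\<lambda>r. cl (V r) \<bullet> w))"
    by (rule indefinite_integral_continuous_1[OF integrable_continuous_interval[OF c]])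
  have mb: "(\<lambda>(t, s). max (s - t) 0) \<in> borel_measurable (borel \<Otimes>\<^sub>M borel :: (real \<times> real) measure)" by measurable
  have "(\<integral>t. beta w t * ((max (\<tau> - t) 0)\<^sup>2 / 2) \<partial>Mt)
      = (\<integral>t. beta w t * (\<integral>s. max (s - t) 0 \<partial>lebesgue_on {0<..<\<tau>}) \<partial>Mt)"
    using \<tau> by (intro Bochner_Integration.integral_cong refl) (simp add: integral_positive_part)
  also have "\<dots> = (\<integral>s. (\<integral>t. beta w t * max (s - t) 0 \<partial>Mt) \<partial>lebesgue_on {0<..<\<tau>})"
    by (rule time_Fubini[where B = \<tau>, OF mb _ beta_integrable]) (auto simp: max_def)
  also have "\<dots> = (\<integral>s. integral {0..s} (\<lambda>r. cl (V r) \<bullet> w) - s * (cl \<xi> \<bullet> w) \<partial>lebesgue_on {0<..<\<tau>})"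
    using \<tau> by (intro Bochner_Integration.integral_cong refl) (simp add: inner)
  also have "\<dots> = integral {0..\<tau>} (\<lambda>s. integral {0..s} (\<lambda>r. cl (V r) \<bullet> w) - s * (cl \<xi> \<bullet> w))"
    using \<tau> by (intro integral_lebesgue_on_Ioo_continuous(2) continuous_intros continuous_on_subset[OF c2]) auto
  also have "\<dots> = integral {0..\<tau>} (\<lambda>s. integral {0..s} (\<lambda>r. cl (V r) \<bullet> w)) - integral {0..\<tau>} (\<lambda>s. s * (cl \<xi> \<bullet> w))"
    using \<tau> by (intro Henstock_Kurzweil_Integration.integral_diff integrable_continuous_interval
        continuous_intros continuous_on_subset[OF c2]) auto
  also have "integral {0..\<tau>} (\<lambda>s. s * (cl \<xi> \<bullet> w)) = \<tau>\<^sup>2 / 2 * (cl \<xi> \<bullet> w)"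
    using \<tau> ident_has_integral[of 0 \<tau>] by (simp add: Henstock_Kurzweil_Integration.integral_unique)
  finally show ?thesis .
qed

lemma V_weak:
  assumes \<tau>: "\<tau> \<in> {0..T}"
  shows "cl (V \<tau>) \<bullet> Kop w = cl \<xi> \<bullet> Kop w + \<tau> * (cl v0 \<bullet> Kop w)
    - integral {0..\<tau>} (\<lambda>s. integral {0..s} (\<lambda>r. cl (V r) \<bullet> w))"
\<comment> \<open>The transposition identity requires \<tau> > 0, so \<tau> = 0 is checked
  directly.\<close>
proof (cases "\<tau> = 0")
  case True
  have "(\<integral>r. hv r 0 * beta (Kop w) r \<partial>Mt) = (\<integral>r. 0 \<partial>Mt)"
    by (intro Bochner_Integration.integral_cong refl) (simp add: hv_def)
  then show ?thesis using V_inner[OF \<tau>, of "Kop w"] True by simp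
next
  case False
  then show ?thesis
    using transposition_identity[of \<tau> w] beta_positive_part_square[OF \<tau>, of w] V_inner[OF \<tau>, of "Kop w"] \<tau>
    by simp argo
qed

end

section \<open>The normal trace of time averages of V\<close>

text \<open>Approximation of \<open>x\<close> from above by the grid points \<open>\<lceil>x * n\<rceil> / n\<close>, which take countably many values.\<close>

lemma continuous_on_product_measurable:
  fixes V :: "real \<Rightarrow> real \<Rightarrow> real"
  assumes a: "0 < a"
    and c: "\<And>s. s \<in> {0<..<T} \<Longrightarrow> continuous_on {a..1} (V s)"
    and m: "\<And>x. x \<in> {a<..1} \<Longrightarrow> (\<lambda>s. V s x) \<in> borel_measurable (lebesgue_on {0<..<T})"
  shows "(\<lambda>(s, x). hv a x * V s x) \<in> borel_measurable (lebesgue_on {0<..<T} \<Otimes>\<^sub>M M01)"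
proof -
  let ?Mt = "lebesgue_on {0<..<T}"
  \<comment> \<open>Grid points outside (a,1] get the value 0, since measurability in s is only
    known for points inside. Rounding upwards keeps the approximants of x > a above a.\<close>
  define F where "F = (\<lambda>n (i :: int) (z :: real \<times> real). if a < i / real (Suc n) \<and> i / real (Suc n) \<le> 1 then V (fst z) (i / real (Suc n)) else 0)"
  have h: "(\<lambda>z. hv a (snd z)) \<in> borel_measurable (?Mt \<Otimes>\<^sub>M M01)"
    by (rule measurable_compose[OF measurable_snd Lebesgue_section(1)[OF hv_borel]])
  have sm: "snd \<in> ?Mt \<Otimes>\<^sub>M M01 \<rightarrow>\<^sub>M borel"
    by (rule measurable_compose[OF measurable_snd measurable_ident_lebesgue_on])
  have Fm: "F n i \<in> borel_measurable (?Mt \<Otimes>\<^sub>M M01)" for n i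
  proof (cases "a < i / real (Suc n) \<and> i / real (Suc n) \<le> 1")
    case True
    then have "(\<lambda>z. V (fst z) (i / real (Suc n))) \<in> borel_measurable (?Mt \<Otimes>\<^sub>M M01)"
      by (intro measurable_compose[OF measurable_fst m]) simp
    then show ?thesis using True by (simp add: F_def)
  next
    case False
    then show ?thesis unfolding F_def by (simp only: if_False) simp
  qed
  have km: "(\<lambda>z. \<lceil>snd z * real (Suc n)\<rceil>) \<in> ?Mt \<Otimes>\<^sub>M M01 \<rightarrow>\<^sub>M count_space UNIV" for n
    using sm by (intro measurable_compose[OF _ measurable_real_ceiling] borel_measurable_times) simp_all
  have Fk: "(\<lambda>z. hv a (snd z) * F n \<lceil>snd z * real (Suc n)\<rceil> z) \<in> borel_measurable (?Mt \<Otimes>\<^sub>M M01)" for n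
    by (intro borel_measurable_times h measurable_compose_countable[OF Fm km])
  show ?thesis
  proof (rule borel_measurable_LIMSEQ_real[OF _ Fk])
    fix z assume "z \<in> space (?Mt \<Otimes>\<^sub>M M01)"
    then obtain s x where z: "z = (s, x)" "s \<in> {0<..<T}" "0 < x" "x < 1" by (auto simp: space_pair_measure)
    show "(\<lambda>n. hv a (snd z) * F n \<lceil>snd z * real (Suc n)\<rceil> z) \<longlonglongrightarrow> (case z of (s, x) \<Rightarrow> hv a x * V s x)"
    proof (cases "a < x")
      case True
      define y where "y = (\<lambda>n. \<lceil>x * real (Suc n)\<rceil> / real (Suc n))"
      have y: "x \<le> y n" "y n \<le> 1" "y n \<le> x + inverse (real (Suc n))" for n
      proof -
        have p: "0 < real (Suc n)" by simp
        have "x * real (Suc n) \<le> real_of_int \<lceil>x * real (Suc n)\<rceil>" by (rule le_of_int_ceiling)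
        then show "x \<le> y n" unfolding y_def using p by (simp add: pos_le_divide_eq del: of_nat_Suc)
        have "x * real (Suc n) \<le> 1 * real (Suc n)" using z p by (intro mult_right_mono) simp_all
        then have "\<lceil>x * real (Suc n)\<rceil> \<le> int (Suc n)" by (simp add: ceiling_le_iff del: of_nat_Suc)
        then have "real_of_int \<lceil>x * real (Suc n)\<rceil> \<le> real (Suc n)" by linarith
        then show "y n \<le> 1" unfolding y_def using p by (simp add: pos_divide_le_eq del: of_nat_Suc)
        have "real_of_int \<lceil>x * real (Suc n)\<rceil> \<le> x * real (Suc n) + 1" by linarith
        then have "y n \<le> (x * real (Suc n) + 1) / real (Suc n)" unfolding y_def using p by (intro divide_right_mono) simp_all
        also have "\<dots> = x + inverse (real (Suc n))" using p by (simp add: add_divide_distrib inverse_eq_divide del: of_nat_Suc)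
        finally show "y n \<le> x + inverse (real (Suc n))" .
      qed
      have "(\<lambda>n. x + inverse (real (Suc n))) \<longlonglongrightarrow> x + 0"
        by (intro tendsto_intros LIMSEQ_inverse_real_of_nat)
      then have "y \<longlonglongrightarrow> x"
        by (intro tendsto_sandwich[of "\<lambda>_. x" y sequentially "\<lambda>n. x + inverse (real (Suc n))"]) (use y in auto)
      moreover have "y n \<in> {a..1}" for n using y[of n] True by auto
      ultimately have "(\<lambda>n. V s (y n)) \<longlonglongrightarrow> V s x"
        using continuous_on_tendsto_compose[OF c[OF z(2)], of y x sequentially] True z by auto
      moreover have "F n \<lceil>snd z * real (Suc n)\<rceil> z = V s (y n)" for n
        using y[of n] True by (auto simp: F_def z y_def simp del: of_nat_Suc)
      ultimately show ?thesis by (simp add: z True hv_def del: of_nat_Suc)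
    qed (simp add: z hv_def)
  qed
qed

context degenerate_wave
begin

lemma H1_continuous_on:
  assumes "w \<in> H1 \<alpha>" "0 < a" "a < 1"
  shows "continuous_on {a..1} w"
proof (cases "\<alpha> < 1")
  case True
  then have "continuous_on {0..1} w" using assms abs_cont_on_imp_continuous_on by (auto simp: H1_def)
  then show ?thesis by (rule continuous_on_subset) (use assms in auto)
next
  case False
  then show ?thesis using assms by (intro abs_cont_on_imp_continuous_on) (simp add: H1_def)
qed

text \<open>\<open>hat\<close> differentiates a particular function, so equality of classes has to
  be strengthened: functions in \<open>H1\<close> are continuous on (0,1), hence agree everywhere
  there, and so do their derivatives.\<close>

lemma H1_eq_of_cl_eq:
  assumes u: "u \<in> H1 \<alpha>" and w: "w \<in> H1 \<alpha>" and eq: "cl u = cl w"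
  shows "cl (hat u) = cl (hat w)"
proof -
  have c: "continuous_on I01 f" if "f \<in> H1 \<alpha>" for f
  proof (rule continuous_at_imp_continuous_on, rule ballI)
    fix x :: real assume x: "x \<in> I01"
    then have "continuous_on {x/2<..<1} f"
      by (intro continuous_on_subset[OF H1_continuous_on[OF that, of "x/2"]]) auto
    then show "isCont f x" using x by (intro continuous_on_interior[of "{x/2<..<1}"]) auto
  qed
  have "AE x in M01. u x = w x"
    using rep_cl[OF H1_L2[OF u]] rep_cl[OF H1_L2[OF w]] unfolding eq by eventually_elim simp
  then have e: "u x = w x" if "x \<in> I01" for x by (rule AE_eq_imp_eq_on_I01[OF c[OF u] c[OF w] _ that])
  have "hat u x = hat w x" if x: "x \<in> I01" for x
  proof -
    have "\<forall>\<^sub>F y in nhds x. u y = w y" by (rule eventually_nhds_in_open[of I01, THEN eventually_mono]) (use x e in auto)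
    then have "deriv u x = deriv w x" by (intro deriv_cong_ev refl)
    then show ?thesis by (simp add: hat_def)
  qed
  then show ?thesis by (intro cl_cong_AE AE_I2 H1_hat_L2 u w) simp
qed

end

context transposed_wave
begin

lemma V_trace:
  assumes nt: "normal_trace T V G" and \<phi>: "test_fun T \<phi>"
    and q: "Kop q = integral {0..T} (\<lambda>s. deriv \<phi> s *\<^sub>R cl (V s))"
  shows "tau q = (\<integral>s. G s * deriv \<phi> s \<partial>Mt)"
proof (rule ccontr)
  \<comment> \<open>\<open>y\<close> and \<open>\<Psi>\<close> represent the same element of \<open>L\<^sup>2\<close>; if their slopes at \<open>1\<close> differed, \<open>\<Psi> - y\<close> would have
    a strict sign near \<open>1\<close>.\<close>
  define \<psi> where "\<psi> = deriv \<phi>"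
  define m where "m = (\<integral>s. G s * \<psi> s \<partial>Mt)"
  define \<Psi> where "\<Psi> = (\<lambda>x. \<integral>s. \<psi> s * V s x \<partial>Mt)"
  define D where "D = (\<lambda>x t. (V t x - V t 1) / (x - 1))"
  define y where "y = kernel_fun wker (rep (S q))"
  assume "tau q \<noteq> (\<integral>s. G s * deriv \<phi> s \<partial>Mt)"
  then have ne: "tau q \<noteq> m" by (simp add: m_def \<psi>_def)
  have c\<psi>: "continuous_on A \<psi>" for A
    unfolding \<psi>_def by (rule test_fun_parts(3)[OF \<phi>, of 0]) (use T_pos in auto)
  have \<psi>m[measurable]: "\<psi> \<in> borel_measurable Mt"
    using integral_lebesgue_on_Ioo_continuous(1)[OF c\<psi>] by auto
  have \<psi>L: "\<psi> \<in> L2 {0<..<T}"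
    using integral_lebesgue_on_Ioo_continuous(1)[of 0 T "\<lambda>s. (\<psi> s)\<^sup>2"] \<psi>m
    by (auto simp: L2_def intro!: continuous_intros c\<psi>)
  have GL: "G \<in> L2 {0<..<T}" and DL: "\<forall>\<^sub>F x in at_left 1. D x \<in> L2 {0<..<T}"
    and lim: "((\<lambda>x. L2_nrm {0<..<T} (\<lambda>t. D x t - G t)) \<longlongrightarrow> 0) (at_left 1)"
    using nt by (simp_all add: normal_trace_def D_def)
  have V1: "V t 1 = 0" if "t \<in> {0..T}" for t using V_H1[OF that] by (simp add: H1_def)
  \<comment> \<open>\<open>normal_trace\<close> provides convergence of the quotients of V in
    L^2(0,T); Cauchy-Schwarz against the fixed function \<psi> turns it into convergence of
    numbers.\<close>
  have "((\<lambda>x. \<Psi> x / (x - 1) - m) \<longlongrightarrow> 0) (at_left 1)"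
  proof (rule Lim_null_comparison)
    show "((\<lambda>x. L2_nrm {0<..<T} \<psi> * L2_nrm {0<..<T} (\<lambda>t. D x t - G t)) \<longlongrightarrow> 0) (at_left 1)"
      by (rule tendsto_mult_right_zero[OF lim])
    show "\<forall>\<^sub>F x in at_left 1. norm (\<Psi> x / (x - 1) - m) \<le> L2_nrm {0<..<T} \<psi> * L2_nrm {0<..<T} (\<lambda>t. D x t - G t)"
      using DL
    proof eventually_elim
      case (elim x)
      have "\<Psi> x / (x - 1) = (\<integral>s. \<psi> s * V s x / (x - 1) \<partial>Mt)" by (simp add: \<Psi>_def)
      also have "\<dots> = (\<integral>s. \<psi> s * D x s \<partial>Mt)"
        by (intro Bochner_Integration.integral_cong refl) (simp add: D_def V1)
      finally have "\<Psi> x / (x - 1) - m = (\<integral>s. \<psi> s * D x s - \<psi> s * G s \<partial>Mt)"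
        using L2_mult_integrable[OF \<psi>L elim] L2_mult_integrable[OF \<psi>L GL] by (simp add: m_def mult.commute)
      also have "\<dots> = (\<integral>s. \<psi> s * (D x s - G s) \<partial>Mt)" by (simp add: right_diff_distrib)
      finally show ?case
        using L2_Cauchy_Schwarz[OF \<psi>L L2_diff[OF elim GL]] by simp
    qed
  qed
  from tendsto_diff[OF kernel_S_trace[of q] LIM_zero_cancel[OF this]]
  have "((\<lambda>x. (y x - \<Psi> x) / (x - 1)) \<longlongrightarrow> tau q - m) (at_left 1)"
    by (simp add: y_def diff_divide_distrib)
  then have "((\<lambda>x. (y x - \<Psi> x) / (x - 1) / (tau q - m)) \<longlongrightarrow> (tau q - m) / (tau q - m)) (at_left 1)"
    using ne by (intro tendsto_divide tendsto_const) auto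
  from order_tendstoD(1)[OF this, of 0]
  have "\<forall>\<^sub>F x in at_left 1. 0 < (y x - \<Psi> x) / (x - 1) / (tau q - m)"
    using ne by simp
  with DL have "\<forall>\<^sub>F x in at_left 1. D x \<in> L2 {0<..<T} \<and> 0 < (y x - \<Psi> x) / (x - 1) / (tau q - m)"
    by eventually_elim simp
  then obtain b where b: "b < 1" "\<And>x. b < x \<Longrightarrow> x < 1 \<Longrightarrow> D x \<in> L2 {0<..<T}"
    "\<And>x. b < x \<Longrightarrow> x < 1 \<Longrightarrow> 0 < (y x - \<Psi> x) / (x - 1) / (tau q - m)"
    unfolding eventually_at_left_field by blast
  define a where "a = max b (1/2)"
  have a: "0 < a" "a < 1" "b \<le> a" using b(1) by (auto simp: a_def)
  \<comment> \<open>Measurability in time at fixed x is extracted from the difference quotients,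
    which are known to lie in L^2(0,T) only for x near 1. Hence the restriction to (a,1) from here
    on.\<close>
  have Vm: "(\<lambda>s. V s x) \<in> borel_measurable Mt" if x: "x \<in> {a<..1}" for x
  proof (cases "x = 1")
    case True
    have "(\<lambda>s. V s x) \<in> borel_measurable Mt \<longleftrightarrow> (\<lambda>s. 0 :: real) \<in> borel_measurable Mt"
      by (rule measurable_cong) (simp add: True V1)
    then show ?thesis by simp
  next
    case False
    then have "D x \<in> borel_measurable Mt" using b(2)[of x] x a by auto
    then have "(\<lambda>s. (x - 1) * D x s) \<in> borel_measurable Mt" by simp
    moreover have "(\<lambda>s. V s x) \<in> borel_measurable Mt \<longleftrightarrow> (\<lambda>s. (x - 1) * D x s) \<in> borel_measurable Mt"
      by (rule measurable_cong) (use False in \<open>simp add: D_def V1\<close>)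
    ultimately show ?thesis by simp
  qed
  have joint[measurable]: "(\<lambda>(s, x). hv a x * V s x) \<in> borel_measurable (Mt \<Otimes>\<^sub>M M01)"
  proof (rule continuous_on_product_measurable[OF a(1) _ Vm])
    show "continuous_on {a..1} (V s)" if "s \<in> {0<..<T}" for s
      by (rule H1_continuous_on[OF V_H1 a(1,2)]) (use that in auto)
  qed
  have ha: "hv a \<in> L2 I01"
    by (rule L2_bounded[OF one_L2 Lebesgue_section(1)[OF hv_borel]]) (simp add: hv_def)
  have VL: "V s \<in> L2 I01" if "s \<in> {0..T}" for s by (rule H1_L2[OF V_H1[OF that]])
  have "bounded ((\<lambda>s. \<psi> s *\<^sub>R cl (V s)) ` {0..T})"
    by (intro compact_imp_bounded compact_continuous_image continuous_intros c\<psi> V_continuous) simp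
  then obtain B where B: "norm (\<psi> s *\<^sub>R cl (V s)) \<le> B" if "s \<in> {0..T}" for s
    unfolding bounded_iff by blast
  have int: "integrable (Mt \<Otimes>\<^sub>M M01) (\<lambda>(s, x). \<psi> s * (hv a x * V s x))"
  proof (rule Mt_M01.Fubini_integrable)
    show j2: "(\<lambda>(s, x). \<psi> s * (hv a x * V s x)) \<in> borel_measurable (Mt \<Otimes>\<^sub>M M01)"
      using measurable_compose[OF measurable_fst \<psi>m, of M01] joint by (simp add: case_prod_beta)
    then have "(\<lambda>(s, x). \<bar>\<psi> s * (hv a x * V s x)\<bar>) \<in> borel_measurable (Mt \<Otimes>\<^sub>M M01)" by (simp add: case_prod_beta)
    then have "(\<lambda>s. \<integral>x. \<bar>\<psi> s * (hv a x * V s x)\<bar> \<partial>M01) \<in> borel_measurable Mt"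
      by (rule M01.borel_measurable_lebesgue_integral)
    moreover have "norm (\<integral>x. \<bar>\<psi> s * (hv a x * V s x)\<bar> \<partial>M01) \<le> B" if s: "s \<in> {0<..<T}" for s
    proof -
      have s': "s \<in> {0..T}" using s by simp
      have "(\<integral>x. \<bar>hv a x * V s x\<bar> \<partial>M01) \<le> (\<integral>x. \<bar>V s x\<bar> \<partial>M01)"
        using integrable_abs[OF L2_mult_integrable[OF ha VL[OF s']]] integral_abs_le_norm_cl(1)[OF VL[OF s']]
        by (intro integral_mono_AE AE_I2) (auto simp: hv_def)
      also have "\<dots> \<le> norm (cl (V s))" by (rule integral_abs_le_norm_cl(2)[OF VL[OF s']])
      finally have "\<bar>\<psi> s\<bar> * (\<integral>x. \<bar>hv a x * V s x\<bar> \<partial>M01) \<le> \<bar>\<psi> s\<bar> * norm (cl (V s))" by (intro mult_left_mono) simp_all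
      also have "\<dots> \<le> B" using B[OF s'] by simp
      finally show ?thesis by (simp add: abs_mult)
    qed
    ultimately show "integrable Mt (\<lambda>s. \<integral>x. norm (case (s, x) of (s, x) \<Rightarrow> \<psi> s * (hv a x * V s x)) \<partial>M01)"
      by (intro Mt.integrable_const_bound[of _ B]) auto
    show "AE s in Mt. integrable M01 (\<lambda>x. case (s, x) of (s, x) \<Rightarrow> \<psi> s * (hv a x * V s x))"
      using L2_mult_integrable[OF ha VL] by (intro AE_I2) simp
  qed
  define W where "W = cl (hv a)"
  have h\<Psi>: "(\<integral>s. \<psi> s * (hv a x * V s x) \<partial>Mt) = hv a x * \<Psi> x" for x
  proof -
    have "(\<integral>s. \<psi> s * (hv a x * V s x) \<partial>Mt) = (\<integral>s. hv a x * (\<psi> s * V s x) \<partial>Mt)" by (simp only: mult.left_commute)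
    then show ?thesis by (simp add: \<Psi>_def)
  qed
  have "(\<integral>x. hv a x * \<Psi> x \<partial>M01) = (\<integral>x. (\<integral>s. \<psi> s * (hv a x * V s x) \<partial>Mt) \<partial>M01)"
    by (simp only: h\<Psi>)
  also have "\<dots> = (\<integral>s. (\<integral>x. \<psi> s * (hv a x * V s x) \<partial>M01) \<partial>Mt)" by (rule Mt_M01.Fubini_integral[OF int])
  also have "\<dots> = (\<integral>s. (\<psi> s *\<^sub>R cl (V s)) \<bullet> W \<partial>Mt)"
    by (intro Bochner_Integration.integral_cong refl) (simp add: W_def inner_cl VL ha mult.commute)
  also have "\<dots> = integral {0..T} (\<lambda>s. (\<psi> s *\<^sub>R cl (V s)) \<bullet> W)"
    by (intro integral_lebesgue_on_Ioo_continuous(2) continuous_intros c\<psi> V_continuous)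
  also have "\<dots> = integral {0..T} (\<lambda>s. \<psi> s *\<^sub>R cl (V s)) \<bullet> W"
    using integral_linear[OF integrable_continuous_interval bounded_linear_inner_left, of 0 T "\<lambda>s. \<psi> s *\<^sub>R cl (V s)" W]
    by (simp add: o_def continuous_intros c\<psi> V_continuous)
  also have "\<dots> = cl y \<bullet> W" using q by (simp add: \<psi>_def y_def cl_kernel Kop_def)
  also have "\<dots> = (\<integral>x. hv a x * y x \<partial>M01)"
    using inner_cl[OF _ ha, of y] kernel_L2[of "S q"] by (simp add: W_def y_def mult.commute)
  finally have eq: "(\<integral>x. hv a x * \<Psi> x \<partial>M01) = (\<integral>x. hv a x * y x \<partial>M01)" .
  have i1: "integrable M01 (\<lambda>x. hv a x * y x)"
    using L2_mult_integrable[OF ha kernel_L2[of "S q"]] by (simp add: y_def)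
  have i2: "integrable M01 (\<lambda>x. hv a x * \<Psi> x)"
    using Mt_M01.integrable_snd[OF int] by (simp only: h\<Psi>)
  \<comment> \<open>The integrals of \<Psi> and y over (a,1) agree, so k has integral 0, while the
    choice of b makes it positive on (a,1).\<close>
  define k where "k = (\<lambda>x. (hv a x * \<Psi> x - hv a x * y x) / (tau q - m))"
  have pos: "0 < k x" if "x \<in> {a<..<1}" for x
  proof -
    have x: "a < x" "x < 1" using that by auto
    have "0 < (y x - \<Psi> x) / (x - 1) / (tau q - m) * (1 - x)"
      using b(3)[of x] x a by (intro mult_pos_pos) auto
    also have "\<dots> = (\<Psi> x - y x) / (tau q - m)" using x ne by (simp add: divide_simps) (simp add: algebra_simps)
    finally show ?thesis using x by (simp add: k_def hv_def)
  qed
  have "integrable M01 k" "(\<integral>x. k x \<partial>M01) = 0" using i1 i2 eq by (simp_all add: k_def)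
  moreover have "AE x in M01. 0 \<le> k x"
  proof (rule AE_I2)
    fix x assume "x \<in> space M01"
    then show "0 \<le> k x" using pos[of x] by (cases "a < x") (auto simp: k_def hv_def)
  qed
  ultimately have "AE x in M01. k x = 0"
    using integral_nonneg_eq_0_iff_AE[of M01 k] by simp
  then have "AE x in lborel. x \<in> I01 \<longrightarrow> k x = 0" by (simp add: AE_lebesgue_on_iff)
  then have "AE x in lborel. x \<notin> {a<..<1}"
    by eventually_elim (use pos a in \<open>force simp: less_le\<close>)
  then have "emeasure lborel {a<..<1} = 0" using AE_iff_null_sets[of "{a<..<1}" lborel] by (simp add: null_sets_def)
  then show False using a by (simp add: ennreal_eq_0_iff)
qed

end

theorem propositionC1:
  fixes \<alpha> :: real
  assumes "0 < \<alpha>" and "\<alpha> < 2"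
  shows "\<exists>T\<alpha>>0. \<forall>T>T\<alpha>. \<forall>v0\<in>L2 I01. \<forall>v1\<in>H1_dual \<alpha>. \<forall>v.
           transposition_solution \<alpha> T v0 v1 v \<longrightarrow>
           (\<exists>g. transposition_normal_trace \<alpha> T v1 v g) \<longrightarrow>
           (\<exists>u\<in>H1 \<alpha>. AE x in lebesgue_on I01. v0 x = u x) \<and>
           (\<exists>h\<in>L2 I01. \<forall>w\<in>H1 \<alpha>. v1 w = (\<integral>x. h x * w x \<partial>lebesgue_on I01))"
proof -
  interpret degenerate_wave \<alpha> by unfold_locales (use assms in auto)
  obtain C where C: "0 \<le> C" "\<And>z. norm (R z) \<le> C * norm z"
    using bounded_linear.nonneg_bounded[OF bounded_linear_R] by (auto simp: mult.commute)
  define T\<alpha> where "T\<alpha> = 8 * (1 + C) / (2 - \<alpha>)"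
  have T\<alpha>: "0 < T\<alpha>" using C(1) assms by (simp add: T\<alpha>_def)
  show ?thesis
  proof (rule exI[of _ T\<alpha>], intro conjI T\<alpha> allI impI ballI)
    fix T v0 v1 v
    assume T: "T\<alpha> < T" and v0: "v0 \<in> L2 I01" and v1: "v1 \<in> H1_dual \<alpha>" and v: "transposition_solution \<alpha> T v0 v1 v"
      and "\<exists>g. transposition_normal_trace \<alpha> T v1 v g"
    then obtain g V G where g: "g \<in> L2 {0<..<T}" and lift: "lifted_solution \<alpha> T v1 v V" and nt: "normal_trace T V G"
      and gG: "\<And>\<phi>. test_fun T \<phi> \<Longrightarrow> (\<integral>t. g t * \<phi> t \<partial>lebesgue_on {0<..<T}) = - (\<integral>t. G t * deriv \<phi> t \<partial>lebesgue_on {0<..<T})"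
      unfolding transposition_normal_trace_def by blast
    obtain \<xi> where \<xi>: "\<xi> \<in> H1 \<alpha>" "\<And>w. w \<in> H1 \<alpha> \<Longrightarrow> flux_form \<alpha> \<xi> w = - v1 w"
      "\<And>t. t \<in> {0..T} \<Longrightarrow> V t \<in> H1 \<alpha>"
      "\<And>t. t \<in> {0..T} \<Longrightarrow> AE x in M01. V t x = (\<integral>s. v s x \<partial>lebesgue_on {0<..<t}) + \<xi> x"
      using lift unfolding lifted_solution_def by blast
    have mQ: "meas_Q T v" and "\<exists>B. AE t in lebesgue_on {0<..<T}. v t \<in> L2 I01 \<and> L2_nrm I01 (v t) \<le> B"
      using v by (simp_all add: transposition_solution_def Linf_L2_def)
    then obtain B where B: "AE t in lebesgue_on {0<..<T}. v t \<in> L2 I01 \<and> L2_nrm I01 (v t) \<le> B" by blast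
    obtain vh where vh: "case_prod vh \<in> borel_measurable (borel \<Otimes>\<^sub>M borel)"
        "AE t in lebesgue_on {0<..<T}. AE x in M01. v t x = vh t x"
        "AE x in M01. AE t in lebesgue_on {0<..<T}. v t x = vh t x"
      by (rule borel_version_on_rectangle[OF mQ])
    have B': "AE t in lebesgue_on {0<..<T}. v t \<in> L2 I01 \<and> L2_nrm I01 (v t) \<le> max B 0"
      using B by eventually_elim auto
    interpret transposed_wave \<alpha> T v0 v1 v V vh \<xi> "max B 0"
      by unfold_locales (use T T\<alpha> v0 v1 v \<xi> vh B' in auto)
    note reg = hidden_regularity[OF C(2,1) T[unfolded T\<alpha>_def] V_continuous g V_weak]
    have trace: "tau q = - (\<integral>s. g s * \<phi> s \<partial>lebesgue_on {0<..<T})"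
      if "test_fun T \<phi>" "Kop q = integral {0..T} (\<lambda>s. deriv \<phi> s *\<^sub>R cl (V s))" for \<phi> q
      using V_trace[OF nt that] gG[OF that(1)] by simp
    obtain z where z: "cl \<xi> = Kop z" using reg(1)[OF _ trace] by blast
    obtain z' where z': "cl v0 = R (Pi z')" using reg(2)[OF _ trace] by blast
    have "kernel_fun wker (rep (Pi z')) \<in> H1 \<alpha>" by (rule kernel_H1(1)) (simp add: Pi_idem)
    moreover have "AE x in lebesgue_on I01. v0 x = kernel_fun wker (rep (Pi z')) x"
      using rep_cl[OF v0] rep_cl[OF kernel_L2[of "Pi z'"]] unfolding z' cl_kernel by eventually_elim simp
    ultimately show "\<exists>u\<in>H1 \<alpha>. AE x in lebesgue_on I01. v0 x = u x" by blast
    \<comment> \<open>\<xi> and the kernel function of \<open>S z\<close> are \<open>H1\<close>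
      representatives of one class, so their weighted derivatives agree. By
      \<open>S_inner_hat\<close> the flux form of \<xi> against w is then the inner product of z
      with w, and v1 is represented by -z.\<close>
    have "cl (hat \<xi>) = S z"
      using H1_eq_of_cl_eq[OF \<xi>(1) kernel_H1(1)[OF Pi_S]] z by (simp add: cl_kernel Kop_def cl_hat_kernel Pi_S)
    then have "v1 w = (\<integral>x. - rep z x * w x \<partial>lebesgue_on I01)" if w: "w \<in> H1 \<alpha>" for w
      using \<xi>(2)[OF w] flux_form_eq_inner[OF \<xi>(1) w] S_inner_hat[OF w, of z] inner_cl[OF rep_L2[of z] H1_L2[OF w]] by simp
    moreover have "(\<lambda>x. - rep z x) \<in> L2 I01" using L2_cmult[OF rep_L2[of z], of "- 1"] by simp
    ultimately show "\<exists>h\<in>L2 I01. \<forall>w\<in>H1 \<alpha>. v1 w = (\<integral>x. h x * w x \<partial>lebesgue_on I01)" by (intro bexI ballI)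
  qed
qed

end
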